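(* Let $k$ be a field and let $\Gamma$ be a finite scheme geometrically in linearly general position in $\mathbf{P}^r_k$. (a) If $\deg\Gamma=r+3$, then $\Gamma$ lies on a rational normal curve if and only if $\Gamma$ is Gorenstein. (b) If $\deg\Gamma\ge r+3$ and $\Gamma$ is Gorenstein, then $\Gamma$ is curvilinear and unramified.
   Context: Gorenstein means that all local rings of $\Gamma$ are Gorenstein. A finite subscheme $\Gamma\subset\mathbf{P}^r_k$ is in linearly general position if every subscheme of $\Gamma$ that lies on a $d$-dimensional linear subspace with $d<r$ has degree $\le d+1$; it is geometrically in linearly general position if $\overline{k}\otimes_k\Gamma\subset\mathbf{P}^r_{\overline k}$ is in linearly general position, where $\overline k$ is the algebraic closure of $k$. A rational normal curve in $\mathbf{P}^r_k$ is the image of $\mathbf{P}^1_k$ under the embedding given by the complete linear series $|\mathcal{O}_{\mathbf{P}^1}(r)|$, up to projective equivalence. $\Gamma$ is curvilinear if each local ring $\mathcal{O}_{\Gamma,p}$ is isomorphic to $F[x]/(x^n)$ for some $n$ and some field extension $F$ of $k$. $\Gamma$ is unramified if, $V$ being the vector space of linear forms on $\mathbf{P}^r$, for each point $p$ of $\Gamma$ the natural map $V\to\mathcal{O}_{\Gamma,p}$ (defined after choosing a local generator of $\mathcal{O}_\Gamma(1)$) has image the complement of an ideal of $\mathcal{O}_{\Gamma,p}$.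
   Formalization: Since "Γ is unramified" can fail over non-closed k at points with larger residue field, (b) asserts it for Γ over the algebraic closure and for Γ at points with residue field k; in "curvilinear" the isomorphism with F[x]/(x^n) is one of rings, as the k-algebra version fails for imperfect k. *)

theory Defs
  imports "HOL-Algebra.Algebra" "HOL-Algebra.Algebraic_Closure_Type" "HOL-Library.Poly_Mapping"
begin

section \<open>Polynomials and forms\<close>

text \<open>
  Polynomials have variables \<open>x\<^sub>0, x\<^sub>1, \<dots>\<close>; a monomial is its exponent vector. The homogeneous
  coordinate ring of \<open>P\<^sup>r\<close> is the subring of polynomials in \<open>x\<^sub>0, \<dots>, x\<^sub>r\<close>.
\<close>

type_synonym 'k mpol = "(nat \<Rightarrow>\<^sub>0 nat) \<Rightarrow>\<^sub>0 'k"

definition polyring :: "nat \<Rightarrow> 'k::field mpol ring" where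
  "polyring r = \<lparr>carrier = {p. \<forall>m\<in>Poly_Mapping.keys p. Poly_Mapping.keys m \<subseteq> {..r}},
     monoid.mult = (*), one = 1, ring.zero = 0, add = (+)\<rparr>"

definition mdeg :: "(nat \<Rightarrow>\<^sub>0 nat) \<Rightarrow> nat" where
  "mdeg m = (\<Sum>i\<in>Poly_Mapping.keys m. Poly_Mapping.lookup m i)"

definition forms :: "nat \<Rightarrow> nat \<Rightarrow> 'k::field mpol set" where
  "forms r n = {p \<in> carrier (polyring r). \<forall>m\<in>Poly_Mapping.keys p. mdeg m = n}"

definition scalem :: "'k::field \<Rightarrow> 'k mpol \<Rightarrow> 'k mpol" where
  "scalem c p = Poly_Mapping.single 0 c * p"

interpretation mpol: vector_space "scalem :: 'k::field \<Rightarrow> 'k mpol \<Rightarrow> 'k mpol"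
proof
  fix a b :: 'k and x y :: "'k mpol"
  show "scalem a (x + y) = scalem a x + scalem a y"
    by (simp add: scalem_def distrib_left)
  show "scalem (a + b) x = scalem a x + scalem b x"
    by (simp add: scalem_def single_add distrib_right)
  show "scalem a (scalem b x) = scalem (a * b) x"
    by (simp add: scalem_def mult_single flip: mult.assoc)
  show "scalem 1 x = x"
    by (simp add: scalem_def)
qed

definition subst_mpol :: "(nat \<Rightarrow> 'k::field mpol) \<Rightarrow> 'k mpol \<Rightarrow> 'k mpol" where
  "subst_mpol b p = (\<Sum>m\<in>Poly_Mapping.keys p. scalem (Poly_Mapping.lookup p m)
     (\<Prod>i\<in>Poly_Mapping.keys m. b i ^ Poly_Mapping.lookup m i))"

section \<open>Closed subschemes of projective space\<close>

text \<open>
  A closed subscheme of \<open>P\<^sup>r\<close> is given by its saturated homogeneous ideal. Inclusion of closed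
  subschemes is reverse inclusion of these ideals, and \<open>polyring r\<close> itself gives the empty
  subscheme.
\<close>

definition homogeneous_ideal :: "nat \<Rightarrow> 'k::field mpol set \<Rightarrow> bool" where
  "homogeneous_ideal r I \<longleftrightarrow> ideal I (polyring r) \<and>
     I = genideal (polyring r) {f \<in> I. \<exists>n. f \<in> forms r n}"

text \<open>The \<open>N\<close>-th power of the irrelevant ideal is generated by the forms of degree \<open>N\<close>.\<close>

definition saturated :: "nat \<Rightarrow> 'k::field mpol set \<Rightarrow> bool" where
  "saturated r I \<longleftrightarrow> (\<forall>f\<in>carrier (polyring r). (\<exists>N. \<forall>g\<in>forms r N. g * f \<in> I) \<longrightarrow> f \<in> I)"

definition closed_subscheme :: "nat \<Rightarrow> 'k::field mpol set \<Rightarrow> bool" where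
  "closed_subscheme r I \<longleftrightarrow> homogeneous_ideal r I \<and> saturated r I"

definition hilbert_fun :: "nat \<Rightarrow> 'k::field mpol set \<Rightarrow> nat \<Rightarrow> nat" where
  "hilbert_fun r I n = mpol.dim (forms r n :: 'k mpol set) - mpol.dim (I \<inter> forms r n)"

text \<open>A closed subscheme is finite iff its Hilbert polynomial is a constant, which is then its degree.\<close>

definition finite_subscheme :: "nat \<Rightarrow> 'k::field mpol set \<Rightarrow> bool" where
  "finite_subscheme r I \<longleftrightarrow> closed_subscheme r I \<and>
     (\<exists>d. \<forall>\<^sub>F n in sequentially. hilbert_fun r I n = d)"

definition scheme_degree :: "nat \<Rightarrow> 'k::field mpol set \<Rightarrow> nat" where
  "scheme_degree r I = (THE d. \<forall>\<^sub>F n in sequentially. hilbert_fun r I n = d)"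

definition base_change :: "nat \<Rightarrow> 'k::field mpol set \<Rightarrow> 'k alg_closure mpol set" where
  "base_change r I = genideal (polyring r) (Poly_Mapping.map to_ac ` I)"

section \<open>Linearly general position\<close>

definition linear_subspace :: "nat \<Rightarrow> nat \<Rightarrow> 'k::field mpol set \<Rightarrow> bool" where
  "linear_subspace r d J \<longleftrightarrow> (\<exists>L. L \<subseteq> forms r 1 \<and> finite L \<and> mpol.independent L \<and>
     card L + d = r \<and> J = genideal (polyring r) L)"

definition lin_gen_pos :: "nat \<Rightarrow> 'k::field mpol set \<Rightarrow> bool" where
  "lin_gen_pos r I \<longleftrightarrow> (\<forall>d J I'. d < r \<and> linear_subspace r d J \<and>
     closed_subscheme r I' \<and> I \<subseteq> I' \<and> J \<subseteq> I' \<longrightarrow> scheme_degree r I' \<le> d + 1)"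

definition geom_lin_gen_pos :: "nat \<Rightarrow> 'k::field mpol set \<Rightarrow> bool" where
  "geom_lin_gen_pos r I \<longleftrightarrow> lin_gen_pos r (base_change r I)"

section \<open>Rational normal curves\<close>

text \<open>
  The polynomials in \<open>x\<^sub>0, x\<^sub>1\<close> form the coordinate ring of \<open>P\<^sup>1\<close>, and \<open>forms 1 r\<close> is the space of
  global sections of \<open>O(r)\<close> on it. The complete linear series \<open>|O(r)|\<close> together with a basis \<open>b\<close>
  of this space gives the embedding \<open>p \<mapsto> (b\<^sub>0(p) : \<dots> : b\<^sub>r(p))\<close>, and projective equivalence amounts
  to varying \<open>b\<close>. The image is given by the kernel of the substitution \<open>x\<^sub>i \<mapsto> b\<^sub>i\<close>.
\<close>

definition rational_normal_curve :: "nat \<Rightarrow> 'k::field mpol set \<Rightarrow> bool" where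
  "rational_normal_curve r C \<longleftrightarrow> r \<ge> 1 \<and>
     (\<exists>b. inj_on b {..r} \<and> mpol.independent (b ` {..r}) \<and> mpol.span (b ` {..r}) = forms 1 r \<and>
        C = {f \<in> carrier (polyring r). subst_mpol b f = 0})"

section \<open>Points and local rings\<close>

definition points :: "nat \<Rightarrow> 'k::field mpol set \<Rightarrow> 'k mpol set set" where
  "points r I = {P. primeideal P (polyring r) \<and> homogeneous_ideal r P \<and> I \<subseteq> P \<and> \<not> forms r 1 \<subseteq> P}"

text \<open>
  The local ring at \<open>P\<close> is the degree-zero part of the localization of \<open>polyring r / I\<close> at the
  homogeneous elements outside \<open>P\<close>: fractions \<open>f/g\<close> of forms of equal degree with \<open>g \<notin> P\<close>.
\<close>

definition fracs :: "nat \<Rightarrow> 'k::field mpol set \<Rightarrow> ('k mpol \<times> 'k mpol) set" where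
  "fracs r P = {(f, g). \<exists>n. f \<in> forms r n \<and> g \<in> forms r n \<and> g \<notin> P}"

definition frac_rel ::
    "nat \<Rightarrow> 'k::field mpol set \<Rightarrow> 'k mpol set \<Rightarrow> (('k mpol \<times> 'k mpol) \<times> ('k mpol \<times> 'k mpol)) set" where
  "frac_rel r I P = {((f, g), (f', g')). (f, g) \<in> fracs r P \<and> (f', g') \<in> fracs r P \<and>
     (\<exists>n. \<exists>h\<in>forms r n. h \<notin> P \<and> h * (f * g' - f' * g) \<in> I)}"

definition frac_class ::
    "nat \<Rightarrow> 'k::field mpol set \<Rightarrow> 'k mpol set \<Rightarrow> 'k mpol \<Rightarrow> 'k mpol \<Rightarrow> ('k mpol \<times> 'k mpol) set" where
  "frac_class r I P f g = frac_rel r I P `` {(f, g)}"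

definition local_ring_at ::
    "nat \<Rightarrow> 'k::field mpol set \<Rightarrow> 'k mpol set \<Rightarrow> ('k mpol \<times> 'k mpol) set ring" where
  "local_ring_at r I P =
     \<lparr>carrier = fracs r P // frac_rel r I P,
      monoid.mult = (\<lambda>A B. \<Union>(f, g)\<in>A. \<Union>(f', g')\<in>B. frac_class r I P (f * f') (g * g')),
      one = frac_class r I P 1 1,
      ring.zero = frac_class r I P 0 1,
      add = (\<lambda>A B. \<Union>(f, g)\<in>A. \<Union>(f', g')\<in>B. frac_class r I P (f * g' + f' * g) (g * g'))\<rparr>"

section \<open>Gorenstein rings\<close>

definition lin_homs :: "'a ring \<Rightarrow> ('a, 'b) module \<Rightarrow> ('a, 'c) module \<Rightarrow> ('b \<Rightarrow> 'c) set" where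
  "lin_homs R M N = {f \<in> carrier M \<rightarrow> carrier N.
     (\<forall>x\<in>carrier M. \<forall>y\<in>carrier M. f (x \<oplus>\<^bsub>M\<^esub> y) = f x \<oplus>\<^bsub>N\<^esub> f y) \<and>
     (\<forall>a\<in>carrier R. \<forall>x\<in>carrier M. f (a \<odot>\<^bsub>M\<^esub> x) = a \<odot>\<^bsub>N\<^esub> f x)}"

text \<open>
  HOL has no quantification over types inside a definition, so the test modules \<open>N\<close> live on the type
  of the elements of \<open>R\<close>. These include \<open>R\<close> itself, so by Baer's criterion nothing is lost.
\<close>

definition injective_module :: "'a ring \<Rightarrow> ('a, 'b) module \<Rightarrow> bool" where
  "injective_module R E \<longleftrightarrow> Module.module R E \<and>
     (\<forall>(N :: ('a, 'a) module) H f. Module.module R N \<and> submodule H R N \<and>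
        f \<in> lin_homs R (N\<lparr>carrier := H\<rparr>) E \<longrightarrow>
        (\<exists>g\<in>lin_homs R N E. \<forall>x\<in>H. g x = f x))"

text \<open>
  A finite injective resolution \<open>0 \<rightarrow> M \<rightarrow> E\<^sub>0 \<rightarrow> \<dots> \<rightarrow> E\<^sub>n \<rightarrow> 0\<close>. Its terms again live on the type of the
  elements of \<open>R\<close>. For a Noetherian local ring \<open>R\<close> and finitely generated \<open>M\<close> of finite injective
  dimension this loses nothing: the terms of a minimal injective resolution have cardinality at
  most that of \<open>R\<close> if \<open>R\<close> is infinite, and if \<open>R\<close> is finite then \<open>M\<close> itself is injective.
\<close>

definition finite_injective_dim :: "'a ring \<Rightarrow> ('a, 'a) module \<Rightarrow> bool" where
  "finite_injective_dim R M \<longleftrightarrow>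
     (\<exists>(E :: nat \<Rightarrow> ('a, 'a) module) e d n.
        (\<forall>i. injective_module R (E i)) \<and> (\<forall>i>n. carrier (E i) = {\<zero>\<^bsub>E i\<^esub>}) \<and>
        e \<in> lin_homs R M (E 0) \<and> inj_on e (carrier M) \<and>
        e ` carrier M = {x \<in> carrier (E 0). d 0 x = \<zero>\<^bsub>E 1\<^esub>} \<and>
        (\<forall>i. d i \<in> lin_homs R (E i) (E (Suc i)) \<and>
           d i ` carrier (E i) = {x \<in> carrier (E (Suc i)). d (Suc i) x = \<zero>\<^bsub>E (Suc (Suc i))\<^esub>}))"

definition self_module :: "'a ring \<Rightarrow> ('a, 'a) module" where
  "self_module R = \<lparr>carrier = carrier R, monoid.mult = monoid.mult R, one = one R,
     ring.zero = ring.zero R, add = add R, module.smult = monoid.mult R\<rparr>"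

definition gorenstein_local_ring :: "'a ring \<Rightarrow> bool" where
  "gorenstein_local_ring R \<longleftrightarrow> cring R \<and> noetherian_ring R \<and> (\<exists>!M. maximalideal M R) \<and>
     finite_injective_dim R (self_module R)"

definition gorenstein :: "nat \<Rightarrow> 'k::field mpol set \<Rightarrow> bool" where
  "gorenstein r I \<longleftrightarrow> (\<forall>P\<in>points r I. gorenstein_local_ring (local_ring_at r I P))"

section \<open>Curvilinear and unramified schemes\<close>

text \<open>
  \<open>F\<close> ranges over fields on the type of the elements of \<open>R\<close>; as \<open>F\<close> embeds in \<open>F[x]/(x\<^sup>n)\<close> for
  \<open>n \<ge> 1\<close>, nothing is lost. The isomorphism is one of rings, not of \<open>k\<close>-algebras: if the residue
  field \<open>k[t]/(f)\<close> is inseparable over \<open>k\<close>, then \<open>k[t]/(f\<^sup>2)\<close> on \<open>P\<^sup>1\<close> is isomorphic to some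
  \<open>F[x]/(x\<^sup>2)\<close> in the former sense only.
\<close>

definition truncated_poly_ring :: "'a ring \<Rightarrow> nat \<Rightarrow> (nat \<Rightarrow> 'a) set ring" where
  "truncated_poly_ring F n = UP F Quot (genideal (UP F) {up_ring.monom (UP F) \<one>\<^bsub>F\<^esub> n})"

definition curvilinear :: "nat \<Rightarrow> 'k::field mpol set \<Rightarrow> bool" where
  "curvilinear r I \<longleftrightarrow> (\<forall>P\<in>points r I. \<exists>(F :: ('k mpol \<times> 'k mpol) set ring) n.
     Ring.field F \<and> ring_hom (ring_of_type_algebra :: 'k ring) F \<noteq> {} \<and>
     local_ring_at r I P \<simeq> truncated_poly_ring F n)"

text \<open>
  A linear form \<open>g \<notin> P\<close> is a local generator of \<open>O(1)\<close> at \<open>P\<close>, and turns a linear form \<open>l\<close> into the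
  function \<open>l/g\<close>. Another generator changes the image by a unit, hence does not affect whether it
  is a vector space complement of an ideal.
\<close>

definition unramified_at :: "nat \<Rightarrow> 'k::field mpol set \<Rightarrow> 'k mpol set \<Rightarrow> bool" where
  "unramified_at r I P \<longleftrightarrow> (let R = local_ring_at r I P in
     \<forall>g\<in>forms r 1 - P. \<exists>J. ideal J R \<and>
       (\<lambda>l. frac_class r I P l g) ` forms r 1 \<inter> J = {\<zero>\<^bsub>R\<^esub>} \<and>
       (\<lambda>l. frac_class r I P l g) ` forms r 1 <+>\<^bsub>R\<^esub> J = carrier R)"

definition unramified :: "nat \<Rightarrow> 'k::field mpol set \<Rightarrow> bool" where
  "unramified r I \<longleftrightarrow> (\<forall>P\<in>points r I. unramified_at r I P)"

text \<open>
  Pitfall: over a field \<open>k\<close> that is not algebraically closed, \<open>unramified\<close> can fail even for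
  subschemes of a rational normal curve, at points whose residue field is bigger than \<open>k\<close>. At a
  point of \<open>P\<^sup>1\<close> with cubic residue field \<open>F\<close> the local ring may be \<open>F\<close>, and the image of the
  linear forms is then a two-dimensional subspace, while the only ideals are \<open>0\<close> and \<open>F\<close>. The notion
  is therefore to be applied over the algebraic closure, or at points with residue field \<open>k\<close>;
  these are the points \<open>P\<close> with \<open>scheme_degree r P = 1\<close>.
\<close>

end

theory Submission
  imports Defs
begin

text \<open>
  Let \<open>A\<close> be the ring of global sections of \<open>\<Gamma>\<close>, let \<open>V \<subseteq> A\<close> be the space of linear forms, and suppose that
  \<open>deg \<Gamma> \<ge> r + 3\<close>. Linearly general position says that, over the algebraic closure, \<open>V\<close> meets every ideal of
  colength at least \<open>r + 1\<close> in zero. If \<open>deg \<Gamma> = r + 3\<close>, then \<open>V\<close> is the common kernel of a pencil of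
  functionals on \<open>A\<close>. Some functional of the pencil vanishes on no nonzero ideal, and then every maximal
  ideal of \<open>A\<close> is principal; the case of larger degree follows by passing to quotients of \<open>A\<close>. So the
  Gorenstein property holds automatically, and descends to the ground field: the local rings are Artinian
  chain rings, hence injective over themselves, and equal to some \<open>F[x]/(x\<^sup>n)\<close> by Cohen's structure theorem.
  At a rational point with local ring \<open>B\<close>, any ideal of colength \<open>min (r + 1) (dim B)\<close> in \<open>B\<close> is a complement
  of the image of \<open>V\<close>.

  For the rational normal curve, choose a functional \<open>\<phi>\<close> on \<open>A\<close> that vanishes on no nonzero ideal. Then
  \<open>V\<close> is the set of all \<open>z\<close> with \<open>\<phi>(a\<^sub>1z) = \<phi>(a\<^sub>2z) = 0\<close>, for suitable \<open>a\<^sub>1\<close> and \<open>a\<^sub>2\<close> in \<open>A\<close>. As \<open>dim A = r + 3\<close>,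
  there is \<open>u \<noteq> 0\<close> such that \<open>\<phi>\<close> vanishes on \<open>u\<close> times each of the \<open>r + 2\<close> monomials of degree \<open>r + 1\<close> in
  \<open>a\<^sub>1\<close> and \<open>a\<^sub>2\<close>. So \<open>u\<close> times the monomials of degree \<open>r\<close> lie in \<open>V\<close>. They form a basis of \<open>V\<close>, and
  writing the coordinates in this basis exhibits \<open>\<Gamma>\<close> as a subscheme of a rational normal curve.
\<close>

section \<open>Subspaces of finite codimension\<close>

text \<open>The algebra \<open>A\<close> depends on the scheme and is not a type, so it never occurs
  as such: elements are taken in an ambient algebra, ideals of \<open>A\<close> are ideals
  containing \<open>\<aa>\<close>, and dimensions of quotients are codimensions. Tensor products are
  avoided likewise: a polynomial over the closure lies in the extension of \<open>J\<close> if every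
  \<open>k\<close>-linear functional, applied to its coefficients, sends it into \<open>J\<close>.
  The number \<open>r + 3\<close> matters through its difference 2 to \<open>dim V\<close>. An ideal
  of colength \<open>r + 1\<close> has dimension 2 in \<open>A\<close>; if a member of the pencil
  vanished on it, a second member would have a kernel vector there, a nonzero element of
  \<open>V\<close> in that ideal. For a nondegenerate member \<open>w\<close> and another one
  \<open>w' x = w (a * x)\<close>, this bounds the annihilator of each \<open>a - c\<close>, which
  therefore generates the maximal ideal where \<open>a\<close> has the value \<open>c\<close>. Over
  a small field every linear form may vanish at some point of the scheme. Forms are therefore turned
  into functions by two forms of consecutive large degrees, whose quotient generates
  \<open>O(1)\<close>.\<close>

locale vspace = vector_space scale
  for scale :: "'a::field \<Rightarrow> 'b::ab_group_add \<Rightarrow> 'b" (infixr \<open>*s\<close> 75)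
begin

definition fdim :: "'b set \<Rightarrow> bool" where
  "fdim U \<longleftrightarrow> subspace U \<and> (\<exists>B. finite B \<and> U \<subseteq> span B)"

definition lin_endo :: "('b \<Rightarrow> 'b) \<Rightarrow> bool" where
  "lin_endo f \<longleftrightarrow> (\<forall>x y. f (x + y) = f x + f y) \<and> (\<forall>c x. f (c *s x) = c *s f x)"

definition lin_fun :: "('b \<Rightarrow> 'a) \<Rightarrow> bool" where
  "lin_fun w \<longleftrightarrow> (\<forall>x y. w (x + y) = w x + w y) \<and> (\<forall>c x. w (c *s x) = c * w x)"

lemma lin_endoD:
  assumes "lin_endo f"
  shows "f (x + y) = f x + f y" "f (c *s x) = c *s f x" "f 0 = 0" "f (- x) = - f x" "f (x - y) = f x - f y"
    "f (sum g A) = (\<Sum>a\<in>A. f (g a))"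
proof -
  show 1: "f (x + y) = f x + f y" for x y
    using assms by (auto simp: lin_endo_def)
  show 2: "f (c *s x) = c *s f x" for c x
    using assms by (auto simp: lin_endo_def)
  show 3: "f 0 = 0" using 2[of 0 0] by simp
  show 4: "f (- x) = - f x" for x using 1[of x "- x"] 3 by (simp add: eq_neg_iff_add_eq_0 add.commute)
  show "f (x - y) = f x - f y" using 1[of x "- y"] 4 by simp
  show "f (sum g A) = (\<Sum>a\<in>A. f (g a))"
    by (induction A rule: infinite_finite_induct) (auto simp: 1 3)
qed

lemma lin_funD:
  assumes "lin_fun w"
  shows "w (x + y) = w x + w y" "w (c *s x) = c * w x" "w 0 = 0" "w (- x) = - w x" "w (x - y) = w x - w y"
    "w (sum g A) = (\<Sum>a\<in>A. w (g a))"
proof -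
  show 1: "w (x + y) = w x + w y" for x y
    using assms by (auto simp: lin_fun_def)
  show 2: "w (c *s x) = c * w x" for c x
    using assms by (auto simp: lin_fun_def)
  show 3: "w 0 = 0" using 2[of 0 0] by simp
  show 4: "w (- x) = - w x" for x using 1[of x "- x"] 3 by (simp add: eq_neg_iff_add_eq_0 add.commute)
  show "w (x - y) = w x - w y" using 1[of x "- y"] 4 by simp
  show "w (sum g A) = (\<Sum>a\<in>A. w (g a))"
    by (induction A rule: infinite_finite_induct) (auto simp: 1 3)
qed

lemma fdim_subspace: "fdim U \<Longrightarrow> subspace U"
  by (simp add: fdim_def)

lemma fdim_subset: "fdim U \<Longrightarrow> subspace T \<Longrightarrow> T \<subseteq> U \<Longrightarrow> fdim T"
  unfolding fdim_def by blast

lemma fdim_basis: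
  assumes "fdim U"
  obtains B where "B \<subseteq> U" "finite B" "independent B" "span B = U" "card B = dim U"
proof -
  obtain F where F: "finite F" "U \<subseteq> span F" using assms by (auto simp: fdim_def)
  obtain B where B: "B \<subseteq> U" "independent B" "U \<subseteq> span B" "card B = dim U" using basis_exists[of U] .
  have "finite B" using independent_span_bound[OF F(1) B(2)] B(1) F(2) by auto
  moreover have "span B = U"
    using B span_minimal[OF B(1) fdim_subspace[OF assms]] by auto
  ultimately show thesis using B that by blast
qed

text \<open>\<open>dim\<close> is the cardinality of a basis and thus 0 for an infinite one, which
  is why the larger space has to be finite-dimensional.\<close>

lemma dim_mono_fdim:
  assumes "fdim U" "T \<subseteq> U"
  shows "dim T \<le> dim U"
proof -
  obtain B where "finite B" "span B = U" "card B = dim U" using fdim_basis[OF assms(1)] by metis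
  then show ?thesis using dim_le_card[of T B] assms(2) by auto
qed

lemma independent_le_dim:
  assumes "fdim U" "B \<subseteq> U" "independent B"
  shows "finite B" "card B \<le> dim U"
proof -
  obtain C where C: "finite C" "span C = U" "card C = dim U" using fdim_basis[OF assms(1)] by metis
  show "finite B" "card B \<le> dim U" using independent_span_bound[OF C(1) assms(3)] assms(2) C by auto
qed

lemma dim_eq_imp_eq:
  assumes "fdim U" "subspace T" "T \<subseteq> U" "dim U \<le> dim T"
  shows "T = U"
proof (rule ccontr)
  assume "T \<noteq> U"
  then obtain x where x: "x \<in> U" "x \<notin> T" using assms(3) by auto
  obtain B where B: "B \<subseteq> T" "finite B" "independent B" "span B = T" "card B = dim T"
    using fdim_basis[OF fdim_subset[OF assms(1-3)]] by metis
  have "independent (insert x B)" using B x by (simp add: independent_insertI)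
  moreover have "insert x B \<subseteq> U" using x B assms(3) by auto
  ultimately have "card (insert x B) \<le> dim U" using independent_le_dim[OF assms(1)] by blast
  moreover have "x \<notin> B" using B x by auto
  ultimately show False using B assms(4) by simp
qed

lemma subspace_kernel_on: "lin_endo f \<Longrightarrow> subspace U \<Longrightarrow> subspace {x \<in> U. f x = 0}"
  by (auto simp: subspace_def lin_endoD)

lemma subspace_image: "lin_endo f \<Longrightarrow> subspace U \<Longrightarrow> subspace (f ` U)"
  unfolding subspace_def
  by (auto simp: lin_endoD) (metis imageI lin_endoD(3), metis imageI lin_endoD(1), metis imageI lin_endoD(2))

text \<open>A basis \<open>B\<close> of the kernel is extended to a basis \<open>C\<close> of
  \<open>U\<close>; the images of the added vectors form a basis of the image.\<close>

lemma rank_nullity: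
  assumes f: "lin_endo f" and U: "fdim U"
  shows "fdim (f ` U)" "dim U = dim (f ` U) + dim {x \<in> U. f x = 0}"
proof -
  let ?K = "{x \<in> U. f x = 0}"
  have sU: "subspace U" by (rule fdim_subspace[OF U])
  have K: "fdim ?K" using fdim_subset[OF U subspace_kernel_on[OF f sU]] by auto
  obtain B where B: "B \<subseteq> ?K" "finite B" "independent B" "span B = ?K" "card B = dim ?K"
    using fdim_basis[OF K] .
  obtain C where C: "B \<subseteq> C" "C \<subseteq> U" "independent C" "U \<subseteq> span C"
  proof -
    have BU: "B \<subseteq> U" using B(1) by auto
    show thesis by (rule maximal_independent_subset_extend[OF BU B(3)]) (rule that)
  qed
  have fC: "finite C" using independent_le_dim(1)[OF U C(2,3)] .
  have spC: "span C = U" using C span_minimal[OF C(2) sU] by auto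
  have dC: "dim U = card C" using dim_eq_card[OF _ C(3), of U] spC sU by (simp add: span_eq_iff[THEN iffD2])
  define D where "D = C - B"
  have fD: "finite D" and DC: "D \<subseteq> C" using fC by (auto simp: D_def)
  \<comment> \<open>Independence in terms of coefficients yields both the injectivity of
    \<open>f\<close> on \<open>D\<close> and the independence of the image of
    \<open>D\<close>.\<close>
  have key: "x \<in> D \<Longrightarrow> u x = 0" if "(\<Sum>x\<in>D. u x *s f x) = 0" for u x
  proof -
    assume x: "x \<in> D"
    have "(\<Sum>x\<in>D. u x *s x) \<in> ?K"
      using that DC C(2) sU by (auto simp: lin_endoD[OF f] intro!: subspace_sum subspace_scale)
    then have "(\<Sum>x\<in>D. u x *s x) \<in> span B" using B by simp
    then obtain v where v: "(\<Sum>x\<in>D. u x *s x) = (\<Sum>x\<in>B. v x *s x)"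
      using span_finite[OF B(2)] by auto
    have "(\<Sum>y\<in>C. (if y \<in> B then - v y else u y) *s y) = (\<Sum>y\<in>D. u y *s y) + (\<Sum>y\<in>B. (- v y) *s y)"
    proof -
      have "(\<Sum>y\<in>C. (if y \<in> B then - v y else u y) *s y)
        = (\<Sum>y\<in>D. (if y \<in> B then - v y else u y) *s y) + (\<Sum>y\<in>B. (if y \<in> B then - v y else u y) *s y)"
        unfolding D_def using sum.subset_diff[OF C(1) fC] by blast
      then show ?thesis by (simp add: D_def)
    qed
    also have "\<dots> = 0" using v by (simp add: sum_negf)
    finally have "(\<Sum>y\<in>C. (if y \<in> B then - v y else u y) *s y) = 0" .
    moreover have "x \<in> C" using x DC by auto
    ultimately have "(if x \<in> B then - v x else u x) = 0"
      using independentD[OF C(3) fC subset_refl, of "\<lambda>y. if y \<in> B then - v y else u y"] by blast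
    then show "u x = 0" using x by (simp add: D_def)
  qed
  have inj: "inj_on f D"
  proof (rule inj_onI, rule ccontr)
    fix x y assume xy: "x \<in> D" "y \<in> D" "f x = f y" "x \<noteq> y"
    define u where "u = (\<lambda>z. if z = x then 1 else if z = y then - 1 else (0::'a))"
    have "(\<Sum>z\<in>D. u z *s f z) = (\<Sum>z\<in>{x,y}. u z *s f z)"
      using xy fD by (intro sum.mono_neutral_right) (auto simp: u_def)
    also have "\<dots> = 0" using xy by (simp add: u_def)
    finally show False using key[of u x] xy by (simp add: u_def)
  qed
  have ind: "independent (f ` D)"
  proof (rule independent_if_scalars_zero)
    show "finite (f ` D)" using fD by simp
    fix g y assume g: "(\<Sum>y\<in>f ` D. g y *s y) = 0" "y \<in> f ` D"
    have "(\<Sum>x\<in>D. (g \<circ> f) x *s f x) = 0" using g(1) by (simp add: sum.reindex[OF inj])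
    then show "g y = 0" using key[of "g \<circ> f"] g(2) by auto
  qed
  have sub: "f ` U \<subseteq> span (f ` D)"
  proof
    fix y assume "y \<in> f ` U"
    then obtain x where x: "x \<in> U" "y = f x" by auto
    then obtain v where v: "x = (\<Sum>z\<in>C. v z *s z)" using span_finite[OF fC] spC by auto
    have "y = (\<Sum>z\<in>C. v z *s f z)" using x v by (simp add: lin_endoD[OF f])
    also have "\<dots> = (\<Sum>z\<in>D. v z *s f z)"
      using fC B(1) by (intro sum.mono_neutral_right) (auto simp: D_def)
    also have "\<dots> \<in> span (f ` D)" by (intro span_sum span_scale span_base imageI)
    finally show "y \<in> span (f ` D)" .
  qed
  show "fdim (f ` U)" using sub fD subspace_image[OF f sU] by (auto simp: fdim_def)
  have "f ` D \<subseteq> f ` U" using DC C(2) by auto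
  then have "dim (f ` U) = card (f ` D)" using dim_unique[OF _ sub ind refl] by simp
  then have "dim (f ` U) = card D" using inj by (simp add: card_image)
  moreover have "card C = card D + card B"
    unfolding D_def using C(1) fC B(2) by (metis card_Diff_subset card_mono le_add_diff_inverse2)
  ultimately show "dim U = dim (f ` U) + dim ?K" using dC B(5) by linarith
qed

section \<open>Complements and codimension\<close>

definition is_compl :: "'b set \<Rightarrow> 'b set \<Rightarrow> bool" where
  "is_compl T J \<longleftrightarrow> subspace T \<and> T \<inter> J \<subseteq> {0} \<and> (\<forall>x. \<exists>t\<in>T. x - t \<in> J)"

text \<open>Finite dimension of the quotient by \<open>J\<close>, expressed by a complement because
  the quotient space has no type of its own.\<close>

definition fcod :: "'b set \<Rightarrow> bool" where
  "fcod J \<longleftrightarrow> subspace J \<and> (\<exists>T. fdim T \<and> is_compl T J)"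

definition codim :: "'b set \<Rightarrow> nat" where
  "codim J = dim (SOME T. fdim T \<and> is_compl T J)"

text \<open>The projection onto \<open>T\<close> along \<open>J\<close> has kernel \<open>J\<close>,
  so that \<open>rank_nullity\<close> becomes available for statements modulo
  \<open>J\<close>.\<close>

lemma is_compl_proj:
  assumes "is_compl T J" "subspace J"
  obtains p where "lin_endo p" "range p = T" "\<And>x. x - p x \<in> J" "\<And>x. p x = 0 \<longleftrightarrow> x \<in> J" "\<And>t. t \<in> T \<Longrightarrow> p t = t"
proof -
  have sT: "subspace T" using assms by (simp add: is_compl_def)
  define p where "p x = (SOME t. t \<in> T \<and> x - t \<in> J)" for x
  have p: "p x \<in> T" "x - p x \<in> J" for x
    using someI_ex[of "\<lambda>t. t \<in> T \<and> x - t \<in> J"] assms(1) by (auto simp: p_def is_compl_def Bex_def)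
  have uniq: "p x = t" if "t \<in> T" "x - t \<in> J" for x t
  proof -
    have "p x - t \<in> T" using p that sT by (simp add: subspace_diff)
    moreover have "p x - t \<in> J" using subspace_diff[OF assms(2) that(2) p(2)[of x]] by simp
    ultimately show ?thesis using assms(1) by (auto simp: is_compl_def)
  qed
  have "lin_endo p" unfolding lin_endo_def
  proof (intro conjI allI)
    fix x y show "p (x + y) = p x + p y"
      using p[of x] p[of y] sT assms(2) by (intro uniq) (auto simp: subspace_add add_diff_add)
  next
    fix c x show "p (c *s x) = c *s p x"
      using p[of x] sT assms(2) by (intro uniq) (auto simp: subspace_scale simp flip: scale_right_diff_distrib)
  qed
  moreover have pt: "p t = t" if "t \<in> T" for t using that uniq assms(2) by (simp add: subspace_0)
  moreover have "range p = T" using p(1) pt by (metis image_subset_iff rangeI subsetI subset_antisym)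
  moreover have "p x = 0 \<longleftrightarrow> x \<in> J" for x
  proof
    assume "p x = 0" then show "x \<in> J" using p(2)[of x] by simp
  next
    assume "x \<in> J" then show "p x = 0" using uniq[of 0 x] sT by (simp add: subspace_0)
  qed
  ultimately show thesis using that p by blast
qed

text \<open>The projection along \<open>J\<close> maps \<open>S\<close> onto \<open>T\<close>, and
  its kernel on \<open>S\<close> is the intersection with \<open>J\<close>.\<close>

lemma dim_supplement:
  assumes "fdim T" "is_compl T J" "subspace J" "fdim S" "\<And>x. \<exists>s\<in>S. x - s \<in> J"
  shows "dim S = dim T + dim (S \<inter> J)"
proof -
  obtain p where p: "lin_endo p" "range p = T" "\<And>x. x - p x \<in> J" "\<And>x. p x = 0 \<longleftrightarrow> x \<in> J"
    using is_compl_proj[OF assms(2,3)] by metis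
  have "p ` S = T"
  proof
    show "p ` S \<subseteq> T" using p(2) by auto
    show "T \<subseteq> p ` S"
    proof
      fix t assume "t \<in> T"
      then obtain x where x: "t = p x" using p(2) by auto
      obtain s where "s \<in> S" "x - s \<in> J" using assms(5) by blast
      then have "p s = t" using p(4)[of "x - s"] x by (simp add: lin_endoD[OF p(1)])
      then show "t \<in> p ` S" using \<open>s \<in> S\<close> by auto
    qed
  qed
  moreover have "{x \<in> S. p x = 0} = S \<inter> J" using p(4) by auto
  ultimately show ?thesis using rank_nullity(2)[OF p(1) assms(4)] by simp
qed

lemma dim_zero: "dim {0} = 0"
  by (rule dim_unique[OF _ _ independent_empty]) (simp_all add: span_0)

lemma codim_eq:
  assumes "fdim T" "is_compl T J" "subspace J"
  shows "codim J = dim T"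
proof -
  have "\<exists>T. fdim T \<and> is_compl T J" using assms by blast
  then have S: "fdim (SOME T. fdim T \<and> is_compl T J)" "is_compl (SOME T. fdim T \<and> is_compl T J) J"
    using someI_ex[of "\<lambda>T. fdim T \<and> is_compl T J"] by auto
  define S where "S = (SOME T. fdim T \<and> is_compl T J)"
  have *: "dim S = dim T + dim (S \<inter> J)"
    using dim_supplement[OF assms S(1)] S(2) by (simp add: S_def is_compl_def)
  have "S \<inter> J = {0}" using S assms(3) by (auto simp: S_def is_compl_def subspace_0)
  then show ?thesis using * by (simp add: codim_def S_def[symmetric] dim_zero)
qed

lemma fcodE:
  assumes "fcod J"
  obtains T where "fdim T" "is_compl T J" "subspace J" "dim T = codim J"
proof -
  obtain T where T: "fdim T" "is_compl T J" "subspace J" using assms by (auto simp: fcod_def)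
  show thesis by (rule that[OF T codim_eq[OF T, symmetric]])
qed

lemma fcod_subspace: "fcod J \<Longrightarrow> subspace J" by (simp add: fcod_def)

lemma codim_supplement:
  assumes "fcod J" "fdim S" "\<And>x. \<exists>s\<in>S. x - s \<in> J"
  shows "dim S = codim J + dim (S \<inter> J)"
proof -
  obtain T where T: "fdim T" "is_compl T J" "subspace J" "dim T = codim J" using fcodE[OF assms(1)] .
  show ?thesis using dim_supplement[OF T(1-3) assms(2,3)] T(4) by simp
qed

text \<open>A basis of the intersection of \<open>S\<close> and \<open>J\<close> is extended to a
  basis of \<open>S\<close>; the added vectors span a complement of \<open>J\<close>.\<close>

lemma ex_compl:
  assumes "subspace J" "fdim S" "\<And>x. \<exists>s\<in>S. x - s \<in> J"
  shows "fcod J"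
proof -
  have sS: "subspace S" using assms(2) by (rule fdim_subspace)
  have K: "fdim (S \<inter> J)" using fdim_subset[OF assms(2)] sS assms(1) by (simp add: subspace_inter)
  obtain B where B: "B \<subseteq> S \<inter> J" "finite B" "independent B" "span B = S \<inter> J" "card B = dim (S \<inter> J)" using fdim_basis[OF K] .
  obtain C where C: "B \<subseteq> C" "C \<subseteq> S" "independent C" "S \<subseteq> span C"
  proof -
    have BS: "B \<subseteq> S" using B(1) by auto
    show thesis by (rule maximal_independent_subset_extend[OF BS B(3)]) (rule that)
  qed
  have fC: "finite C" using independent_le_dim(1)[OF assms(2) C(2,3)] .
  define T where "T = span (C - B)"
  have TS: "T \<subseteq> S" unfolding T_def using C(2) sS by (metis Diff_subset span_minimal subset_trans)
  have "T \<inter> J \<subseteq> {0}"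
  proof
    fix x assume x: "x \<in> T \<inter> J"
    then have "x \<in> span B" using TS B by auto
    have fB: "finite B" using fC C(1) finite_subset by blast
    obtain v where v: "x = (\<Sum>z\<in>B. v z *s z)" using \<open>x \<in> span B\<close> span_finite[OF fB] by auto
    have "x \<in> span (C - B)" using x by (simp add: T_def)
    then obtain u where u: "x = (\<Sum>z\<in>C-B. u z *s z)" using span_finite[of "C - B"] fC by auto
    have "(\<Sum>y\<in>C. (if y \<in> B then - v y else u y) *s y)
        = (\<Sum>y\<in>C-B. (if y \<in> B then - v y else u y) *s y) + (\<Sum>y\<in>B. (if y \<in> B then - v y else u y) *s y)"
      using sum.subset_diff[OF C(1) fC] by blast
    also have "\<dots> = x - x" using u v by (simp add: sum_negf)
    finally have "(\<Sum>y\<in>C. (if y \<in> B then - v y else u y) *s y) = 0" by simp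
    then have "\<forall>y\<in>C. (if y \<in> B then - v y else u y) = 0"
      using independentD[OF C(3) fC subset_refl, of "\<lambda>y. if y \<in> B then - v y else u y"] by blast
    then have "\<forall>z\<in>C-B. u z = 0" by (metis DiffD1 DiffD2)
    then show "x \<in> {0}" using u by simp
  qed
  moreover have "\<exists>t\<in>T. x - t \<in> J" for x
  proof -
    obtain s where s: "s \<in> S" "x - s \<in> J" using assms(3) by blast
    then obtain v where v: "s = (\<Sum>z\<in>C. v z *s z)" using C(4) span_finite[OF fC] by auto
    have sp: "s = (\<Sum>z\<in>C-B. v z *s z) + (\<Sum>z\<in>B. v z *s z)"
      unfolding v using sum.subset_diff[OF C(1) fC] by blast
    have "(\<Sum>z\<in>B. v z *s z) \<in> J" using B(1) assms(1) by (auto intro!: subspace_sum subspace_scale)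
    then have "x - (\<Sum>z\<in>C-B. v z *s z) \<in> J"
      using subspace_add[OF assms(1) s(2), of "(\<Sum>z\<in>B. v z *s z)"] sp by (simp add: algebra_simps)
    moreover have "(\<Sum>z\<in>C-B. v z *s z) \<in> T"
      unfolding T_def by (intro span_sum span_scale span_base)
    ultimately show ?thesis by blast
  qed
  ultimately have "is_compl T J" by (auto simp: is_compl_def T_def)
  moreover have "fdim T" using fdim_subset[OF assms(2) _ TS] by (simp add: T_def)
  ultimately show ?thesis using assms(1) by (auto simp: fcod_def)
qed

lemma fcod_mono:
  assumes "fcod J" "J \<subseteq> J'" "subspace J'"
  shows "fcod J'"
proof -
  obtain T where "fdim T" "is_compl T J" "subspace J" "dim T = codim J" using fcodE[OF assms(1)] .
  then show ?thesis using ex_compl[OF assms(3)] assms(2) by (meson is_compl_def subsetD)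
qed

lemma codim_mono:
  assumes "fcod J" "J \<subseteq> J'" "subspace J'"
  shows "codim J' \<le> codim J"
proof -
  obtain T where T: "fdim T" "is_compl T J" "subspace J" "dim T = codim J" using fcodE[OF assms(1)] .
  have "dim T = codim J' + dim (T \<inter> J')"
    using codim_supplement[OF fcod_mono[OF assms] T(1)] T(2) assms(2) by (meson is_compl_def subsetD)
  then show ?thesis using T(4) by simp
qed

text \<open>The usual way below to prove that two ideals coincide: one inclusion and a comparison of
  codimensions. The part of a complement of \<open>J\<close> that lies in \<open>J'\<close> has
  dimension 0.\<close>

lemma codim_eq_imp_eq:
  assumes "fcod J" "J \<subseteq> J'" "subspace J'" "codim J \<le> codim J'"
  shows "J = J'"
proof -
  obtain T where T: "fdim T" "is_compl T J" "subspace J" "dim T = codim J" using fcodE[OF assms(1)] .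
  have "dim T = codim J' + dim (T \<inter> J')"
    using codim_supplement[OF fcod_mono[OF assms(1-3)] T(1)] T(2) assms(2) by (meson is_compl_def subsetD)
  then have 0: "dim (T \<inter> J') = 0" using T(4) assms(4) by simp
  have "T \<inter> J' \<subseteq> {0}"
  proof -
    have "fdim (T \<inter> J')" using fdim_subset[OF T(1)] assms(3) T(1) by (simp add: subspace_inter fdim_subspace)
    then obtain B where "finite B" "span B = T \<inter> J'" "card B = dim (T \<inter> J')" using fdim_basis by metis
    then show ?thesis using 0 by auto
  qed
  moreover have "subspace J" using assms(1) by (rule fcod_subspace)
  ultimately have "J' \<subseteq> J"
  proof (intro subsetI)
    fix x assume x: "x \<in> J'"
    obtain t where t: "t \<in> T" "x - t \<in> J" using T(2) by (auto simp: is_compl_def)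
    then have "t \<in> J'" using x assms(2,3) subspace_diff[OF assms(3) x, of "x - t"] by auto
    then have "t = 0" using t \<open>T \<inter> J' \<subseteq> {0}\<close> by auto
    then show "x \<in> J" using t by simp
  qed
  then show ?thesis using assms(2) by blast
qed

lemma codim_strict:
  assumes "fcod J" "J \<subset> J'" "subspace J'"
  shows "codim J' < codim J"
  using codim_mono[OF assms(1) _ assms(3)] codim_eq_imp_eq[OF assms(1) _ assms(3)] assms(2)
  by (metis less_le_not_le linorder_le_less_linear order_less_le)

lemma fcod_UNIV: "fcod UNIV" and codim_UNIV: "codim UNIV = 0"
proof -
  have "fdim {0}" "is_compl {0} UNIV" by (auto simp: fdim_def is_compl_def intro: exI[of _ "{}"])
  then show "fcod UNIV" "codim UNIV = 0" using codim_eq[of "{0}" UNIV] by (auto simp: fcod_def dim_zero)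
qed

lemma codim_eq_0: "fcod J \<Longrightarrow> codim J = 0 \<Longrightarrow> J = UNIV"
  using codim_eq_imp_eq[of J UNIV] by (simp add: codim_UNIV)

text \<open>The quotient by the kernel is the image. Finitely many preimages of a basis of the image
  span a space that covers everything modulo the kernel.\<close>

lemma codim_kernel:
  assumes "lin_endo f" "fdim U" "range f \<subseteq> U"
  shows "fcod {x. f x = 0}" "codim {x. f x = 0} = dim (range f)"
proof -
  let ?H = "{x. f x = 0}"
  have sH: "subspace ?H" using subspace_kernel_on[OF assms(1) subspace_UNIV] by simp
  have "subspace (range f)" using subspace_image[OF assms(1) subspace_UNIV] .
  then have R: "fdim (range f)" using fdim_subset[OF assms(2)] assms(3) by blast
  obtain B where B: "B \<subseteq> range f" "finite B" "span B = range f" using fdim_basis[OF R] by metis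
  obtain C where C: "finite C" "f ` C = B" using B(1,2) by (metis finite_subset_image)
  have S: "fdim (span C)" unfolding fdim_def using C by blast
  have sp: "\<exists>s\<in>span C. x - s \<in> ?H" for x
  proof -
    have "f x \<in> span B" using B by auto
    moreover have "span B \<subseteq> f ` span C"
      using C by (intro span_minimal subspace_image[OF assms(1)]) (auto simp: span_base)
    ultimately obtain s where "s \<in> span C" "f x = f s" by auto
    then show ?thesis by (auto simp: lin_endoD[OF assms(1)])
  qed
  show H: "fcod ?H" by (rule ex_compl[OF sH S sp])
  have "dim (span C) = codim ?H + dim (span C \<inter> ?H)" by (rule codim_supplement[OF H S sp])
  moreover have "f ` span C = range f"
  proof
    show "range f \<subseteq> f ` span C"
    proof
      fix y assume "y \<in> range f"
      then obtain x where "y = f x" by auto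
      moreover obtain s where "s \<in> span C" "f (x - s) = 0" using sp[of x] by auto
      ultimately show "y \<in> f ` span C" by (auto simp: lin_endoD[OF assms(1)])
    qed
  qed auto
  moreover have "{x \<in> span C. f x = 0} = span C \<inter> ?H" by auto
  ultimately show "codim ?H = dim (range f)" using rank_nullity(2)[OF assms(1) S] by simp
qed

section \<open>Adjoining a vector, and linear functionals modulo a subspace\<close>

definition adjoin :: "'b \<Rightarrow> 'b set \<Rightarrow> 'b set" where
  "adjoin v J = {c *s v + j | c j. j \<in> J}"

lemma subspace_adjoin:
  assumes "subspace J"
  shows "subspace (adjoin v J)"
proof (rule subspaceI)
  show "0 \<in> adjoin v J"
    unfolding adjoin_def using subspace_0[OF assms] by (intro CollectI exI[of _ 0] exI[of _ 0]) auto
  fix x y assume "x \<in> adjoin v J" "y \<in> adjoin v J"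
  then obtain c j d j' where cj: "x = c *s v + j" "j \<in> J" "y = d *s v + j'" "j' \<in> J" unfolding adjoin_def by blast
  have "x + y = (c + d) *s v + (j + j')" using cj by (simp add: scale_left_distrib)
  then show "x + y \<in> adjoin v J" unfolding adjoin_def using subspace_add[OF assms cj(2,4)] by blast
next
  fix c x assume "x \<in> adjoin v J"
  then obtain d j where cj: "x = d *s v + j" "j \<in> J" unfolding adjoin_def by blast
  have "c *s x = (c * d) *s v + c *s j" using cj by (simp add: scale_right_distrib)
  then show "c *s x \<in> adjoin v J" unfolding adjoin_def using subspace_scale[OF assms cj(2)] by blast
qed

lemma adjoin_superset: "J \<subseteq> adjoin v J"
  unfolding adjoin_def by (auto intro: exI[of _ 0])

lemma adjoin_mem: "subspace J \<Longrightarrow> v \<in> adjoin v J"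
  unfolding adjoin_def by (intro CollectI exI[of _ 1] exI[of _ 0]) (simp add: subspace_0)

lemma adjoin_least: "subspace H \<Longrightarrow> J \<subseteq> H \<Longrightarrow> v \<in> H \<Longrightarrow> adjoin v J \<subseteq> H"
  unfolding adjoin_def by (auto intro: subspace_add subspace_scale)

text \<open>A complement of \<open>J\<close> meets the enlarged space exactly in the line through
  its representative \<open>t\<close> of \<open>v\<close>.\<close>

lemma codim_adjoin:
  assumes "fcod J" "v \<notin> J"
  shows "codim J = Suc (codim (adjoin v J))"
proof -
  obtain T where T: "fdim T" "is_compl T J" "subspace J" "dim T = codim J" using fcodE[OF assms(1)] .
  have f: "fcod (adjoin v J)" using fcod_mono[OF assms(1) adjoin_superset subspace_adjoin[OF T(3)]] .
  have 1: "dim T = codim (adjoin v J) + dim (T \<inter> adjoin v J)"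
    using T adjoin_superset by (intro codim_supplement[OF f T(1)]) (meson is_compl_def subsetD)
  obtain t where t: "t \<in> T" "v - t \<in> J" using T(2) by (auto simp: is_compl_def)
  have t0: "t \<noteq> 0" using t assms(2) by auto
  have "T \<inter> adjoin v J = span {t}"
  proof
    show "T \<inter> adjoin v J \<subseteq> span {t}"
    proof
      fix x assume x: "x \<in> T \<inter> adjoin v J"
      then obtain c j where c: "x = c *s v + j" "j \<in> J" by (auto simp: adjoin_def)
      have "x - c *s t = c *s (v - t) + j" using c by (simp add: scale_right_diff_distrib)
      also have "\<dots> \<in> J" using t c T(3) by (intro subspace_add subspace_scale)
      finally have "x - c *s t \<in> J" .
      moreover have "x - c *s t \<in> T" using x t T(1) by (auto intro!: subspace_diff subspace_scale simp: fdim_def)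
      ultimately have "x = c *s t" using T(2) by (auto simp: is_compl_def)
      then show "x \<in> span {t}" by (simp add: span_base span_scale)
    qed
    have "t = v - (v - t)" by simp
    then have "t \<in> adjoin v J"
      using adjoin_mem[OF T(3)] adjoin_superset t subspace_adjoin[OF T(3)] subspace_diff
      by (metis subsetD)
    then show "span {t} \<subseteq> T \<inter> adjoin v J"
      using t T(1,3) by (intro span_minimal) (auto intro: subspace_inter subspace_adjoin fdim_subspace)
  qed
  then have "dim (T \<inter> adjoin v J) = 1" using t0 dim_span_eq_card_independent[of "{t}"] by simp
  then show ?thesis using 1 T(4) by simp
qed

lemma ex_lin_fun:
  assumes "subspace J" "v \<notin> J"
  obtains w where "lin_fun w" "\<And>j. j \<in> J \<Longrightarrow> w j = 0" "w v = 1"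
proof -
  interpret vp: vector_space_pair scale "(*) :: 'a \<Rightarrow> 'a \<Rightarrow> 'a"
    by unfold_locales (auto simp: algebra_simps)
  obtain B where B: "B \<subseteq> J" "independent B" "J \<subseteq> span B" using basis_exists[of J] by metis
  have spB: "span B = J" using B span_minimal[OF B(1) assms(1)] by auto
  have "independent (insert v B)" using B spB assms(2) by (simp add: independent_insertI)
  then obtain g where g: "Vector_Spaces.linear scale (*) g" "\<forall>x\<in>insert v B. g x = (if x = v then 1 else 0)"
    using vp.linear_independent_extend[of "insert v B" "\<lambda>x. if x = v then 1 else 0"] by blast
  have lf: "lin_fun g" using g(1) by (auto simp: lin_fun_def Vector_Spaces.linear_iff)
  have "v \<notin> B" using assms(2) B(1) by auto
  then have gB: "b \<in> B \<Longrightarrow> g b = 0" for b using g(2) by auto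
  have "g j = 0" if "j \<in> J" for j
  proof -
    have "j \<in> span B" using that spB by simp
    then show ?thesis
      by (induction rule: span_induct_alt) (auto simp: lin_funD[OF lf] gB)
  qed
  then show thesis using that[OF lf] g(2) by auto
qed

text \<open>The quotient of \<open>J\<close> by \<open>I\<close> has dimension at least 2, and on
  such a space every functional has a nonzero kernel vector.\<close>

lemma ex_kernel_vector:
  assumes "fcod I" "I \<subseteq> J" "subspace J" "codim J + 2 \<le> codim I" "lin_fun w" "\<And>x. x \<in> I \<Longrightarrow> w x = 0"
  obtains x where "x \<in> J" "x \<notin> I" "w x = 0"
proof -
  have "I \<noteq> J" using assms(4) by auto
  then obtain x where x: "x \<in> J" "x \<notin> I" using assms(2) by auto
  show thesis
  proof (cases "w x = 0")
    case True then show ?thesis using that x by blast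
  next
    case False
    have sI: "subspace I" using assms(1) by (rule fcod_subspace)
    have "adjoin x I \<noteq> J" using codim_adjoin[OF assms(1) x(2)] assms(4) by auto
    moreover have "adjoin x I \<subseteq> J" by (rule adjoin_least[OF assms(3,2) x(1)])
    ultimately obtain y where y: "y \<in> J" "y \<notin> adjoin x I" by auto
    \<comment> \<open>As \<open>y\<close> is independent of \<open>x\<close> modulo
      \<open>I\<close>, correcting it by a multiple of \<open>x\<close> cannot make it fall into
      \<open>I\<close>.\<close>
    define z where "z = y - (w y / w x) *s x"
    have "z \<in> J" using y x assms(3) by (auto simp: z_def intro: subspace_diff subspace_scale)
    moreover have "z \<notin> I"
    proof
      assume "z \<in> I"
      then have "y \<in> adjoin x I" unfolding adjoin_def
        by (intro CollectI exI[of _ "w y / w x"] exI[of _ z]) (simp add: z_def)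
      then show False using y by simp
    qed
    moreover have "w z = 0" using False by (simp add: z_def lin_funD[OF assms(5)])
    ultimately show ?thesis using that by blast
  qed
qed

text \<open>\<open>x1\<close> and \<open>x2\<close> are a basis of the two-dimensional quotient by
  \<open>J\<close>, and \<open>w1\<close>, \<open>w2\<close> its dual basis.\<close>

lemma ex_two_lin_funs:
  assumes "fcod J" "codim J = 2"
  obtains w1 w2 x1 x2 where "lin_fun w1" "lin_fun w2" "J = {z. w1 z = 0 \<and> w2 z = 0}"
    "w1 x1 = 1" "w2 x1 = 0" "w1 x2 = 0" "w2 x2 = 1"
proof -
  have sJ: "subspace J" using assms(1) by (rule fcod_subspace)
  have "J \<noteq> UNIV" using assms(2) codim_UNIV by auto
  then obtain x where x: "x \<notin> J" by auto
  have s1: "subspace (adjoin x J)" by (rule subspace_adjoin[OF sJ])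
  have f1: "fcod (adjoin x J)" by (rule fcod_mono[OF assms(1) adjoin_superset s1])
  have c1: "codim (adjoin x J) = 1" using codim_adjoin[OF assms(1) x] assms(2) by simp
  then have "adjoin x J \<noteq> UNIV" using codim_UNIV by auto
  then obtain y where y: "y \<notin> adjoin x J" by auto
  have xy: "x \<notin> adjoin y J"
  proof
    assume "x \<in> adjoin y J"
    then obtain c j where c: "x = c *s y + j" "j \<in> J" by (auto simp: adjoin_def)
    then have "c \<noteq> 0" using x by auto
    have "y = (1 / c) *s x + (- (1 / c)) *s j" using c \<open>c \<noteq> 0\<close> by (simp add: scale_right_distrib)
    moreover have "(- (1 / c)) *s j \<in> J" using subspace_scale[OF sJ c(2)] .
    ultimately have "y \<in> adjoin x J" unfolding adjoin_def by blast
    then show False using y by simp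
  qed
  obtain w2 where w2: "lin_fun w2" "\<And>j. j \<in> adjoin x J \<Longrightarrow> w2 j = 0" "w2 y = 1"
    using ex_lin_fun[OF s1 y] by metis
  obtain w1 where w1: "lin_fun w1" "\<And>j. j \<in> adjoin y J \<Longrightarrow> w1 j = 0" "w1 x = 1"
    using ex_lin_fun[OF subspace_adjoin[OF sJ] xy] by metis
  have all: "adjoin y (adjoin x J) = UNIV"
  proof (rule codim_eq_0)
    show "fcod (adjoin y (adjoin x J))" by (rule fcod_mono[OF f1 adjoin_superset subspace_adjoin[OF s1]])
    show "codim (adjoin y (adjoin x J)) = 0" using codim_adjoin[OF f1 y] c1 by simp
  qed
  have z: "w2 x = 0" "w1 y = 0" using w2(2) w1(2) adjoin_mem[OF sJ] by auto
  have J0: "j \<in> J \<Longrightarrow> w1 j = 0 \<and> w2 j = 0" for j using w1(2) w2(2) adjoin_superset by blast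
  have "J = {z. w1 z = 0 \<and> w2 z = 0}"
  proof (intro equalityI subsetI CollectI)
    fix u assume "u \<in> {z. w1 z = 0 \<and> w2 z = 0}"
    then have u: "w1 u = 0" "w2 u = 0" by auto
    obtain c d j where cdj: "u = c *s y + (d *s x + j)" "j \<in> J" using all unfolding adjoin_def by blast
    have "c = 0" using u(2) J0[OF cdj(2)] z w2(3) unfolding cdj(1) by (simp add: lin_funD[OF w2(1)])
    moreover have "d = 0" using u(1) J0[OF cdj(2)] z w1(3) unfolding cdj(1) by (simp add: lin_funD[OF w1(1)])
    ultimately show "u \<in> J" using cdj by simp
  qed (use J0 in auto)
  then show thesis using that[OF w1(1) w2(1)] w1(3) w2(3) z by blast
qed

text \<open>\<open>B\<close> induces a bilinear form on the quotient of \<open>M\<close> by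
  \<open>J\<close> that has no kernel on the left; in finite dimension an injection into the dual
  space is onto.\<close>

lemma representable:
  assumes J: "fcod J" "J \<subseteq> M" "subspace M"
    and B1: "\<And>y. lin_fun (\<lambda>x. B x y)" and B2: "\<And>x. lin_fun (B x)"
    and BJ: "\<And>x y. x \<in> M \<Longrightarrow> y \<in> J \<Longrightarrow> B x y = 0"
    and nd: "\<And>x. x \<in> M \<Longrightarrow> (\<And>y. y \<in> M \<Longrightarrow> B x y = 0) \<Longrightarrow> x \<in> J"
    and psi: "lin_fun \<psi>" "\<And>y. y \<in> J \<Longrightarrow> \<psi> y = 0"
  obtains a where "a \<in> M" "\<And>y. y \<in> M \<Longrightarrow> \<psi> y = B a y"
proof -
  obtain T where T: "fdim T" "is_compl T J" "subspace J" "dim T = codim J" using fcodE[OF J(1)] .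
  define U where "U = T \<inter> M"
  have U: "fdim U" using fdim_subset[OF T(1)] J(3) T(1) by (auto simp: U_def subspace_inter fdim_subspace)
  obtain E where E: "E \<subseteq> U" "finite E" "independent E" "span E = U" using fdim_basis[OF U] by metis
  \<comment> \<open>The functional \<open>B a\<close> is encoded by its values on the basis
    \<open>E\<close>, taken as the coordinates of a vector of \<open>U\<close>. The map to the dual
    space thus becomes an endomorphism of \<open>U\<close>, for which injective implies
    surjective.\<close>
  define f where "f a = (\<Sum>e\<in>E. B a e *s e)" for a
  have lf: "lin_endo f" unfolding lin_endo_def f_def
    using B1 by (auto simp: lin_fun_def scale_left_distrib sum.distrib scale_sum_right)
  have dec: "\<exists>u\<in>U. y - u \<in> J" if "y \<in> M" for y
  proof -
    obtain t where t: "t \<in> T" "y - t \<in> J" using T(2) by (auto simp: is_compl_def)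
    then have "t \<in> M" using subspace_diff[OF J(3) that, of "y - t"] J(2) by auto
    then show ?thesis using t by (auto simp: U_def)
  qed
  have ext: "\<psi>' y = B a y" if "\<And>e. e \<in> E \<Longrightarrow> \<psi>' e = B a e" "a \<in> M" "y \<in> M" "lin_fun \<psi>'"
    "\<And>y. y \<in> J \<Longrightarrow> \<psi>' y = 0" for \<psi>' a y
  proof -
    have onU: "\<psi>' u = B a u" if "u \<in> U" for u
    proof -
      have "u \<in> span E" using that E by simp
      then show ?thesis
      proof (induction rule: span_induct_alt)
        case base
        show ?case by (simp only: lin_funD(3)[OF \<open>lin_fun \<psi>'\<close>] lin_funD(3)[OF B2])
      next
        case (step c e z)
        show ?case
          by (simp only: lin_funD(1,2)[OF \<open>lin_fun \<psi>'\<close>] lin_funD(1,2)[OF B2] \<open>\<And>e. e \<in> E \<Longrightarrow> \<psi>' e = B a e\<close>[OF step(1)] step(2))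
      qed
    qed
    obtain u where u: "u \<in> U" "y - u \<in> J" using dec[OF \<open>y \<in> M\<close>] by auto
    have "\<psi>' (y - u) = 0" "B a (y - u) = 0" using u(2) BJ that by auto
    then show ?thesis using onU[OF u(1)] by (simp add: lin_funD[OF \<open>lin_fun \<psi>'\<close>] lin_funD[OF B2])
  qed
  have indE: "\<forall>e\<in>E. c e = 0" if "(\<Sum>e\<in>E. c e *s e) = 0" for c
    using independentD[OF E(3) E(2) subset_refl that] by blast
  have ker: "{x \<in> U. f x = 0} = {0}"
  proof
    show "{x \<in> U. f x = 0} \<subseteq> {0}"
    proof
      fix x assume x: "x \<in> {x \<in> U. f x = 0}"
      then have "\<forall>e\<in>E. B x e = 0" using indE unfolding f_def by blast
      moreover have xM: "x \<in> M" using x by (auto simp: U_def)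
      moreover have "lin_fun (\<lambda>_. 0)" by (simp add: lin_fun_def)
      ultimately have "\<And>y. y \<in> M \<Longrightarrow> 0 = B x y" using ext[of "\<lambda>_. 0" x] by auto
      then have "x \<in> J" using nd[OF xM] by metis
      then show "x \<in> {0}" using x T(2) by (auto simp: U_def is_compl_def)
    qed
    show "{0} \<subseteq> {x \<in> U. f x = 0}" using fdim_subspace[OF U] lin_endoD(3)[OF lf] by (simp add: subspace_0)
  qed
  have "dim U = dim (f ` U)" using rank_nullity(2)[OF lf U] ker dim_zero by simp
  moreover have "f ` U \<subseteq> U"
    using E(1) fdim_subspace[OF U] by (auto simp: f_def intro!: subspace_sum subspace_scale)
  moreover have "subspace (f ` U)" by (rule subspace_image[OF lf fdim_subspace[OF U]])
  ultimately have fU: "f ` U = U" using dim_eq_imp_eq[OF U] by simp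
  have "(\<Sum>e\<in>E. \<psi> e *s e) \<in> U"
    using E(1) fdim_subspace[OF U] by (auto intro!: subspace_sum subspace_scale)
  then obtain a where a: "a \<in> U" "f a = (\<Sum>e\<in>E. \<psi> e *s e)" using fU by (metis imageE)
  have "(\<Sum>e\<in>E. (\<psi> e - B a e) *s e) = 0"
    using a(2) by (simp add: f_def scale_left_diff_distrib sum_subtractf)
  then have "\<And>e. e \<in> E \<Longrightarrow> \<psi> e = B a e" using indE[of "\<lambda>e. \<psi> e - B a e"] by simp
  moreover have "a \<in> M" using a by (auto simp: U_def)
  ultimately show thesis using that ext[of \<psi> a] psi by blast
qed

text \<open>By induction on \<open>F\<close>: a further functional either vanishes on the space
  found so far or cuts out a hyperplane in it.\<close>

lemma codim_kernel_functionals: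
  assumes "fcod J" "finite F" "\<And>w. w \<in> F \<Longrightarrow> lin_fun w"
  shows "codim {x \<in> J. \<forall>w\<in>F. w x = 0} \<le> codim J + card F" "fcod {x \<in> J. \<forall>w\<in>F. w x = 0}"
proof -
  have "codim {x \<in> J. \<forall>w\<in>F. w x = 0} \<le> codim J + card F \<and> fcod {x \<in> J. \<forall>w\<in>F. w x = 0}"
    using assms(2,3)
  proof (induction F rule: finite_induct)
    case empty then show ?case using assms(1) by simp
  next
    case (insert w F)
    let ?I = "{x \<in> J. \<forall>w\<in>F. w x = 0}" let ?I' = "{x \<in> J. \<forall>w\<in>insert w F. w x = 0}"
    have IH: "codim ?I \<le> codim J + card F" "fcod ?I" using insert by auto
    have w: "lin_fun w" using insert by auto
    have eq: "?I' = {x \<in> ?I. w x = 0}" by auto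
    have sI: "subspace ?I" using IH by (simp add: fcod_def)
    have sI': "subspace ?I'" unfolding eq using sI by (auto simp: subspace_def lin_funD[OF w])
    show ?case
    proof (cases "?I \<subseteq> {x. w x = 0}")
      case True
      then have "?I' = ?I" by auto
      then show ?thesis using IH insert by (auto simp del: insert_iff)
    next
      case False
      then obtain v where v: "v \<in> ?I" "w v \<noteq> 0" by auto
      have adj: "adjoin v ?I' = ?I"
      proof
        show "adjoin v ?I' \<subseteq> ?I" by (rule adjoin_least[OF sI _ v(1)]) auto
        show "?I \<subseteq> adjoin v ?I'"
        proof
          fix x assume x: "x \<in> ?I"
          define j where "j = x - (w x / w v) *s v"
          have "j \<in> ?I" unfolding j_def by (rule subspace_diff[OF sI x subspace_scale[OF sI v(1)]])
          moreover have "w j = 0" using v(2) by (simp add: j_def lin_funD[OF w])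
          ultimately have "j \<in> ?I'" by auto
          then show "x \<in> adjoin v ?I'" unfolding adjoin_def
            by (intro CollectI exI[of _ "w x / w v"] exI[of _ j]) (auto simp: j_def)
        qed
      qed
      obtain T where T: "fdim T" "is_compl T ?I" "subspace ?I" "dim T = codim ?I" using fcodE[OF IH(2)] .
      obtain B where B: "finite B" "T \<subseteq> span B" using T(1) by (auto simp: fdim_def)
      have "fdim (span (insert v B))" using B(1) unfolding fdim_def by (auto intro!: exI[of _ "insert v B"])
      moreover have "\<exists>s\<in>span (insert v B). x - s \<in> ?I'" for x
      proof -
        obtain t where t: "t \<in> T" "x - t \<in> ?I" using T(2) unfolding is_compl_def by blast
        then obtain c j where cj: "x - t = c *s v + j" "j \<in> ?I'" unfolding adj[symmetric] adjoin_def by blast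
        have "t + c *s v \<in> span (insert v B)"
          using t(1) B(2) by (meson span_add span_base span_mono span_scale insertI1 subset_insertI subsetD)
        moreover have "x - (t + c *s v) \<in> ?I'" using cj by (simp add: algebra_simps)
        ultimately show ?thesis by blast
      qed
      ultimately have f: "fcod ?I'" using ex_compl[OF sI'] by blast
      have "v \<notin> ?I'" using v by auto
      then have "codim ?I' = Suc (codim ?I)" using codim_adjoin[OF f] adj by simp
      then show ?thesis using IH f insert by auto
    qed
  qed
  then show "codim {x \<in> J. \<forall>w\<in>F. w x = 0} \<le> codim J + card F" "fcod {x \<in> J. \<forall>w\<in>F. w x = 0}" by auto
qed

end

section \<open>Commutative algebras modulo ideals of finite codimension\<close>

locale comm_alg = vspace scale
  for scale :: "'a::field \<Rightarrow> 'b::comm_ring_1 \<Rightarrow> 'b" (infixr \<open>*s\<close> 75) +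
  assumes scale_mult: "(c *s x) * y = c *s (x * y)"
begin

lemma mult_scale: "x * (c *s y) = c *s (x * y)"
  using scale_mult[of c y x] by (simp add: mult.commute)

definition tideal :: "'b set \<Rightarrow> bool" where
  "tideal J \<longleftrightarrow> 0 \<in> J \<and> (\<forall>x\<in>J. \<forall>y\<in>J. x + y \<in> J) \<and> (\<forall>x\<in>J. \<forall>a. a * x \<in> J)"

text \<open>A maximal ideal, described by invertibility modulo \<open>m\<close> instead of a
  comparison with other ideals.\<close>

definition maxi :: "'b set \<Rightarrow> bool" where
  "maxi m \<longleftrightarrow> tideal m \<and> 1 \<notin> m \<and> (\<forall>x. x \<notin> m \<longrightarrow> (\<exists>y. 1 - x * y \<in> m))"

text \<open>The colon ideal \<open>(J : x)\<close>, the annihilator of \<open>x\<close> modulo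
  \<open>J\<close>.\<close>

definition quo :: "'b set \<Rightarrow> 'b \<Rightarrow> 'b set" where
  "quo J x = {y. x * y \<in> J}"

text \<open>The ideal \<open>(x) + J\<close>, which is the principal ideal of \<open>x\<close> in
  the quotient by \<open>J\<close>.\<close>

definition prin :: "'b \<Rightarrow> 'b set \<Rightarrow> 'b set" where
  "prin x J = {x * t + j | t j. j \<in> J}"

text \<open>The ideal \<open>M^2 + J\<close>; for maximal \<open>M\<close> it measures the cotangent
  space of the quotient by \<open>J\<close>.\<close>

definition msq :: "'b set \<Rightarrow> 'b set \<Rightarrow> 'b set" where
  "msq M J = \<Inter>{H. tideal H \<and> J \<subseteq> H \<and> (\<forall>a\<in>M. \<forall>b\<in>M. a * b \<in> H)}"

text \<open>The kernel of the map to the localization at \<open>m\<close> of the quotient by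
  \<open>\<aa>\<close>. If \<open>\<aa>\<close> has finite codimension, that quotient is Artinian
  and its localization is the quotient by this ideal.\<close>

definition loc :: "'b set \<Rightarrow> 'b set \<Rightarrow> 'b set" where
  "loc \<aa> m = {x. \<exists>y. y \<notin> m \<and> x * y \<in> \<aa>}"

lemma tidealD:
  assumes "tideal J"
  shows "0 \<in> J" "x \<in> J \<Longrightarrow> y \<in> J \<Longrightarrow> x + y \<in> J" "x \<in> J \<Longrightarrow> a * x \<in> J" "x \<in> J \<Longrightarrow> x * a \<in> J"
    "x \<in> J \<Longrightarrow> - x \<in> J" "x \<in> J \<Longrightarrow> y \<in> J \<Longrightarrow> x - y \<in> J" "x \<in> J \<Longrightarrow> c *s x \<in> J"
    "(\<And>i. i \<in> F \<Longrightarrow> g i \<in> J) \<Longrightarrow> sum g F \<in> J"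
proof -
  show 0: "0 \<in> J" using assms by (auto simp: tideal_def)
  show a: "x + y \<in> J" if "x \<in> J" "y \<in> J" for x y using assms that by (auto simp: tideal_def)
  show m: "a * x \<in> J" if "x \<in> J" for a x using assms that by (auto simp: tideal_def)
  show "x * a \<in> J" if "x \<in> J" using m[OF that] by (simp add: mult.commute)
  show n: "- x \<in> J" if "x \<in> J" for x using m[OF that, of "- 1"] by simp
  show "x - y \<in> J" if "x \<in> J" "y \<in> J" using a[OF that(1) n[OF that(2)]] by simp
  show "c *s x \<in> J" if "x \<in> J" using m[OF that, of "c *s 1"] by (simp add: scale_mult)
  show "sum g F \<in> J" if "\<And>i. i \<in> F \<Longrightarrow> g i \<in> J"
    using that by (induction F rule: infinite_finite_induct) (auto simp: 0 a)
qed

lemma tideal_subspace: "tideal J \<Longrightarrow> subspace J"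
  by (rule subspaceI) (auto simp: tidealD)

lemma tideal_UNIV: "tideal UNIV" by (simp add: tideal_def)

lemma tideal_one: "tideal J \<Longrightarrow> 1 \<in> J \<Longrightarrow> J = UNIV"
  using tidealD(3)[of J 1] by auto

lemma tideal_cong: "tideal J \<Longrightarrow> x - y \<in> J \<Longrightarrow> x \<in> J \<longleftrightarrow> y \<in> J"
  using tidealD(2)[of J "x - y" y] tidealD(6)[of J x "x - y"] by auto

lemma tideal_quo: "tideal J \<Longrightarrow> tideal (quo J x)"
  by (auto simp: tideal_def quo_def distrib_left mult.left_commute)

lemma quo_superset: "tideal J \<Longrightarrow> J \<subseteq> quo J x"
  by (auto simp: quo_def tidealD)

lemma tideal_prin:
  assumes "tideal J"
  shows "tideal (prin x J)"
  unfolding tideal_def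
proof (intro conjI ballI allI)
  show "0 \<in> prin x J" unfolding prin_def using tidealD(1)[OF assms]
    by (intro CollectI exI[of _ 0] exI[of _ 0]) simp
  fix u assume "u \<in> prin x J"
  then obtain t j where u: "u = x * t + j" "j \<in> J" by (auto simp: prin_def)
  show "a * u \<in> prin x J" for a
    unfolding prin_def u using tidealD(3)[OF assms u(2), of a]
    by (intro CollectI exI[of _ "a * t"] exI[of _ "a * j"]) (simp add: algebra_simps)
  fix v assume "v \<in> prin x J"
  then obtain t' j' where v: "v = x * t' + j'" "j' \<in> J" by (auto simp: prin_def)
  show "u + v \<in> prin x J"
    unfolding prin_def u v using tidealD(2)[OF assms u(2) v(2)]
    by (intro CollectI exI[of _ "t + t'"] exI[of _ "j + j'"]) (simp add: algebra_simps)
qed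

lemma prin_superset: "J \<subseteq> prin x J"
  unfolding prin_def by (auto intro: exI[of _ 0])

lemma prin_mem: "tideal J \<Longrightarrow> x * t \<in> prin x J"
  unfolding prin_def by (intro CollectI exI[of _ t] exI[of _ 0]) (auto simp: tidealD)

lemma prin_self: "tideal J \<Longrightarrow> x \<in> prin x J"
  using prin_mem[of J x 1] by simp

lemma prin_least: "tideal H \<Longrightarrow> J \<subseteq> H \<Longrightarrow> x \<in> H \<Longrightarrow> prin x J \<subseteq> H"
  unfolding prin_def by (auto simp: tidealD)

lemma prin_iff: "z \<in> prin x J \<longleftrightarrow> (\<exists>t. z - x * t \<in> J)"
proof
  assume "z \<in> prin x J"
  then obtain t j where t: "z = x * t + j" "j \<in> J" by (auto simp: prin_def)
  then have "z - x * t \<in> J" by simp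
  then show "\<exists>t. z - x * t \<in> J" by blast
next
  assume "\<exists>t. z - x * t \<in> J"
  then obtain t where t: "z - x * t \<in> J" by blast
  then show "z \<in> prin x J" unfolding prin_def by (intro CollectI exI[of _ t] exI[of _ "z - x * t"]) simp
qed

text \<open>Multiplication by \<open>x\<close> identifies the quotient by \<open>(J : x)\<close>
  with the submodule generated by \<open>x\<close> in the quotient by \<open>J\<close>.\<close>

lemma codim_quo_prin:
  assumes "fcod J" "tideal J"
  shows "fcod (quo J x)" "fcod (prin x J)" "codim (quo J x) + codim (prin x J) = codim J"
proof -
  obtain T where T: "fdim T" "is_compl T J" "subspace J" "dim T = codim J" using fcodE[OF assms(1)] .
  obtain p where p: "lin_endo p" "range p = T" "\<And>x. x - p x \<in> J" "\<And>x. p x = 0 \<longleftrightarrow> x \<in> J" "\<And>t. t \<in> T \<Longrightarrow> p t = t"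
    using is_compl_proj[OF T(2,3)] by blast
  define f where "f t = p (x * t)" for t
  have f: "lin_endo f"
    unfolding lin_endo_def f_def by (auto simp: distrib_left lin_endoD[OF p(1)] mult_scale)
  have rT: "range f \<subseteq> T" using p(2) by (auto simp: f_def)
  have ker: "{t. f t = 0} = quo J x" using p(4) by (auto simp: f_def quo_def)
  show 1: "fcod (quo J x)" using codim_kernel(1)[OF f T(1) rT] by (simp add: ker)
  have cq: "codim (quo J x) = dim (range f)" using codim_kernel(2)[OF f T(1) rT] by (simp add: ker)
  show 2: "fcod (prin x J)"
    using fcod_mono[OF assms(1) prin_superset tideal_subspace[OF tideal_prin[OF assms(2)]]] .
  have "dim T = codim (prin x J) + dim (T \<inter> prin x J)"
    using T(2) prin_superset by (intro codim_supplement[OF 2 T(1)]) (meson is_compl_def subsetD)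
  moreover have "T \<inter> prin x J = range f"
  proof
    show "range f \<subseteq> T \<inter> prin x J"
    proof
      fix u assume "u \<in> range f"
      then obtain t where u: "u = p (x * t)" by (auto simp: f_def)
      have "x * t - p (x * t) \<in> prin x J" using p(3) prin_superset by blast
      then have "x * t - (x * t - p (x * t)) \<in> prin x J"
        using tidealD(6)[OF tideal_prin[OF assms(2)] prin_mem[OF assms(2)]] by blast
      then show "u \<in> T \<inter> prin x J" using u p(2) by auto
    qed
    show "T \<inter> prin x J \<subseteq> range f"
    proof
      fix u assume u: "u \<in> T \<inter> prin x J"
      then obtain t j where t: "u = x * t + j" "j \<in> J" by (auto simp: prin_def)
      have "u = p u" using p(5) u by simp
      also have "\<dots> = f t" using t p(4)[of j] by (simp add: f_def lin_endoD[OF p(1)])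
      finally show "u \<in> range f" by simp
    qed
  qed
  ultimately show "codim (quo J x) + codim (prin x J) = codim J" using cq T(4) by simp
qed

section \<open>Minimal ideals and maximal ideals\<close>

lemma fcod_tideal: "fcod I \<Longrightarrow> I \<subseteq> J \<Longrightarrow> tideal J \<Longrightarrow> fcod J"
  using fcod_mono tideal_subspace by blast

lemma codim_max_exists:
  assumes "P (x0::'c)" "\<And>x. P x \<Longrightarrow> f x \<le> (N::nat)"
  obtains x where "P x" "\<And>y. P y \<Longrightarrow> f y \<le> f x"
proof -
  obtain x where x: "P x" "\<And>y. P y \<Longrightarrow> N - f x \<le> N - f y"
    using ex_has_least_nat[of P x0 "\<lambda>x. N - f x"] assms(1) by blast
  have "f y \<le> f x" if "P y" for y using x(2)[OF that] assms(2)[OF that] assms(2)[OF x(1)] by linarith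
  then show thesis using that[OF x(1)] by blast
qed

text \<open>An element \<open>t\<close> with the smallest possible ideal \<open>(t) + I\<close>
  spans a simple submodule modulo \<open>I\<close>: a multiple of \<open>t\<close> outside
  \<open>I\<close> generates the same ideal, so \<open>t\<close> can be recovered from it.\<close>

lemma minimal_above:
  assumes "fcod I" "tideal I" "tideal J" "I \<subset> J"
  obtains t where "t \<in> J" "t \<notin> I" "maxi (quo I t)"
proof -
  obtain t0 where t0: "t0 \<in> J \<and> t0 \<notin> I" using assms(4) by auto
  have le: "codim (prin t I) \<le> codim I" for t using codim_quo_prin(3)[OF assms(1,2), of t] by simp
  obtain t where t: "t \<in> J \<and> t \<notin> I" "\<And>y. y \<in> J \<and> y \<notin> I \<Longrightarrow> codim (prin y I) \<le> codim (prin t I)"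
    using codim_max_exists[of "\<lambda>t. t \<in> J \<and> t \<notin> I" t0 "\<lambda>t. codim (prin t I)" "codim I"] t0 le by blast
  have "maxi (quo I t)" unfolding maxi_def
  proof (intro conjI allI impI)
    show "tideal (quo I t)" by (rule tideal_quo[OF assms(2)])
    show "1 \<notin> quo I t" using t(1) by (simp add: quo_def)
    fix y assume "y \<notin> quo I t"
    then have y: "t * y \<notin> I" by (simp add: quo_def)
    have "prin (t * y) I = prin t I"
    proof (rule codim_eq_imp_eq)
      show "fcod (prin (t * y) I)" by (rule codim_quo_prin(2)[OF assms(1,2)])
      show "subspace (prin t I)" by (rule tideal_subspace[OF tideal_prin[OF assms(2)]])
      show "prin (t * y) I \<subseteq> prin t I"
        by (rule prin_least[OF tideal_prin[OF assms(2)] prin_superset prin_mem[OF assms(2)]])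
      show "codim (prin (t * y) I) \<le> codim (prin t I)" using t y tidealD(4)[OF assms(3)] by blast
    qed
    then have "t \<in> prin (t * y) I" using prin_self[OF assms(2)] by blast
    then obtain z where "t - t * y * z \<in> I" using prin_iff by blast
    then show "\<exists>z. 1 - y * z \<in> quo I t" by (intro exI[of _ z]) (simp add: quo_def algebra_simps)
  qed
  then show thesis using that t by blast
qed

lemma codim_prin_minimal:
  assumes "fcod I" "tideal I" "codim (quo I t) = 1"
  shows "codim I = Suc (codim (prin t I))"
  using codim_quo_prin(3)[OF assms(1,2), of t] assms(3) by simp

text \<open>Minimal ideals are added to \<open>I\<close> one at a time. Each adds dimension 1
  because the residue fields have dimension 1, so no value of the codimension is skipped.\<close>

lemma ideal_between:
  assumes "fcod I" "tideal I" "tideal J" "I \<subseteq> J" "codim J \<le> d" "d \<le> codim I"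
    and max1: "\<And>m. maxi m \<Longrightarrow> I \<subseteq> m \<Longrightarrow> codim m = 1"
  obtains K where "tideal K" "I \<subseteq> K" "K \<subseteq> J" "codim K = d"
proof -
  have "\<exists>K. tideal K \<and> I \<subseteq> K \<and> K \<subseteq> J \<and> codim K = d"
    using assms(1,2,4,6) max1
  proof (induction "codim I - d" arbitrary: I)
    case 0
    then show ?case by (intro exI[of _ I]) auto
  next
    case (Suc n)
    have "I \<noteq> J" using Suc assms(5) by auto
    then have "I \<subset> J" using Suc by auto
    then obtain t where t: "t \<in> J" "t \<notin> I" "maxi (quo I t)"
      using minimal_above[OF Suc(3,4) assms(3)] by blast
    have c: "codim I = Suc (codim (prin t I))"
      by (rule codim_prin_minimal[OF Suc(3,4) Suc(7)[OF t(3) quo_superset[OF Suc(4)]]])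
    have "\<exists>K. tideal K \<and> prin t I \<subseteq> K \<and> K \<subseteq> J \<and> codim K = d"
    proof (rule Suc(1))
      show "n = codim (prin t I) - d" using c Suc(2) by simp
      show "fcod (prin t I)" by (rule codim_quo_prin(2)[OF Suc(3,4)])
      show "tideal (prin t I)" by (rule tideal_prin[OF Suc(4)])
      show "prin t I \<subseteq> J" by (rule prin_least[OF assms(3) Suc(5) t(1)])
      show "d \<le> codim (prin t I)" using c Suc(2) by simp
      fix m assume "maxi m" "prin t I \<subseteq> m"
      then show "codim m = 1" using Suc(7) prin_superset by blast
    qed
    then show ?case using prin_superset by blast
  qed
  then show thesis using that by blast
qed

lemma maxi_tideal: "maxi m \<Longrightarrow> tideal m" by (simp add: maxi_def)

lemma maxi_prime: "maxi m \<Longrightarrow> x * y \<in> m \<Longrightarrow> x \<in> m \<or> y \<in> m"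
proof (rule ccontr)
  assume m: "maxi m" "x * y \<in> m" "\<not> (x \<in> m \<or> y \<in> m)"
  have mt: "tideal m" by (rule maxi_tideal[OF m(1)])
  obtain z where z: "1 - x * z \<in> m" using m by (auto simp: maxi_def)
  have "y = y * (1 - x * z) + z * (x * y)" by (simp add: algebra_simps)
  also have "\<dots> \<in> m" by (rule tidealD(2)[OF mt tidealD(3)[OF mt z] tidealD(3)[OF mt m(2)]])
  finally show False using m by simp
qed

lemma maxi_power: "maxi m \<Longrightarrow> x ^ n \<in> m \<Longrightarrow> x \<in> m"
proof (induction n)
  case 0 then show ?case by (simp add: maxi_def)
next
  case (Suc n) then show ?case using maxi_prime[of m x "x ^ n"] by auto
qed

lemma maxi_subset_eq: "maxi m \<Longrightarrow> tideal H \<Longrightarrow> m \<subseteq> H \<Longrightarrow> 1 \<notin> H \<Longrightarrow> H = m"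
proof (rule ccontr)
  assume m: "maxi m" "tideal H" "m \<subseteq> H" "1 \<notin> H" "H \<noteq> m"
  then obtain x where x: "x \<in> H" "x \<notin> m" by auto
  then obtain y where "1 - x * y \<in> m" using m by (auto simp: maxi_def)
  then have "(1 - x * y) + x * y \<in> H" using m x by (intro tidealD(2)[OF m(2)] tidealD(4)[OF m(2)]) auto
  then show False using m by simp
qed

lemma maxi_comaximal:
  assumes "maxi m" "maxi m'" "m \<noteq> m'"
  obtains e where "e \<in> m" "1 - e \<in> m'"
proof -
  have "\<not> m \<subseteq> m'" using maxi_subset_eq[OF assms(1), of m'] assms by (auto simp: maxi_def)
  then obtain z where z: "z \<in> m" "z \<notin> m'" by auto
  then obtain y where "1 - z * y \<in> m'" using assms(2) by (auto simp: maxi_def)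
  then show thesis using that[of "z * y"] z tidealD(4)[OF maxi_tideal[OF assms(1)]] by blast
qed

text \<open>Elements with different maximal annihilators are independent: the relation is multiplied
  by an element that is 1 modulo \<open>mm i\<close> and lies in all the other annihilators, which
  isolates the term at \<open>i\<close>.\<close>

lemma independent_simple:
  assumes "tideal \<aa>" "finite F" "inj_on mm F"
    and "\<And>i. i \<in> F \<Longrightarrow> maxi (mm i) \<and> s i \<notin> \<aa> \<and> (\<forall>z\<in>mm i. z * s i \<in> \<aa>)"
    and "(\<Sum>i\<in>F. c i *s s i) \<in> \<aa>" "i \<in> F"
  shows "c i = 0"
proof (rule ccontr)
  assume ci: "c i \<noteq> 0"
  have "\<exists>e. (\<forall>j\<in>F-{i}. e j \<in> mm j \<and> 1 - e j \<in> mm i)"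
  proof (intro bchoice ballI)
    fix j assume j: "j \<in> F - {i}"
    then have "mm j \<noteq> mm i" using assms(3,6) by (auto dest: inj_onD)
    then show "\<exists>e. e \<in> mm j \<and> 1 - e \<in> mm i" using maxi_comaximal assms(4,6) j by (metis DiffD1)
  qed
  then obtain e where e: "\<And>j. j \<in> F - {i} \<Longrightarrow> e j \<in> mm j \<and> 1 - e j \<in> mm i" by blast
  define p where "p = prod e (F - {i})"
  have mi: "maxi (mm i)" "tideal (mm i)" using assms(4,6) maxi_tideal by auto
  have p1: "1 - prod e G \<in> mm i" if "G \<subseteq> F - {i}" for G
  proof -
    have "finite G" using that assms(2) finite_subset by blast
    then show ?thesis using that
    proof (induction G rule: finite_induct)
      case empty then show ?case using tidealD(1)[OF mi(2)] by simp
    next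
      case (insert j G)
      have "1 - prod e (insert j G) = (1 - e j) + e j * (1 - prod e G)"
        using insert by (simp add: algebra_simps)
      moreover have "1 - e j \<in> mm i" "1 - prod e G \<in> mm i" using insert e[of j] by auto
      ultimately show ?case using tidealD(2)[OF mi(2) _ tidealD(3)[OF mi(2)]] by metis
    qed
  qed
  have ps: "p * s j \<in> \<aa>" if "j \<in> F - {i}" for j
  proof -
    have "p = e j * prod e (F - {i} - {j})"
      unfolding p_def using that assms(2) by (intro prod.remove) auto
    then have "p * s j = prod e (F - {i} - {j}) * (e j * s j)" by (simp add: mult_ac)
    moreover have "e j * s j \<in> \<aa>" using e[OF that] assms(4)[of j] that by auto
    ultimately show ?thesis using tidealD(3)[OF assms(1)] by simp
  qed
  have "p * (\<Sum>i\<in>F. c i *s s i) = p * (c i *s s i) + (\<Sum>j\<in>F-{i}. c j *s (p * s j))"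
    using assms(2,6) by (simp add: sum.remove distrib_left sum_distrib_left mult_scale)
  moreover have "p * (\<Sum>i\<in>F. c i *s s i) \<in> \<aa>" using tidealD(3)[OF assms(1,5)] .
  moreover have "(\<Sum>j\<in>F-{i}. c j *s (p * s j)) \<in> \<aa>" using ps by (intro tidealD(8)[OF assms(1)] tidealD(7)[OF assms(1)])
  ultimately have "p * (c i *s s i) \<in> \<aa>" using tidealD(6)[OF assms(1)] by (metis add_diff_cancel_right')
  moreover have "(1 - p) * s i \<in> \<aa>" using p1[of "F - {i}"] assms(4,6) by (auto simp: p_def)
  ultimately have "p * (c i *s s i) + c i *s ((1 - p) * s i) \<in> \<aa>"
    by (intro tidealD(2)[OF assms(1)] tidealD(7)[OF assms(1)])
  moreover have "p * (c i *s s i) + c i *s ((1 - p) * s i) = c i *s s i"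
    by (simp add: mult_scale left_diff_distrib scale_right_diff_distrib)
  ultimately have "(1 / c i) *s (c i *s s i) \<in> \<aa>" using tidealD(7)[OF assms(1)] by metis
  then show False using ci assms(4,6) by auto
qed

subsection \<open>Relations and eigenvectors\<close>

text \<open>A linear relation among the vectors \<open>v i\<close>, with its coefficients stored in
  a polynomial. If \<open>v i\<close> is the \<open>i\<close>-th iterate of an operator on
  \<open>v 0\<close>, this is a polynomial in the operator applied to \<open>v 0\<close>, and
  \<open>psum_linear_factor\<close> splits off linear factors without mentioning the
  operator.\<close>

definition psum :: "'a poly \<Rightarrow> (nat \<Rightarrow> 'b) \<Rightarrow> 'b" where
  "psum p v = (\<Sum>i\<le>Polynomial.degree p. Polynomial.coeff p i *s v i)"

lemma psum_bound: "Polynomial.degree p \<le> n \<Longrightarrow> psum p v = (\<Sum>i\<le>n. Polynomial.coeff p i *s v i)"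
  unfolding psum_def by (intro sum.mono_neutral_left) (auto simp: coeff_eq_0)

lemma psum_diff: "psum (p - q) v = psum p v - psum q v"
proof -
  let ?n = "max (Polynomial.degree p) (Polynomial.degree q)"
  have "psum (p - q) v = (\<Sum>i\<le>?n. Polynomial.coeff (p - q) i *s v i)" by (intro psum_bound degree_diff_le) auto
  also have "\<dots> = (\<Sum>i\<le>?n. Polynomial.coeff p i *s v i) - (\<Sum>i\<le>?n. Polynomial.coeff q i *s v i)"
    by (simp add: scale_left_diff_distrib sum_subtractf)
  also have "\<dots> = psum p v - psum q v" by (simp add: psum_bound[of p ?n] psum_bound[of q ?n])
  finally show ?thesis .
qed

lemma psum_smult: "psum (Polynomial.smult c p) v = c *s psum p v"
  by (subst psum_bound[of _ "Polynomial.degree p"]) (auto simp: psum_def scale_sum_right)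

lemma psum_pCons_0: "psum (pCons 0 p) v = psum p (\<lambda>i. v (Suc i))"
  by (subst psum_bound[of _ "Suc (Polynomial.degree p)"])
     (auto simp: psum_def sum.atMost_Suc_shift degree_pCons_le simp del: sum.atMost_Suc)

lemma psum_scale_arg: "psum p (\<lambda>i. c *s v i) = c *s psum p v"
  by (simp add: psum_def scale_sum_right mult.commute)

lemma psum_diff_arg: "psum p (\<lambda>i. u i - v i) = psum p u - psum p v"
  by (simp add: psum_def scale_right_diff_distrib sum_subtractf)

lemma psum_linear_factor: "psum ([:- c, 1:] * q) v = psum q (\<lambda>i. v (Suc i) - c *s v i)"
proof -
  have "[:- c, 1:] * q = pCons 0 q - Polynomial.smult c q" by simp
  then show ?thesis by (simp only: psum_diff psum_smult psum_pCons_0 psum_diff_arg psum_scale_arg)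
qed

text \<open>More vectors than the codimension are dependent modulo \<open>J\<close>. The bound on
  the degree matters where only \<open>codim J + 1\<close> suitable vectors are available.\<close>

lemma ex_relation:
  assumes "fcod J"
  obtains p where "p \<noteq> 0" "psum p v \<in> J" "Polynomial.degree p \<le> codim J"
proof -
  have sJ: "subspace J" using assms by (rule fcod_subspace)
  \<comment> \<open>Either the first \<open>n\<close> vectors already satisfy a relation, or
    \<open>H\<close> is the sum of \<open>J\<close> and their span and its codimension is smaller by
    \<open>n\<close>. For \<open>n = codim J + 1\<close> only the first case is possible.\<close>
  have "(\<exists>p. p \<noteq> 0 \<and> Polynomial.degree p < n \<and> psum p v \<in> J) \<or>
    (\<exists>H. fcod H \<and> J \<subseteq> H \<and> codim H + n = codim J \<and>
       (\<forall>h\<in>H. \<exists>p. (p = 0 \<or> Polynomial.degree p < n) \<and> h - psum p v \<in> J))" for n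
  proof (induction n)
    case 0 show ?case using assms by (intro disjI2 exI[of _ J]) (auto simp: psum_def intro: exI[of _ 0])
  next
    case (Suc n)
    show ?case
    proof (cases "\<exists>p. p \<noteq> 0 \<and> Polynomial.degree p < n \<and> psum p v \<in> J")
      case True then show ?thesis by (meson less_Suc_eq)
    next
      case False
      then obtain H where H: "fcod H" "J \<subseteq> H" "codim H + n = codim J"
        "\<And>h. h \<in> H \<Longrightarrow> \<exists>p. (p = 0 \<or> Polynomial.degree p < n) \<and> h - psum p v \<in> J" using Suc by blast
      have mon: "psum (Polynomial.monom c n) v = c *s v n" for c
        by (subst psum_bound[of _ n]) (auto simp: degree_monom_le if_distrib[of "\<lambda>x. x *s _"] cong: if_cong)
      show ?thesis
      proof (cases "v n \<in> H")
        case True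
        then obtain p where p: "p = 0 \<or> Polynomial.degree p < n" "v n - psum p v \<in> J" using H(4) by blast
        let ?q = "Polynomial.monom 1 n - p"
        have "psum ?q v \<in> J" using p mon[of 1] by (simp add: psum_diff)
        moreover have "Polynomial.coeff p n = 0" using p(1) by (auto simp: coeff_eq_0)
        then have "Polynomial.coeff ?q n = 1" by simp
        then have "?q \<noteq> 0" by (metis coeff_0 zero_neq_one)
        moreover have "Polynomial.degree ?q < Suc n"
          using p(1) by (auto simp: less_Suc_eq_le intro!: degree_diff_le degree_monom_le)
        ultimately show ?thesis by blast
      next
        case False
        have "fcod (adjoin (v n) H)" using fcod_mono[OF H(1) adjoin_superset subspace_adjoin] H(1) fcod_subspace by blast
        moreover have "codim (adjoin (v n) H) + Suc n = codim J" using codim_adjoin[OF H(1) False] H(3) by simp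
        moreover have "J \<subseteq> adjoin (v n) H" using H(2) adjoin_superset by blast
        moreover have "\<exists>p. (p = 0 \<or> Polynomial.degree p < Suc n) \<and> h - psum p v \<in> J" if h: "h \<in> adjoin (v n) H" for h
        proof -
          obtain c h' where h': "h = c *s v n + h'" "h' \<in> H" using h by (auto simp: adjoin_def)
          obtain p where p: "p = 0 \<or> Polynomial.degree p < n" "h' - psum p v \<in> J" using H(4)[OF h'(2)] by blast
          let ?q = "p - Polynomial.monom (- c) n"
          have "psum ?q v = psum p v + c *s v n" by (simp add: psum_diff mon)
          then have "h - psum ?q v \<in> J" using p h' by (simp add: algebra_simps)
          moreover have "Polynomial.degree ?q < Suc n"
            using p(1) by (auto simp: less_Suc_eq_le intro!: degree_diff_le degree_monom_le)
          ultimately show ?thesis by blast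
        qed
        ultimately show ?thesis by blast
      qed
    qed
  qed
  from this[of "Suc (codim J)"] show thesis using that by (auto simp: less_Suc_eq_le)
qed

subsection \<open>The local ring at a maximal ideal\<close>

lemma tideal_loc: "maxi m \<Longrightarrow> tideal \<aa> \<Longrightarrow> tideal (loc \<aa> m)"
  unfolding tideal_def[of "loc \<aa> m"]
proof (intro conjI ballI allI)
  assume m: "maxi m" and a: "tideal \<aa>"
  show "0 \<in> loc \<aa> m" using m tidealD(1)[OF a] by (auto simp: loc_def maxi_def)
  fix x assume "x \<in> loc \<aa> m"
  then obtain y where y: "y \<notin> m" "x * y \<in> \<aa>" by (auto simp: loc_def)
  show "b * x \<in> loc \<aa> m" for b using y tidealD(3)[OF a y(2), of b] by (auto simp: loc_def mult.assoc)
  fix x' assume "x' \<in> loc \<aa> m"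
  then obtain y' where y': "y' \<notin> m" "x' * y' \<in> \<aa>" by (auto simp: loc_def)
  have "y * y' \<notin> m" using maxi_prime[OF m] y y' by blast
  moreover have "(x + x') * (y * y') = y' * (x * y) + y * (x' * y')" by (simp add: algebra_simps)
  then have "(x + x') * (y * y') \<in> \<aa>" using y y' by (auto intro!: tidealD(2,3)[OF a])
  ultimately show "x + x' \<in> loc \<aa> m" unfolding loc_def by blast
qed

lemma loc_superset: "maxi m \<Longrightarrow> \<aa> \<subseteq> loc \<aa> m"
  unfolding loc_def maxi_def by (auto intro!: exI[of _ 1])

lemma loc_subset: "maxi m \<Longrightarrow> \<aa> \<subseteq> m \<Longrightarrow> loc \<aa> m \<subseteq> m"
  unfolding loc_def using maxi_prime by blast

text \<open>The ideals \<open>(x^i) + \<aa>\<close> decrease and their codimensions are bounded by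
  \<open>codim \<aa>\<close>, so two consecutive ones agree for some
  \<open>i \<le> codim \<aa>\<close>.\<close>

lemma power_stable:
  assumes "fcod \<aa>" "tideal \<aa>"
  obtains i y where "i \<le> codim \<aa>" "x ^ i * (1 - x * y) \<in> \<aa>"
proof -
  let ?f = "\<lambda>i. codim (prin (x ^ i) \<aa>)"
  have le: "?f i \<le> codim \<aa>" for i using codim_quo_prin(3)[OF assms, of "x ^ i"] by simp
  have sub: "prin (x ^ Suc i) \<aa> \<subseteq> prin (x ^ i) \<aa>" for i
    using prin_mem[OF assms(2), of "x ^ i" x]
    by (intro prin_least[OF tideal_prin[OF assms(2)] prin_superset]) (simp add: mult.commute)
  have "\<exists>i\<le>codim \<aa>. ?f (Suc i) \<le> ?f i"
  proof (rule ccontr)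
    assume "\<not> ?thesis"
    then have lt: "i \<le> codim \<aa> \<Longrightarrow> ?f i < ?f (Suc i)" for i using not_le by blast
    have "i \<le> Suc (codim \<aa>) \<Longrightarrow> i \<le> ?f i" for i
    proof (induction i)
      case (Suc i) then show ?case using lt[of i] by simp
    qed simp
    from this[of "Suc (codim \<aa>)"] show False using le[of "Suc (codim \<aa>)"] by simp
  qed
  then obtain i where i: "i \<le> codim \<aa>" "?f (Suc i) \<le> ?f i" by blast
  have "prin (x ^ Suc i) \<aa> = prin (x ^ i) \<aa>"
    by (rule codim_eq_imp_eq[OF codim_quo_prin(2)[OF assms] sub tideal_subspace[OF tideal_prin[OF assms(2)]] i(2)])
  then have "x ^ i \<in> prin (x ^ Suc i) \<aa>" using prin_self[OF assms(2)] by blast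
  then obtain y where "x ^ i - x ^ Suc i * y \<in> \<aa>" using prin_iff by blast
  then show thesis using that[OF i(1), of y] by (simp add: algebra_simps)
qed

text \<open>In the relation of \<open>power_stable\<close> the factor \<open>1 - z * y\<close> is
  outside \<open>m\<close>, hence invertible in the localization.\<close>

lemma loc_nilpotent:
  assumes "fcod \<aa>" "maxi m" "tideal \<aa>" "z \<in> m"
  shows "z ^ codim \<aa> \<in> loc \<aa> m"
proof -
  obtain i y where i: "i \<le> codim \<aa>" "z ^ i * (1 - z * y) \<in> \<aa>" using power_stable[OF assms(1,3)] by blast
  have mt: "tideal m" by (rule maxi_tideal[OF assms(2)])
  have "1 - z * y \<notin> m"
  proof
    assume "1 - z * y \<in> m"
    then have "(1 - z * y) + z * y \<in> m" using assms(4) by (intro tidealD(2)[OF mt] tidealD(4)[OF mt])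
    then show False using assms(2) by (simp add: maxi_def)
  qed
  then have "z ^ i \<in> loc \<aa> m" using i by (auto simp: loc_def)
  then have "z ^ (codim \<aa> - i) * z ^ i \<in> loc \<aa> m" using tidealD(3)[OF tideal_loc[OF assms(2,3)]] by blast
  then show ?thesis using i by (simp flip: power_add)
qed

text \<open>The relation of \<open>power_stable\<close> again, now with \<open>x ^ i\<close> as the
  factor outside \<open>m\<close>.\<close>

lemma loc_unit:
  assumes "fcod \<aa>" "maxi m" "tideal \<aa>" "x \<notin> m"
  obtains y where "1 - x * y \<in> loc \<aa> m"
proof -
  obtain i y where i: "i \<le> codim \<aa>" "x ^ i * (1 - x * y) \<in> \<aa>" using power_stable[OF assms(1,3)] by blast
  moreover have "x ^ i \<notin> m" using maxi_power[OF assms(2)] assms(4) by blast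
  ultimately have "1 - x * y \<in> loc \<aa> m" unfolding loc_def by (auto simp: mult.commute)
  then show thesis by (rule that)
qed

lemma tideal_msq: "tideal (msq M J)"
  unfolding msq_def tideal_def by auto

lemma msq_superset: "J \<subseteq> msq M J" and msq_mem: "a \<in> M \<Longrightarrow> b \<in> M \<Longrightarrow> a * b \<in> msq M J"
  by (auto simp: msq_def)

lemma msq_least: "tideal H \<Longrightarrow> J \<subseteq> H \<Longrightarrow> (\<And>a b. a \<in> M \<Longrightarrow> b \<in> M \<Longrightarrow> a * b \<in> H) \<Longrightarrow> msq M J \<subseteq> H"
  by (auto simp: msq_def)

text \<open>If \<open>(y) + loc \<aa> m\<close> were smaller than \<open>m\<close>, a maximal ideal
  \<open>T\<close> between them would leave a simple module, annihilated by \<open>m\<close>. Then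
  \<open>T\<close> contains all products of two elements of \<open>m\<close>, hence
  \<open>prin y (msq m \<aa>)\<close>, hence \<open>m\<close>.\<close>

lemma nakayama:
  assumes a: "fcod \<aa>" "tideal \<aa>" and m: "maxi m" "\<aa> \<subseteq> m" and "y \<in> m" "m \<subseteq> prin y (msq m \<aa>)"
  shows "m = prin y (loc \<aa> m)"
proof (rule ccontr)
  assume ne: "m \<noteq> prin y (loc \<aa> m)"
  have mt: "tideal m" by (rule maxi_tideal[OF m(1)])
  have lt: "tideal (loc \<aa> m)" by (rule tideal_loc[OF m(1) a(2)])
  let ?Q = "prin y (loc \<aa> m)"
  let ?P = "\<lambda>T. tideal T \<and> ?Q \<subseteq> T \<and> T \<subset> m"
  have Qm: "?Q \<subseteq> m" by (rule prin_least[OF mt loc_subset[OF m] assms(5)])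
  have aQ: "\<aa> \<subseteq> ?Q" using loc_superset[OF m(1), of \<aa>] prin_superset[of "loc \<aa> m" y] by blast
  have "?P ?Q" using Qm ne tideal_prin[OF lt] by auto
  then obtain T where T: "?P T" "\<And>H. ?P H \<Longrightarrow> codim T \<le> codim H"
    using ex_has_least_nat[of ?P ?Q codim] by blast
  have fT: "fcod T" using fcod_tideal[OF a(1)] aQ T(1) by blast
  obtain t where t: "t \<in> m" "t \<notin> T" using T(1) by auto
  have bet: "H = T \<or> H = m" if "tideal H" "T \<subseteq> H" "H \<subseteq> m" for H
  proof (rule ccontr)
    assume n: "\<not> (H = T \<or> H = m)"
    then have "?P H" using that T(1) by auto
    then have "codim T \<le> codim H" using T(2) by blast
    then show False using codim_eq_imp_eq[OF fT that(2) tideal_subspace[OF that(1)]] n by auto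
  qed
  have pt: "prin t T = m"
    using bet[OF tideal_prin prin_superset prin_least[OF mt _ t(1)]] T(1) t prin_self[of T t] by blast
  \<comment> \<open>Otherwise \<open>t * b\<close> generates \<open>m\<close> modulo
    \<open>T\<close> just as \<open>t\<close> does, so \<open>t * (1 - b * r) \<in> T\<close>; but
    \<open>1 - b * r\<close> is invertible modulo \<open>loc \<aa> m\<close>, which lies in
    \<open>T\<close>.\<close>
  have tb: "t * b \<in> T" if b: "b \<in> m" for b
  proof (rule ccontr)
    assume n: "t * b \<notin> T"
    have "prin (t * b) T = m"
      using bet[OF tideal_prin prin_superset prin_least[OF mt]] T(1) tidealD(4)[OF mt t(1), of b] prin_self[of T "t * b"] n by blast
    then obtain r where r: "t - t * b * r \<in> T" using t(1) prin_iff T(1) by blast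
    have "1 - b * r \<notin> m"
    proof
      assume "1 - b * r \<in> m"
      then have "(1 - b * r) + b * r \<in> m" using b by (intro tidealD(2)[OF mt] tidealD(4)[OF mt])
      then show False using m(1) by (simp add: maxi_def)
    qed
    then obtain u where u: "1 - (1 - b * r) * u \<in> loc \<aa> m" using loc_unit[OF a(1) m(1) a(2)] by blast
    then have "1 - (1 - b * r) * u \<in> T" using T(1) prin_superset[of "loc \<aa> m" y] by blast
    then have "t * (1 - (1 - b * r) * u) + (t - t * b * r) * u \<in> T"
      using r T(1) by (intro tidealD(2) tidealD(3,4)) auto
    then have "t \<in> T" by (simp add: algebra_simps)
    then show False using t by simp
  qed
  have "a * b \<in> T" if ab: "a \<in> m" "b \<in> m" for a b
  proof -
    obtain r where r: "a - t * r \<in> T" using ab(1) pt prin_iff T(1) by blast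
    have "a * b = (a - t * r) * b + r * (t * b)" by (simp add: algebra_simps)
    also have "\<dots> \<in> T" using T(1) tidealD(2)[OF _ tidealD(4)[OF _ r] tidealD(3)[OF _ tb[OF ab(2)]]] by blast
    finally show ?thesis .
  qed
  then have "msq m \<aa> \<subseteq> T" using T(1) aQ by (intro msq_least) auto
  moreover have "y \<in> T" using T(1) prin_self[OF lt, of y] by blast
  ultimately have "prin y (msq m \<aa>) \<subseteq> T" using T(1) by (intro prin_least) auto
  then show False using assms(6) t by auto
qed

text \<open>Modulo \<open>\<aa>\<close>, the element \<open>u\<close> is the idempotent of the local
  factor at \<open>m\<close>: it is 1 modulo \<open>loc \<aa> m\<close> and annihilates that ideal.
  The generator \<open>x\<close> is \<open>y\<close> on this factor and 1 on the complementary
  one.\<close>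

lemma local_to_global:
  assumes a: "fcod \<aa>" "tideal \<aa>" and m: "maxi m" "\<aa> \<subseteq> m" and y: "y \<in> m" "m = prin y (loc \<aa> m)"
  obtains x where "m = prin x \<aa>"
proof -
  have mt: "tideal m" by (rule maxi_tideal[OF m(1)])
  have lt: "tideal (loc \<aa> m)" by (rule tideal_loc[OF m(1) a(2)])
  \<comment> \<open>One element outside \<open>m\<close> has to annihilate all of
    \<open>loc \<aa> m\<close>. An annihilator of least codimension cannot grow when
    \<open>s\<close> is multiplied by an \<open>s'\<close> outside \<open>m\<close>, so it contains
    whatever some \<open>s'\<close> annihilates.\<close>
  obtain s where s: "s \<notin> m" "\<And>s'. s' \<notin> m \<Longrightarrow> codim (quo \<aa> s) \<le> codim (quo \<aa> s')"
    using ex_has_least_nat[of "\<lambda>s. s \<notin> m" 1 "\<lambda>s. codim (quo \<aa> s)"] m(1) by (auto simp: maxi_def)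
  have sl: "s * l \<in> \<aa>" if l: "l \<in> loc \<aa> m" for l
  proof -
    obtain s' where s': "s' \<notin> m" "l * s' \<in> \<aa>" using l by (auto simp: loc_def)
    have "s * s' \<notin> m" using maxi_prime[OF m(1)] s(1) s'(1) by blast
    then have "codim (quo \<aa> s) \<le> codim (quo \<aa> (s * s'))" by (rule s(2))
    moreover have "quo \<aa> s \<subseteq> quo \<aa> (s * s')"
      using tidealD(3)[OF a(2)] by (auto simp: quo_def) (metis mult.assoc mult.commute)
    ultimately have "quo \<aa> s = quo \<aa> (s * s')"
      using codim_eq_imp_eq[OF codim_quo_prin(1)[OF a]] tideal_subspace[OF tideal_quo[OF a(2)]] by blast
    moreover have "l \<in> quo \<aa> (s * s')" using tidealD(3)[OF a(2) s'(2), of s] by (simp add: quo_def mult_ac)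
    ultimately show ?thesis by (auto simp: quo_def)
  qed
  obtain y0 where y0: "1 - s * y0 \<in> loc \<aa> m" using loc_unit[OF a(1) m(1) a(2) s(1)] by blast
  define u where "u = s * y0"
  have q: "1 - u \<in> loc \<aa> m" using y0 by (simp add: u_def)
  have ul: "u * l \<in> \<aa>" if "l \<in> loc \<aa> m" for l
    using tidealD(3)[OF a(2) sl[OF that], of y0] by (simp add: u_def mult_ac)
  define x where "x = u * y + (1 - u)"
  have "m = prin x \<aa>"
  proof
    have "x \<in> m" unfolding x_def using y(1) q loc_subset[OF m] by (auto intro!: tidealD(2,3)[OF mt])
    then show "prin x \<aa> \<subseteq> m" by (rule prin_least[OF mt m(2)])
    show "m \<subseteq> prin x \<aa>"
    proof
      fix z assume z: "z \<in> m"
      then obtain t where t: "z - y * t \<in> loc \<aa> m" using y(2) prin_iff by blast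
      have eq: "z - x * (z * (1 - u) + u * t) = u * (z - y * t) + u * (1 - u) * ((z - t) * (1 - y))"
        by (simp add: algebra_simps x_def)
      have "\<dots> \<in> \<aa>" by (rule tidealD(2)[OF a(2) ul[OF t] tidealD(4)[OF a(2) ul[OF q]]])
      then have "z - x * (z * (1 - u) + u * t) \<in> \<aa>" using eq by simp
      then show "z \<in> prin x \<aa>" using prin_iff by blast
    qed
  qed
  then show thesis by (rule that)
qed

text \<open>Induction on the codimension. A slightly larger ideal \<open>J1 = (t) + J\<close>
  exceeds \<open>J\<close> by a simple module with annihilator \<open>M\<close>; if
  \<open>J1 = (y1)\<close> and \<open>M = (x)\<close> modulo \<open>\<aa>\<close>, then
  \<open>J = (y1 * x)\<close>.\<close>

lemma all_ideals_principal:
  assumes a: "fcod \<aa>" "tideal \<aa>" and max: "\<And>m. maxi m \<Longrightarrow> \<aa> \<subseteq> m \<Longrightarrow> \<exists>x. m = prin x \<aa>"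
    and J: "tideal J" "\<aa> \<subseteq> J"
  shows "\<exists>y. J = prin y \<aa>"
  using J
proof (induction "codim J" arbitrary: J rule: less_induct)
  case less
  have fJ: "fcod J" by (rule fcod_tideal[OF a(1) less(3,2)])
  show ?case
  proof (cases "J = UNIV")
    case True
    have "prin 1 \<aa> = UNIV" using tideal_one[OF tideal_prin[OF a(2)] prin_self[OF a(2)]] .
    then show ?thesis using True by blast
  next
    case False
    then obtain t where t: "t \<notin> J" "maxi (quo J t)"
      using minimal_above[OF fJ less(2) tideal_UNIV] by blast
    let ?M = "quo J t" let ?J1 = "prin t J"
    have J1: "tideal ?J1" "J \<subseteq> ?J1" "t \<in> ?J1" using tideal_prin prin_superset prin_self less(2) by auto
    have "codim ?J1 < codim J" using codim_strict[OF fJ _ tideal_subspace[OF J1(1)]] J1 t(1) by blast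
    then obtain y1 where y1: "?J1 = prin y1 \<aa>" using less(1) J1 less(3) by blast
    obtain x where x: "?M = prin x \<aa>" using max[OF t(2)] quo_superset[OF less(2)] less(3) by blast
    have "y1 \<in> ?J1" using y1 prin_self[OF a(2)] by blast
    then obtain r where r: "y1 - t * r \<in> J" using prin_iff by blast
    \<comment> \<open>The generator \<open>y1\<close> is \<open>t * r\<close> modulo
      \<open>J\<close>, and \<open>r\<close> is outside \<open>M\<close>; therefore
      \<open>(J : y1)\<close> is again \<open>M\<close>.\<close>
    have rM: "r \<notin> ?M"
    proof
      assume "r \<in> ?M"
      then have "y1 \<in> J" using r tideal_cong[OF less(2) r] by (simp add: quo_def)
      then have "?J1 \<subseteq> J" unfolding y1 by (rule prin_least[OF less(2,3)])
      then show False using J1 t by auto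
    qed
    have qy: "z \<in> ?M" if "y1 * z \<in> J" for z
    proof -
      have "y1 * z - (t * (r * z)) \<in> J" using tidealD(4)[OF less(2) r, of z] by (simp add: algebra_simps)
      then have "t * (r * z) \<in> J" using tideal_cong[OF less(2)] that by blast
      then have "r * z \<in> ?M" by (simp add: quo_def)
      then show ?thesis using maxi_prime[OF t(2)] rM by blast
    qed
    have y1x: "y1 * x \<in> J"
    proof -
      have "x \<in> ?M" using x prin_self[OF a(2)] by blast
      then have "t * x \<in> J" by (simp add: quo_def)
      then have "(y1 - t * r) * x + r * (t * x) \<in> J"
        by (rule tidealD(2)[OF less(2) tidealD(4)[OF less(2) r] tidealD(3)[OF less(2)]])
      then show ?thesis by (simp add: algebra_simps)
    qed
    have "J = prin (y1 * x) \<aa>"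
    proof
      show "prin (y1 * x) \<aa> \<subseteq> J" by (rule prin_least[OF less(2,3) y1x])
      show "J \<subseteq> prin (y1 * x) \<aa>"
      proof
        fix w assume w: "w \<in> J"
        then obtain z where z: "w - y1 * z \<in> \<aa>" using J1(2) y1 prin_iff by blast
        then have "y1 * z \<in> J" using w tideal_cong[OF less(2), of w "y1 * z"] less(3) by blast
        then obtain z' where z': "z - x * z' \<in> \<aa>" using qy x prin_iff by blast
        have "w - y1 * x * z' = (w - y1 * z) + y1 * (z - x * z')" by (simp add: algebra_simps)
        also have "\<dots> \<in> \<aa>" using z z' by (intro tidealD(2)[OF a(2)] tidealD(3)[OF a(2)])
        finally show "w \<in> prin (y1 * x) \<aa>" using prin_iff by blast
      qed
    qed
    then show ?thesis by blast
  qed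
qed

end

section \<open>Linear general position forces principal maximal ideals\<close>

lemma (in comm_alg) psum_mult: "psum p v * z = psum p (\<lambda>i. v i * z)"
  by (simp add: psum_def sum_distrib_right scale_mult)

lemma (in comm_alg) psum_lin_fun: "lin_fun w \<Longrightarrow> w (psum p v) = (\<Sum>i\<le>Polynomial.degree p. Polynomial.coeff p i * w (v i))"
  by (simp add: psum_def lin_funD)

lemma (in comm_alg) codim_sum:
  assumes "fcod J" "fdim V" "\<And>v. v \<in> V \<Longrightarrow> v \<in> J \<Longrightarrow> v = 0"
  shows "fcod {v + j | v j. v \<in> V \<and> j \<in> J}" "codim {v + j | v j. v \<in> V \<and> j \<in> J} + dim V = codim J"
proof -
  let ?S = "{v + j | v j. v \<in> V \<and> j \<in> J}"
  obtain T where T: "fdim T" "is_compl T J" "subspace J" "dim T = codim J" using fcodE[OF assms(1)] .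
  obtain p where p: "lin_endo p" "range p = T" "\<And>x. x - p x \<in> J" "\<And>x. p x = 0 \<longleftrightarrow> x \<in> J" "\<And>t. t \<in> T \<Longrightarrow> p t = t"
    using is_compl_proj[OF T(2,3)] by blast
  have sV: "subspace V" by (rule fdim_subspace[OF assms(2)])
  have sS: "subspace ?S" using subspace_sums[OF sV T(3)] .
  have JS: "J \<subseteq> ?S" using subspace_0[OF sV] by force
  show 1: "fcod ?S" by (rule fcod_mono[OF assms(1) JS sS])
  have "dim T = codim ?S + dim (T \<inter> ?S)"
    using T(2) JS by (intro codim_supplement[OF 1 T(1)]) (meson is_compl_def subsetD)
  moreover have "T \<inter> ?S = p ` V"
  proof
    show "T \<inter> ?S \<subseteq> p ` V"
    proof
      fix u assume u: "u \<in> T \<inter> ?S"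
      then obtain v j where v: "u = v + j" "v \<in> V" "j \<in> J" by blast
      have "u = p u" using p(5) u by simp
      also have "\<dots> = p v" using v p(4)[of j] by (simp add: lin_endoD[OF p(1)])
      finally show "u \<in> p ` V" using v by blast
    qed
    show "p ` V \<subseteq> T \<inter> ?S"
    proof
      fix u assume "u \<in> p ` V"
      then obtain v where v: "v \<in> V" "u = p v" by blast
      have "- (v - p v) \<in> J" using p(3) subspace_neg[OF T(3)] by blast
      moreover have "u = v + - (v - p v)" using v by simp
      ultimately show "u \<in> T \<inter> ?S" using v p(2) by blast
    qed
  qed
  moreover have "{x \<in> V. p x = 0} = {0}" using assms(3) p(4) subspace_0[OF sV] lin_endoD(3)[OF p(1)] by auto
  then have "dim V = dim (p ` V)" using rank_nullity(2)[OF p(1) assms(2)] dim_zero by simp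
  ultimately show "codim ?S + dim V = codim J" using T(4) by simp
qed

lemma infinite_alg_closed: "infinite (UNIV :: 'a::alg_closed_field set)"
proof
  assume fin: "finite (UNIV :: 'a set)"
  define p :: "'a poly" where "p = (\<Prod>a\<in>UNIV. [:- a, 1:]) + 1"
  have ev: "poly p x = 1" for x
  proof -
    have "poly (\<Prod>a\<in>UNIV. [:- a, 1:]) x = 0"
      using fin by (auto simp: poly_prod prod_zero_iff)
    then show ?thesis by (simp add: p_def)
  qed
  have "Polynomial.degree (\<Prod>a\<in>(UNIV::'a set). [:- a, 1:]) = card (UNIV :: 'a set)"
    using fin by (subst degree_prod_eq_sum_degree) auto
  moreover have "card (UNIV :: 'a set) > 0" using fin by (simp add: finite_UNIV_card_ge_0)
  ultimately have "Polynomial.degree p > 0" unfolding p_def by (subst degree_add_eq_left) auto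
  then obtain x where "poly p x = 0" using alg_closed_imp_poly_has_root by blast
  then show False using ev by simp
qed

locale ac_alg = comm_alg scale
  for scale :: "'a::alg_closed_field \<Rightarrow> 'b::comm_ring_1 \<Rightarrow> 'b" (infixr \<open>*s\<close> 75)
begin

text \<open>For the iterates \<open>v i\<close> of an operator on \<open>v 0\<close> this produces
  an eigenvector modulo \<open>J\<close> with eigenvalue \<open>c\<close>. A relation among the
  \<open>v i\<close> is divided by linear factors of its polynomial, one by one; the first quotient
  whose value leaves \<open>J\<close> is the eigenvector.\<close>

lemma eigen_sequence:
  assumes "fcod J" "v 0 \<notin> J"
  obtains c q where "psum q v \<notin> J" "psum q (\<lambda>i. v (Suc i) - c *s v i) \<in> J"
proof -
  have "\<exists>c q. psum q v \<notin> J \<and> psum q (\<lambda>i. v (Suc i) - c *s v i) \<in> J" if "p \<noteq> 0" "psum p v \<in> J" for p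
    using that
  proof (induction "Polynomial.degree p" arbitrary: p rule: less_induct)
    case less
    show ?case
    proof (cases "Polynomial.degree p = 0")
      case True
      then obtain a where a: "p = [:a:]" using degree_0_id by metis
      then have "a \<noteq> 0" "a *s v 0 \<in> J" using less by (auto simp: psum_def)
      then have "(1 / a) *s (a *s v 0) \<in> J" using fcod_subspace[OF assms(1)] subspace_scale by blast
      then show ?thesis using \<open>a \<noteq> 0\<close> assms(2) by simp
    next
      case False
      then obtain c where "poly p c = 0" using alg_closed_imp_poly_has_root by blast
      then obtain q where q: "p = [:- c, 1:] * q" by (metis poly_eq_0_iff_dvd dvdE)
      then have q0: "q \<noteq> 0" using less by auto
      have dq: "Polynomial.degree q < Polynomial.degree p" unfolding q using q0 by (subst degree_mult_eq) auto
      show ?thesis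
      proof (cases "psum q v \<in> J")
        case True then show ?thesis using less(1)[OF dq q0] by blast
      next
        case False then show ?thesis using less(3) unfolding q psum_linear_factor by blast
      qed
    qed
  qed
  moreover obtain p where "p \<noteq> 0" "psum p v \<in> J" using ex_relation[OF assms(1)] by blast
  ultimately show thesis using that by blast
qed

text \<open>A form of the Nullstellensatz. Applied to the powers of \<open>x\<close>,
  \<open>eigen_sequence\<close> gives \<open>q(x)\<close> outside \<open>m\<close> with
  \<open>q(x) * (x - c) \<in> m\<close>, and \<open>m\<close> is prime.\<close>

lemma maxi_scalar:
  assumes "fcod m" "maxi m"
  obtains c where "x - c *s 1 \<in> m"
proof -
  have "x ^ 0 \<notin> m" using assms(2) by (simp add: maxi_def)
  then obtain c q where c: "psum q (\<lambda>i. x ^ i) \<notin> m" "psum q (\<lambda>i. x ^ Suc i - c *s x ^ i) \<in> m"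
    using eigen_sequence[OF assms(1), of "\<lambda>i. x ^ i"] by blast
  have "(\<lambda>i. x ^ Suc i - c *s x ^ i) = (\<lambda>i. x ^ i * (x - c *s 1))"
    by (auto simp: right_diff_distrib mult_scale mult.commute)
  then have "psum q (\<lambda>i. x ^ i) * (x - c *s 1) \<in> m" using c(2) by (simp add: psum_mult)
  then have "x - c *s 1 \<in> m" using maxi_prime[OF assms(2)] c(1) by blast
  then show thesis by (rule that)
qed

lemma maxi_codim:
  assumes "fcod m" "maxi m"
  shows "codim m = 1"
proof -
  have one: "1 \<notin> m" using assms(2) by (simp add: maxi_def)
  have "adjoin 1 m = UNIV"
  proof -
    have "x \<in> adjoin 1 m" for x
    proof -
      obtain c where "x - c *s 1 \<in> m" using maxi_scalar[OF assms] .
      then show ?thesis unfolding adjoin_def by (intro CollectI exI[of _ c] exI[of _ "x - c *s 1"]) simp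
    qed
    then show ?thesis by auto
  qed
  then show ?thesis using codim_adjoin[OF assms(1) one] codim_UNIV by simp
qed

lemma ideal_between_ac:
  assumes "fcod I" "tideal I" "tideal J" "I \<subseteq> J" "codim J \<le> d" "d \<le> codim I"
  obtains K where "tideal K" "I \<subseteq> K" "K \<subseteq> J" "codim K = d"
  using ideal_between[OF assms] maxi_codim fcod_tideal[OF assms(1)] maxi_tideal by metis

end

text \<open>The critical colength. For schemes of larger degree, \<open>bb\<close> will be chosen
  between \<open>\<aa>\<close> and a given ideal.\<close>

locale lgp_quotient = ac_alg scale
  for scale :: "'a::alg_closed_field \<Rightarrow> 'b::comm_ring_1 \<Rightarrow> 'b" (infixr \<open>*s\<close> 75) +
  fixes bb V :: "'b set" and r :: nat
  assumes fb: "fcod bb" and tb: "tideal bb" and cb: "codim bb = r + 3" and r1: "r \<ge> 1"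
    and fV: "fdim V" and dV: "dim V = r + 1"
    and lgp: "\<And>K v. tideal K \<Longrightarrow> bb \<subseteq> K \<Longrightarrow> r + 1 \<le> codim K \<Longrightarrow> v \<in> V \<Longrightarrow> v \<in> K \<Longrightarrow> v = 0"
begin

definition VB :: "'b set" where "VB = {v + j | v j. v \<in> V \<and> j \<in> bb}"

lemma bb_VB: "bb \<subseteq> VB"
  unfolding VB_def using subspace_0[OF fdim_subspace[OF fV]] by force

lemma VB_codim: "fcod VB" "codim VB = 2"
proof -
  have "v = 0" if "v \<in> V" "v \<in> bb" for v using lgp[OF tb] cb that by simp
  from codim_sum[OF fb fV this] show "fcod VB" "codim VB = 2" using dV cb by (auto simp: VB_def)
qed

lemma VB_ideal:
  assumes "tideal K" "bb \<subseteq> K" "r + 1 \<le> codim K" "x \<in> K" "x \<in> VB"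
  shows "x \<in> bb"
proof -
  obtain v b where v: "x = v + b" "v \<in> V" "b \<in> bb" using assms(5) by (auto simp: VB_def)
  then have "v \<in> K" using tidealD(6)[OF assms(1,4), of b] assms(2) by auto
  then have "v = 0" using lgp assms v by blast
  then show ?thesis using v by simp
qed

text \<open>\<open>K\<close> has dimension 2 modulo \<open>bb\<close>. If the given member of the
  pencil vanished on \<open>K\<close>, a second member would still have a kernel vector in
  \<open>K\<close> outside \<open>bb\<close>; that vector would lie in \<open>VB\<close>, against
  linearly general position.\<close>

lemma not_killed:
  assumes u: "lin_fun u1" "lin_fun u2" "VB = {z. u1 z = 0 \<and> u2 z = 0}" and ab: "\<alpha> \<noteq> 0 \<or> \<beta> \<noteq> 0"
    and K: "tideal K" "bb \<subseteq> K" "codim K = r + 1"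
  shows "\<exists>x\<in>K. \<alpha> * u1 x + \<beta> * u2 x \<noteq> 0"
proof (rule ccontr)
  assume "\<not> ?thesis"
  then have k: "x \<in> K \<Longrightarrow> \<alpha> * u1 x + \<beta> * u2 x = 0" for x by auto
  \<comment> \<open>Chosen so that \<open>u\<close> and the member with coefficients
    \<open>\<alpha>\<close>, \<open>\<beta>\<close> together span the pencil.\<close>
  define u where "u = (if \<alpha> \<noteq> 0 then u2 else u1)"
  have lu: "lin_fun u" using u by (simp add: u_def)
  have ub: "x \<in> bb \<Longrightarrow> u x = 0" for x using bb_VB u(3) by (auto simp: u_def)
  have "codim K + 2 \<le> codim bb" using K cb by simp
  then obtain x where x: "x \<in> K" "x \<notin> bb" "u x = 0"
    using ex_kernel_vector[OF fb K(2) tideal_subspace[OF K(1)] _ lu ub] by blast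
  have "u1 x = 0 \<and> u2 x = 0" using k[OF x(1)] x(3) ab by (auto simp: u_def split: if_splits)
  then have "x \<in> VB" using u(3) by simp
  then show False using VB_ideal[OF K(1,2) _ x(1)] K x by simp
qed

text \<open>By nondegeneracy \<open>w' x = w (a * x)\<close> for some \<open>a\<close>. Let
  \<open>c\<close> be the value of \<open>a\<close> at \<open>m\<close> and
  \<open>y = a - c\<close>. The member \<open>w' - c * w\<close> of the pencil vanishes on
  \<open>(bb : y)\<close>, which by \<open>not_killed\<close> contains no ideal of colength
  \<open>r + 1\<close> over \<open>bb\<close>. So \<open>(bb : y)\<close> has dimension at most 1
  modulo \<open>bb\<close>; this dimension is the codimension of \<open>(y) + bb\<close>, which thus
  equals \<open>m\<close>.\<close>

lemma max_principal_nondegenerate: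
  assumes u: "lin_fun w" "lin_fun w'" "VB = {z. w z = 0 \<and> w' z = 0}"
    and nd: "\<And>x. (\<And>y. w (x * y) = 0) \<Longrightarrow> x \<in> bb" and m: "maxi m" "bb \<subseteq> m"
  shows "\<exists>y. m = prin y bb"
proof -
  have wb: "x \<in> bb \<Longrightarrow> w x = 0" "x \<in> bb \<Longrightarrow> w' x = 0" for x using bb_VB u(3) by auto
  obtain a where a: "\<And>y. w' y = w (a * y)"
  proof (rule representable[where J = bb and M = UNIV and B = "\<lambda>x y. w (x * y)" and \<psi> = w'])
    show "fcod bb" by (rule fb)
    show "lin_fun (\<lambda>x. w (x * y))" for y
      using u(1) by (auto simp: lin_fun_def distrib_right scale_mult)
    show "lin_fun (\<lambda>y. w (x * y))" for x
      using u(1) by (auto simp: lin_fun_def distrib_left mult_scale)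
    show "y \<in> bb \<Longrightarrow> w (x * y) = 0" for x y using wb tidealD(3)[OF tb] by blast
  qed (use u nd wb in auto)
  have fm: "fcod m" using fcod_tideal[OF fb m(2) maxi_tideal[OF m(1)]] .
  obtain c where c: "a - c *s 1 \<in> m" using maxi_scalar[OF fm m(1)] .
  define y where "y = a - c *s 1"
  have "codim bb \<le> Suc (codim (quo bb y))"
  proof (rule ccontr)
    assume "\<not> ?thesis"
    then have "codim (quo bb y) \<le> r + 1" using cb by simp
    then obtain K where K: "tideal K" "bb \<subseteq> K" "K \<subseteq> quo bb y" "codim K = r + 1"
      using ideal_between_ac[OF fb tb tideal_quo[OF tb] quo_superset[OF tb]] cb by (metis add_le_cancel_left one_le_numeral)
    have "- c * w x + 1 * w' x = 0" if "x \<in> K" for x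
    proof -
      have "w (y * x) = 0" using that K wb by (auto simp: quo_def)
      moreover have "y * x = a * x - c *s x" by (simp add: y_def left_diff_distrib scale_mult)
      ultimately have "w (a * x) = c * w x" by (simp add: lin_funD[OF u(1)])
      then show ?thesis using a by simp
    qed
    then show False using not_killed[OF u _ K(1,2,4), of "- c" 1] by auto
  qed
  then have "codim (prin y bb) \<le> 1" using codim_quo_prin(3)[OF fb tb, of y] by simp
  moreover have "prin y bb \<subseteq> m" using prin_least[OF maxi_tideal[OF m(1)] m(2)] c by (simp add: y_def)
  ultimately have "prin y bb = m"
    using codim_eq_imp_eq[OF codim_quo_prin(2)[OF fb tb] _ tideal_subspace[OF maxi_tideal[OF m(1)]]] maxi_codim[OF fm m(1)] by simp
  then show ?thesis by blast
qed

text \<open>A degenerate functional vanishes on a minimal ideal, generated by some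
  \<open>t \<beta>\<close>. The field is infinite, while minimal ideals with distinct annihilators
  are independent modulo \<open>bb\<close>; so two members of the pencil have minimal ideals with
  the same annihilator \<open>m\<close>. These two members become the new basis of the
  pencil.\<close>

lemma degenerate_same_point:
  assumes w: "lin_fun w1" "lin_fun w2" "VB = {z. w1 z = 0 \<and> w2 z = 0}"
    and deg: "\<And>\<beta>. \<exists>x. x \<notin> bb \<and> (\<forall>y. w1 (x * y) + \<beta> * w2 (x * y) = 0)"
  obtains u1 u2 t1 t2 m where "lin_fun u1" "lin_fun u2" "VB = {z. u1 z = 0 \<and> u2 z = 0}"
    "\<And>y. u1 (t1 * y) = 0" "\<And>y. u2 (t2 * y) = 0" "t1 \<notin> bb" "t2 \<notin> bb" "maxi m" "quo bb t1 = m" "quo bb t2 = m"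
proof -
  have "\<exists>t. t \<notin> bb \<and> (\<forall>y. w1 (t * y) + \<beta> * w2 (t * y) = 0) \<and> maxi (quo bb t)" for \<beta>
  proof -
    obtain x where x: "x \<notin> bb" "\<And>y. w1 (x * y) + \<beta> * w2 (x * y) = 0" using deg by blast
    have "bb \<subset> prin x bb" using x(1) prin_superset prin_self[OF tb] by blast
    then obtain t where t: "t \<in> prin x bb" "t \<notin> bb" "maxi (quo bb t)"
      using minimal_above[OF fb tb tideal_prin[OF tb]] by blast
    obtain z b where zb: "t = x * z + b" "b \<in> bb" using t(1) by (auto simp: prin_def)
    have "w1 (t * y) + \<beta> * w2 (t * y) = 0" for y
    proof -
      have "t * y = x * (z * y) + b * y" using zb by (simp add: algebra_simps)
      moreover have "w1 (b * y) = 0" "w2 (b * y) = 0" using tidealD(4)[OF tb zb(2), of y] bb_VB w(3) by auto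
      ultimately show ?thesis using x(2)[of "z * y"] by (simp add: lin_funD[OF w(1)] lin_funD[OF w(2)])
    qed
    then show ?thesis using t by blast
  qed
  then obtain t where t: "\<And>\<beta>. t \<beta> \<notin> bb" "\<And>\<beta> y. w1 (t \<beta> * y) + \<beta> * w2 (t \<beta> * y) = 0" "\<And>\<beta>. maxi (quo bb (t \<beta>))"
    by metis
  obtain g :: "nat \<Rightarrow> 'a" where g: "inj g" using infinite_countable_subset[OF infinite_alg_closed] by blast
  have "\<exists>i j. i \<noteq> j \<and> quo bb (t (g i)) = quo bb (t (g j))"
  proof (rule ccontr)
    assume n: "\<not> ?thesis"
    obtain p where p: "p \<noteq> 0" "psum p (\<lambda>i. t (g i)) \<in> bb" using ex_relation[OF fb] by blast
    have "Polynomial.coeff p (Polynomial.degree p) = 0"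
    proof (rule independent_simple[OF tb, where F = "{..Polynomial.degree p}" and mm = "\<lambda>i. quo bb (t (g i))" and s = "\<lambda>i. t (g i)"])
      show "inj_on (\<lambda>i. quo bb (t (g i))) {..Polynomial.degree p}" using n by (auto intro!: inj_onI)
      show "(\<Sum>i\<le>Polynomial.degree p. Polynomial.coeff p i *s t (g i)) \<in> bb" using p(2) by (simp add: psum_def)
      show "maxi (quo bb (t (g i))) \<and> t (g i) \<notin> bb \<and> (\<forall>z\<in>quo bb (t (g i)). z * t (g i) \<in> bb)" for i
        using t by (auto simp: quo_def mult.commute)
    qed auto
    then show False using p(1) by simp
  qed
  then obtain i j where ij: "i \<noteq> j" "quo bb (t (g i)) = quo bb (t (g j))" by blast
  define u1 where "u1 z = w1 z + g i * w2 z" for z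
  define u2 where "u2 z = w1 z + g j * w2 z" for z
  have gij: "g i \<noteq> g j" using g ij by (auto dest: injD)
  show thesis
  proof (rule that[of u1 u2 "t (g i)" "t (g j)" "quo bb (t (g i))"])
    show "lin_fun u1" "lin_fun u2" using w(1,2) by (auto simp: lin_fun_def u1_def u2_def algebra_simps)
    have "w1 z = 0 \<and> w2 z = 0" if "w1 z + g i * w2 z = 0" "w1 z + g j * w2 z = 0" for z
    proof -
      have "(g i - g j) * w2 z = (w1 z + g i * w2 z) - (w1 z + g j * w2 z)" by (simp add: algebra_simps)
      then have "(g i - g j) * w2 z = 0" using that by simp
      then have "w2 z = 0" using gij by simp
      then show ?thesis using that by simp
    qed
    then show "VB = {z. u1 z = 0 \<and> u2 z = 0}" unfolding w(3) u1_def u2_def by auto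
  qed (use t ij in \<open>auto simp: u1_def u2_def\<close>)
qed

text \<open>Both functionals give bilinear forms \<open>u (x * z)\<close> on \<open>m\<close> modulo
  \<open>J\<close>. If the first form is nondegenerate, the second arises from it by an operator,
  and an eigenvector of that operator is in the kernel of a member of the pencil of forms.\<close>

lemma degenerate_pencil:
  assumes u: "lin_fun u1" "lin_fun u2" and m: "maxi m" "tideal J" "J \<subset> m" "fcod J"
    and mJ: "\<And>x y. x \<in> m \<Longrightarrow> y \<in> J \<Longrightarrow> x * y \<in> bb" and ub: "\<And>x. x \<in> bb \<Longrightarrow> u1 x = 0 \<and> u2 x = 0"
  obtains \<alpha> \<beta> x where "\<alpha> \<noteq> 0 \<or> \<beta> \<noteq> 0" "x \<in> m" "x \<notin> J" "\<And>z. z \<in> m \<Longrightarrow> \<alpha> * u1 (x * z) + \<beta> * u2 (x * z) = 0"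
proof (cases "\<exists>x\<in>m. x \<notin> J \<and> (\<forall>z\<in>m. u1 (x * z) = 0)")
  case True then show thesis using that[of 1 0] by auto
next
  case False
  then have nd: "x \<in> J" if "x \<in> m" "\<And>z. z \<in> m \<Longrightarrow> u1 (x * z) = 0" for x using that by blast
  have mt: "tideal m" by (rule maxi_tideal[OF m(1)])
  have "\<forall>x\<in>m. \<exists>x'\<in>m. \<forall>z\<in>m. u2 (x * z) = u1 (x' * z)"
  proof
    fix x assume x: "x \<in> m"
    obtain a where "a \<in> m" "\<And>y. y \<in> m \<Longrightarrow> u2 (x * y) = u1 (a * y)"
    proof (rule representable[where J = J and M = m and B = "\<lambda>x y. u1 (x * y)" and \<psi> = "\<lambda>y. u2 (x * y)"])
      show "fcod J" "J \<subseteq> m" "subspace m" using m tideal_subspace[OF mt] by auto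
      show "lin_fun (\<lambda>x. u1 (x * y))" for y using u(1) by (auto simp: lin_fun_def distrib_right scale_mult)
      show "lin_fun (\<lambda>y. u1 (x * y))" "lin_fun (\<lambda>y. u2 (x * y))" for x
        using u by (auto simp: lin_fun_def distrib_left mult_scale)
    qed (use mJ ub nd x in auto)
    then show "\<exists>x'\<in>m. \<forall>z\<in>m. u2 (x * z) = u1 (x' * z)" by blast
  qed
  then obtain f where f: "\<And>x. x \<in> m \<Longrightarrow> f x \<in> m" "\<And>x z. x \<in> m \<Longrightarrow> z \<in> m \<Longrightarrow> u2 (x * z) = u1 (f x * z)" by metis
  obtain x0 where x0: "x0 \<in> m" "x0 \<notin> J" using m(3) by auto
  \<comment> \<open>The operator \<open>f\<close> comes from a choice and need not be linear; the
    sequence of iterates is all that \<open>eigen_sequence\<close> asks for.\<close>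
  define v where "v i = (f ^^ i) x0" for i
  have vm: "v i \<in> m" for i unfolding v_def using x0 f(1) by (induction i) auto
  have v0: "v 0 \<notin> J" using x0 by (simp add: v_def)
  obtain c q where q: "psum q v \<notin> J" "psum q (\<lambda>i. v (Suc i) - c *s v i) \<in> J"
    using eigen_sequence[of J v, OF m(4) v0] by blast
  have "(- c) * u1 (psum q v * z) + 1 * u2 (psum q v * z) = 0" if z: "z \<in> m" for z
  proof -
    have "u2 (v i * z) = u1 (v (Suc i) * z)" for i using f(2)[OF vm z, of i] by (simp add: v_def)
    then have "u2 (psum q v * z) = u1 (psum q (\<lambda>i. v (Suc i) * z))"
      by (simp add: psum_mult psum_lin_fun[OF u(1)] psum_lin_fun[OF u(2)])
    moreover have "u1 (psum q (\<lambda>i. v (Suc i) - c *s v i) * z) = 0"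
      using mJ[OF z q(2)] ub by (simp add: mult.commute)
    then have "u1 (psum q (\<lambda>i. v (Suc i) * z)) - c * u1 (psum q v * z) = 0"
      by (simp add: psum_mult left_diff_distrib scale_mult psum_diff_arg psum_scale_arg lin_funD[OF u(1)])
    ultimately show ?thesis by simp
  qed
  moreover have "psum q v \<in> m" unfolding psum_def using vm by (intro tidealD(8)[OF mt] tidealD(7)[OF mt])
  ultimately show thesis using that[of "- c" 1 "psum q v"] q(1) by auto
qed

text \<open>\<open>t1\<close> and \<open>t2\<close> are independent socle elements at the same
  maximal ideal \<open>m\<close>, and \<open>J\<close> is the ideal they generate over
  \<open>bb\<close>. Some member \<open>w\<close> of the pencil vanishes on \<open>x * m\<close> for
  an \<open>x\<close> in \<open>m\<close> outside \<open>J\<close>. Correcting \<open>x\<close> by a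
  socle element gives \<open>y\<close> such that \<open>w\<close> vanishes on the whole ideal of
  \<open>y\<close>; it also vanishes on that of a combination \<open>z0\<close> of \<open>t1\<close>
  and \<open>t2\<close>. The ideal \<open>H\<close> of \<open>y\<close> and \<open>z0\<close> has
  dimension at least 2 modulo \<open>bb\<close>, so it contains an ideal of colength
  \<open>r + 1\<close> killed by \<open>w\<close>, contrary to \<open>not_killed\<close>.\<close>

lemma degenerate_impossible:
  assumes w: "lin_fun w1" "lin_fun w2" "VB = {z. w1 z = 0 \<and> w2 z = 0}"
    and deg: "\<And>\<beta>. \<exists>x. x \<notin> bb \<and> (\<forall>y. w1 (x * y) + \<beta> * w2 (x * y) = 0)"
  shows False
proof -
  obtain u1 u2 t1 t2 m where u: "lin_fun u1" "lin_fun u2" "VB = {z. u1 z = 0 \<and> u2 z = 0}"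
    and t: "\<And>y. u1 (t1 * y) = 0" "\<And>y. u2 (t2 * y) = 0" "t1 \<notin> bb" "t2 \<notin> bb" "maxi m" "quo bb t1 = m" "quo bb t2 = m"
    using degenerate_same_point[OF w deg] by blast
  have mt: "tideal m" by (rule maxi_tideal[OF t(5)])
  have bm: "bb \<subseteq> m" using quo_superset[OF tb] t(6) by blast
  have fm: "fcod m" by (rule fcod_tideal[OF fb bm mt])
  have ub: "u1 x = 0 \<and> u2 x = 0" if "x \<in> bb" for x using that bb_VB u(3) by auto
  have u0: "u1 t1 = 0" "u2 t2 = 0" using t(1)[of 1] t(2)[of 1] by auto
  have cm: "codim m = 1" by (rule maxi_codim[OF fm t(5)])
  \<comment> \<open>The ideal of such an \<open>x\<close> has colength \<open>r + 2\<close>, large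
    enough for linearly general position to keep \<open>x\<close> out of \<open>VB\<close>. It
    follows that \<open>u2 t1\<close> and \<open>u1 t2\<close> are nonzero.\<close>
  have not_VB: "x \<notin> VB" if "x \<notin> bb" "quo bb x = m" for x
  proof
    assume "x \<in> VB"
    moreover have "codim bb = Suc (codim (prin x bb))" by (rule codim_prin_minimal[OF fb tb]) (simp add: that cm)
    ultimately show False
      using VB_ideal[OF tideal_prin[OF tb] prin_superset _ prin_self[OF tb]] cb that by simp
  qed
  have u2t1: "u2 t1 \<noteq> 0" and u1t2: "u1 t2 \<noteq> 0"
    using not_VB[OF t(3,6)] not_VB[OF t(4,7)] u0 u(3) by auto
  have mt1: "z * t1 \<in> bb" and mt2: "z * t2 \<in> bb" if "z \<in> m" for z
    using that t(6,7) by (auto simp: quo_def mult.commute)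
  define P where "P = prin t2 bb"
  define J where "J = prin t1 P"
  have P: "tideal P" "fcod P" "codim P = r + 2"
    using tideal_prin[OF tb] codim_quo_prin(2)[OF fb tb] codim_prin_minimal[OF fb tb, of t2] t(7) cm cb by (auto simp: P_def)
  have t1P: "t1 \<notin> P"
  proof
    assume "t1 \<in> P"
    then obtain z where "t1 - t2 * z \<in> bb" using prin_iff by (auto simp: P_def)
    then have "u2 (t1 - t2 * z) = 0" using ub by blast
    then show False using t(2) u2t1 by (simp add: lin_funD[OF u(2)])
  qed
  have "quo P t1 = m"
  proof (rule maxi_subset_eq[OF t(5) tideal_quo[OF P(1)]])
    show "m \<subseteq> quo P t1" using mt1 prin_superset[of bb t2] by (auto simp: quo_def P_def mult.commute)
    show "1 \<notin> quo P t1" using t1P by (simp add: quo_def)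
  qed
  then have J: "tideal J" "fcod J" "codim J = r + 1"
    using tideal_prin[OF P(1)] codim_quo_prin(2)[OF P(2,1)] codim_prin_minimal[OF P(2,1), of t1] cm P(3) by (auto simp: J_def)
  have mJ: "x * y \<in> bb" if "x \<in> m" "y \<in> J" for x y
  proof -
    obtain z p where z: "y = t1 * z + p" "p \<in> P" using \<open>y \<in> J\<close> by (auto simp: J_def prin_def)
    obtain z' b where z': "p = t2 * z' + b" "b \<in> bb" using z(2) by (auto simp: P_def prin_def)
    note xm = \<open>x \<in> m\<close>
    have "x * y = z * (x * t1) + (z' * (x * t2) + x * b)" using z z' by (simp add: algebra_simps)
    also have "\<dots> \<in> bb"
      by (rule tidealD(2)[OF tb tidealD(3)[OF tb mt1[OF xm]] tidealD(2)[OF tb tidealD(3)[OF tb mt2[OF xm]] tidealD(3)[OF tb z'(2)]]])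
    finally show ?thesis .
  qed
  have sc: "\<exists>c. x - c *s 1 \<in> m" for x using maxi_scalar[OF fm t(5)] by metis
  have prod: "u1 (t1 * t2) = 0" "u2 (t1 * t2) = 0" using t(1)[of t2] t(2)[of t1] by (auto simp: mult.commute)
  \<comment> \<open>If \<open>d\<close> is the value of \<open>t1\<close> at \<open>m\<close>, then
    \<open>u1 (t1 * t2) = d * u1 t2\<close>; the left side is 0 and \<open>u1 t2\<close> is
    not.\<close>
  have t1m: "t1 \<in> m"
  proof -
    obtain d where d: "t1 - d *s 1 \<in> m" using sc by blast
    have "u1 ((t1 - d *s 1) * t2) = 0" using mt2[OF d] ub by blast
    then have "d * u1 t2 = 0" using prod by (simp add: left_diff_distrib scale_mult lin_funD[OF u(1)])
    then show ?thesis using d u1t2 by auto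
  qed
  have t2m: "t2 \<in> m"
  proof -
    obtain d where d: "t2 - d *s 1 \<in> m" using sc by blast
    have "u2 ((t2 - d *s 1) * t1) = 0" using mt1[OF d] ub by blast
    moreover have "(t2 - d *s 1) * t1 = t1 * t2 - d *s t1" by (simp add: left_diff_distrib scale_mult)
    ultimately have "d * u2 t1 = 0" using prod by (simp add: lin_funD[OF u(2)])
    then show ?thesis using d u2t1 by auto
  qed
  have t2P: "t2 \<in> P" unfolding P_def by (rule prin_self[OF tb])
  have PJ: "P \<subseteq> J" unfolding J_def by (rule prin_superset)
  have bP: "bb \<subseteq> P" unfolding P_def by (rule prin_superset)
  have tJ: "t1 \<in> J" "t2 \<in> J" using t2P PJ prin_self[OF P(1)] by (auto simp: J_def)
  have "J \<subseteq> m"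
    unfolding J_def P_def by (intro prin_least[OF mt] prin_least[OF mt bm] t1m t2m)
  \<comment> \<open>The colengths are \<open>r + 1\<close> and 1, so this is where
    \<open>r \<ge> 1\<close> enters.\<close>
  moreover have "J \<noteq> m" using J(3) cm r1 by auto
  ultimately have "J \<subset> m" by blast
  then obtain \<alpha> \<beta> x where x: "\<alpha> \<noteq> 0 \<or> \<beta> \<noteq> 0" "x \<in> m" "x \<notin> J"
    and xz: "\<And>z. z \<in> m \<Longrightarrow> \<alpha> * u1 (x * z) + \<beta> * u2 (x * z) = 0"
    using degenerate_pencil[OF u(1,2) t(5) J(1) _ J(2) mJ ub] by metis
  define w where "w z = \<alpha> * u1 z + \<beta> * u2 z" for z
  have lw: "lin_fun w" using u(1,2) by (auto simp: lin_fun_def w_def algebra_simps)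
  have wb: "w z = 0" if "z \<in> bb" for z using ub[OF that] by (simp add: w_def)
  have wt: "w t1 = \<beta> * u2 t1" "w t2 = \<alpha> * u1 t2" using u0 by (auto simp: w_def)
  \<comment> \<open>As \<open>\<alpha>\<close> and \<open>\<beta>\<close> are not both 0,
    \<open>w\<close> is nonzero at \<open>t1\<close> or at \<open>t2\<close>, and a multiple of that
    element takes the value \<open>w x\<close>.\<close>
  have "\<exists>s\<in>J. w s = w x"
  proof (cases "\<beta> = 0")
    case False
    then have "w ((w x / w t1) *s t1) = w x" using wt u2t1 by (simp add: lin_funD[OF lw])
    then show ?thesis using tidealD(7)[OF J(1) tJ(1)] by blast
  next
    case True
    then have "w ((w x / w t2) *s t2) = w x" using wt u1t2 x(1) by (simp add: lin_funD[OF lw])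
    then show ?thesis using tidealD(7)[OF J(1) tJ(2)] by blast
  qed
  then obtain s where s: "s \<in> J" "w s = w x" by blast
  define y where "y = x - s"
  \<comment> \<open>Every \<open>b\<close> is a scalar modulo \<open>m\<close>, so it suffices that
    \<open>w\<close> vanishes at \<open>h\<close> and on \<open>h * m\<close>.\<close>
  have kill: "w (h * b) = 0" if "w h = 0" "\<And>z. z \<in> m \<Longrightarrow> w (h * z) = 0" for h b
  proof -
    obtain c where c: "b - c *s 1 \<in> m" using sc by blast
    have "h * b = h * (b - c *s 1) + c *s h" by (simp add: right_diff_distrib mult_scale)
    then show ?thesis using that(1) that(2)[OF c] by (simp add: lin_funD[OF lw])
  qed
  have wJ: "w (h * z) = 0" if "h \<in> J" "z \<in> m" for h z using wb[OF mJ[OF that(2,1)]] by (simp add: mult.commute)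
  have wy: "w (y * b) = 0" for b
  proof (rule kill)
    show "w y = 0" using s by (simp add: y_def lin_funD[OF lw])
    show "w (y * z) = 0" if "z \<in> m" for z
      using xz[OF that] wJ[OF s(1) that] by (simp add: y_def left_diff_distrib lin_funD[OF lw]) (simp add: w_def)
  qed
  \<comment> \<open>The combination of \<open>t1\<close> and \<open>t2\<close> in the kernel of
    \<open>w\<close>, whose values there are \<open>\<beta> * u2 t1\<close> and
    \<open>\<alpha> * u1 t2\<close>.\<close>
  define z0 where "z0 = (\<alpha> * u1 t2) *s t1 - (\<beta> * u2 t1) *s t2"
  have z0J: "z0 \<in> J" unfolding z0_def by (rule tidealD(6)[OF J(1) tidealD(7)[OF J(1) tJ(1)] tidealD(7)[OF J(1) tJ(2)]])
  have "w z0 = 0" by (simp add: z0_def lin_funD[OF lw] wt)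
  then have wz0: "w (z0 * b) = 0" for b using kill wJ[OF z0J] by blast
  have z0b: "z0 \<notin> bb"
  proof
    assume "z0 \<in> bb"
    then have "u1 z0 = 0" "u2 z0 = 0" using ub by auto
    then have "\<beta> * u2 t1 * u1 t2 = 0" "\<alpha> * u1 t2 * u2 t1 = 0"
      using u0 by (auto simp: z0_def lin_funD[OF u(1)] lin_funD[OF u(2)])
    then show False using u1t2 u2t1 x(1) by auto
  qed
  define Q where "Q = prin z0 bb"
  define H where "H = prin y Q"
  have Q: "tideal Q" "fcod Q" "bb \<subseteq> Q" using tideal_prin[OF tb] codim_quo_prin(2)[OF fb tb] prin_superset by (auto simp: Q_def)
  have H: "tideal H" "Q \<subseteq> H" using tideal_prin[OF Q(1)] prin_superset by (auto simp: H_def)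
  have "z0 \<in> Q" unfolding Q_def by (rule prin_self[OF tb])
  then have "codim Q < codim bb" using z0b Q by (intro codim_strict[OF fb _ tideal_subspace[OF Q(1)]]) blast
  moreover have "Q \<subseteq> J" unfolding Q_def using bP PJ z0J by (intro prin_least[OF J(1)]) auto
  then have "y \<notin> Q" using x(3) s(1) tidealD(2)[OF J(1), of y s] by (auto simp: y_def)
  then have "codim H < codim Q"
    using prin_self[OF Q(1), of y] H by (intro codim_strict[OF Q(2) _ tideal_subspace[OF H(1)]]) (auto simp: H_def)
  ultimately have "codim H \<le> r + 1" using cb by simp
  moreover have "r + 1 \<le> codim bb" using cb by simp
  ultimately obtain K where K: "tideal K" "bb \<subseteq> K" "K \<subseteq> H" "codim K = r + 1"
    using ideal_between_ac[OF fb tb H(1) subset_trans[OF Q(3) H(2)]] by blast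
  have "w h = 0" if "h \<in> H" for h
  proof -
    obtain a q where a: "h = y * a + q" "q \<in> Q" using \<open>h \<in> H\<close> by (auto simp: H_def prin_def)
    obtain a' b where a': "q = z0 * a' + b" "b \<in> bb" using a(2) by (auto simp: Q_def prin_def)
    show ?thesis using a a' wy wz0 wb by (simp add: lin_funD[OF lw])
  qed
  then have "\<forall>h\<in>K. \<alpha> * u1 h + \<beta> * u2 h = 0" using K(3) by (auto simp: w_def)
  then show False using not_killed[OF u x(1) K(1,2,4)] by blast
qed

lemma max_principal:
  assumes "maxi m" "bb \<subseteq> m"
  shows "\<exists>y. m = prin y bb"
proof -
  obtain w1 w2 where w: "lin_fun w1" "lin_fun w2" "VB = {z. w1 z = 0 \<and> w2 z = 0}"
    using ex_two_lin_funs[OF VB_codim] by metis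
  obtain \<beta> where b: "\<And>x. (\<And>y. w1 (x * y) + \<beta> * w2 (x * y) = 0) \<Longrightarrow> x \<in> bb"
    using degenerate_impossible[OF w] by metis
  define w where "w z = w1 z + \<beta> * w2 z" for z
  show ?thesis
  proof (rule max_principal_nondegenerate[OF _ w(2) _ _ assms])
    show "lin_fun w" using w(1,2) by (auto simp: lin_fun_def w_def algebra_simps)
    show "VB = {z. w z = 0 \<and> w2 z = 0}" unfolding w(3) by (auto simp: w_def)
    show "x \<in> bb" if "\<And>y. w (x * y) = 0" for x using b that by (simp add: w_def)
  qed
qed

end

context ac_alg
begin

text \<open>It suffices that \<open>m\<close> has dimension at most 1 modulo
  \<open>msq m \<aa>\<close>. Otherwise some \<open>J\<close> of colength 3 between the two contains
  an ideal \<open>bb\<close> of colength \<open>r + 3\<close>, for which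
  \<open>max_principal\<close> gives \<open>m = (y) + bb\<close>. Then \<open>(y) + J\<close> and
  \<open>(J : y)\<close> both contain \<open>m\<close>, so the colength of \<open>J\<close> would be
  at most 2.\<close>

lemma lgp_max_principal:
  assumes a: "fcod \<aa>" "tideal \<aa>" "r + 3 \<le> codim \<aa>" "r \<ge> 1" and V: "fdim V" "dim V = r + 1"
    and lgp: "\<And>K v. tideal K \<Longrightarrow> \<aa> \<subseteq> K \<Longrightarrow> r + 1 \<le> codim K \<Longrightarrow> v \<in> V \<Longrightarrow> v \<in> K \<Longrightarrow> v = 0"
    and m: "maxi m" "\<aa> \<subseteq> m"
  shows "\<exists>x. m = prin x \<aa>"
proof -
  have mt: "tideal m" by (rule maxi_tideal[OF m(1)])
  have fm: "fcod m" by (rule fcod_tideal[OF a(1) m(2) mt])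
  have cm: "codim m = 1" by (rule maxi_codim[OF fm m(1)])
  let ?S = "msq m \<aa>"
  have S: "tideal ?S" "fcod ?S" "?S \<subseteq> m" "\<aa> \<subseteq> ?S"
    using tideal_msq fcod_tideal[OF a(1) msq_superset tideal_msq] msq_superset msq_least[OF mt m(2)] tidealD(3)[OF mt] by auto
  have c2: "codim ?S \<le> 2"
  proof (rule ccontr)
    assume "\<not> ?thesis"
    then have "3 \<le> codim ?S" by simp
    moreover have "codim m \<le> 3" using cm by simp
    ultimately obtain J where J: "tideal J" "?S \<subseteq> J" "J \<subseteq> m" "codim J = 3"
      using ideal_between_ac[OF S(2,1) mt S(3)] by blast
    have aJ: "\<aa> \<subseteq> J" using S(4) J(2) by blast
    obtain bb where bb: "tideal bb" "\<aa> \<subseteq> bb" "bb \<subseteq> J" "codim bb = r + 3"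
      using ideal_between_ac[OF a(1,2) J(1) aJ _ a(3)] J(4) by (metis le_add2)
    interpret lgp_quotient scale bb V r
      by unfold_locales (use fcod_tideal[OF a(1) bb(2,1)] bb a V lgp in auto)
    obtain y where y: "m = prin y bb" using max_principal[OF m(1)] bb(3) J(3) by blast
    have fJ: "fcod J" by (rule fcod_tideal[OF a(1) aJ J(1)])
    have ym: "y \<in> m" using y prin_self[OF bb(1)] by blast
    have "m \<subseteq> prin y J" unfolding y using prin_least[OF tideal_prin[OF J(1)] subset_trans[OF bb(3) prin_superset] prin_self[OF J(1)]] .
    then have "codim (prin y J) \<le> 1" using codim_mono[OF fm _ tideal_subspace[OF tideal_prin[OF J(1)]]] cm by simp
    moreover have "m \<subseteq> quo J y" using msq_mem[OF ym] J(2) by (auto simp: quo_def)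
    then have "codim (quo J y) \<le> 1" using codim_mono[OF fm _ tideal_subspace[OF tideal_quo[OF J(1)]]] cm by simp
    ultimately show False using codim_quo_prin(3)[OF fJ J(1), of y] J(4) by simp
  qed
  obtain y where y: "y \<in> m" "m \<subseteq> prin y ?S"
  proof (cases "m = ?S")
    case True then show thesis using that[of 0] prin_superset[of ?S 0] tidealD(1)[OF mt] by auto
  next
    case False
    then obtain y where y: "y \<in> m" "y \<notin> ?S" using S(3) by blast
    have "?S \<subset> prin y ?S" using y prin_superset prin_self[OF S(1)] by blast
    then have "codim (prin y ?S) < codim ?S" by (rule codim_strict[OF S(2) _ tideal_subspace[OF tideal_prin[OF S(1)]]])
    then have "codim (prin y ?S) \<le> codim m" using c2 cm by simp
    then have "prin y ?S = m"
      using codim_eq_imp_eq[OF codim_quo_prin(2)[OF S(2,1)] prin_least[OF mt S(3) y(1)] tideal_subspace[OF mt]] by blast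
    then show thesis using that y by blast
  qed
  have "m = prin y (loc \<aa> m)" by (rule nakayama[OF a(1,2) m y])
  then show ?thesis using local_to_global[OF a(1,2) m y(1)] by metis
qed

end

section \<open>Polynomials and their homogeneous components\<close>

interpretation mp: comm_alg "scalem :: 'k::field \<Rightarrow> 'k mpol \<Rightarrow> 'k mpol"
  by unfold_locales (simp add: scalem_def mult.assoc)

interpretation mpc: ac_alg "scalem :: 'k::alg_closed_field \<Rightarrow> 'k mpol \<Rightarrow> 'k mpol"
  by unfold_locales

lemma pm_sum_single: "(p :: 'a \<Rightarrow>\<^sub>0 'b::comm_monoid_add) = (\<Sum>m\<in>Poly_Mapping.keys p. Poly_Mapping.single m (Poly_Mapping.lookup p m))"
  by (rule poly_mapping_eqI) (auto simp: lookup_sum lookup_single when_def not_in_keys_iff_lookup_eq_zero)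

lemma pm_induct [case_names zero single add]:
  fixes p :: "'a \<Rightarrow>\<^sub>0 'b::comm_monoid_add"
  assumes "P 0" "\<And>m c. P (Poly_Mapping.single m c)" "\<And>p q. P p \<Longrightarrow> P q \<Longrightarrow> P (p + q)"
  shows "P p"
proof -
  have "P (\<Sum>m\<in>M. Poly_Mapping.single m (Poly_Mapping.lookup p m))" for M
    by (induction M rule: infinite_finite_induct) (auto intro: assms)
  then show ?thesis using pm_sum_single[of p] by metis
qed

lemma lookup_scalem: "Poly_Mapping.lookup (scalem c p) m = c * Poly_Mapping.lookup p m"
proof (induction p rule: pm_induct)
  case (single m' d) then show ?case by (auto simp: scalem_def mult_single lookup_single when_def)
qed (auto simp: mpol.scale_right_distrib lookup_add distrib_left mpol.scale_zero_right)

lemma scalem_single: "scalem c (Poly_Mapping.single m d) = Poly_Mapping.single m (c * d)"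
  by (simp add: scalem_def mult_single)

lemma mdeg_superset: "finite A \<Longrightarrow> Poly_Mapping.keys m \<subseteq> A \<Longrightarrow> mdeg m = (\<Sum>i\<in>A. Poly_Mapping.lookup m i)"
  unfolding mdeg_def by (intro sum.mono_neutral_left) (auto simp: not_in_keys_iff_lookup_eq_zero)

lemma keys_add_nat: "Poly_Mapping.keys ((m :: nat \<Rightarrow>\<^sub>0 nat) + m') = Poly_Mapping.keys m \<union> Poly_Mapping.keys m'"
  by (auto simp: in_keys_iff lookup_add)

lemma mdeg_add: "mdeg (m + m') = mdeg m + mdeg m'"
proof -
  let ?A = "Poly_Mapping.keys m \<union> Poly_Mapping.keys m'"
  have "finite ?A" by simp
  then have "mdeg (m + m') = (\<Sum>i\<in>?A. Poly_Mapping.lookup (m + m') i)" "mdeg m = (\<Sum>i\<in>?A. Poly_Mapping.lookup m i)"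
    "mdeg m' = (\<Sum>i\<in>?A. Poly_Mapping.lookup m' i)" by (rule mdeg_superset; auto simp: keys_add_nat)+
  then show ?thesis by (simp add: lookup_add sum.distrib)
qed

lemma mdeg_zero [simp]: "mdeg 0 = 0" by (simp add: mdeg_def)

lemma mdeg_single [simp]: "mdeg (Poly_Mapping.single i n) = n" by (auto simp: mdeg_def)

section \<open>Monomials and forms of a fixed degree\<close>

definition mons :: "nat \<Rightarrow> nat \<Rightarrow> (nat \<Rightarrow>\<^sub>0 nat) set" where
  "mons r n = {m. Poly_Mapping.keys m \<subseteq> {..r} \<and> mdeg m = n}"

lemma mons_add: "m \<in> mons r n \<Longrightarrow> m' \<in> mons r n' \<Longrightarrow> m + m' \<in> mons r (n + n')"
  by (auto simp: mons_def keys_add_nat mdeg_add)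

lemma mons_cancel: "m \<in> mons r n \<Longrightarrow> m + m' \<in> mons r k \<longleftrightarrow> m' \<in> mons r (k - n) \<and> n \<le> k"
  by (auto simp: mons_def keys_add_nat mdeg_add)

lemma mons_split:
  assumes "m \<in> mons r (a + b)"
  shows "\<exists>m1\<in>mons r a. \<exists>m2\<in>mons r b. m = m1 + m2"
  using assms
proof (induction b arbitrary: m)
  case 0 then show ?case by (auto intro!: bexI[of _ m] bexI[of _ 0] simp: mons_def)
next
  case (Suc b)
  have "m \<noteq> 0" using Suc.prems by (auto simp: mons_def)
  then obtain i where i: "i \<in> Poly_Mapping.keys m" by (metis all_not_in_conv keys_eq_empty poly_mapping_eqI lookup_zero not_in_keys_iff_lookup_eq_zero)
  define m' where "m' = m - Poly_Mapping.single i 1"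
  have mm: "m = Poly_Mapping.single i 1 + m'"
    using i by (intro poly_mapping_eqI) (auto simp: m'_def lookup_add lookup_minus lookup_single when_def in_keys_iff)
  have "i \<le> r" using i Suc.prems by (auto simp: mons_def)
  then have s: "Poly_Mapping.single i 1 \<in> mons r 1" by (auto simp: mons_def)
  then have "m' \<in> mons r (a + b)" using mons_cancel[of "Poly_Mapping.single i 1" r 1 m' "a + Suc b"] Suc.prems mm by simp
  then obtain m1 m2 where "m1 \<in> mons r a" "m2 \<in> mons r b" "m' = m1 + m2" using Suc.IH by blast
  moreover from this have "Poly_Mapping.single i 1 + m2 \<in> mons r (Suc b)" using mons_add[OF s, of m2 b] by simp
  ultimately show ?case using mm by (metis add.left_commute)
qed

lemma finite_mons: "finite (mons r n)"
proof (rule finite_subset)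
  let ?S = "{f :: nat \<Rightarrow> nat. \<forall>i. (i \<in> {..r} \<longrightarrow> f i \<in> {..n}) \<and> (i \<notin> {..r} \<longrightarrow> f i = 0)}"
  show "mons r n \<subseteq> Poly_Mapping.lookup -` ?S"
  proof
    fix m assume m: "m \<in> mons r n"
    have "Poly_Mapping.lookup m i \<le> n" for i
    proof (cases "i \<in> Poly_Mapping.keys m")
      case True
      then have "Poly_Mapping.lookup m i \<le> mdeg m" unfolding mdeg_def by (intro member_le_sum) auto
      then show ?thesis using m by (simp add: mons_def)
    qed (auto simp: not_in_keys_iff_lookup_eq_zero)
    then show "m \<in> Poly_Mapping.lookup -` ?S"
      using m by (auto simp: mons_def in_keys_iff)
  qed
  have "finite ?S" by (rule finite_set_of_finite_funs) auto
  then show "finite (Poly_Mapping.lookup -` ?S)"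
    by (rule finite_vimageI) (auto intro!: injI poly_mapping_eqI)
qed

lemma carrier_polyring: "p \<in> carrier (polyring r) \<longleftrightarrow> (\<forall>m\<in>Poly_Mapping.keys p. Poly_Mapping.keys m \<subseteq> {..r})"
  by (simp add: polyring_def)

lemma polyring_simps [simp]:
  "x \<otimes>\<^bsub>polyring r\<^esub> y = x * y" "x \<oplus>\<^bsub>polyring r\<^esub> y = x + y" "\<one>\<^bsub>polyring r\<^esub> = 1" "\<zero>\<^bsub>polyring r\<^esub> = 0"
  by (simp_all add: polyring_def)

lemma forms_iff: "p \<in> forms r n \<longleftrightarrow> Poly_Mapping.keys p \<subseteq> mons r n"
  by (auto simp: forms_def mons_def carrier_polyring)

lemma single_in_forms: "m \<in> mons r n \<Longrightarrow> Poly_Mapping.single m c \<in> forms r n"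
  by (auto simp: forms_iff)

lemma forms_subspace: "mpol.subspace (forms r n)"
proof (rule mpol.subspaceI)
  show "0 \<in> forms r n" by (simp add: forms_iff)
  show "x + y \<in> forms r n" if "x \<in> forms r n" "y \<in> forms r n" for x y
    using that keys_add[of x y] by (auto simp: forms_iff)
  show "scalem c x \<in> forms r n" if "x \<in> forms r n" for c x
    using that by (auto simp: forms_iff in_keys_iff lookup_scalem)
qed

lemma forms_0: "0 \<in> forms r n" using mpol.subspace_0[OF forms_subspace] .
lemma forms_add: "x \<in> forms r n \<Longrightarrow> y \<in> forms r n \<Longrightarrow> x + y \<in> forms r n" by (rule mpol.subspace_add[OF forms_subspace])
lemma forms_diff: "x \<in> forms r n \<Longrightarrow> y \<in> forms r n \<Longrightarrow> x - y \<in> forms r n" by (rule mpol.subspace_diff[OF forms_subspace])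
lemma forms_sum: "(\<And>i. i \<in> A \<Longrightarrow> f i \<in> forms r n) \<Longrightarrow> sum f A \<in> forms r n" by (rule mpol.subspace_sum[OF forms_subspace])

lemma forms_mult: "x \<in> forms r n \<Longrightarrow> y \<in> forms r n' \<Longrightarrow> x * y \<in> forms r (n + n')"
  unfolding forms_iff using keys_mult[of x y] mons_add by fast

lemma one_in_forms: "1 \<in> forms r 0"
  by (auto simp: forms_iff mons_def)

lemma forms_power: "x \<in> forms r n \<Longrightarrow> x ^ k \<in> forms r (n * k)"
  by (induction k) (auto simp: one_in_forms dest: forms_mult)

lemma forms_carrier: "forms r n \<subseteq> carrier (polyring r)" by (auto simp: forms_def)

lemma forms_span: "forms r n = mpol.span ((\<lambda>m. Poly_Mapping.single m 1) ` mons r n)"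
proof
  show "forms r n \<subseteq> mpol.span ((\<lambda>m. Poly_Mapping.single m 1) ` mons r n)"
  proof
    fix p assume p: "p \<in> forms r n"
    have "p = (\<Sum>m\<in>Poly_Mapping.keys p. scalem (Poly_Mapping.lookup p m) (Poly_Mapping.single m 1))"
      using pm_sum_single[of p] by (simp add: scalem_single)
    also have "\<dots> \<in> mpol.span ((\<lambda>m. Poly_Mapping.single m 1) ` mons r n)"
      using p by (intro mpol.span_sum mpol.span_scale mpol.span_base) (auto simp: forms_iff)
    finally show "p \<in> mpol.span ((\<lambda>m. Poly_Mapping.single m 1) ` mons r n)" .
  qed
  show "mpol.span ((\<lambda>m. Poly_Mapping.single m 1) ` mons r n) \<subseteq> forms r n"
    by (rule mpol.span_minimal) (auto simp: single_in_forms forms_subspace)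
qed

lemma independent_singles: "mpol.independent ((\<lambda>m. Poly_Mapping.single m (1::'k::field)) ` (M :: (nat \<Rightarrow>\<^sub>0 nat) set))"
  unfolding mpol.independent_explicit_finite_subsets
proof (intro allI impI ballI)
  fix S :: "'k mpol set" and u v
  assume S: "S \<subseteq> (\<lambda>m. Poly_Mapping.single m 1) ` M" "finite S" and u: "(\<Sum>v\<in>S. scalem (u v) v) = 0" and v: "v \<in> S"
  obtain m where m: "v = Poly_Mapping.single m 1" using S v by auto
  have "Poly_Mapping.lookup (\<Sum>v\<in>S. scalem (u v) v) m = (\<Sum>v\<in>S. u v * Poly_Mapping.lookup v m)"
    by (simp add: lookup_sum lookup_scalem)
  also have "\<dots> = (\<Sum>w\<in>{v}. u w * Poly_Mapping.lookup w m)"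
  proof (rule sum.mono_neutral_right)
    show "\<forall>w\<in>S - {v}. u w * Poly_Mapping.lookup w m = 0"
    proof
      fix w assume w: "w \<in> S - {v}"
      then obtain m' where m': "w = Poly_Mapping.single m' 1" using S(1) by auto
      then have "m' \<noteq> m" using w m by auto
      then show "u w * Poly_Mapping.lookup w m = 0" using m' by (simp add: lookup_single when_def)
    qed
  qed (use S v in auto)
  also have "\<dots> = u v" using m by simp
  finally show "u v = 0" using u by simp
qed

lemma dim_forms: "mpol.dim (forms r n :: 'k::field mpol set) = card (mons r n)"
proof -
  have "inj (\<lambda>m. Poly_Mapping.single m (1::'k))" by (rule inj_on_inverseI[where g = "\<lambda>m. the_elem (Poly_Mapping.keys m)"]) simp
  then have "card ((\<lambda>m. Poly_Mapping.single m (1::'k)) ` mons r n) = card (mons r n)"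
    by (intro card_image) (auto intro: inj_on_subset)
  then show ?thesis unfolding forms_span using mpol.dim_span_eq_card_independent[OF independent_singles] by metis
qed

lemma forms_fdim: "mp.fdim (forms r n)"
proof -
  have "finite ((\<lambda>m. Poly_Mapping.single m 1) ` mons r n)" by (rule finite_imageI[OF finite_mons])
  moreover have "forms r n \<subseteq> mpol.span ((\<lambda>m. Poly_Mapping.single m 1) ` mons r n)" by (rule equalityD1[OF forms_span])
  ultimately show ?thesis unfolding mp.fdim_def using forms_subspace by (intro conjI exI)
qed

lemma mons_1: "mons r 1 = (\<lambda>i. Poly_Mapping.single i 1) ` {..r}"
proof
    show "mons r 1 \<subseteq> (\<lambda>i. Poly_Mapping.single i 1) ` {..r}"
    proof
      fix m assume m: "m \<in> mons r 1"
      then have s: "(\<Sum>i\<in>Poly_Mapping.keys m. Poly_Mapping.lookup m i) = 1" "Poly_Mapping.keys m \<subseteq> {..r}" by (auto simp: mons_def mdeg_def)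
      then obtain i where i: "i \<in> Poly_Mapping.keys m" by fastforce
      have "(\<Sum>i\<in>Poly_Mapping.keys m. Poly_Mapping.lookup m i) = Poly_Mapping.lookup m i + (\<Sum>i\<in>Poly_Mapping.keys m - {i}. Poly_Mapping.lookup m i)"
        using i by (simp add: sum.remove)
      moreover have "Poly_Mapping.lookup m i > 0" using i by (simp add: in_keys_iff)
      ultimately have l: "Poly_Mapping.lookup m i = 1" "(\<Sum>i\<in>Poly_Mapping.keys m - {i}. Poly_Mapping.lookup m i) = 0"
        using s(1) by linarith+
      have "m = Poly_Mapping.single i 1"
      proof (rule poly_mapping_eqI)
        fix j
        have "j \<in> Poly_Mapping.keys m - {i} \<Longrightarrow> Poly_Mapping.lookup m j = 0" using l(2) by (simp add: sum_eq_0_iff)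
        then show "Poly_Mapping.lookup m j = Poly_Mapping.lookup (Poly_Mapping.single i 1) j"
          using l(1) by (cases "j = i") (auto simp: lookup_single when_def in_keys_iff)
      qed
      then show "m \<in> (\<lambda>i. Poly_Mapping.single i 1) ` {..r}" using i s(2) by auto
    qed
qed (auto simp: mons_def)

lemma card_mons_1: "card (mons r 1) = r + 1"
proof -
  have "inj_on (\<lambda>i. Poly_Mapping.single i (1::nat)) {..r}"
    by (rule inj_on_inverseI[where g = "\<lambda>m. the_elem (Poly_Mapping.keys m)"]) simp
  then show ?thesis unfolding mons_1 by (simp add: card_image)
qed

lemma card_mons_P0: "card (mons 0 n) \<le> 1"
proof -
  have "mons 0 n \<subseteq> {Poly_Mapping.single 0 n}"
  proof
    fix m assume m: "m \<in> mons 0 n"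
    then have k: "Poly_Mapping.keys m \<subseteq> {0}" by (auto simp: mons_def)
    then have "mdeg m = Poly_Mapping.lookup m 0" using mdeg_superset[of "{0}" m] by simp
    then have "m = Poly_Mapping.single 0 n" using m k
      by (intro poly_mapping_eqI) (auto simp: lookup_single when_def mons_def in_keys_iff)
    then show "m \<in> {Poly_Mapping.single 0 n}" by simp
  qed
  then show ?thesis using card_mono[of "{Poly_Mapping.single 0 n}"] by simp
qed

text \<open>The exponent vector of \<open>x_0^i * x_1^(r - i)\<close>.\<close>

definition bin :: "nat \<Rightarrow> nat \<Rightarrow> nat \<Rightarrow>\<^sub>0 nat" where
  "bin r i = Poly_Mapping.single 0 i + Poly_Mapping.single 1 (r - i)"

lemma mons_P1: "mons 1 r = bin r ` {..r}" and inj_bin: "inj_on (bin r) {..r}"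
proof
  show "mons 1 r \<subseteq> bin r ` {..r}"
  proof
    fix m assume m: "m \<in> mons 1 r"
    then have k: "Poly_Mapping.keys m \<subseteq> {0, 1}" by (auto simp: mons_def)
    then have "mdeg m = Poly_Mapping.lookup m 0 + Poly_Mapping.lookup m 1" using mdeg_superset[of "{0, 1}" m] by simp
    then have r: "Poly_Mapping.lookup m 0 + Poly_Mapping.lookup m 1 = r" using m by (simp add: mons_def)
    have "m = bin r (Poly_Mapping.lookup m 0)" using r k
      by (intro poly_mapping_eqI) (auto simp: bin_def lookup_add lookup_single when_def in_keys_iff)
    then show "m \<in> bin r ` {..r}" using r by auto
  qed
  show "bin r ` {..r} \<subseteq> mons 1 r" by (auto simp: mons_def bin_def mdeg_add keys_add_nat split: if_splits)
  show "inj_on (bin r) {..r}"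
    by (rule inj_on_inverseI[where g = "\<lambda>m. Poly_Mapping.lookup m 0"]) (simp add: bin_def lookup_add lookup_single)
qed

lemma card_mons_P1: "card (mons 1 r) = r + 1"
  unfolding mons_P1 by (simp add: card_image inj_bin)

text \<open>The component of degree \<open>j\<close>, after all monomials with a variable beyond
  \<open>x_r\<close> have been dropped. The type of polynomials has infinitely many variables; on
  \<open>polyring r\<close> this is the usual component.\<close>

definition hcr :: "nat \<Rightarrow> nat \<Rightarrow> 'k::field mpol \<Rightarrow> 'k mpol" where
  "hcr r j f = (\<Sum>m\<in>Poly_Mapping.keys f \<inter> mons r j. Poly_Mapping.single m (Poly_Mapping.lookup f m))"

lemma lookup_hcr: "Poly_Mapping.lookup (hcr r j f) m = (if m \<in> mons r j then Poly_Mapping.lookup f m else 0)"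
  by (auto simp: hcr_def lookup_sum lookup_single when_def not_in_keys_iff_lookup_eq_zero)

lemma hcr_lin: "mp.lin_endo (hcr r j)"
  unfolding mp.lin_endo_def by (intro conjI allI poly_mapping_eqI) (auto simp: lookup_hcr lookup_add lookup_scalem)

lemmas hcr_simps = mp.lin_endoD[OF hcr_lin]

lemma hcr_forms: "hcr r j f \<in> forms r j"
  by (auto simp: forms_iff in_keys_iff lookup_hcr split: if_splits)

lemma hcr_form: "f \<in> forms r i \<Longrightarrow> hcr r j f = (if i = j then f else 0)"
  by (rule poly_mapping_eqI) (auto simp: lookup_hcr forms_iff in_keys_iff mons_def)

lemma hcr_single: "hcr r j (Poly_Mapping.single m c) = (if m \<in> mons r j then Poly_Mapping.single m c else 0)"
  by (rule poly_mapping_eqI) (auto simp: lookup_hcr lookup_single when_def)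

lemma hcr_single_mult:
  fixes f :: "'k::field mpol"
  assumes "m \<in> mons r e"
  shows "hcr r j (Poly_Mapping.single m c * f) = (if e \<le> j then Poly_Mapping.single m c * hcr r (j - e) f else 0)"
proof (induction f rule: pm_induct)
  case (single m' d)
  then show ?case using mons_cancel[OF assms, of m' j] by (auto simp: mult_single hcr_single)
qed (auto simp: hcr_simps distrib_left)

lemma hcr_bad_mult:
  fixes f :: "'k::field mpol"
  assumes "\<not> Poly_Mapping.keys m \<subseteq> {..r}"
  shows "hcr r j (Poly_Mapping.single m c * f) = 0"
proof (induction f rule: pm_induct)
  case (single m' d)
  have "m + m' \<notin> mons r j" using assms by (auto simp: mons_def keys_add_nat)
  then show ?case by (auto simp: mult_single hcr_single)
qed (auto simp: hcr_simps distrib_left)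

lemma hcr_form_mult:
  assumes "u \<in> forms r e"
  shows "hcr r j (u * f) = (if e \<le> j then u * hcr r (j - e) f else 0)"
proof -
  have u: "u * f = (\<Sum>m\<in>Poly_Mapping.keys u. Poly_Mapping.single m (Poly_Mapping.lookup u m) * f)" for f
    using arg_cong[OF pm_sum_single[of u], of "\<lambda>u. u * f"] by (simp only: sum_distrib_right)
  have k: "m \<in> mons r e" if "m \<in> Poly_Mapping.keys u" for m using assms that by (auto simp: forms_iff)
  show ?thesis
    by (simp add: u[of f] u[of "hcr r (j - e) f"] hcr_simps(6) hcr_single_mult[OF k])
qed

definition dbound :: "'k::field mpol \<Rightarrow> nat" where
  "dbound f = Max (insert 0 (mdeg ` Poly_Mapping.keys f))"

lemma hcr_dbound: "dbound f < j \<Longrightarrow> hcr r j f = 0"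
proof (rule poly_mapping_eqI)
  fix m assume j: "dbound f < j"
  show "Poly_Mapping.lookup (hcr r j f) m = Poly_Mapping.lookup 0 m"
  proof (cases "m \<in> Poly_Mapping.keys f")
    case True
    then have "mdeg m \<le> dbound f" unfolding dbound_def by (intro Max_ge) auto
    then show ?thesis using j by (auto simp: lookup_hcr mons_def)
  qed (auto simp: lookup_hcr not_in_keys_iff_lookup_eq_zero)
qed

lemma hcr_expand:
  assumes "f \<in> carrier (polyring r)" "dbound f \<le> D"
  shows "f = (\<Sum>j\<le>D. hcr r j f)"
proof (rule poly_mapping_eqI)
  fix m
  show "Poly_Mapping.lookup f m = Poly_Mapping.lookup (\<Sum>j\<le>D. hcr r j f) m"
  proof (cases "m \<in> Poly_Mapping.keys f")
    case True
    then have "mdeg m \<le> dbound f" unfolding dbound_def by (intro Max_ge) auto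
    then have d: "mdeg m \<le> D" using assms(2) by simp
    have "Poly_Mapping.lookup (\<Sum>j\<le>D. hcr r j f) m = (\<Sum>j\<le>D. if j = mdeg m then Poly_Mapping.lookup f m else 0)"
      using assms(1) True by (auto simp: lookup_sum lookup_hcr mons_def carrier_polyring intro!: sum.cong)
    then show ?thesis using d by simp
  next
    case False
    then have "Poly_Mapping.lookup f m = 0" by (simp add: not_in_keys_iff_lookup_eq_zero)
    then show ?thesis by (simp add: lookup_sum lookup_hcr cong: if_cong)
  qed
qed

lemma hcr_carrier: "hcr r j f \<in> carrier (polyring r)"
  using hcr_forms forms_carrier by blast

section \<open>The homogeneous coordinate ring and its homogeneous ideals\<close>

lemma polyring_add_closed: "x \<in> carrier (polyring r) \<Longrightarrow> y \<in> carrier (polyring r) \<Longrightarrow> x + y \<in> carrier (polyring r)"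
  using keys_add[of x y] by (auto simp: carrier_polyring)

lemma polyring_mult_closed:
  assumes "x \<in> carrier (polyring r)" "y \<in> carrier (polyring r)"
  shows "x * y \<in> carrier (polyring r)"
  unfolding carrier_polyring
proof
  fix m assume "m \<in> Poly_Mapping.keys (x * y)"
  then obtain a b where "m = a + b" "a \<in> Poly_Mapping.keys x" "b \<in> Poly_Mapping.keys y" using keys_mult[of x y] by blast
  then show "Poly_Mapping.keys m \<subseteq> {..r}" using assms by (auto simp: carrier_polyring keys_add_nat)
qed

lemma polyring_cring: "cring (polyring r :: 'k::field mpol ring)"
proof (rule cringI)
  show "abelian_group (polyring r :: 'k mpol ring)"
  proof (rule abelian_groupI)
    fix x :: "'k mpol" assume x: "x \<in> carrier (polyring r)"
    have "- x \<in> carrier (polyring r)" using x by (simp add: carrier_polyring)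
    then show "\<exists>y\<in>carrier (polyring r). y \<oplus>\<^bsub>polyring r\<^esub> x = \<zero>\<^bsub>polyring r\<^esub>" by force
  qed (auto simp: polyring_add_closed carrier_polyring[of 0] add.assoc add.commute)
  show "comm_monoid (polyring r :: 'k mpol ring)"
    by (rule comm_monoidI) (auto simp: polyring_mult_closed carrier_polyring[of 1] mult.assoc mult.commute)
qed (auto simp: distrib_right)

interpretation PR: cring "polyring r :: 'k::field mpol ring"
  by (rule polyring_cring)

lemma ideal_polyring_iff:
  "ideal I (polyring r) \<longleftrightarrow> I \<subseteq> carrier (polyring r) \<and> 0 \<in> I \<and> (\<forall>x\<in>I. \<forall>y\<in>I. x + y \<in> I) \<and>
     (\<forall>x\<in>I. \<forall>a\<in>carrier (polyring r). a * x \<in> I)"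
proof
  assume id: "ideal I (polyring r)"
  have sg: "additive_subgroup I (polyring r)" by (rule ideal.axioms(1)[OF id])
  show "I \<subseteq> carrier (polyring r) \<and> 0 \<in> I \<and> (\<forall>x\<in>I. \<forall>y\<in>I. x + y \<in> I) \<and> (\<forall>x\<in>I. \<forall>a\<in>carrier (polyring r). a * x \<in> I)"
  proof (intro conjI ballI)
    show "I \<subseteq> carrier (polyring r)" using additive_subgroup.a_Hcarr[OF sg] by (rule subsetI)
    show "0 \<in> I" using additive_subgroup.zero_closed[OF sg] by (simp only: polyring_simps)
    fix x assume x: "x \<in> I"
    show "x + y \<in> I" if "y \<in> I" for y
      using additive_subgroup.a_closed[OF sg x that] by (simp only: polyring_simps)
    show "a * x \<in> I" if "a \<in> carrier (polyring r)" for a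
      using ideal.I_l_closed[OF id x that] by (simp only: polyring_simps)
  qed
next
  assume I: "I \<subseteq> carrier (polyring r) \<and> 0 \<in> I \<and> (\<forall>x\<in>I. \<forall>y\<in>I. x + y \<in> I) \<and> (\<forall>x\<in>I. \<forall>a\<in>carrier (polyring r). a * x \<in> I)"
  show "ideal I (polyring r)"
  proof (rule idealI)
    show "ring (polyring r)" by (rule PR.ring_axioms)
    show "subgroup I (add_monoid (polyring r))"
    proof (rule PR.add.subgroupI)
      show "I \<noteq> {}" "I \<subseteq> carrier (polyring r)" using I by auto
      fix x assume x: "x \<in> I"
      then have xc: "x \<in> carrier (polyring r)" using I by auto
      have mx: "- x \<in> carrier (polyring r)" using xc by (simp add: carrier_polyring)
      have "\<ominus>\<^bsub>polyring r\<^esub> x = - x" by (rule PR.minus_equality[OF _ xc mx]) simp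
      moreover have "- 1 \<in> carrier (polyring r)" by (simp add: carrier_polyring)
      then have "- 1 * x \<in> I" using I x by blast
      ultimately show "\<ominus>\<^bsub>polyring r\<^esub> x \<in> I" by simp
    next
      show "x \<oplus>\<^bsub>polyring r\<^esub> y \<in> I" if "x \<in> I" "y \<in> I" for x y using I that by (simp only: polyring_simps)
    qed
    have xa: "x * a \<in> I" if "a \<in> I" "x \<in> carrier (polyring r)" for a x using I that by blast
    show "x \<otimes>\<^bsub>polyring r\<^esub> a \<in> I" "a \<otimes>\<^bsub>polyring r\<^esub> x \<in> I" if "a \<in> I" "x \<in> carrier (polyring r)" for a x
      using xa[OF that] by (simp_all only: polyring_simps mult.commute[of a x])
  qed
qed

lemma ideal_polyringD:
  assumes "ideal I (polyring r)"
  shows "I \<subseteq> carrier (polyring r)" "0 \<in> I" "x \<in> I \<Longrightarrow> y \<in> I \<Longrightarrow> x + y \<in> I" "x \<in> I \<Longrightarrow> a \<in> carrier (polyring r) \<Longrightarrow> a * x \<in> I"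
    "x \<in> I \<Longrightarrow> y \<in> I \<Longrightarrow> x - y \<in> I" "(\<And>i. i \<in> A \<Longrightarrow> f i \<in> I) \<Longrightarrow> sum f A \<in> I" "x \<in> I \<Longrightarrow> scalem c x \<in> I"
proof -
  show 1: "I \<subseteq> carrier (polyring r)" "0 \<in> I" using assms by (auto simp: ideal_polyring_iff)
  show 2: "x + y \<in> I" if "x \<in> I" "y \<in> I" for x y using assms that by (auto simp: ideal_polyring_iff)
  show 3: "a * x \<in> I" if "x \<in> I" "a \<in> carrier (polyring r)" for a x using assms that by (auto simp: ideal_polyring_iff)
  have "- 1 \<in> carrier (polyring r)" by (simp add: carrier_polyring)
  then show "x - y \<in> I" if "x \<in> I" "y \<in> I" using 2[OF that(1) 3[OF that(2)]] by force
  show "sum f A \<in> I" if "\<And>i. i \<in> A \<Longrightarrow> f i \<in> I" using that by (induction A rule: infinite_finite_induct) (auto simp: 1 2)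
  show "scalem c x \<in> I" if "x \<in> I" unfolding scalem_def by (rule 3[OF that]) (simp add: carrier_polyring)
qed

text \<open>The factor \<open>a\<close> may contain any variables, but only its monomials in
  \<open>x_0, ..., x_r\<close> contribute to components of the product. Asking stability of
  \<open>J\<close> under those alone covers ideals of \<open>polyring r\<close> as well as ideals of
  the full polynomial ring.\<close>

lemma hcr_mult_mem:
  fixes x :: "'k::field mpol"
  assumes J: "0 \<in> J" "\<And>x y. x \<in> J \<Longrightarrow> y \<in> J \<Longrightarrow> x + y \<in> J"
      "\<And>m c y. Poly_Mapping.keys m \<subseteq> {..r} \<Longrightarrow> y \<in> J \<Longrightarrow> Poly_Mapping.single m c * y \<in> J"
    and x: "\<And>j. hcr r j x \<in> J"
  shows "hcr r j (a * x) \<in> J"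
proof (induction a rule: pm_induct)
  case (single m c)
  show ?case
  proof (cases "Poly_Mapping.keys m \<subseteq> {..r}")
    case True
    then have m: "m \<in> mons r (mdeg m)" by (simp add: mons_def)
    show ?thesis using J(1) J(3)[OF True x, of c "j - mdeg m"] by (simp add: hcr_single_mult[OF m])
  next
    case False then show ?thesis using J(1) by (simp add: hcr_bad_mult)
  qed
next
  case zero show ?case using J(1) by (simp add: hcr_simps(3))
next
  case (add p q) then show ?case using J(2) by (simp add: hcr_simps(1) distrib_right)
qed

lemma hcr_mult_ideal:
  fixes x :: "'k::field mpol"
  assumes I: "ideal I (polyring r)" and x: "\<And>j. hcr r j x \<in> I"
  shows "hcr r j (a * x) \<in> I"
  by (rule hcr_mult_mem[OF ideal_polyringD(2,3)[OF I] _ x])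
    (assumption+, rule ideal_polyringD(4)[OF I], assumption, simp add: carrier_polyring)

lemma hcr_mult_closed:
  fixes x :: "'k::field mpol"
  assumes K: "mp.tideal K" and x: "\<And>j. hcr r j x \<in> K"
  shows "hcr r j (a * x) \<in> K"
  by (rule hcr_mult_mem[OF mp.tidealD(1,2)[OF K] _ x]) (assumption+, rule mp.tidealD(3)[OF K])

text \<open>The polynomials with all components in \<open>I\<close> form an ideal, which contains
  the homogeneous generators of \<open>I\<close>.\<close>

lemma homogeneous_ideal_iff:
  "homogeneous_ideal r I \<longleftrightarrow> ideal I (polyring r) \<and> (\<forall>f\<in>I. \<forall>j. hcr r j f \<in> I)"
proof
  assume h: "homogeneous_ideal r I"
  let ?F = "{f \<in> I. \<exists>n. f \<in> forms r n}" let ?H = "{f \<in> carrier (polyring r). \<forall>j. hcr r j f \<in> I}"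
  have I: "ideal I (polyring r)" "I = genideal (polyring r) ?F" using h by (auto simp: homogeneous_ideal_def)
  have "ideal ?H (polyring r)"
    unfolding ideal_polyring_iff
  proof (intro conjI ballI)
    show "0 \<in> ?H" using ideal_polyringD(2)[OF I(1)] by (simp add: hcr_simps(3) carrier_polyring)
    fix x assume x: "x \<in> ?H"
    show "x + y \<in> ?H" if "y \<in> ?H" for y
      using x that ideal_polyringD(3)[OF I(1)] polyring_add_closed[of x r y] by (simp add: hcr_simps(1))
    show "a * x \<in> ?H" if "a \<in> carrier (polyring r)" for a
      using x that hcr_mult_ideal[OF I(1)] polyring_mult_closed[of a r x] by simp
  qed blast
  moreover have "?F \<subseteq> ?H"
  proof
    fix f assume "f \<in> ?F"
    then obtain n where "f \<in> I" "f \<in> forms r n" by blast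
    then show "f \<in> ?H" using ideal_polyringD(2)[OF I(1)] forms_carrier by (auto simp: hcr_form)
  qed
  ultimately have "genideal (polyring r) ?F \<subseteq> ?H" by (rule PR.genideal_minimal)
  then have "I \<subseteq> ?H" using I(2) by blast
  then show "ideal I (polyring r) \<and> (\<forall>f\<in>I. \<forall>j. hcr r j f \<in> I)" using I by auto
next
  assume h: "ideal I (polyring r) \<and> (\<forall>f\<in>I. \<forall>j. hcr r j f \<in> I)"
  let ?F = "{f \<in> I. \<exists>n. f \<in> forms r n}"
  have F: "?F \<subseteq> carrier (polyring r)" using forms_carrier by auto
  have "genideal (polyring r) ?F \<subseteq> I" using h by (intro PR.genideal_minimal) auto
  moreover have "I \<subseteq> genideal (polyring r) ?F"
  proof
    fix f assume f: "f \<in> I"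
    have G: "ideal (genideal (polyring r) ?F) (polyring r)" by (rule PR.genideal_ideal[OF F])
    have "hcr r j f \<in> genideal (polyring r) ?F" for j
      using PR.genideal_self[OF F] h f hcr_forms by blast
    then have "(\<Sum>j\<le>dbound f. hcr r j f) \<in> genideal (polyring r) ?F" by (intro ideal_polyringD(6)[OF G])
    moreover have "f = (\<Sum>j\<le>dbound f. hcr r j f)" using f h by (intro hcr_expand) (auto simp: ideal_polyring_iff)
    ultimately show "f \<in> genideal (polyring r) ?F" by simp
  qed
  ultimately show "homogeneous_ideal r I" using h by (auto simp: homogeneous_ideal_def)
qed

section \<open>Base change to the algebraic closure\<close>

interpretation kv: vspace "\<lambda>(c::'k::field) (x::'k alg_closure). to_ac c * x"
  by unfold_locales (auto simp: algebra_simps)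

abbreviation klin :: "('k::field alg_closure \<Rightarrow> 'k) \<Rightarrow> bool" where "klin \<equiv> kv.lin_fun"

definition cm :: "('k::field alg_closure \<Rightarrow> 'k) \<Rightarrow> 'k alg_closure mpol \<Rightarrow> 'k mpol" where
  "cm l f = Poly_Mapping.map l f"

definition up :: "'k::field mpol \<Rightarrow> 'k alg_closure mpol" where
  "up f = Poly_Mapping.map to_ac f"

text \<open>For a subspace \<open>J\<close>, its extension of scalars to the algebraic closure: by
  \<open>cm_expand\<close> the elements are combinations of polynomials from \<open>J\<close>. In
  this form membership is a condition over \<open>k\<close>.\<close>

definition ext :: "'k::field mpol set \<Rightarrow> 'k alg_closure mpol set" where
  "ext J = {f. \<forall>l. klin l \<longrightarrow> cm l f \<in> J}"

lemma lookup_cm: "klin l \<Longrightarrow> Poly_Mapping.lookup (cm l f) m = l (Poly_Mapping.lookup f m)"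
  by (auto simp: cm_def Poly_Mapping.map.rep_eq when_def kv.lin_funD(3))

lemma lookup_up: "Poly_Mapping.lookup (up f) m = to_ac (Poly_Mapping.lookup f m)"
  by (auto simp: up_def Poly_Mapping.map.rep_eq when_def)

lemma klin_mult: "klin l \<Longrightarrow> klin (\<lambda>x. l (c * x))"
  by (auto simp: kv.lin_fun_def distrib_left) (metis mult.left_commute)

lemma cm_add: "klin l \<Longrightarrow> cm l (f + g) = cm l f + cm l g"
  by (rule poly_mapping_eqI) (simp add: lookup_cm lookup_add kv.lin_funD(1))

lemma cm_0: "klin l \<Longrightarrow> cm l 0 = 0"
  by (rule poly_mapping_eqI) (simp add: lookup_cm kv.lin_funD(3))

lemma cm_sum: "klin l \<Longrightarrow> cm l (sum f A) = (\<Sum>a\<in>A. cm l (f a))"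
  by (induction A rule: infinite_finite_induct) (auto simp: cm_0 cm_add)

lemma cm_scalem: "klin l \<Longrightarrow> cm l (scalem c f) = cm (\<lambda>x. l (c * x)) f"
  by (rule poly_mapping_eqI) (simp add: lookup_cm klin_mult lookup_scalem)

lemma cm_up: "klin l \<Longrightarrow> cm l (up f) = scalem (l 1) f"
proof (rule poly_mapping_eqI)
  fix m assume l: "klin l"
  show "Poly_Mapping.lookup (cm l (up f)) m = Poly_Mapping.lookup (scalem (l 1) f) m"
    using kv.lin_funD(2)[OF l, of _ 1] by (simp add: lookup_cm[OF l] lookup_up lookup_scalem mult.commute)
qed

lemma cm_scalem_up: "klin l \<Longrightarrow> cm l (scalem c (up f)) = scalem (l c) f"
  by (simp add: cm_scalem cm_up klin_mult)

lemma up_0: "up 0 = 0" by (rule poly_mapping_eqI) (simp add: lookup_up)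
lemma up_add: "up (f + g) = up f + up g" by (rule poly_mapping_eqI) (simp add: lookup_up lookup_add)
lemma up_diff: "up (f - g) = up f - up g" by (rule poly_mapping_eqI) (simp add: lookup_up lookup_minus)
lemma up_scalem: "up (scalem c f) = scalem (to_ac c) (up f)" by (rule poly_mapping_eqI) (simp add: lookup_up lookup_scalem)
lemma up_sum: "up (sum f A) = (\<Sum>a\<in>A. up (f a))"
  by (induction A rule: infinite_finite_induct) (auto simp: up_0 up_add)
lemma up_single: "up (Poly_Mapping.single m c) = Poly_Mapping.single m (to_ac c)"
  by (rule poly_mapping_eqI) (simp add: lookup_up lookup_single when_def)
lemma up_1: "up 1 = 1" using up_single[of 0 1] by simp
lemma up_inj: "up f = up g \<Longrightarrow> f = g"
  by (rule poly_mapping_eqI) (metis lookup_up to_ac_eq_iff)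

lemma up_mult: "up (f * g) = up f * up g"
proof (induction f rule: pm_induct)
  case (single m c)
  show ?case
  proof (induction g rule: pm_induct)
    case (single m' c') then show ?case by (simp add: mult_single up_single)
  qed (auto simp: up_0 up_add distrib_left)
qed (auto simp: up_0 up_add distrib_right)

lemma up_power: "up (f ^ n) = up f ^ n"
  by (induction n) (auto simp: up_1 up_mult)

lemma klin_separates:
  assumes "x \<noteq> 0"
  obtains l where "klin l" "l x = 1"
proof -
  have "kv.subspace {0}" by (rule kv.subspaceI) auto
  moreover have "x \<notin> {0}" using assms by simp
  ultimately obtain w where "klin w" "w x = 1" by (rule kv.ex_lin_fun)
  then show thesis using that by blast
qed

text \<open>A basis of the closure over \<open>k\<close> is fixed. Only finitely many basis elements
  \<open>b\<close> occur in the coefficients of \<open>f\<close>, and \<open>\<Lambda> b\<close> is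
  the coordinate at \<open>b\<close>.\<close>

lemma cm_expand:
  fixes f :: "'k::field alg_closure mpol"
  obtains S \<Lambda> where "finite S" "\<And>b. klin (\<Lambda> b)" "f = (\<Sum>b\<in>S. scalem b (up (cm (\<Lambda> b) f)))"
proof -
  define B where "B = kv.extend_basis ({} :: 'k alg_closure set)"
  have B: "kv.independent B" "kv.span B = UNIV"
    using kv.independent_extend_basis[OF kv.independent_empty] kv.span_extend_basis[OF kv.independent_empty] by (auto simp: B_def)
  define \<Lambda> where "\<Lambda> b x = kv.representation B x b" for b x
  have kl: "klin (\<Lambda> b)" for b
    unfolding kv.lin_fun_def \<Lambda>_def using B by (auto simp: kv.representation_add kv.representation_scale)
  define S where "S = (\<Union>m\<in>Poly_Mapping.keys f. {b. \<Lambda> b (Poly_Mapping.lookup f m) \<noteq> 0})"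
  have fS: "finite S" unfolding S_def \<Lambda>_def by (auto intro: kv.finite_representation)
  have "f = (\<Sum>b\<in>S. scalem b (up (cm (\<Lambda> b) f)))"
  proof (rule poly_mapping_eqI)
    fix m
    let ?x = "Poly_Mapping.lookup f m"
    have "Poly_Mapping.lookup (\<Sum>b\<in>S. scalem b (up (cm (\<Lambda> b) f))) m = (\<Sum>b\<in>S. to_ac (\<Lambda> b ?x) * b)"
      by (simp add: lookup_sum lookup_scalem lookup_up lookup_cm[OF kl] mult.commute)
    also have "\<dots> = (\<Sum>b | \<Lambda> b ?x \<noteq> 0. to_ac (\<Lambda> b ?x) * b)"
    proof (cases "m \<in> Poly_Mapping.keys f")
      case True
      then show ?thesis using fS by (intro sum.mono_neutral_right) (auto simp: S_def)
    next
      case False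
      then have "?x = 0" by (simp add: not_in_keys_iff_lookup_eq_zero)
      then show ?thesis by (simp add: kv.lin_funD(3)[OF kl])
    qed
    also have "\<dots> = ?x" unfolding \<Lambda>_def using B by (intro kv.sum_nonzero_representation_eq) auto
    finally show "?x = Poly_Mapping.lookup (\<Sum>b\<in>S. scalem b (up (cm (\<Lambda> b) f))) m" by simp
  qed
  then show thesis using that[of S \<Lambda>] fS kl by blast
qed

lemma up_sum_product:
  "(\<Sum>b\<in>S. scalem b (up (F b))) * (\<Sum>b'\<in>S'. scalem b' (up (G b'))) = (\<Sum>b\<in>S. \<Sum>b'\<in>S'. scalem (b * b') (up (F b * G b')))"
  unfolding sum_product
  by (intro sum.cong refl) (simp only: mp.scale_mult, simp only: mp.mult_scale mpol.scale_scale up_mult)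

lemma ext_mono: "J \<subseteq> J' \<Longrightarrow> ext J \<subseteq> ext J'" by (auto simp: ext_def)

lemma ext_subspace:
  assumes "mpol.subspace J"
  shows "mpol.subspace (ext J)"
proof (rule mpol.subspaceI)
  show "0 \<in> ext J" using mpol.subspace_0[OF assms] by (simp add: ext_def cm_0)
  show "x + y \<in> ext J" if "x \<in> ext J" "y \<in> ext J" for x y
    using that mpol.subspace_add[OF assms] by (auto simp: ext_def cm_add)
  show "scalem c x \<in> ext J" if "x \<in> ext J" for c x
    using that klin_mult by (auto simp: ext_def cm_scalem)
qed

lemma ext_up:
  assumes "mpol.subspace J"
  shows "up f \<in> ext J \<longleftrightarrow> f \<in> J"
proof
  assume f: "up f \<in> ext J"
  obtain l where l: "klin (l :: 'a alg_closure \<Rightarrow> 'a)" "l 1 = 1" using klin_separates[of 1] by auto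
  have "cm l (up f) \<in> J" using f l(1) unfolding ext_def by blast
  then show "f \<in> J" using l by (simp add: cm_up)
next
  assume "f \<in> J" then show "up f \<in> ext J" using mpol.subspace_scale[OF assms] by (simp add: ext_def cm_up)
qed

text \<open>Expanding both factors leaves products of polynomials over \<open>k\<close>, with
  products of basis elements as scalars.\<close>

lemma ext_mult:
  assumes "f \<in> ext J1" "g \<in> ext J2" "mp.tideal H" "\<And>a b. a \<in> J1 \<Longrightarrow> b \<in> J2 \<Longrightarrow> a * b \<in> H"
  shows "f * g \<in> ext H"
proof -
  obtain S \<Lambda> where S: "finite S" "\<And>b. klin (\<Lambda> b)" "f = (\<Sum>b\<in>S. scalem b (up (cm (\<Lambda> b) f)))" by (rule cm_expand[of f]) (rule that, assumption+)
  obtain S' \<Lambda>' where S': "finite S'" "\<And>b. klin (\<Lambda>' b)" "g = (\<Sum>b\<in>S'. scalem b (up (cm (\<Lambda>' b) g)))" by (rule cm_expand[of g]) (rule that, assumption+)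
  have "f * g = (\<Sum>b\<in>S. scalem b (up (cm (\<Lambda> b) f))) * (\<Sum>b\<in>S'. scalem b (up (cm (\<Lambda>' b) g)))"
    using S(3) S'(3) by simp
  also have "\<dots> = (\<Sum>b\<in>S. \<Sum>b'\<in>S'. scalem (b * b') (up (cm (\<Lambda> b) f * cm (\<Lambda>' b') g)))"
    by (rule up_sum_product)
  finally have fg: "f * g = (\<Sum>b\<in>S. \<Sum>b'\<in>S'. scalem (b * b') (up (cm (\<Lambda> b) f * cm (\<Lambda>' b') g)))" .
  have "cm l (f * g) \<in> H" if l: "klin l" for l
  proof -
    have "cm l (f * g) = (\<Sum>b\<in>S. \<Sum>b'\<in>S'. scalem (l (b * b')) (cm (\<Lambda> b) f * cm (\<Lambda>' b') g))"
      unfolding fg by (simp add: cm_sum[OF l] cm_scalem_up[OF l])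
    also have "\<dots> \<in> H"
    proof (intro mp.tidealD(8)[OF assms(3)] mp.tidealD(7)[OF assms(3)] assms(4))
      show "cm (\<Lambda> b) f \<in> J1" "cm (\<Lambda>' b') g \<in> J2" for b b' using assms(1,2) S(2) S'(2) by (auto simp: ext_def)
    qed
    finally show ?thesis .
  qed
  then show ?thesis by (simp add: ext_def)
qed

lemma ext_UNIV: "ext UNIV = UNIV" by (simp add: ext_def)

lemma ext_tideal:
  assumes "mp.tideal J"
  shows "mp.tideal (ext J)"
  unfolding mp.tideal_def
proof (intro conjI ballI allI)
  have s: "mpol.subspace (ext J)" by (rule ext_subspace[OF mp.tideal_subspace[OF assms]])
  show "0 \<in> ext J" by (rule mpol.subspace_0[OF s])
  fix x assume x: "x \<in> ext J"
  show "x + y \<in> ext J" if "y \<in> ext J" for y by (rule mpol.subspace_add[OF s x that])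
  show "a * x \<in> ext J" for a
    by (rule ext_mult[of a UNIV x J J, OF _ x assms]) (auto simp: ext_UNIV mp.tidealD[OF assms])
qed

text \<open>A basis \<open>E\<close> of a complement of \<open>J\<close> stays one over the closure.
  If a combination lay in \<open>ext J\<close> with \<open>c e \<noteq> 0\<close>, a functional
  \<open>l\<close> with \<open>l (c e) = 1\<close> would turn it into a nontrivial combination over
  \<open>k\<close> in \<open>J\<close>.\<close>

lemma ext_codim:
  assumes "mp.fcod J"
  shows "mp.fcod (ext J)" "mp.codim (ext J) = mp.codim J"
proof -
  obtain T where T: "mp.fdim T" "mp.is_compl T J" "mpol.subspace J" "mpol.dim T = mp.codim J" using mp.fcodE[OF assms] .
  obtain E where E: "E \<subseteq> T" "finite E" "mpol.independent E" "mpol.span E = T" "card E = mpol.dim T" using mp.fdim_basis[OF T(1)] .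
  have sE: "mpol.subspace (ext J)" by (rule ext_subspace[OF T(3)])
  let ?T = "mpol.span (up ` E)"
  have key: "c e = 0" if c: "(\<Sum>e\<in>E. scalem (c e) (up e)) \<in> ext J" and e: "e \<in> E" for c e
  proof (rule ccontr)
    assume "c e \<noteq> 0"
    then obtain l where l: "klin l" "l (c e) = 1" by (rule klin_separates)
    have "cm l (\<Sum>e\<in>E. scalem (c e) (up e)) = (\<Sum>e\<in>E. scalem (l (c e)) e)"
      by (simp add: cm_sum[OF l(1)] cm_scalem_up[OF l(1)])
    then have "(\<Sum>e\<in>E. scalem (l (c e)) e) \<in> J" using c l(1) by (auto simp: ext_def)
    moreover have "(\<Sum>e\<in>E. scalem (l (c e)) e) \<in> T"
      using E(1) mp.fdim_subspace[OF T(1)] by (intro mpol.subspace_sum mpol.subspace_scale) auto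
    ultimately have "(\<Sum>e\<in>E. scalem (l (c e)) e) = 0" using T(2) by (auto simp: mp.is_compl_def)
    then have "l (c e) = 0" using mpol.independentD[OF E(3,2) subset_refl, of "\<lambda>e. l (c e)"] e by blast
    then show False using l(2) by simp
  qed
  have inj: "inj_on up E" using up_inj by (auto intro: inj_onI)
  have ind: "mpol.independent (up ` E)"
  proof (rule mpol.independent_if_scalars_zero)
    show "finite (up ` E)" using E(2) by simp
    fix g x assume g: "(\<Sum>x\<in>up ` E. scalem (g x) x) = 0" "x \<in> up ` E"
    then obtain e where e: "x = up e" "e \<in> E" by auto
    have "(\<Sum>e\<in>E. scalem (g (up e)) (up e)) = 0" using g(1) by (simp add: sum.reindex[OF inj])
    then have "(\<Sum>e\<in>E. scalem (g (up e)) (up e)) \<in> ext J" using mpol.subspace_0[OF sE] by simp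
    then show "g x = 0" using key e by metis
  qed
  have fT: "mp.fdim ?T" unfolding mp.fdim_def using E(2) by (auto intro!: exI[of _ "up ` E"])
  have cT: "mp.is_compl ?T (ext J)"
    unfolding mp.is_compl_def
  proof (intro conjI allI subsetI)
    show "mpol.subspace ?T" by simp
    fix x assume x: "x \<in> ?T \<inter> ext J"
    then obtain g where g: "x = (\<Sum>y\<in>up ` E. scalem (g y) y)" using mpol.span_finite[of "up ` E"] E(2) by auto
    then have "x = (\<Sum>e\<in>E. scalem (g (up e)) (up e))" by (simp add: sum.reindex[OF inj])
    moreover from this have "\<And>e. e \<in> E \<Longrightarrow> g (up e) = 0" using key[of "\<lambda>e. g (up e)"] x by simp
    ultimately show "x \<in> {0}" by simp
  next
    fix x :: "'a alg_closure mpol"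
    obtain S \<Lambda> where S: "finite S" "\<And>b. klin (\<Lambda> b)" "x = (\<Sum>b\<in>S. scalem b (up (cm (\<Lambda> b) x)))" by (rule cm_expand[of x]) (rule that, assumption+)
    have "\<exists>t. \<forall>b. t b \<in> T \<and> cm (\<Lambda> b) x - t b \<in> J" using T(2) unfolding mp.is_compl_def by (intro choice) blast
    then obtain t where t: "\<And>b. t b \<in> T" "\<And>b. cm (\<Lambda> b) x - t b \<in> J" by blast
    have upT: "up y \<in> ?T" if "y \<in> T" for y
    proof -
      obtain g where "y = (\<Sum>e\<in>E. scalem (g e) e)" using \<open>y \<in> T\<close> mpol.span_finite[OF E(2)] E(4) by auto
      then have "up y = (\<Sum>e\<in>E. scalem (to_ac (g e)) (up e))" by (simp add: up_sum up_scalem)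
      also have "\<dots> \<in> ?T" by (intro mpol.span_sum mpol.span_scale mpol.span_base imageI)
      finally show ?thesis .
    qed
    let ?s = "\<Sum>b\<in>S. scalem b (up (t b))"
    have "?s \<in> ?T" using upT[OF t(1)] by (intro mpol.span_sum mpol.span_scale)
    moreover have "x - ?s = (\<Sum>b\<in>S. scalem b (up (cm (\<Lambda> b) x - t b)))"
      by (subst (1) S(3)) (simp add: up_diff mpol.scale_right_diff_distrib sum_subtractf)
    then have "x - ?s \<in> ext J"
      using t(2) ext_up[OF T(3)] by (auto intro!: mpol.subspace_sum[OF sE] mpol.subspace_scale[OF sE])
    ultimately show "\<exists>t\<in>?T. x - t \<in> ext J" by blast
  qed
  show "mp.fcod (ext J)" using fT cT sE by (auto simp: mp.fcod_def)
  have "mpol.dim ?T = card (up ` E)" by (rule mpol.dim_span_eq_card_independent[OF ind])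
  then show "mp.codim (ext J) = mp.codim J" using mp.codim_eq[OF fT cT sE] E(5) T(4) card_image[OF inj] by simp
qed

lemma ext_proper: "mpol.subspace J \<Longrightarrow> ext J = UNIV \<Longrightarrow> J = UNIV"
  using ext_up by blast

text \<open>
  Principality of an ideal does not descend from the algebraic closure, but the bounds on codimensions
  that it implies do.
\<close>

lemma descend_principal:
  fixes \<aa> :: "'k::field mpol set"
  assumes a: "mp.fcod \<aa>" "mp.tideal \<aa>"
    and pr: "\<And>M. mp.maxi M \<Longrightarrow> ext \<aa> \<subseteq> M \<Longrightarrow> \<exists>x. M = mp.prin x (ext \<aa>)"
    and m: "mp.maxi m" "\<aa> \<subseteq> m"
  shows "\<exists>x\<in>m. m = mp.prin x (mp.loc \<aa> m)"
    and "mp.codim \<aa> \<le> mp.codim m + mp.codim {x. \<forall>z\<in>m. x * z \<in> \<aa>}"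
proof -
  have mt: "mp.tideal m" by (rule mp.maxi_tideal[OF m(1)])
  have fm: "mp.fcod m" by (rule mp.fcod_tideal[OF a(1) m(2) mt])
  have ea: "mp.fcod (ext \<aa>)" "mp.tideal (ext \<aa>)" using ext_codim(1)[OF a(1)] ext_tideal[OF a(2)] by auto
  have em: "mp.tideal (ext m)" "ext \<aa> \<subseteq> ext m" "mp.fcod (ext m)" "mp.codim (ext m) = mp.codim m"
    using ext_tideal[OF mt] ext_mono[OF m(2)] ext_codim[OF fm] by auto
  obtain y where y: "ext m = mp.prin y (ext \<aa>)"
    using mp.all_ideals_principal[OF ea pr em(1,2)] by blast
  have ym: "y \<in> ext m" using y mp.prin_self[OF ea(2)] by blast
  let ?S = "mp.msq m \<aa>"
  have S: "mp.tideal ?S" "mp.fcod ?S" "?S \<subseteq> m" "\<aa> \<subseteq> ?S"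
    by (rule mp.tideal_msq, rule mp.fcod_tideal[OF a(1) mp.msq_superset mp.tideal_msq],
      rule mp.msq_least[OF mt m(2) mp.tidealD(3)[OF mt]], assumption, rule mp.msq_superset)
  have eS: "mp.tideal (ext ?S)" "mp.fcod (ext ?S)" "mp.codim (ext ?S) = mp.codim ?S"
    using ext_tideal[OF S(1)] ext_codim[OF S(2)] by auto
  \<comment> \<open>Both \<open>(y) + ext ?S\<close> and \<open>(ext ?S : y)\<close> contain
    \<open>ext m\<close>. So the codimension of \<open>?S\<close> is at most twice that of
    \<open>m\<close>, a statement that no longer refers to the closure.\<close>
  have "ext m \<subseteq> mp.quo (ext ?S) y"
  proof
    fix f assume "f \<in> ext m"
    then have "y * f \<in> ext ?S" using ext_mult[OF ym _ S(1)] mp.msq_mem by blast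
    then show "f \<in> mp.quo (ext ?S) y" by (simp add: mp.quo_def)
  qed
  then have 1: "mp.codim (mp.quo (ext ?S) y) \<le> mp.codim m"
    using mp.codim_mono[OF em(3) _ mp.tideal_subspace[OF mp.tideal_quo[OF eS(1)]]] em(4) by simp
  have "ext m \<subseteq> mp.prin y (ext ?S)" unfolding y
    by (rule mp.prin_least[OF mp.tideal_prin[OF eS(1)] subset_trans[OF ext_mono[OF S(4)] mp.prin_superset] mp.prin_self[OF eS(1)]])
  then have 2: "mp.codim (mp.prin y (ext ?S)) \<le> mp.codim m"
    using mp.codim_mono[OF em(3) _ mp.tideal_subspace[OF mp.tideal_prin[OF eS(1)]]] em(4) by simp
  have c2: "mp.codim ?S \<le> 2 * mp.codim m" using mp.codim_quo_prin(3)[OF eS(2,1), of y] 1 2 eS(3) by simp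
  obtain x where x: "x \<in> m" "m \<subseteq> mp.prin x ?S"
  proof (cases "m = ?S")
    case True then show thesis using that[of 0] mp.prin_superset[of ?S 0] mp.tidealD(1)[OF mt] by auto
  next
    case False
    \<comment> \<open>Over \<open>k\<close> any such \<open>x\<close> generates: its annihilator
      modulo \<open>?S\<close> is \<open>m\<close>, so its submodule has the dimension of the
      residue field, which is already the maximal dimension of \<open>m\<close> modulo
      \<open>?S\<close>.\<close>
    then obtain x where x: "x \<in> m" "x \<notin> ?S" using S(3) by blast
    have "m \<subseteq> mp.quo ?S x" using mp.msq_mem[OF x(1)] by (auto simp: mp.quo_def)
    then have "mp.quo ?S x = m" using x(2) by (intro mp.maxi_subset_eq[OF m(1) mp.tideal_quo[OF S(1)]]) (auto simp: mp.quo_def)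
    then have "mp.codim (mp.prin x ?S) \<le> mp.codim m" using mp.codim_quo_prin(3)[OF S(2,1), of x] c2 by simp
    then have "mp.prin x ?S = m"
      using mp.codim_eq_imp_eq[OF mp.codim_quo_prin(2)[OF S(2,1)] mp.prin_least[OF mt S(3) x(1)] mp.tideal_subspace[OF mt]] by blast
    then show thesis using that x by blast
  qed
  have "m = mp.prin x (mp.loc \<aa> m)" by (rule mp.nakayama[OF a m x])
  then show "\<exists>x\<in>m. m = mp.prin x (mp.loc \<aa> m)" using x(1) by blast
  \<comment> \<open>This is the socle at \<open>m\<close>, modulo \<open>\<aa>\<close>. As
    \<open>y\<close> lies in \<open>ext m\<close>, the extension of the socle lies in
    \<open>(ext \<aa> : y)\<close>, and the codimension of the latter is
    \<open>codim \<aa> - codim m\<close> because \<open>y\<close> generates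
    \<open>ext m\<close>.\<close>
  let ?A = "{x. \<forall>z\<in>m. x * z \<in> \<aa>}"
  have A: "mp.tideal ?A" unfolding mp.tideal_def by (auto simp: distrib_right mult.assoc mp.tidealD[OF a(2)])
  have aA: "\<aa> \<subseteq> ?A" by (auto simp: mp.tidealD[OF a(2)])
  have fA: "mp.fcod ?A" by (rule mp.fcod_tideal[OF a(1) aA A])
  have "ext ?A \<subseteq> mp.quo (ext \<aa>) y"
  proof
    fix f assume "f \<in> ext ?A"
    then have "f * y \<in> ext \<aa>" using ext_mult[OF _ ym a(2)] by blast
    then show "f \<in> mp.quo (ext \<aa>) y" by (simp add: mp.quo_def mult.commute)
  qed
  then have "mp.codim (mp.quo (ext \<aa>) y) \<le> mp.codim ?A"
    using mp.codim_mono[OF ext_codim(1)[OF fA] _ mp.tideal_subspace[OF mp.tideal_quo[OF ea(2)]]] ext_codim(2)[OF fA] by simp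
  moreover have "mp.codim (mp.prin y (ext \<aa>)) = mp.codim m" using y em(4) by simp
  ultimately show "mp.codim \<aa> \<le> mp.codim m + mp.codim ?A"
    using mp.codim_quo_prin(3)[OF ea, of y] ext_codim(2)[OF a(1)] by simp
qed

section \<open>Base change of forms and of homogeneous ideals\<close>

lemma cm_hcr: "klin l \<Longrightarrow> cm l (hcr r j f) = hcr r j (cm l f)"
  by (rule poly_mapping_eqI) (auto simp: lookup_cm lookup_hcr kv.lin_funD(3))

lemma keys_cm: "klin l \<Longrightarrow> Poly_Mapping.keys (cm l f) \<subseteq> Poly_Mapping.keys f"
proof
  fix m assume l: "klin l" and m: "m \<in> Poly_Mapping.keys (cm l f)"
  then have "l (Poly_Mapping.lookup f m) \<noteq> 0" by (simp add: in_keys_iff lookup_cm)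
  then have "Poly_Mapping.lookup f m \<noteq> 0" using kv.lin_funD(3)[OF l] by auto
  then show "m \<in> Poly_Mapping.keys f" by (simp add: in_keys_iff)
qed

lemma cm_forms: "klin l \<Longrightarrow> f \<in> forms r j \<Longrightarrow> cm l f \<in> forms r j"
  using keys_cm by (auto simp: forms_iff)

lemma up_forms: "f \<in> forms r j \<Longrightarrow> up f \<in> forms r j"
  by (auto simp: forms_iff in_keys_iff lookup_up)

lemma cm_carrier: "klin l \<Longrightarrow> f \<in> carrier (polyring r) \<Longrightarrow> cm l f \<in> carrier (polyring r)"
  using keys_cm by (auto simp: carrier_polyring)

lemma up_carrier: "f \<in> carrier (polyring r) \<Longrightarrow> up f \<in> carrier (polyring r)"
  by (auto simp: carrier_polyring in_keys_iff lookup_up)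

lemma ext_forms_1: "f \<in> forms r j \<longleftrightarrow> f \<in> ext (forms r j)"
proof
  assume f: "f \<in> ext (forms r j)"
  obtain S \<Lambda> where S: "finite S" "\<And>b. klin (\<Lambda> b)" "f = (\<Sum>b\<in>S. scalem b (up (cm (\<Lambda> b) f)))" by (rule cm_expand[of f]) (rule that, assumption+)
  have "(\<Sum>b\<in>S. scalem b (up (cm (\<Lambda> b) f))) \<in> forms r j"
    using S(2) f by (intro forms_sum mpol.subspace_scale[OF forms_subspace] up_forms) (auto simp: ext_def)
  then show "f \<in> forms r j" using S(3) by simp
qed (auto simp: ext_def cm_forms)

text \<open>This replaces the generated ideal by \<open>ext\<close> from here on. One inclusion
  holds because the right side is an ideal of \<open>polyring r\<close>, the other by
  \<open>cm_expand\<close>.\<close>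

lemma base_change_iff:
  assumes "ideal I (polyring r)"
  shows "f \<in> base_change r I \<longleftrightarrow> f \<in> carrier (polyring r) \<and> f \<in> ext I"
proof -
  note I = ideal_polyringD[OF assms]
  have sI: "mpol.subspace I" by (rule mpol.subspaceI) (use I in auto)
  have sE: "mpol.subspace (ext I)" by (rule ext_subspace[OF sI])
  let ?B = "carrier (polyring r) \<inter> ext I"
  have upc: "up ` I \<subseteq> carrier (polyring r)" using I(1) up_carrier by blast
  have bc: "base_change r I = genideal (polyring r) (up ` I)" unfolding base_change_def up_def[abs_def] ..
  have "ideal ?B (polyring r)"
    unfolding ideal_polyring_iff
  proof (intro conjI ballI)
    show "0 \<in> ?B" using mpol.subspace_0[OF sE] by (simp add: carrier_polyring)
    fix x assume x: "x \<in> ?B"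
    show "x + y \<in> ?B" if "y \<in> ?B" for y using x that mpol.subspace_add[OF sE] polyring_add_closed by blast
    fix a :: "'a alg_closure mpol" assume a: "a \<in> carrier (polyring r)"
    obtain S \<Lambda> where S: "finite S" "\<And>b. klin (\<Lambda> b)" "a = (\<Sum>b\<in>S. scalem b (up (cm (\<Lambda> b) a)))" by (rule cm_expand[of a]) (rule that, assumption+)
    obtain S' \<Lambda>' where S': "finite S'" "\<And>b. klin (\<Lambda>' b)" "x = (\<Sum>b\<in>S'. scalem b (up (cm (\<Lambda>' b) x)))" by (rule cm_expand[of x]) (rule that, assumption+)
    have "a * x = (\<Sum>b\<in>S. scalem b (up (cm (\<Lambda> b) a))) * (\<Sum>b\<in>S'. scalem b (up (cm (\<Lambda>' b) x)))" using S(3) S'(3) by simp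
    also have "\<dots> = (\<Sum>b\<in>S. \<Sum>b'\<in>S'. scalem (b * b') (up (cm (\<Lambda> b) a * cm (\<Lambda>' b') x)))"
      by (rule up_sum_product)
    also have "\<dots> \<in> ext I"
    proof (intro mpol.subspace_sum[OF sE] mpol.subspace_scale[OF sE])
      fix b b'
      have "cm (\<Lambda> b) a * cm (\<Lambda>' b') x \<in> I"
        using x S'(2) by (intro I(4) cm_carrier S(2) a) (auto simp: ext_def)
      then show "up (cm (\<Lambda> b) a * cm (\<Lambda>' b') x) \<in> ext I" using ext_up[OF sI] by blast
    qed
    finally show "a * x \<in> ?B" using polyring_mult_closed[OF a] x by blast
  qed blast
  moreover have "up ` I \<subseteq> ?B" using upc ext_up[OF sI] by blast
  ultimately have 1: "base_change r I \<subseteq> ?B" unfolding bc by (rule PR.genideal_minimal)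
  have G: "ideal (base_change r I) (polyring r)" unfolding bc by (rule PR.genideal_ideal[OF upc])
  have "f \<in> base_change r I" if f: "f \<in> ext I" for f
  proof -
    obtain S \<Lambda> where S: "finite S" "\<And>b. klin (\<Lambda> b)" "f = (\<Sum>b\<in>S. scalem b (up (cm (\<Lambda> b) f)))" by (rule cm_expand[of f]) (rule that, assumption+)
    have "up (cm (\<Lambda> b) f) \<in> base_change r I" for b
      using f S(2) PR.genideal_self[OF upc] unfolding bc ext_def by blast
    then have "(\<Sum>b\<in>S. scalem b (up (cm (\<Lambda> b) f))) \<in> base_change r I" by (intro ideal_polyringD(6)[OF G] ideal_polyringD(7)[OF G])
    then show ?thesis using S(3) by simp
  qed
  then show ?thesis using 1 by blast
qed

lemma base_change_homogeneous:
  assumes "homogeneous_ideal r I"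
  shows "homogeneous_ideal r (base_change r I)"
proof -
  have I: "ideal I (polyring r)" "\<And>f j. f \<in> I \<Longrightarrow> hcr r j f \<in> I" using assms by (auto simp: homogeneous_ideal_iff)
  have "up ` I \<subseteq> carrier (polyring r)" using ideal_polyringD(1)[OF I(1)] up_carrier by blast
  then have "ideal (base_change r I) (polyring r)" unfolding base_change_def up_def[abs_def, symmetric] by (rule PR.genideal_ideal)
  moreover have "hcr r j f \<in> base_change r I" if "f \<in> base_change r I" for f j
    using that I(2) hcr_carrier unfolding base_change_iff[OF I(1)] by (auto simp: ext_def cm_hcr)
  ultimately show ?thesis by (simp add: homogeneous_ideal_iff)
qed

subsection \<open>Affine presentations of finite schemes\<close>

text \<open>
  The quotient of the polynomial ring by \<open>\<aa>\<close> is the ring of global sections of the scheme defined by \<open>I\<close>;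
  a form is mapped to a section by dividing by a power of a fixed local generator of \<open>O(1)\<close>.
\<close>

definition presents :: "nat \<Rightarrow> 'k::field mpol set \<Rightarrow> 'k mpol set \<Rightarrow> nat \<Rightarrow> bool" where
  "presents r I \<aa> N \<longleftrightarrow> mp.tideal \<aa> \<and> mp.fcod \<aa> \<and> (\<forall>j. \<forall>f\<in>forms r j. f \<in> \<aa> \<longleftrightarrow> f \<in> I) \<and>
     (\<forall>j\<ge>N. \<forall>p. \<exists>f\<in>forms r j. p - f \<in> \<aa>)"

lemma presentsD:
  assumes "presents r I \<aa> N"
  shows "mp.tideal \<aa>" "mp.fcod \<aa>" "f \<in> forms r j \<Longrightarrow> f \<in> \<aa> \<longleftrightarrow> f \<in> I" "N \<le> j \<Longrightarrow> \<exists>f\<in>forms r j. p - f \<in> \<aa>"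
  using assms by (auto simp: presents_def)

lemma presents_base_change:
  assumes p: "presents r I \<aa> N" and I: "ideal I (polyring r)"
  shows "presents r (base_change r I) (ext \<aa>) N"
  unfolding presents_def
proof (intro conjI allI impI ballI)
  have sa: "mpol.subspace \<aa>" by (rule mp.tideal_subspace[OF presentsD(1)[OF p]])
  have sE: "mpol.subspace (ext \<aa>)" by (rule ext_subspace[OF sa])
  show "mp.tideal (ext \<aa>)" "mp.fcod (ext \<aa>)" using ext_tideal ext_codim(1) presentsD(1,2)[OF p] by auto
  fix j
  show "f \<in> ext \<aa> \<longleftrightarrow> f \<in> base_change r I" if f: "f \<in> forms r j" for f
    using presentsD(3)[OF p cm_forms[OF _ f]] f forms_carrier unfolding base_change_iff[OF I] by (auto simp: ext_def)
  fix x :: "'a alg_closure mpol" assume j: "N \<le> j"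
  obtain S \<Lambda> where S: "finite S" "\<And>b. klin (\<Lambda> b)" "x = (\<Sum>b\<in>S. scalem b (up (cm (\<Lambda> b) x)))" by (rule cm_expand[of x]) (rule that, assumption+)
  have "\<exists>t. \<forall>b. t b \<in> forms r j \<and> cm (\<Lambda> b) x - t b \<in> \<aa>" using presentsD(4)[OF p j] by (intro choice) blast
  then obtain t where t: "\<And>b. t b \<in> forms r j" "\<And>b. cm (\<Lambda> b) x - t b \<in> \<aa>" by blast
  let ?s = "\<Sum>b\<in>S. scalem b (up (t b))"
  have "?s \<in> forms r j" using up_forms[OF t(1)] by (intro forms_sum mpol.subspace_scale[OF forms_subspace])
  moreover have "x - ?s = (\<Sum>b\<in>S. scalem b (up (cm (\<Lambda> b) x - t b)))"
    by (subst (1) S(3)) (simp add: up_diff mpol.scale_right_diff_distrib sum_subtractf)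
  then have "x - ?s \<in> ext \<aa>"
    using t(2) ext_up[OF sa] by (auto intro!: mpol.subspace_sum[OF sE] mpol.subspace_scale[OF sE])
  ultimately show "\<exists>f\<in>forms r j. x - f \<in> ext \<aa>" by blast
qed

lemma scheme_degreeI:
  assumes "\<And>n. N \<le> n \<Longrightarrow> hilbert_fun r I n = d"
  shows "scheme_degree r I = d"
  unfolding scheme_degree_def
proof (rule the_equality)
  show "\<forall>\<^sub>F n in sequentially. hilbert_fun r I n = d" using assms by (auto simp: eventually_sequentially)
  fix d' assume "\<forall>\<^sub>F n in sequentially. hilbert_fun r I n = d'"
  then obtain N' where "\<forall>n\<ge>N'. hilbert_fun r I n = d'" by (auto simp: eventually_sequentially)
  then show "d' = d" using assms[of "max N N'"] by (metis max.cobounded1 max.cobounded2)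
qed

lemma presents_dim:
  fixes K :: "'k::field mpol set"
  assumes p: "presents r I \<aa> N" and K: "mpol.subspace K" "\<aa> \<subseteq> K" and n: "N \<le> n"
  shows "mpol.dim (forms r n :: 'k mpol set) = mp.codim K + mpol.dim (forms r n \<inter> K)"
proof -
  have f: "mp.fcod K" by (rule mp.fcod_mono[OF presentsD(2)[OF p] K(2,1)])
  have "\<exists>s\<in>forms r n. x - s \<in> K" for x
  proof -
    obtain s where "s \<in> forms r n" "x - s \<in> \<aa>" using presentsD(4)[OF p n, of x] by (rule bexE)
    then show ?thesis using K(2) by (intro bexI[of _ s]) auto
  qed
  then show ?thesis by (rule mp.codim_supplement[OF f forms_fdim])
qed

text \<open>By \<open>presents_dim\<close> the Hilbert function of \<open>J\<close> has the value
  \<open>codim K\<close> in all degrees from \<open>N\<close> on. Degrees of schemes thus become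
  codimensions of ideals.\<close>

lemma presents_degree:
  fixes K :: "'k::field mpol set"
  assumes p: "presents r I \<aa> N" and K: "mpol.subspace K" "\<aa> \<subseteq> K" and J: "\<And>n f. f \<in> forms r n \<Longrightarrow> f \<in> J \<longleftrightarrow> f \<in> K"
  shows "scheme_degree r J = mp.codim K"
proof (rule scheme_degreeI)
  fix n assume "N \<le> n"
  then have "mpol.dim (forms r n :: 'k mpol set) = mp.codim K + mpol.dim (forms r n \<inter> K)" by (rule presents_dim[OF p K])
  moreover have "J \<inter> forms r n = forms r n \<inter> K" using J by blast
  ultimately show "hilbert_fun r J n = mp.codim K" by (simp add: hilbert_fun_def)
qed

text \<open>For an ideal \<open>K\<close> over \<open>\<aa>\<close>, the saturated homogeneous ideal
  of the subscheme that \<open>K\<close> cuts out.\<close>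

definition sch :: "nat \<Rightarrow> 'k::field mpol set \<Rightarrow> 'k mpol set" where
  "sch r K = {f \<in> carrier (polyring r). \<forall>j. hcr r j f \<in> K}"

lemma sch_form: "mp.tideal K \<Longrightarrow> f \<in> forms r n \<Longrightarrow> f \<in> sch r K \<longleftrightarrow> f \<in> K"
  using forms_carrier by (auto simp: sch_def hcr_form mp.tidealD)

lemma forms_add_closed:
  fixes f :: "'k::field mpol"
  assumes J: "ideal J (polyring r)" and n: "\<And>g. g \<in> forms r n \<Longrightarrow> g * f \<in> J" and g: "g \<in> forms r (n + k)"
  shows "g * f \<in> J"
proof -
  have m: "Poly_Mapping.single m c * f \<in> J" if mk: "m \<in> mons r (n + k)" for m and c :: 'k
  proof -
    obtain m1 m2 where m: "m1 \<in> mons r n" "m2 \<in> mons r k" "m = m1 + m2" using mons_split[OF mk] by blast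
    have "Poly_Mapping.single m1 1 * f \<in> J" by (rule n[OF single_in_forms[OF m(1)]])
    moreover have "Poly_Mapping.single m2 c \<in> carrier (polyring r)" using m(2) by (simp add: carrier_polyring mons_def)
    ultimately have "Poly_Mapping.single m2 c * (Poly_Mapping.single m1 1 * f) \<in> J" by (rule ideal_polyringD(4)[OF J])
    then show ?thesis by (simp add: mult_single m(3) add.commute flip: mult.assoc)
  qed
  have "g * f = (\<Sum>m\<in>Poly_Mapping.keys g. Poly_Mapping.single m (Poly_Mapping.lookup g m) * f)"
    using arg_cong[OF pm_sum_single[of g], of "\<lambda>u. u * f"] by (simp only: sum_distrib_right)
  also have "\<dots> \<in> J" using g m by (intro ideal_polyringD(6)[OF J]) (auto simp: forms_iff)
  finally show ?thesis .
qed

text \<open>For saturation: in every large degree some form \<open>g\<close> is congruent to 1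
  modulo \<open>\<aa>\<close>. If all forms of that degree multiply \<open>f\<close> into the ideal,
  so does \<open>g\<close>, and the factor \<open>g\<close> can be removed modulo
  \<open>K\<close>.\<close>

lemma sch_closed_subscheme:
  assumes p: "presents r I \<aa> N" and K: "mp.tideal K" "\<aa> \<subseteq> K"
  shows "closed_subscheme r (sch r K)"
proof -
  have id: "ideal (sch r K) (polyring r)"
    unfolding ideal_polyring_iff
  proof (intro conjI ballI)
    show "0 \<in> sch r K" using mp.tidealD(1)[OF K(1)] by (simp add: sch_def carrier_polyring hcr_simps(3))
    fix x assume x: "x \<in> sch r K"
    show "x + y \<in> sch r K" if "y \<in> sch r K" for y
      using x that mp.tidealD(2)[OF K(1)] polyring_add_closed by (auto simp: sch_def hcr_simps(1))
    show "a * x \<in> sch r K" if "a \<in> carrier (polyring r)" for a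
      using x that polyring_mult_closed hcr_mult_closed[OF K(1)] by (auto simp: sch_def)
  qed (auto simp: sch_def)
  have h: "homogeneous_ideal r (sch r K)"
    unfolding homogeneous_ideal_iff using id sch_form[OF K(1) hcr_forms] by (auto simp: sch_def)
  have "saturated r (sch r K)"
    unfolding saturated_def
  proof (intro ballI impI)
    fix f :: "'a mpol" assume f: "f \<in> carrier (polyring r)" and ex: "\<exists>n. \<forall>g\<in>forms r n. g * f \<in> sch r K"
    then obtain n where n: "\<And>g. g \<in> forms r n \<Longrightarrow> g * f \<in> sch r K" by blast
    obtain g where g: "g \<in> forms r (n + N)" "1 - g \<in> \<aa>" using presentsD(4)[OF p, of "n + N" 1] by auto
    have "g * f \<in> sch r K" by (rule forms_add_closed[OF id n g(1)])
    then have "hcr r ((n + N) + j) (g * f) \<in> K" for j by (auto simp: sch_def)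
    moreover have "hcr r ((n + N) + j) (g * f) = g * hcr r j f" for j using hcr_form_mult[OF g(1), of "(n + N) + j" f] by simp
    ultimately have gf: "g * hcr r j f \<in> K" for j by metis
    have "hcr r j f \<in> K" for j
    proof -
      have "(1 - g) * hcr r j f + g * hcr r j f \<in> K"
        by (rule mp.tidealD(2)[OF K(1) mp.tidealD(4)[OF K(1) subsetD[OF K(2) g(2)]] gf])
      then show ?thesis by (simp add: algebra_simps)
    qed
    then show "f \<in> sch r K" using f by (simp add: sch_def)
  qed
  then show ?thesis using h by (simp add: closed_subscheme_def)
qed

text \<open>A nonzero \<open>v\<close> defines a hyperplane, and the subscheme
  \<open>sch r K\<close>, of degree \<open>codim K\<close>, lies on it. Linearly general position
  allows degree at most \<open>r\<close> there.\<close>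

lemma lgp_hyperplane:
  assumes p: "presents r I \<aa> N" and h: "homogeneous_ideal r I" and lgp: "lin_gen_pos r I" and r: "1 \<le> r"
    and K: "mp.tideal K" "\<aa> \<subseteq> K" "r + 1 \<le> mp.codim K" and v: "v \<in> forms r 1" "v \<in> K"
  shows "v = 0"
proof (rule ccontr)
  assume v0: "v \<noteq> 0"
  have I: "ideal I (polyring r)" "\<And>f j. f \<in> I \<Longrightarrow> hcr r j f \<in> I" using h by (auto simp: homogeneous_ideal_iff)
  have cs: "closed_subscheme r (sch r K)" by (rule sch_closed_subscheme[OF p K(1,2)])
  then have id: "ideal (sch r K) (polyring r)" by (simp add: closed_subscheme_def homogeneous_ideal_def)
  have IK: "I \<subseteq> sch r K"
  proof
    fix f assume f: "f \<in> I"
    have "hcr r j f \<in> \<aa>" for j using presentsD(3)[OF p hcr_forms] I(2)[OF f] by blast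
    then show "f \<in> sch r K" using K(2) f ideal_polyringD(1)[OF I(1)] by (auto simp: sch_def)
  qed
  have vK: "v \<in> sch r K" using sch_form[OF K(1) v(1)] v(2) by blast
  have "genideal (polyring r) {v} \<subseteq> sch r K" using id vK by (intro PR.genideal_minimal) auto
  moreover have "linear_subspace r (r - 1) (genideal (polyring r) {v})"
    unfolding linear_subspace_def using v v0 r by (intro exI[of _ "{v}"]) auto
  ultimately have "scheme_degree r (sch r K) \<le> (r - 1) + 1"
    using lgp cs IK r unfolding lin_gen_pos_def by (metis diff_less less_le_trans zero_less_one)
  moreover have "scheme_degree r (sch r K) = mp.codim K"
    by (rule presents_degree[OF p mp.tideal_subspace[OF K(1)] K(2) sch_form[OF K(1)]])
  ultimately show False using K(3) r by simp
qed

section \<open>Finite subschemes have affine presentations\<close>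

text \<open>\<open>\<mu>\<close> induces an injection of the quotient by the preimage of
  \<open>J\<close> into the quotient by \<open>J\<close>, which is onto once the dimensions
  agree.\<close>

lemma (in vspace) codim_preimage:
  assumes "lin_endo \<mu>" "fcod J"
  shows "fcod {x. \<mu> x \<in> J}" "codim {x. \<mu> x \<in> J} \<le> codim J"
    and "codim J \<le> codim {x. \<mu> x \<in> J} \<Longrightarrow> \<exists>y. x - \<mu> y \<in> J"
proof -
  obtain T where T: "fdim T" "is_compl T J" "subspace J" "dim T = codim J" using fcodE[OF assms(2)] .
  obtain p where p: "lin_endo p" "range p = T" "\<And>x. x - p x \<in> J" "\<And>x. p x = 0 \<longleftrightarrow> x \<in> J" "\<And>t. t \<in> T \<Longrightarrow> p t = t"
    using is_compl_proj[OF T(2,3)] by blast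
  define f where "f x = p (\<mu> x)" for x
  have f: "lin_endo f" using p(1) assms(1) by (auto simp: lin_endo_def f_def)
  have rf: "range f \<subseteq> T" using p(2) by (auto simp: f_def)
  have ker: "{x. f x = 0} = {x. \<mu> x \<in> J}" using p(4) by (simp add: f_def)
  show "fcod {x. \<mu> x \<in> J}" using codim_kernel(1)[OF f T(1) rf] by (simp add: ker)
  have c: "codim {x. \<mu> x \<in> J} = dim (range f)" using codim_kernel(2)[OF f T(1) rf] by (simp add: ker)
  then show "codim {x. \<mu> x \<in> J} \<le> codim J" using dim_mono_fdim[OF T(1) rf] T(4) by simp
  assume "codim J \<le> codim {x. \<mu> x \<in> J}"
  then have "range f = T" using dim_eq_imp_eq[OF T(1) subspace_image[OF f subspace_UNIV] rf] c T(4) by simp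
  then have "p x \<in> range f" using p(2) by blast
  then obtain y where "p x = p (\<mu> y)" by (auto simp: f_def)
  then have "p (x - \<mu> y) = 0" by (simp add: lin_endoD[OF p(1)])
  then show "\<exists>y. x - \<mu> y \<in> J" using p(4) by blast
qed

lemma (in comm_alg) tideal_add_cancel: "tideal J \<Longrightarrow> x + y \<in> J \<Longrightarrow> y \<in> J \<Longrightarrow> x \<in> J"
  using tidealD(6)[of J "x + y" y] by simp

text \<open>Homogeneous ideals of the full polynomial ring. The equivalence also puts into
  \<open>Q\<close> every polynomial without components, such as a variable beyond
  \<open>x_r\<close>, so \<open>Q\<close> is determined by its forms.\<close>

definition hid :: "nat \<Rightarrow> 'k::field mpol set \<Rightarrow> bool" where
  "hid r Q \<longleftrightarrow> mp.tideal Q \<and> (\<forall>f. f \<in> Q \<longleftrightarrow> (\<forall>j. hcr r j f \<in> Q))"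

text \<open>The codimension of this space is the Hilbert function of \<open>Q\<close> at
  \<open>e\<close>; the ambient space is the same for all \<open>e\<close>.\<close>

definition comp :: "nat \<Rightarrow> 'k::field mpol set \<Rightarrow> nat \<Rightarrow> 'k mpol set" where
  "comp r Q e = {f. hcr r e f \<in> Q}"

definition hprime :: "nat \<Rightarrow> 'k::field mpol set \<Rightarrow> bool" where
  "hprime r P \<longleftrightarrow> hid r P \<and> \<not> forms r 1 \<subseteq> P \<and>
     (\<forall>i j. \<forall>f\<in>forms r i. \<forall>g\<in>forms r j. f * g \<in> P \<longrightarrow> f \<in> P \<or> g \<in> P)"

lemma hidD:
  assumes "hid r Q"
  shows "mp.tideal Q" "f \<in> Q \<Longrightarrow> hcr r j f \<in> Q" "(\<And>j. hcr r j f \<in> Q) \<Longrightarrow> f \<in> Q"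
  using assms unfolding hid_def by blast+

lemma hprimeD:
  assumes "hprime r P"
  shows "mp.tideal P" "hid r P" "f \<in> forms r i \<Longrightarrow> g \<in> forms r j \<Longrightarrow> f * g \<in> P \<Longrightarrow> f \<in> P \<or> g \<in> P"
  using assms unfolding hprime_def by (blast dest: hidD(1))+

text \<open>The difference between \<open>f\<close> and the sum of its components has no components,
  so it already lies in \<open>Q\<close>.\<close>

lemma hid_superset:
  assumes "hid r Q" "mp.tideal Q'" "Q \<subseteq> Q'" "\<And>x j. x \<in> Q' \<Longrightarrow> hcr r j x \<in> Q'"
  shows "hid r Q'"
  unfolding hid_def
proof (intro conjI allI iffI assms(2))
  fix f assume f: "\<forall>j. hcr r j f \<in> Q'"
  let ?s = "\<Sum>j\<le>dbound f. hcr r j f"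
  have "hcr r i (f - ?s) = 0" for i
  proof -
    have "hcr r i ?s = (\<Sum>j\<le>dbound f. if i = j then hcr r i f else 0)"
      by (simp add: hcr_simps hcr_form[OF hcr_forms] if_distrib eq_commute[of i] cong: if_cong)
    also have "\<dots> = hcr r i f" using hcr_dbound[of f i r] by (cases "i \<le> dbound f") (auto simp: not_le)
    finally show ?thesis by (simp add: hcr_simps)
  qed
  then have "f - ?s \<in> Q" using hidD(1,3)[OF assms(1)] by (simp add: mp.tidealD(1))
  moreover have "?s \<in> Q'" using f by (intro mp.tidealD(8)[OF assms(2)]) blast
  ultimately have "(f - ?s) + ?s \<in> Q'" using assms(3) by (intro mp.tidealD(2)[OF assms(2)]) auto
  then show "f \<in> Q'" by simp
qed (use assms(4) in blast)

lemma forms_subset_span: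
  assumes "mpol.subspace Q" "\<And>m. m \<in> mons r n \<Longrightarrow> Poly_Mapping.single m 1 \<in> Q"
  shows "forms r n \<subseteq> Q"
  unfolding forms_span by (rule mpol.span_minimal[OF _ assms(1)]) (use assms(2) in auto)

text \<open>Zorn's lemma among the homogeneous ideals over \<open>Q\<close> that contain no power of
  the irrelevant ideal. If \<open>f\<close> and \<open>g\<close> are outside a maximal one
  \<open>M\<close>, then \<open>M + (f)\<close> and \<open>M + (g)\<close> contain all forms of some
  degrees \<open>a\<close> and \<open>b\<close>; with \<open>f * g \<in> M\<close>, all forms of
  degree \<open>a + b\<close> would lie in \<open>M\<close>.\<close>

lemma ex_hprime:
  assumes Q: "hid r Q" "\<And>j. \<not> forms r j \<subseteq> Q"
  obtains P where "hprime r P" "Q \<subseteq> P"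
proof -
  let ?A = "{P. hid r P \<and> Q \<subseteq> P \<and> (\<forall>j. \<not> forms r j \<subseteq> P)}"
  have "\<exists>M\<in>?A. \<forall>Z\<in>?A. M \<subseteq> Z \<longrightarrow> Z = M"
  proof (rule subset_Zorn_nonempty)
    show "?A \<noteq> {}" using Q by blast
    fix C assume C: "C \<noteq> {}" "subset.chain ?A C"
    have CA: "C \<subseteq> ?A" using C(2) by (simp add: subset.chain_def)
    have fin: "\<exists>P\<in>C. F \<subseteq> P" if "finite F" "F \<subseteq> \<Union>C" for F
      by (rule finite_subset_Union_chain[OF that C]) (rule bexI)
    have t: "mp.tideal (\<Union>C)" unfolding mp.tideal_def
    proof (intro conjI ballI allI)
      have tP: "mp.tideal P" if "P \<in> C" for P using that CA hidD(1) by blast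
      show "0 \<in> \<Union>C" using C(1) tP mp.tidealD(1) by blast
      fix x assume x: "x \<in> \<Union>C"
      show "a * x \<in> \<Union>C" for a using x tP mp.tidealD(3) by blast
      fix y assume "y \<in> \<Union>C"
      then obtain P where P: "P \<in> C" "x \<in> P" "y \<in> P" using fin[of "{x, y}"] x by auto
      then have "x + y \<in> P" using tP mp.tidealD(2) by blast
      then show "x + y \<in> \<Union>C" using P(1) by blast
    qed
    have QC: "Q \<subseteq> \<Union>C" using C(1) CA by blast
    have "hid r (\<Union>C)"
    proof (rule hid_superset[OF Q(1) t QC])
      fix x j assume "x \<in> \<Union>C"
      then show "hcr r j x \<in> \<Union>C" using CA hidD(2) by blast
    qed
    \<comment> \<open>The forms of degree \<open>j\<close> are spanned by finitely many monomials,
      which would already lie in one member of the chain.\<close>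
    moreover have "\<not> forms r j \<subseteq> \<Union>C" for j
    proof
      assume "forms r j \<subseteq> \<Union>C"
      then have "(\<lambda>m. Poly_Mapping.single m 1) ` mons r j \<subseteq> \<Union>C" using single_in_forms by blast
      from fin[OF finite_imageI[OF finite_mons] this]
      obtain P where P: "P \<in> C" "(\<lambda>m. Poly_Mapping.single m 1) ` mons r j \<subseteq> P" by (rule bexE)
      then have "mpol.subspace P" using CA hidD(1) mp.tideal_subspace by blast
      then have "forms r j \<subseteq> P" using P(2) by (intro forms_subset_span) auto
      then show False using P(1) CA by blast
    qed
    ultimately show "\<Union>C \<in> ?A" using QC by blast
  qed
  then obtain M where M0: "M \<in> ?A" and max0: "\<forall>Z\<in>?A. M \<subseteq> Z \<longrightarrow> Z = M" by (rule bexE)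
  have M: "hid r M" "Q \<subseteq> M" "\<not> forms r j \<subseteq> M" for j using M0 by simp_all
  have max: "Z = M" if "hid r Z" "Q \<subseteq> Z" "\<And>j. \<not> forms r j \<subseteq> Z" "M \<subseteq> Z" for Z
    by (rule mp[OF bspec[OF max0] that(4)]) (use that in simp)
  have Mt: "mp.tideal M" by (rule hidD(1)[OF M(1)])
  have big: "\<exists>a. forms r a \<subseteq> mp.prin f M" if f: "f \<in> forms r i" "f \<notin> M" for f i
  proof (rule ccontr)
    assume n: "\<not> ?thesis"
    have t: "mp.tideal (mp.prin f M)" by (rule mp.tideal_prin[OF Mt])
    have "hid r (mp.prin f M)"
    proof (rule hid_superset[OF M(1) t mp.prin_superset])
      fix x j assume "x \<in> mp.prin f M"
      then obtain t m where x: "x = f * t + m" "m \<in> M" by (auto simp: mp.prin_def)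
      have "hcr r j (f * t) \<in> mp.prin f M"
        using hcr_form_mult[OF f(1), of j t] mp.prin_mem[OF Mt] mp.tidealD(1)[OF t] by auto
      moreover have "hcr r j m \<in> mp.prin f M" using hidD(2)[OF M(1) x(2)] mp.prin_superset by blast
      ultimately show "hcr r j x \<in> mp.prin f M" using x mp.tidealD(2)[OF t] by (simp add: hcr_simps(1))
    qed
    then have "mp.prin f M = M" using max[of "mp.prin f M"] M(2) mp.prin_superset n by blast
    then show False using f(2) mp.prin_self[OF Mt] by blast
  qed
  have "hprime r M" unfolding hprime_def
  proof (intro conjI M(1,3) allI ballI impI)
    fix i j f g assume f: "f \<in> forms r i" and g: "g \<in> forms r j" and fg: "f * g \<in> M"
    show "f \<in> M \<or> g \<in> M"
    proof (rule ccontr)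
      assume "\<not> ?thesis"
      then have n: "f \<notin> M" "g \<notin> M" by auto
      obtain a where a: "forms r a \<subseteq> mp.prin f M" using big[OF f n(1)] by (rule exE)
      obtain b where b: "forms r b \<subseteq> mp.prin g M" using big[OF g n(2)] by (rule exE)
      note ab = a b
      have pq: "p * q \<in> M" if "p \<in> forms r a" "q \<in> forms r b" for p q
      proof -
        have pm: "p \<in> mp.prin f M" "q \<in> mp.prin g M" using that ab by blast+
        obtain t m where p: "p = f * t + m" "m \<in> M" using pm(1) by (auto simp: mp.prin_def)
        obtain t' m' where q: "q = g * t' + m'" "m' \<in> M" using pm(2) by (auto simp: mp.prin_def)
        have "p * q = (t * t') * (f * g) + ((f * t) * m' + q * m)" unfolding p(1) q(1) by (simp add: algebra_simps)
        also have "\<dots> \<in> M" by (rule mp.tidealD(2)[OF Mt mp.tidealD(3)[OF Mt fg] mp.tidealD(2)[OF Mt mp.tidealD(3)[OF Mt q(2)] mp.tidealD(3)[OF Mt p(2)]]])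
        finally show ?thesis .
      qed
      have "forms r (a + b) \<subseteq> M"
      proof (rule forms_subset_span[OF mp.tideal_subspace[OF Mt]])
        fix m assume "m \<in> mons r (a + b)"
        then obtain m1 m2 where m: "m1 \<in> mons r a" "m2 \<in> mons r b" "m = m1 + m2" using mons_split by blast
        then show "Poly_Mapping.single m 1 \<in> M" using pq[OF single_in_forms[OF m(1)] single_in_forms[OF m(2)], of 1 1] by (simp add: mult_single)
      qed
      then show False using M(3) by blast
    qed
  qed
  then show thesis using that M(2) by blast
qed

lemma comp_codim:
  fixes Q :: "'k::field mpol set"
  assumes "mpol.subspace Q"
  shows "mp.fcod (comp r Q e)" "mpol.dim (forms r e :: 'k mpol set) = mp.codim (comp r Q e) + mpol.dim (forms r e \<inter> Q)"
proof -
  have s: "mpol.subspace (comp r Q e)"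
    using assms by (intro mpol.subspaceI) (auto simp: comp_def hcr_simps mpol.subspace_0 mpol.subspace_add mpol.subspace_scale)
  have sp: "\<exists>s\<in>forms r e. x - s \<in> comp r Q e" for x
    using hcr_forms[of r e x] mpol.subspace_0[OF assms] by (intro bexI[of _ "hcr r e x"]) (auto simp: comp_def hcr_simps hcr_form)
  show f: "mp.fcod (comp r Q e)" by (rule mp.ex_compl[OF s forms_fdim sp])
  have "forms r e \<inter> comp r Q e = forms r e \<inter> Q" by (auto simp: comp_def hcr_form)
  then show "mpol.dim (forms r e :: 'k mpol set) = mp.codim (comp r Q e) + mpol.dim (forms r e \<inter> Q)"
    using mp.codim_supplement[OF f forms_fdim sp] by simp
qed

text \<open>Multiplication by \<open>u\<close> is injective from degree \<open>e\<close> modulo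
  \<open>Q'\<close> to degree \<open>e + d\<close> modulo \<open>Q\<close>, hence onto when the
  Hilbert functions agree.\<close>

lemma comp_mult:
  assumes Q: "mpol.subspace Q" and u: "u \<in> forms r d"
    and nzd: "\<And>f. f \<in> forms r e \<Longrightarrow> u * f \<in> Q \<longleftrightarrow> f \<in> Q'"
  shows "mp.codim (comp r Q' e) \<le> mp.codim (comp r Q (e + d))"
    and "mp.codim (comp r Q (e + d)) \<le> mp.codim (comp r Q' e) \<Longrightarrow> q \<in> forms r (e + d) \<Longrightarrow> \<exists>f\<in>forms r e. q - u * f \<in> Q"
proof -
  define \<mu> where "\<mu> f = u * hcr r e f" for f
  have lm: "mp.lin_endo \<mu>" by (auto simp: mp.lin_endo_def \<mu>_def hcr_simps distrib_left mp.mult_scale)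
  have form: "\<mu> f \<in> forms r (e + d)" for f unfolding \<mu>_def add.commute[of e d] by (rule forms_mult[OF u hcr_forms])
  have "\<mu> f \<in> comp r Q (e + d) \<longleftrightarrow> f \<in> comp r Q' e" for f
    using form[of f] nzd[OF hcr_forms] by (simp add: comp_def hcr_form) (simp add: \<mu>_def)
  then have ker: "{f. \<mu> f \<in> comp r Q (e + d)} = comp r Q' e" by blast
  note P = mp.codim_preimage[OF lm comp_codim(1)[OF Q, of r "e + d"], unfolded ker]
  show "mp.codim (comp r Q' e) \<le> mp.codim (comp r Q (e + d))" by (rule P(2))
  assume "mp.codim (comp r Q (e + d)) \<le> mp.codim (comp r Q' e)" and q: "q \<in> forms r (e + d)"
  then obtain y where "q - \<mu> y \<in> comp r Q (e + d)" using P(3) by blast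
  then have "q - \<mu> y \<in> Q" using forms_diff[OF q form[of y]] by (simp add: comp_def hcr_form)
  then show "\<exists>f\<in>forms r e. q - u * f \<in> Q" using hcr_forms unfolding \<mu>_def by blast
qed

lemma hprime_linear:
  assumes "hprime r P"
  obtains x where "x \<in> forms r 1" "\<And>j. x ^ j \<in> forms r j" "\<And>j. x ^ j \<notin> P"
proof -
  obtain x where x: "x \<in> forms r 1" "x \<notin> P" using assms by (auto simp: hprime_def)
  have t: "mp.tideal P" by (rule hprimeD(1)[OF assms])
  have f: "x ^ j \<in> forms r j" for j using forms_power[OF x(1), of j] by simp
  have "x ^ j \<notin> P" for j
  proof (induction j)
    case 0 then show ?case using mp.tideal_one[OF t] x(2) by auto
  next
    case (Suc j)
    show ?case
    proof
      assume "x ^ Suc j \<in> P"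
      then have "x * x ^ j \<in> P" by simp
      then have "x \<in> P \<or> x ^ j \<in> P" by (rule hprimeD(3)[OF assms x(1) f])
      then show False using Suc x(2) by blast
    qed
  qed
  then show thesis using that x(1) f by blast
qed

locale finite_hid =
  fixes r :: nat and Q :: "'k::field mpol set" and n N :: nat
  assumes Q: "hid r Q"
    and sat: "\<And>i k f. f \<in> forms r i \<Longrightarrow> (\<And>g. g \<in> forms r k \<Longrightarrow> g * f \<in> Q) \<Longrightarrow> f \<in> Q"
    and hilb: "\<And>e. N \<le> e \<Longrightarrow> mp.codim (comp r Q e) = n"
begin

definition Pts :: "'k mpol set set" where "Pts = {P. hprime r P \<and> Q \<subseteq> P}"

lemma PtsD [dest]: "P \<in> Pts \<Longrightarrow> hprime r P" "P \<in> Pts \<Longrightarrow> Q \<subseteq> P"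
  by (auto simp: Pts_def)

text \<open>A strictly larger \<open>P'\<close> contains a form \<open>p\<close> outside
  \<open>P\<close>. Multiplication by \<open>p\<close> is injective modulo \<open>P\<close> but
  never onto, since it misses the powers of a linear form outside \<open>P'\<close>. The Hilbert
  function of \<open>P\<close> would be unbounded, although it is at most \<open>n\<close> in large
  degrees.\<close>

lemma Pts_incomparable:
  assumes P: "P \<in> Pts" "P' \<in> Pts" "P \<subseteq> P'"
  shows "P' = P"
proof (rule ccontr)
  assume "P' \<noteq> P"
  then obtain f where f: "f \<in> P'" "f \<notin> P" using P(3) by blast
  have hp: "hprime r P" "hprime r P'" "Q \<subseteq> P" using P by auto
  have h: "hid r P" "hid r P'" using hprimeD(2) hp by auto
  obtain j where j: "hcr r j f \<notin> P" using hidD(3)[OF h(1)] f(2) by blast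
  obtain x where x: "x \<in> forms r 1" "\<And>j. x ^ j \<in> forms r j" "\<And>j. x ^ j \<notin> P'" by (rule hprime_linear[OF hp(2)]) (rule that, assumption+)
  have xP: "x \<notin> P" using x(3)[of 1] P(3) by auto
  \<comment> \<open>The factor \<open>x\<close> makes the degree \<open>d\<close> positive.\<close>
  define p where "p = hcr r j f * x"
  define d where "d = j + 1"
  have p: "p \<in> forms r d" "p \<notin> P" "p \<in> P'"
    using forms_mult[OF hcr_forms x(1)] hprimeD(3)[OF hp(1) hcr_forms x(1)] j xP
      mp.tidealD(4)[OF hidD(1)[OF h(2)] hidD(2)[OF h(2) f(1)]]
    unfolding p_def d_def by blast+
  have sP: "mpol.subspace P" by (rule mp.tideal_subspace[OF hidD(1)[OF h(1)]])
  have step: "Suc (mp.codim (comp r P e)) \<le> mp.codim (comp r P (e + d))" for e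
  proof (rule ccontr)
    assume n: "\<not> ?thesis"
    have nz: "p * g \<in> P \<longleftrightarrow> g \<in> P" if "g \<in> forms r e" for g
      using hprimeD(3)[OF hp(1) p(1) that] p(2) mp.tidealD(3)[OF hidD(1)[OF h(1)]] by blast
    have "mp.codim (comp r P (e + d)) \<le> mp.codim (comp r P e)" using n by simp
    then obtain g where g: "x ^ (e + d) - p * g \<in> P" using comp_mult(2)[OF sP p(1) nz _ x(2)] by blast
    have "(x ^ (e + d) - p * g) + p * g \<in> P'"
      using g P(3) p(3) mp.tidealD(2,4)[OF hidD(1)[OF h(2)]] by blast
    then show False using x(3) by simp
  qed
  have ge: "m \<le> mp.codim (comp r P (m * d))" for m
  proof (induction m)
    case (Suc m) then show ?case using step[of "m * d"] by (simp add: add.commute)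
  qed simp
  \<comment> \<open>The degree \<open>?m * d\<close> is at least \<open>N\<close>, and the Hilbert
    function of \<open>P\<close> there is at least \<open>?m > n\<close>.\<close>
  let ?m = "N + n + 1"
  have "N \<le> ?m * d" by (simp add: d_def)
  then have "mp.codim (comp r Q (?m * d)) = n" by (rule hilb)
  moreover have "mp.codim (comp r P (?m * d)) \<le> mp.codim (comp r Q (?m * d))"
  proof (rule mp.codim_mono)
    show "mp.fcod (comp r Q (?m * d))" by (rule comp_codim(1)[OF mp.tideal_subspace[OF hidD(1)[OF Q]]])
    show "comp r Q (?m * d) \<subseteq> comp r P (?m * d)" using hp(3) by (auto simp: comp_def)
    show "mpol.subspace (comp r P (?m * d))" using comp_codim(1)[OF sP] by (rule mp.fcod_subspace)
  qed
  ultimately show False using ge[of ?m] by simp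
qed

text \<open>Prime avoidance by products: for each further point a form vanishing there but not at
  \<open>P\<close> is multiplied on. All large degrees occur because the first factor is a power of
  a linear form.\<close>

lemma Pts_separate:
  assumes "finite F" "F \<subseteq> Pts" "P \<in> Pts" "P \<notin> F"
  shows "\<exists>d. \<forall>j\<ge>d. \<exists>f\<in>forms r j. f \<notin> P \<and> (\<forall>P'\<in>F. f \<in> P')"
  using assms(1,2,4)
proof (induction F rule: finite_induct)
  case empty
  obtain x where "x \<in> forms r 1" "\<And>j. x ^ j \<in> forms r j" "\<And>j. x ^ j \<notin> P" by (rule hprime_linear[OF PtsD(1)[OF assms(3)]]) (rule that, assumption+)
  then show ?case by blast
next
  case (insert P' F)
  obtain d where d: "\<And>j. d \<le> j \<Longrightarrow> \<exists>f\<in>forms r j. f \<notin> P \<and> (\<forall>P'\<in>F. f \<in> P')" using insert by blast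
  have "\<not> P' \<subseteq> P" using Pts_incomparable[of P' P] insert assms(3) by blast
  then obtain g where g: "g \<in> P'" "g \<notin> P" by blast
  have hp: "hprime r P" "hprime r P'" using insert.prems(1) assms(3) by auto
  have h: "hid r P" "hid r P'" using hp hprimeD(2) by auto
  obtain i where i: "hcr r i g \<notin> P" using hidD(3)[OF h(1)] g(2) by blast
  have i': "hcr r i g \<in> P'" by (rule hidD(2)[OF h(2) g(1)])
  show ?case
  proof (intro exI allI impI)
    fix j assume "d + i \<le> j"
    then obtain f where f: "f \<in> forms r (j - i)" "f \<notin> P" "\<forall>P'\<in>F. f \<in> P'" using d[of "j - i"] by (auto simp: le_diff_conv2)
    have "f * hcr r i g \<in> forms r j" using forms_mult[OF f(1) hcr_forms, of i g] \<open>d + i \<le> j\<close> by simp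
    moreover have "f * hcr r i g \<notin> P" using hprimeD(3)[OF hp(1) f(1) hcr_forms] f(2) i by blast
    moreover have "f * hcr r i g \<in> P''" if "P'' \<in> insert P' F" for P''
    proof -
      have t: "mp.tideal P''" using that insert.prems(1) hprimeD(1) by blast
      show ?thesis
      proof (cases "P'' = P'")
        case True then show ?thesis using mp.tidealD(3)[OF t] i' by blast
      next
        case False then show ?thesis using mp.tidealD(4)[OF t] f(3) that by blast
      qed
    qed
    ultimately show "\<exists>f\<in>forms r j. f \<notin> P \<and> (\<forall>P'\<in>insert P' F. f \<in> P')" by blast
  qed
qed

text \<open>Given \<open>n + 1\<close> points with separating forms of a common degree, these forms
  satisfy a relation modulo \<open>Q\<close>, because the space has dimension \<open>n\<close>
  there. At the point of the leading coefficient all other terms vanish.\<close>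

lemma Pts_finite: "finite Pts"
proof (rule ccontr)
  assume inf: "infinite Pts"
  from infinite_countable_subset[OF this]
  obtain g :: "nat \<Rightarrow> 'k mpol set" where g0: "inj g \<and> range g \<subseteq> Pts" by (rule exE)
  have g: "inj g" "range g \<subseteq> Pts" using g0 by (rule conjunct1, rule conjunct2)
  have "\<forall>i. \<exists>d. \<forall>j\<ge>d. \<exists>f\<in>forms r j. f \<notin> g i \<and> (\<forall>P'\<in>g ` ({..n} - {i}). f \<in> P')"
  proof
    fix i show "\<exists>d. \<forall>j\<ge>d. \<exists>f\<in>forms r j. f \<notin> g i \<and> (\<forall>P'\<in>g ` ({..n} - {i}). f \<in> P')"
    proof (rule Pts_separate)
      show "g ` ({..n} - {i}) \<subseteq> Pts" "g i \<in> Pts" using g(2) by blast+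
      show "g i \<notin> g ` ({..n} - {i})" using g(1) by (auto dest: injD)
    qed simp
  qed
  from choice[OF this] obtain d where d0: "\<forall>i. \<forall>j\<ge>d i. \<exists>f\<in>forms r j. f \<notin> g i \<and> (\<forall>P'\<in>g ` ({..n} - {i}). f \<in> P')" by (rule exE)
  have d: "\<exists>f\<in>forms r j. f \<notin> g i \<and> (\<forall>P'\<in>g ` ({..n} - {i}). f \<in> P')" if "d i \<le> j" for i j
    by (rule mp[OF spec[OF spec[OF d0, of i], of j] that])
  define j where "j = N + (\<Sum>i\<le>n. d i)"
  have dj: "d i \<le> j" if "i \<le> n" for i
  proof -
    have "d i \<le> (\<Sum>i\<le>n. d i)" by (rule member_le_sum) (use that in auto)
    then show ?thesis unfolding j_def by linarith
  qed
  have "\<forall>i. \<exists>f. i \<le> n \<longrightarrow> f \<in> forms r j \<and> f \<notin> g i \<and> (\<forall>P'\<in>g ` ({..n} - {i}). f \<in> P')"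
  proof
    fix i show "\<exists>f. i \<le> n \<longrightarrow> f \<in> forms r j \<and> f \<notin> g i \<and> (\<forall>P'\<in>g ` ({..n} - {i}). f \<in> P')"
    proof (cases "i \<le> n")
      case True
      obtain f where "f \<in> forms r j" "f \<notin> g i \<and> (\<forall>P'\<in>g ` ({..n} - {i}). f \<in> P')" using d[OF dj[OF True]] by (rule bexE)
      then show ?thesis by (intro exI[of _ f]) simp
    qed simp
  qed
  then have "\<exists>f. \<forall>i. i \<le> n \<longrightarrow> f i \<in> forms r j \<and> f i \<notin> g i \<and> (\<forall>P'\<in>g ` ({..n} - {i}). f i \<in> P')" by (rule choice)
  then obtain f where f0: "\<And>i. i \<le> n \<Longrightarrow> f i \<in> forms r j \<and> f i \<notin> g i \<and> (\<forall>P'\<in>g ` ({..n} - {i}). f i \<in> P')" by blast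
  have f: "i \<le> n \<Longrightarrow> f i \<in> forms r j" "i \<le> n \<Longrightarrow> f i \<notin> g i" for i using f0 by blast+
  have f3: "f i \<in> g k" if "i \<le> n" "k \<le> n" "k \<noteq> i" for i k using f0[OF that(1)] that(2,3) by blast
  have cq: "mp.codim (comp r Q j) = n" by (rule hilb) (simp add: j_def)
  have fc: "mp.fcod (comp r Q j)" by (rule comp_codim(1)[OF mp.tideal_subspace[OF hidD(1)[OF Q]]])
  obtain p where p: "p \<noteq> 0" "mp.psum p f \<in> comp r Q j" "Polynomial.degree p \<le> mp.codim (comp r Q j)"
    using mp.ex_relation[OF fc, of f] .
  note p = p(1,2) p(3)[unfolded cq]
  let ?d = "Polynomial.degree p"
  have "mp.psum p f \<in> forms r j"
    unfolding mp.psum_def using f(1) p(3) by (intro forms_sum mpol.subspace_scale[OF forms_subspace]) auto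
  then have "mp.psum p f \<in> Q" using p(2) by (simp add: comp_def hcr_form)
  then have pP: "mp.psum p f \<in> g ?d" using g(2) by blast
  have t: "mp.tideal (g ?d)" using g(2) hprimeD(1) by blast
  have "mp.psum p f = scalem (Polynomial.coeff p ?d) (f ?d) + (\<Sum>i\<in>{..?d}-{?d}. scalem (Polynomial.coeff p i) (f i))"
    unfolding mp.psum_def by (intro sum.remove) auto
  moreover have "(\<Sum>i\<in>{..?d}-{?d}. scalem (Polynomial.coeff p i) (f i)) \<in> g ?d"
    using f3 p(3) by (intro mp.tidealD(8)[OF t] mp.tidealD(7)[OF t]) auto
  ultimately have "scalem (Polynomial.coeff p ?d) (f ?d) \<in> g ?d"
    using mp.tideal_add_cancel[OF t] pP by simp
  then have "scalem (1 / Polynomial.coeff p ?d) (scalem (Polynomial.coeff p ?d) (f ?d)) \<in> g ?d" by (rule mp.tidealD(7)[OF t])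
  then have "f ?d \<in> g ?d" using p(1) by simp
  then show False using f(2) p(3) by blast
qed

text \<open>The sum over the points of forms that are nonzero at exactly one of them. Large degrees
  are taken because over a finite field every linear form may vanish at some point.\<close>

lemma ex_nonvanishing:
  obtains d where "\<And>j. d \<le> j \<Longrightarrow> \<exists>g\<in>forms r j. \<forall>P\<in>Pts. g \<notin> P"
proof -
  have "\<forall>P\<in>Pts. \<exists>d. \<forall>j\<ge>d. \<exists>f\<in>forms r j. f \<notin> P \<and> (\<forall>P'\<in>Pts - {P}. f \<in> P')"
  proof
    fix P assume "P \<in> Pts"
    then show "\<exists>d. \<forall>j\<ge>d. \<exists>f\<in>forms r j. f \<notin> P \<and> (\<forall>P'\<in>Pts - {P}. f \<in> P')"
    proof (rule Pts_separate[OF finite_Diff[OF Pts_finite] Diff_subset])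
      show "P \<notin> Pts - {P}" by simp
    qed
  qed
  from bchoice[OF this] obtain d where d0: "\<forall>P\<in>Pts. \<forall>j\<ge>d P. \<exists>f\<in>forms r j. f \<notin> P \<and> (\<forall>P'\<in>Pts - {P}. f \<in> P')" by (rule exE)
  have "\<exists>g\<in>forms r j. \<forall>P\<in>Pts. g \<notin> P" if j: "(\<Sum>P\<in>Pts. d P) \<le> j" for j
  proof -
    have le: "d P \<le> j" if "P \<in> Pts" for P
      by (rule order_trans[OF member_le_sum[OF that _ Pts_finite] j]) simp
    have "\<forall>P\<in>Pts. \<exists>f. f \<in> forms r j \<and> f \<notin> P \<and> (\<forall>P'\<in>Pts - {P}. f \<in> P')"
    proof
      fix P assume P: "P \<in> Pts"
      obtain f where "f \<in> forms r j" "f \<notin> P \<and> (\<forall>P'\<in>Pts - {P}. f \<in> P')"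
        using mp[OF spec[OF bspec[OF d0 P], of j] le[OF P]] by (rule bexE)
      then show "\<exists>f. f \<in> forms r j \<and> f \<notin> P \<and> (\<forall>P'\<in>Pts - {P}. f \<in> P')" by (intro exI[of _ f]) simp
    qed
    from bchoice[OF this] obtain f where f0: "\<forall>P\<in>Pts. f P \<in> forms r j \<and> f P \<notin> P \<and> (\<forall>P'\<in>Pts - {P}. f P \<in> P')" by (rule exE)
    have f: "f P \<in> forms r j \<and> f P \<notin> P \<and> (\<forall>P'\<in>Pts - {P}. f P \<in> P')" if "P \<in> Pts" for P using bspec[OF f0 that] .
    have "(\<Sum>P\<in>Pts. f P) \<notin> P" if P: "P \<in> Pts" for P
    proof
      assume s: "(\<Sum>P\<in>Pts. f P) \<in> P"
      have t: "mp.tideal P" using P hprimeD(1) by blast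
      have "(\<Sum>P\<in>Pts. f P) = f P + (\<Sum>P'\<in>Pts - {P}. f P')" using Pts_finite P by (rule sum.remove)
      moreover have "(\<Sum>P'\<in>Pts - {P}. f P') \<in> P" using f P by (intro mp.tidealD(8)[OF t]) blast
      ultimately have "f P \<in> P" using mp.tideal_add_cancel[OF t] s by simp
      then show False using f P by blast
    qed
    moreover have "(\<Sum>P\<in>Pts. f P) \<in> forms r j" using f by (intro forms_sum) blast
    ultimately show ?thesis by blast
  qed
  then show thesis using that by blast
qed

text \<open>Otherwise \<open>(Q : f)\<close> is a homogeneous ideal which by saturation contains no
  power of the irrelevant ideal; so it lies in one of the points, and it contains
  \<open>g\<close>.\<close>

lemma nonvanishing_nzd:
  assumes "\<forall>P\<in>Pts. g \<notin> P" "f \<in> forms r i" "g * f \<in> Q"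
  shows "f \<in> Q"
proof (rule ccontr)
  assume fQ: "f \<notin> Q"
  let ?H = "mp.quo Q f"
  have tQ: "mp.tideal Q" by (rule hidD(1)[OF Q])
  have hH: "hid r ?H"
  proof (rule hid_superset[OF Q mp.tideal_quo[OF tQ] mp.quo_superset[OF tQ]])
    fix x j assume "x \<in> ?H"
    then have "hcr r (j + i) (f * x) \<in> Q" using hidD(2)[OF Q] by (simp add: mp.quo_def)
    then show "hcr r j x \<in> ?H" using hcr_form_mult[OF assms(2), of "j + i" x] by (simp add: mp.quo_def)
  qed
  have "\<not> forms r j \<subseteq> ?H" for j
    using sat[OF assms(2), of j] fQ by (auto simp: mp.quo_def mult.commute)
  then obtain P where P: "hprime r P" "?H \<subseteq> P" using ex_hprime[OF hH] by blast
  then have "P \<in> Pts" using mp.quo_superset[OF tQ, of f] by (auto simp: Pts_def)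
  moreover have "g \<in> P" using P(2) assms(3) by (auto simp: mp.quo_def mult.commute)
  ultimately show False using assms(1) by blast
qed

text \<open>With \<open>g\<close> and \<open>h\<close> of degrees \<open>M\<close> and
  \<open>M + 1\<close> vanishing at no point, \<open>h / g\<close> generates \<open>O(1)\<close>,
  and a form \<open>f\<close> of degree \<open>j\<close> becomes the function
  \<open>f * (g / h)^j\<close>. The ideal is the kernel of the resulting homomorphism on all
  polynomials, which sends the variables beyond \<open>x_r\<close> to 0.\<close>

lemma ex_affine:
  "\<exists>\<aa>. mp.tideal \<aa> \<and> (\<forall>j. \<forall>f\<in>forms r j. f \<in> \<aa> \<longleftrightarrow> f \<in> Q) \<and> (\<forall>j\<ge>N. \<forall>p. \<exists>f\<in>forms r j. p - f \<in> \<aa>)"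
proof -
  have tQ: "mp.tideal Q" by (rule hidD(1)[OF Q])
  have sQ: "mpol.subspace Q" by (rule mp.tideal_subspace[OF tQ])
  obtain M where M: "\<exists>g\<in>forms r j. \<forall>P\<in>Pts. g \<notin> P" if "M \<le> j" for j using ex_nonvanishing by metis
  obtain g where g: "g \<in> forms r M" "\<forall>P\<in>Pts. g \<notin> P" using M[of M] by blast
  obtain h where h: "h \<in> forms r (M + 1)" "\<forall>P\<in>Pts. h \<notin> P" using M[of "M + 1"] by auto
  have nzd: "f \<in> Q" if "f \<in> forms r i" "u ^ k * f \<in> Q" "u \<in> forms r d" "\<forall>P\<in>Pts. u \<notin> P" for f i u k d
    using that(2)
  proof (induction k)
    case (Suc k)
    have "u ^ k * f \<in> forms r (d * k + i)" by (rule forms_mult[OF forms_power[OF that(3)] that(1)])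
    moreover have "u * (u ^ k * f) \<in> Q" using Suc.prems by (simp add: mult.assoc)
    ultimately have "u ^ k * f \<in> Q" by (rule nonvanishing_nzd[OF that(4)])
    then show ?case by (rule Suc.IH)
  qed simp
  \<comment> \<open>The numerator of the image of \<open>f\<close> over the common denominator
    \<open>h ^ D\<close>; it is a form of degree \<open>(M + 1) * D\<close>.\<close>
  define S where "S D f = (\<Sum>j\<le>D. hcr r j f * (g ^ j * h ^ (D - j)))" for D f
  have form1: "f * (g ^ j * h ^ (D - j)) \<in> forms r ((M + 1) * D)" if "f \<in> forms r j" "j \<le> D" for f j D
  proof -
    have "j + (M * j + (M + 1) * (D - j)) = (M + 1) * (j + (D - j))" by (simp add: algebra_simps)
    then have "j + (M * j + (M + 1) * (D - j)) = (M + 1) * D" using that(2) by simp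
    then show ?thesis using forms_mult[OF that(1) forms_mult[OF forms_power[OF g(1), of j] forms_power[OF h(1), of "D - j"]]] by simp
  qed
  have Sform: "S D f \<in> forms r ((M + 1) * D)" for D f
    unfolding S_def by (intro forms_sum form1 hcr_forms) simp
  have Sadd: "S D (f + f') = S D f + S D f'" for D f f'
    by (simp add: S_def hcr_simps distrib_right sum.distrib)
  have Sdiff: "S D (f - f') = S D f - S D f'" for D f f'
    by (simp add: S_def hcr_simps left_diff_distrib sum_subtractf)
  have Smono: "S (D + k) f = h ^ k * S D f" if "\<And>j. D < j \<Longrightarrow> hcr r j f = 0" for D k f
  proof -
    have "S (D + k) f = (\<Sum>j\<le>D. hcr r j f * (g ^ j * h ^ (D + k - j)))"
      unfolding S_def using that by (intro sum.mono_neutral_right) auto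
    also have "\<dots> = (\<Sum>j\<le>D. h ^ k * (hcr r j f * (g ^ j * h ^ (D - j))))"
    proof (rule sum.cong[OF refl])
      fix j assume "j \<in> {..D}"
      then have "D + k - j = k + (D - j)" by simp
      then show "hcr r j f * (g ^ j * h ^ (D + k - j)) = h ^ k * (hcr r j f * (g ^ j * h ^ (D - j)))"
        by (simp add: power_add mult_ac)
    qed
    finally show ?thesis by (simp add: S_def sum_distrib_left)
  qed
  \<comment> \<open>Membership refers to large \<open>D\<close> because a small \<open>D\<close>
    would truncate \<open>f\<close>. By \<open>Smono\<close> any single \<open>D\<close> beyond
    which \<open>f\<close> has no components decides it, as \<open>aI\<close> and \<open>aD\<close>
    record.\<close>
  define \<aa> where "\<aa> = {f. \<exists>D0. \<forall>D\<ge>D0. S D f \<in> Q}"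
  have aI: "f \<in> \<aa>" if "S D f \<in> Q" "\<And>j. D < j \<Longrightarrow> hcr r j f = 0" for D f
    unfolding \<aa>_def
  proof (intro CollectI exI[of _ D] allI impI)
    fix D' assume "D \<le> D'"
    then obtain k where "D' = D + k" using le_Suc_ex by blast
    then show "S D' f \<in> Q" using Smono[OF that(2), where k = k] mp.tidealD(3)[OF tQ that(1)] by simp
  qed
  have aD: "S D f \<in> Q" if "f \<in> \<aa>" "\<And>j. D < j \<Longrightarrow> hcr r j f = 0" for D f
  proof -
    have "\<exists>D0. \<forall>D\<ge>D0. S D f \<in> Q" using that(1) by (simp add: \<aa>_def)
    then obtain D0 where "\<forall>D\<ge>D0. S D f \<in> Q" by (rule exE)
    then have "S (D + D0) f \<in> Q" by simp
    then have "h ^ D0 * S D f \<in> Q" using Smono[OF that(2), where k = D0] by simp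
    then show ?thesis by (rule nzd[OF Sform _ h])
  qed
  have t: "mp.tideal \<aa>" unfolding mp.tideal_def
  proof (intro conjI ballI allI)
    show 0: "0 \<in> \<aa>" using mp.tidealD(1)[OF tQ] by (auto simp: \<aa>_def S_def hcr_simps)
    show add: "x + y \<in> \<aa>" if xy: "x \<in> \<aa>" "y \<in> \<aa>" for x y
    proof -
      have "\<exists>D0. \<forall>D\<ge>D0. S D x \<in> Q" "\<exists>D0. \<forall>D\<ge>D0. S D y \<in> Q" using xy by (simp_all add: \<aa>_def)
      then obtain D0 D1 where "\<forall>D\<ge>D0. S D x \<in> Q" "\<forall>D\<ge>D1. S D y \<in> Q" by (elim exE)
      then have "\<forall>D\<ge>max D0 D1. S D (x + y) \<in> Q" using mp.tidealD(2)[OF tQ] by (simp add: Sadd)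
      then show ?thesis unfolding \<aa>_def by (intro CollectI) (rule exI)
    qed
    fix x assume x: "x \<in> \<aa>"
    show "a * x \<in> \<aa>" for a
    proof (induction a rule: pm_induct)
      case zero then show ?case using 0 by simp
    next
      case (single m c)
      show ?case
      proof (cases "Poly_Mapping.keys m \<subseteq> {..r}")
        case False
        then have "S D (Poly_Mapping.single m c * x) = 0" for D by (simp add: S_def hcr_bad_mult)
        then show ?thesis using mp.tidealD(1)[OF tQ] by (simp add: \<aa>_def)
      next
        case True
        define e where "e = mdeg m"
        have m: "m \<in> mons r e" using True by (simp add: mons_def e_def)
        define D where "D = dbound x"
        let ?s = "Poly_Mapping.single m c"
        have z: "hcr r j x = 0" if "D < j" for j using hcr_dbound that by (simp add: D_def)
        \<comment> \<open>A monomial of degree \<open>e\<close> shifts the components by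
          \<open>e\<close>, so the numerator is multiplied by \<open>?s * g ^ e\<close>.\<close>
        have "S (D + e) (?s * x) = (\<Sum>j\<in>{0+e..D+e}. hcr r j (?s * x) * (g ^ j * h ^ (D + e - j)))"
          unfolding S_def by (intro sum.mono_neutral_right) (auto simp: hcr_single_mult[OF m])
        also have "\<dots> = (\<Sum>j\<in>{0..D}. hcr r (j + e) (?s * x) * (g ^ (j + e) * h ^ (D + e - (j + e))))"
          by (rule sum.shift_bounds_cl_nat_ivl)
        also have "\<dots> = (\<Sum>j\<in>{0..D}. (?s * g ^ e) * (hcr r j x * (g ^ j * h ^ (D - j))))"
        proof (rule sum.cong[OF refl])
          fix j
          have "hcr r (j + e) (?s * x) = ?s * hcr r j x" by (simp add: hcr_single_mult[OF m])
          then show "hcr r (j + e) (?s * x) * (g ^ (j + e) * h ^ (D + e - (j + e))) = (?s * g ^ e) * (hcr r j x * (g ^ j * h ^ (D - j)))"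
            by (simp add: power_add mult_ac)
        qed
        also have "\<dots> = (?s * g ^ e) * S D x" by (simp add: S_def sum_distrib_left atMost_atLeast0)
        finally have "S (D + e) (?s * x) \<in> Q" using mp.tidealD(3)[OF tQ aD[OF x z]] by simp
        moreover have "hcr r j (?s * x) = 0" if "D + e < j" for j using z[of "j - e"] that by (simp add: hcr_single_mult[OF m])
        ultimately show ?thesis by (rule aI)
      qed
    next
      case (add p q) then show ?case using \<open>\<And>x y. x \<in> \<aa> \<Longrightarrow> y \<in> \<aa> \<Longrightarrow> x + y \<in> \<aa>\<close> by (simp add: distrib_right)
    qed
  qed
  have unit: "(g ^ j * h ^ k) * f \<in> Q \<longleftrightarrow> f \<in> Q" if "f \<in> forms r i" for f i j k
  proof
    assume "(g ^ j * h ^ k) * f \<in> Q"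
    then have "g ^ j * (h ^ k * f) \<in> Q" by (simp add: mult.assoc)
    then have "h ^ k * f \<in> Q" by (rule nzd[OF forms_mult[OF forms_power[OF h(1)] that] _ g])
    then show "f \<in> Q" by (rule nzd[OF that _ h])
  qed (rule mp.tidealD(3)[OF tQ])
  have Sf: "S D f = (g ^ j * h ^ (D - j)) * f" if "f \<in> forms r j" "j \<le> D" for f j D
  proof -
    have "S D f = (\<Sum>i\<in>{j}. hcr r i f * (g ^ i * h ^ (D - i)))"
      unfolding S_def using that by (intro sum.mono_neutral_right) (auto simp: hcr_form)
    then show ?thesis using that by (simp add: hcr_form mult.commute)
  qed
  have E1: "f \<in> \<aa> \<longleftrightarrow> f \<in> Q" if f: "f \<in> forms r j" for f j
  proof -
    have z: "hcr r i f = 0" if "j < i" for i using that f by (simp add: hcr_form)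
    have "f \<in> \<aa> \<longleftrightarrow> S j f \<in> Q" using aI aD z by blast
    then show ?thesis using Sf[OF f order_refl] unit[OF f, of j 0] by simp
  qed
  \<comment> \<open>Multiplication by \<open>?u\<close> is injective modulo \<open>Q\<close> from
    degree \<open>j\<close> to degree \<open>(M + 1) * D\<close>. Both degrees are at least
    \<open>N\<close>, so both spaces have the same dimension, and the numerator of \<open>p\<close>
    is also that of a form of degree \<open>j\<close>.\<close>
  have E2: "\<exists>f\<in>forms r j. p - f \<in> \<aa>" if j: "N \<le> j" for j p
  proof -
    define D where "D = max j (dbound p)"
    let ?u = "g ^ j * h ^ (D - j)"
    have u: "?u \<in> forms r (M * j + (M + 1) * (D - j))" by (rule forms_mult[OF forms_power[OF g(1)] forms_power[OF h(1)]])
    let ?d = "M * j + (M + 1) * (D - j)"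
    have jD: "j \<le> D" by (simp add: D_def)
    have "j + ?d = (M + 1) * (j + (D - j))" by (simp add: algebra_simps)
    then have d: "j + ?d = (M + 1) * D" using jD by simp
    have "mp.codim (comp r Q (j + ?d)) \<le> mp.codim (comp r Q j)" using hilb[OF j] hilb[of "j + ?d"] j by simp
    moreover have "S D p \<in> forms r (j + ?d)" unfolding d by (rule Sform)
    moreover have "?u * f \<in> Q \<longleftrightarrow> f \<in> Q" if "f \<in> forms r j" for f by (rule unit[OF that])
    ultimately have "\<exists>f\<in>forms r j. S D p - ?u * f \<in> Q" by (intro comp_mult(2)[OF sQ u])
    then obtain f where f: "f \<in> forms r j" "S D p - ?u * f \<in> Q" by (rule bexE)
    have "S D (p - f) \<in> Q" using f(2) Sf[OF f(1) jD] by (simp add: Sdiff)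
    moreover have "hcr r i (p - f) = 0" if "D < i" for i
      using that hcr_dbound[of p i r] hcr_form[OF f(1), of i] by (simp add: hcr_simps D_def)
    ultimately have "p - f \<in> \<aa>" by (rule aI)
    then show ?thesis using f(1) by blast
  qed
  show ?thesis using t E1 E2 by blast
qed

end

lemma finite_subscheme_presents:
  fixes I :: "'k::field mpol set"
  assumes "finite_subscheme r I"
  obtains \<aa> N where "presents r I \<aa> N" "mp.codim \<aa> = scheme_degree r I"
proof -
  have h: "homogeneous_ideal r I" and st: "saturated r I" and ex: "\<exists>d. \<forall>\<^sub>F n in sequentially. hilbert_fun r I n = d"
    using assms by (auto simp: finite_subscheme_def closed_subscheme_def)
  have I: "ideal I (polyring r)" "\<And>f j. f \<in> I \<Longrightarrow> hcr r j f \<in> I" using h by (auto simp: homogeneous_ideal_iff)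
  obtain d N where N: "\<And>n. N \<le> n \<Longrightarrow> hilbert_fun r I n = d" using ex by (auto simp: eventually_sequentially)
  \<comment> \<open>The extension of \<open>I\<close> to the full polynomial ring, with the same
    forms.\<close>
  define Q where "Q = {f :: 'k mpol. \<forall>j. hcr r j f \<in> I}"
  have QI: "f \<in> Q \<longleftrightarrow> f \<in> I" if "f \<in> forms r n" for f n
    using that ideal_polyringD(2)[OF I(1)] by (auto simp: Q_def hcr_form)
  have tQ: "mp.tideal Q" unfolding mp.tideal_def Q_def
    using ideal_polyringD(2,3)[OF I(1)] hcr_mult_ideal[OF I(1)] by (auto simp: hcr_simps)
  have hQ: "hid r Q" unfolding hid_def using tQ QI[OF hcr_forms] by (auto simp: Q_def)
  interpret finite_hid r Q d N
  proof
    show "hid r Q" by (rule hQ)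
    fix i k and f :: "'k mpol" assume f: "f \<in> forms r i" and g: "\<And>g. g \<in> forms r k \<Longrightarrow> g * f \<in> Q"
    have "\<forall>g\<in>forms r k. g * f \<in> I" using g QI[OF forms_mult[OF _ f]] by blast
    then have "f \<in> I" using st f forms_carrier unfolding saturated_def by blast
    then show "f \<in> Q" using QI[OF f] by simp
  next
    fix e assume e: "N \<le> e"
    have "forms r e \<inter> Q = I \<inter> forms r e" using QI by blast
    then have "mpol.dim (forms r e :: 'k mpol set) = mp.codim (comp r Q e) + mpol.dim (I \<inter> forms r e)"
      using comp_codim(2)[OF mp.tideal_subspace[OF tQ], of r e] by simp
    then show "mp.codim (comp r Q e) = d" using N[OF e] by (simp add: hilbert_fun_def)
  qed
  obtain \<aa> where a: "mp.tideal \<aa>" "\<And>j f. f \<in> forms r j \<Longrightarrow> f \<in> \<aa> \<longleftrightarrow> f \<in> Q" "\<And>j p. N \<le> j \<Longrightarrow> \<exists>f\<in>forms r j. p - f \<in> \<aa>"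
    using ex_affine by blast
  have "mp.fcod \<aa>" by (rule mp.ex_compl[OF mp.tideal_subspace[OF a(1)] forms_fdim a(3)[OF order_refl]])
  then have p: "presents r I \<aa> N" unfolding presents_def using a QI by blast
  moreover have "scheme_degree r I = mp.codim \<aa>"
    by (rule presents_degree[OF p mp.tideal_subspace[OF a(1)] order_refl]) (use a(2) QI in blast)
  ultimately show thesis using that by simp
qed

section \<open>Local rings\<close>

text \<open>A ring given by a carrier is tied to the ambient algebra by a surjection
  \<open>\<rho>\<close> with kernel \<open>\<qq>\<close>, so that its identities become congruences
  modulo \<open>\<qq>\<close>.\<close>

locale quotient_ring = comm_alg scale
  for scale :: "'a::field \<Rightarrow> 'b::comm_ring_1 \<Rightarrow> 'b" (infixr \<open>*s\<close> 75) +
  fixes R :: "'r ring" and \<rho> :: "'b \<Rightarrow> 'r" and \<qq> :: "'b set"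
  assumes R: "carrier R = range \<rho>" "\<And>x y. \<rho> x \<otimes>\<^bsub>R\<^esub> \<rho> y = \<rho> (x * y)" "\<And>x y. \<rho> x \<oplus>\<^bsub>R\<^esub> \<rho> y = \<rho> (x + y)"
      "\<one>\<^bsub>R\<^esub> = \<rho> 1" "\<zero>\<^bsub>R\<^esub> = \<rho> 0"
    and rho_eq: "\<And>x y. \<rho> x = \<rho> y \<longleftrightarrow> x - y \<in> \<qq>" and tqR: "tideal \<qq>"

context
  fixes r :: nat and I \<aa> P :: "'k::field mpol set" and N :: nat
  assumes p: "presents r I \<aa> N" and P: "P \<in> points r I"
begin

text \<open>The maximal ideal over \<open>\<aa>\<close> that corresponds to the point
  \<open>P\<close>.\<close>

private definition "mx = {x. \<exists>j. \<exists>f\<in>forms r j. f \<in> P \<and> x - f \<in> \<aa>}"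

private lemma ta: "mp.tideal \<aa>" by (rule presentsD(1)[OF p])

private lemma Pfacts: "ideal P (polyring r)" "I \<subseteq> P" "\<not> forms r 1 \<subseteq> P"
  using P by (auto simp: points_def homogeneous_ideal_def)

private lemma Pprime: "f \<in> forms r i \<Longrightarrow> g \<in> forms r j \<Longrightarrow> f * g \<in> P \<Longrightarrow> f \<in> P \<or> g \<in> P"
  using P primeideal.I_prime[of P "polyring r" f g] forms_carrier by (auto simp: points_def)

private lemma Pmult: "f \<in> P \<Longrightarrow> g \<in> forms r j \<Longrightarrow> f * g \<in> P"
  using ideal_polyringD(4)[OF Pfacts(1), of f g] forms_carrier by (auto simp: mult.commute)

private lemma rep: "N \<le> j \<Longrightarrow> \<exists>f\<in>forms r j. x - f \<in> \<aa>" by (rule presentsD(4)[OF p])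

private lemma same_degree: "f \<in> forms r j \<Longrightarrow> g \<in> forms r j \<Longrightarrow> f - g \<in> \<aa> \<Longrightarrow> f \<in> P \<longleftrightarrow> g \<in> P"
proof -
  assume f: "f \<in> forms r j" "g \<in> forms r j" "f - g \<in> \<aa>"
  have d: "f - g \<in> P" using presentsD(3)[OF p forms_diff[OF f(1,2)]] f(3) Pfacts(2) by blast
  show ?thesis using ideal_polyringD(5)[OF Pfacts(1) _ d, of f] ideal_polyringD(3)[OF Pfacts(1) d, of g] by auto
qed

text \<open>If \<open>G\<close> were in \<open>P\<close>, every form of degree \<open>3 * j\<close>
  would be congruent modulo \<open>\<aa>\<close> to a multiple \<open>f' * (G * G)\<close> of the
  same degree, hence lie in \<open>P\<close>; but some linear form has no power in
  \<open>P\<close>.\<close>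

private lemma one_rep:
  assumes G: "G \<in> forms r j" "N \<le> j" "1 - G \<in> \<aa>"
  shows "G \<notin> P"
proof
  assume GP: "G \<in> P"
  have all: "f \<in> P" if f: "f \<in> forms r (3 * j)" for f
  proof -
    obtain f' where f': "f' \<in> forms r j" "f - f' \<in> \<aa>" using rep[OF G(2)] by blast
    have "f' * (G * G) \<in> forms r (3 * j)" using forms_mult[OF f'(1) forms_mult[OF G(1,1)]] by (simp add: numeral_3_eq_3)
    moreover have "f - f' * (G * G) = (f - f') + f' * (1 + G) * (1 - G)" by (simp add: algebra_simps)
    then have "f - f' * (G * G) \<in> \<aa>" by (simp only: mp.tidealD(2)[OF ta f'(2) mp.tidealD(3)[OF ta G(3)]])
    moreover have "f' * (G * G) \<in> P" using Pmult[OF GP forms_mult[OF f'(1) G(1)]] by (simp add: mult_ac)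
    ultimately show ?thesis using same_degree[OF f] by blast
  qed
  obtain x where x: "x \<in> forms r 1" "x \<notin> P" using Pfacts(3) by blast
  have "x ^ k \<notin> P" for k
  proof (induction k)
    case 0
    have "x \<in> P" if "1 \<in> P" using Pmult[OF that x(1)] by simp
    then show ?case using x(2) by auto
  next
    case (Suc k) then show ?case using Pprime[OF x(1) forms_power[OF x(1), of k]] x(2) by auto
  qed
  then show False using all[of "x ^ (3 * j)"] forms_power[OF x(1), of "3 * j"] by simp
qed

text \<open>By \<open>same_degree\<close> the claim holds for forms of equal degree. Multiplying by
  representatives of 1 of degrees \<open>N + i\<close> and \<open>N + j\<close> brings
  \<open>f\<close> and \<open>g\<close> to the common degree \<open>N + i + j\<close>, and these
  factors are outside \<open>P\<close>.\<close>

private lemma agree: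
  assumes f: "f \<in> forms r j" "g \<in> forms r i" "f - g \<in> \<aa>"
  shows "f \<in> P \<longleftrightarrow> g \<in> P"
proof -
  obtain G1 where G1: "G1 \<in> forms r (N + i)" "1 - G1 \<in> \<aa>" using rep[of "N + i" 1] by auto
  obtain G2 where G2: "G2 \<in> forms r (N + j)" "1 - G2 \<in> \<aa>" using rep[of "N + j" 1] by auto
  have "f * G1 \<in> forms r (j + (N + i))" "g * G2 \<in> forms r (j + (N + i))"
    using forms_mult[OF f(1) G1(1)] forms_mult[OF f(2) G2(1)] by (simp_all add: add_ac)
  moreover have "f * G1 - g * G2 = (f - g) + g * (1 - G2) - f * (1 - G1)" by (simp add: algebra_simps)
  then have "f * G1 - g * G2 \<in> \<aa>"
    using mp.tidealD(6)[OF ta mp.tidealD(2)[OF ta f(3) mp.tidealD(3)[OF ta G2(2)]] mp.tidealD(3)[OF ta G1(2)]] by simp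
  ultimately have "f * G1 \<in> P \<longleftrightarrow> g * G2 \<in> P" by (rule same_degree)
  moreover have "f * G1 \<in> P \<longleftrightarrow> f \<in> P" using Pmult[OF _ G1(1)] Pprime[OF f(1) G1(1)] one_rep[OF G1(1) le_add1 G1(2)] by blast
  moreover have "g * G2 \<in> P \<longleftrightarrow> g \<in> P" using Pmult[OF _ G2(1)] Pprime[OF f(2) G2(1)] one_rep[OF G2(1) le_add1 G2(2)] by blast
  ultimately show ?thesis by blast
qed

private lemma mx_iff:
  assumes f: "f \<in> forms r j" "x - f \<in> \<aa>"
  shows "x \<in> mx \<longleftrightarrow> f \<in> P"
proof
  assume "x \<in> mx"
  then obtain i g where g: "g \<in> forms r i" "g \<in> P" "x - g \<in> \<aa>" by (auto simp: mx_def)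
  have "f - g \<in> \<aa>" using mp.tidealD(6)[OF ta g(3) f(2)] by simp
  then show "f \<in> P" using agree[OF f(1) g(1)] g(2) by simp
qed (use f in \<open>auto simp: mx_def\<close>)

private lemma mx_form: "f \<in> forms r j \<Longrightarrow> f \<in> mx \<longleftrightarrow> f \<in> P"
  by (rule mx_iff) (simp_all add: mp.tidealD(1)[OF ta])

private definition "S x = (SOME f. f \<in> forms r N \<and> x - f \<in> \<aa>)"

private lemma S: "S x \<in> forms r N" "x - S x \<in> \<aa>"
  using someI_ex[of "\<lambda>f. f \<in> forms r N \<and> x - f \<in> \<aa>"] rep[OF order_refl, of x] unfolding S_def by blast+

private lemma mxS: "x \<in> mx \<longleftrightarrow> S x \<in> P" by (rule mx_iff[OF S])

private lemma mx_prod: "x * y \<in> mx \<longleftrightarrow> S x * S y \<in> P"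
proof (rule mx_iff[OF forms_mult[OF S(1) S(1)]])
  have "x * y - S x * S y = y * (x - S x) + S x * (y - S y)" by (simp add: algebra_simps)
  then show "x * y - S x * S y \<in> \<aa>" using mp.tidealD(2)[OF ta mp.tidealD(3)[OF ta S(2)] mp.tidealD(3)[OF ta S(2)]] by simp
qed

private lemma mx_superset: "\<aa> \<subseteq> mx"
proof
  fix x assume "x \<in> \<aa>"
  then show "x \<in> mx" using mx_iff[OF forms_0, of x] ideal_polyringD(2)[OF Pfacts(1)] by simp
qed

text \<open>Primality comes from \<open>P\<close>, and a prime ideal of finite codimension is
  maximal by \<open>power_stable\<close>.\<close>

private lemma mx_maxi: "mp.maxi mx"
proof -
  have prime: "x \<in> mx \<or> y \<in> mx" if "x * y \<in> mx" for x y
    using that Pprime[OF S(1) S(1)] unfolding mx_prod mxS[of x] mxS[of y] by blast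
  have one: "1 \<notin> mx" using one_rep[OF S(1) order_refl S(2)] by (simp add: mxS)
  have t: "mp.tideal mx" unfolding mp.tideal_def
  proof (intro conjI ballI allI)
    show "0 \<in> mx" using mx_superset mp.tidealD(1)[OF ta] by blast
    fix x assume x: "x \<in> mx"
    show "a * x \<in> mx" for a using x Pmult[OF _ S(1), of "S x"] unfolding mult.commute[of a] mx_prod mxS[of x] by blast
    fix y assume y: "y \<in> mx"
    have "(x + y) - (S x + S y) \<in> \<aa>" using mp.tidealD(2)[OF ta S(2)[of x] S(2)[of y]] by (simp add: algebra_simps)
    then show "x + y \<in> mx" using mx_iff[OF forms_add[OF S(1) S(1)]] ideal_polyringD(3)[OF Pfacts(1)] x y by (simp add: mxS)
  qed
  have "\<exists>y. 1 - x * y \<in> mx" if x: "x \<notin> mx" for x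
  proof -
    obtain i y where iy: "x ^ i * (1 - x * y) \<in> \<aa>" using mp.power_stable[OF presentsD(2,1)[OF p], of x] .
    have "x ^ i \<notin> mx" using x one prime by (induction i) auto
    then show ?thesis using prime[of "x ^ i" "1 - x * y"] iy mx_superset by blast
  qed
  then show ?thesis using t one by (simp add: mp.maxi_def)
qed

private lemma mx_degree: "scheme_degree r P = mp.codim mx"
  by (rule presents_degree[OF p mp.tideal_subspace[OF mp.maxi_tideal[OF mx_maxi]] mx_superset]) (simp add: mx_form)

private abbreviation "\<qq> \<equiv> mp.loc \<aa> mx"

private lemma tq: "mp.tideal \<qq>" by (rule mp.tideal_loc[OF mx_maxi ta])

private lemma aq: "\<aa> \<subseteq> \<qq>" by (rule mp.loc_superset[OF mx_maxi])

private lemma q_cancel: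
  assumes "x * y \<in> \<qq>" "y \<notin> mx"
  shows "x \<in> \<qq>"
proof -
  obtain z where z: "z \<notin> mx" "x * y * z \<in> \<aa>" using assms(1) by (auto simp: mp.loc_def)
  have "y * z \<notin> mx" using mp.maxi_prime[OF mx_maxi] assms(2) z(1) by blast
  moreover have "x * (y * z) \<in> \<aa>" using z(2) by (simp add: mult_ac)
  ultimately show ?thesis by (auto simp: mp.loc_def)
qed

private lemma fracsD:
  assumes "(f, g) \<in> fracs r P"
  obtains n where "f \<in> forms r n" "g \<in> forms r n" "g \<notin> mx"
  using assms mx_form by (auto simp: fracs_def)

private lemma fracsI: "f \<in> forms r n \<Longrightarrow> g \<in> forms r n \<Longrightarrow> g \<notin> mx \<Longrightarrow> (f, g) \<in> fracs r P"
  using mx_form by (auto simp: fracs_def)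

text \<open>The factor \<open>h\<close> in \<open>frac_rel\<close> plays the part of the factor
  outside \<open>mx\<close> in \<open>loc\<close>; an arbitrary such factor \<open>y\<close> is
  replaced by the form \<open>S y\<close>.\<close>

private lemma rel_iff:
  assumes F: "(f, g) \<in> fracs r P" "(f', g') \<in> fracs r P"
  shows "((f, g), (f', g')) \<in> frac_rel r I P \<longleftrightarrow> f * g' - f' * g \<in> \<qq>"
proof -
  obtain n where n: "f \<in> forms r n" "g \<in> forms r n" by (rule fracsD[OF F(1)])
  obtain n' where n': "f' \<in> forms r n'" "g' \<in> forms r n'" by (rule fracsD[OF F(2)])
  let ?d = "f * g' - f' * g"
  have d: "?d \<in> forms r (n + n')"
    using forms_diff[OF forms_mult[OF n(1) n'(2)]] forms_mult[OF n'(1) n(2)] by (simp add: add.commute)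
  have "(\<exists>n. \<exists>h\<in>forms r n. h \<notin> P \<and> h * ?d \<in> I) \<longleftrightarrow> ?d \<in> \<qq>"
  proof
    assume "\<exists>n. \<exists>h\<in>forms r n. h \<notin> P \<and> h * ?d \<in> I"
    then obtain i h where h: "h \<in> forms r i" "h \<notin> P" "h * ?d \<in> I" by blast
    have "?d * h \<in> \<aa>" using presentsD(3)[OF p forms_mult[OF h(1) d]] h(3) by (simp add: mult.commute)
    then show "?d \<in> \<qq>" using h(2) mx_form[OF h(1)] by (auto simp: mp.loc_def)
  next
    assume "?d \<in> \<qq>"
    then obtain y where y: "y \<notin> mx" "?d * y \<in> \<aa>" by (auto simp: mp.loc_def)
    have "S y * ?d = ?d * y - ?d * (y - S y)" by (simp add: algebra_simps)
    then have "S y * ?d \<in> \<aa>" using mp.tidealD(6)[OF ta y(2) mp.tidealD(3)[OF ta S(2)]] by simp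
    then have "S y * ?d \<in> I" using presentsD(3)[OF p forms_mult[OF S(1) d]] by simp
    then show "\<exists>n. \<exists>h\<in>forms r n. h \<notin> P \<and> h * ?d \<in> I" using S(1) y(1) by (auto simp: mxS)
  qed
  then show ?thesis using F by (simp add: frac_rel_def)
qed

text \<open>Numerator and denominator need the same degree, so 1 too is represented by a form of
  degree \<open>N\<close>.\<close>

private definition "\<rho> x = frac_class r I P (S x) (S 1)"

private lemma S1: "S 1 \<notin> mx" using mx_maxi mx_form[OF S(1)] mxS by (auto simp: mp.maxi_def)

text \<open>With the fractions in a class described in this way, every identity in the local ring is
  a congruence modulo \<open>\<qq>\<close>.\<close>

private lemma frac_val: "(f, g) \<in> \<rho> x \<longleftrightarrow> (f, g) \<in> fracs r P \<and> f - x * g \<in> \<qq>"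
proof -
  have Sx: "(S x, S 1) \<in> fracs r P" by (rule fracsI[OF S(1) S(1) S1])
  have "S x * g - f * S 1 \<in> \<qq> \<longleftrightarrow> f - x * g \<in> \<qq>"
  proof -
    have "(S x * g - f * S 1) - (- (f - x * g)) = f * (1 - S 1) - g * (x - S x)" by (simp add: algebra_simps)
    then have "(S x * g - f * S 1) - (- (f - x * g)) \<in> \<qq>"
      using mp.tidealD(6)[OF ta mp.tidealD(3)[OF ta S(2)] mp.tidealD(3)[OF ta S(2)]] aq by auto
    then have "S x * g - f * S 1 \<in> \<qq> \<longleftrightarrow> - (f - x * g) \<in> \<qq>" by (rule mp.tideal_cong[OF tq])
    also have "\<dots> \<longleftrightarrow> f - x * g \<in> \<qq>" using mp.tidealD(5)[OF tq, of "- (f - x * g)"] mp.tidealD(5)[OF tq, of "f - x * g"] by auto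
    finally show ?thesis .
  qed
  moreover have "(f, g) \<in> \<rho> x \<longleftrightarrow> ((S x, S 1), (f, g)) \<in> frac_rel r I P" by (auto simp: \<rho>_def frac_class_def)
  moreover have "((S x, S 1), (f, g)) \<in> frac_rel r I P \<Longrightarrow> (f, g) \<in> fracs r P" by (simp add: frac_rel_def)
  ultimately show ?thesis using rel_iff[OF Sx] by blast
qed

private lemma frac_exists:
  assumes "(f, g) \<in> fracs r P"
  shows "\<exists>x. f - x * g \<in> \<qq>"
proof -
  obtain n where n: "f \<in> forms r n" "g \<in> forms r n" "g \<notin> mx" by (rule fracsD[OF assms])
  obtain y where y: "1 - g * y \<in> \<qq>" by (rule mp.loc_unit[OF presentsD(2)[OF p] mx_maxi ta n(3)])
  have "f - (f * y) * g = f * (1 - g * y)" by (simp add: algebra_simps)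
  then show ?thesis using mp.tidealD(3)[OF tq y] by metis
qed

private lemma frac_class_eq:
  assumes F: "(f, g) \<in> fracs r P" and x: "f - x * g \<in> \<qq>"
  shows "frac_class r I P f g = \<rho> x"
proof -
  obtain n where n: "f \<in> forms r n" "g \<in> forms r n" "g \<notin> mx" by (rule fracsD[OF F])
  have "(f', g') \<in> frac_class r I P f g \<longleftrightarrow> (f', g') \<in> \<rho> x" for f' g'
  proof (cases "(f', g') \<in> fracs r P")
    case True
    then obtain n' where n': "g' \<notin> mx" by (rule fracsD)
    have "(f', g') \<in> frac_class r I P f g \<longleftrightarrow> f * g' - f' * g \<in> \<qq>" using rel_iff[OF F True] by (auto simp: frac_class_def)
    also have "\<dots> \<longleftrightarrow> (x * g' - f') * g \<in> \<qq>"
      by (rule mp.tideal_cong[OF tq]) (use mp.tidealD(3)[OF tq x, of g'] in \<open>simp add: algebra_simps\<close>)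
    also have "\<dots> \<longleftrightarrow> x * g' - f' \<in> \<qq>" using q_cancel[OF _ n(3)] mp.tidealD(4)[OF tq] by blast
    also have "\<dots> \<longleftrightarrow> f' - x * g' \<in> \<qq>" using mp.tidealD(5)[OF tq, of "x * g' - f'"] mp.tidealD(5)[OF tq, of "f' - x * g'"] by auto
    finally show ?thesis using True by (simp add: frac_val)
  next
    case False then show ?thesis by (auto simp: frac_val frac_class_def frac_rel_def)
  qed
  then show ?thesis by auto
qed

private lemma rho_mem: "(S x, S 1) \<in> \<rho> x"
proof -
  have "S x - x * S 1 = x * (1 - S 1) - (x - S x)" by (simp add: algebra_simps)
  moreover have "x * (1 - S 1) - (x - S x) \<in> \<qq>" using mp.tidealD(6)[OF ta mp.tidealD(3)[OF ta S(2)] S(2)] aq by blast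
  ultimately show ?thesis unfolding frac_val using fracsI[OF S(1) S(1) S1] by (simp only:)
qed

private lemma local_ring_quotient: "quotient_ring scalem (local_ring_at r I P) \<rho> \<qq>"
proof
  let ?R = "local_ring_at r I P"
  have F1: "(1, 1) \<in> fracs r P" "(0, 1) \<in> fracs r P"
    by (rule fracsI[OF one_in_forms one_in_forms], use mx_maxi in \<open>simp add: mp.maxi_def\<close>)
      (rule fracsI[OF forms_0 one_in_forms], use mx_maxi in \<open>simp add: mp.maxi_def\<close>)
  show "\<one>\<^bsub>?R\<^esub> = \<rho> 1" "\<zero>\<^bsub>?R\<^esub> = \<rho> 0"
    using frac_class_eq[OF F1(1), of 1] frac_class_eq[OF F1(2), of 0] mp.tidealD(1)[OF tq] by (simp_all add: local_ring_at_def)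
  have prod_val: "(f * f', g * g') \<in> fracs r P" "f * f' - (x * y) * (g * g') \<in> \<qq>"
    and sum_val: "(f * g' + f' * g, g * g') \<in> fracs r P" "f * g' + f' * g - (x + y) * (g * g') \<in> \<qq>"
    if fg: "(f, g) \<in> \<rho> x" "(f', g') \<in> \<rho> y" for f g f' g' x y
  proof -
    have F: "(f, g) \<in> fracs r P" "f - x * g \<in> \<qq>" "(f', g') \<in> fracs r P" "f' - y * g' \<in> \<qq>" using fg by (auto simp: frac_val)
    obtain n where n: "f \<in> forms r n" "g \<in> forms r n" "g \<notin> mx" by (rule fracsD[OF F(1)])
    obtain n' where n': "f' \<in> forms r n'" "g' \<in> forms r n'" "g' \<notin> mx" by (rule fracsD[OF F(3)])
    have gg: "g * g' \<notin> mx" using n(3) n'(3) mp.maxi_prime[OF mx_maxi] by blast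
    show "(f * f', g * g') \<in> fracs r P" by (rule fracsI[OF forms_mult[OF n(1) n'(1)] forms_mult[OF n(2) n'(2)] gg])
    have "f' * g \<in> forms r (n + n')" using forms_mult[OF n'(1) n(2)] by (simp add: add.commute)
    then show "(f * g' + f' * g, g * g') \<in> fracs r P"
      using fracsI[OF forms_add[OF forms_mult[OF n(1) n'(2)]] forms_mult[OF n(2) n'(2)] gg] by blast
    have "f * f' - (x * y) * (g * g') = f' * (f - x * g) + (x * g) * (f' - y * g')" by (simp add: algebra_simps)
    then show "f * f' - (x * y) * (g * g') \<in> \<qq>" using mp.tidealD(2)[OF tq mp.tidealD(3)[OF tq F(2)] mp.tidealD(3)[OF tq F(4)]] by simp
    have "f * g' + f' * g - (x + y) * (g * g') = g' * (f - x * g) + g * (f' - y * g')" by (simp add: algebra_simps)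
    then show "f * g' + f' * g - (x + y) * (g * g') \<in> \<qq>" using mp.tidealD(2)[OF tq mp.tidealD(3)[OF tq F(2)] mp.tidealD(3)[OF tq F(4)]] by simp
  qed
  show "\<rho> x \<otimes>\<^bsub>?R\<^esub> \<rho> y = \<rho> (x * y)" for x y
  proof -
    have "\<rho> x \<otimes>\<^bsub>?R\<^esub> \<rho> y = (\<Union>(f, g)\<in>\<rho> x. \<Union>(f', g')\<in>\<rho> y. frac_class r I P (f * f') (g * g'))" by (simp add: local_ring_at_def)
    also have "\<dots> = (\<Union>(f, g)\<in>\<rho> x. \<Union>(f', g')\<in>\<rho> y. \<rho> (x * y))"
    proof (intro SUP_cong refl, clarify, intro SUP_cong refl, clarify)
      fix f g f' g' assume "(f, g) \<in> \<rho> x" "(f', g') \<in> \<rho> y"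
      then show "frac_class r I P (f * f') (g * g') = \<rho> (x * y)" by (intro frac_class_eq[OF prod_val])
    qed
    finally show ?thesis using rho_mem[of x] rho_mem[of y] by fastforce
  qed
  show "\<rho> x \<oplus>\<^bsub>?R\<^esub> \<rho> y = \<rho> (x + y)" for x y
  proof -
    have "\<rho> x \<oplus>\<^bsub>?R\<^esub> \<rho> y = (\<Union>(f, g)\<in>\<rho> x. \<Union>(f', g')\<in>\<rho> y. frac_class r I P (f * g' + f' * g) (g * g'))" by (simp add: local_ring_at_def)
    also have "\<dots> = (\<Union>(f, g)\<in>\<rho> x. \<Union>(f', g')\<in>\<rho> y. \<rho> (x + y))"
    proof (intro SUP_cong refl, clarify, intro SUP_cong refl, clarify)
      fix f g f' g' assume "(f, g) \<in> \<rho> x" "(f', g') \<in> \<rho> y"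
      then show "frac_class r I P (f * g' + f' * g) (g * g') = \<rho> (x + y)" by (intro frac_class_eq[OF sum_val])
    qed
    finally show ?thesis using rho_mem[of x] rho_mem[of y] by fastforce
  qed
  show "\<rho> x = \<rho> y \<longleftrightarrow> x - y \<in> \<qq>" for x y
  proof
    assume "\<rho> x = \<rho> y"
    then have "(S x, S 1) \<in> \<rho> y" using rho_mem[of x] by simp
    then have "S x - x * S 1 \<in> \<qq>" "S x - y * S 1 \<in> \<qq>" using rho_mem[of x] unfolding frac_val by auto
    then have "(S x - y * S 1) - (S x - x * S 1) \<in> \<qq>" using mp.tidealD(6)[OF tq] by blast
    then have "(x - y) * S 1 \<in> \<qq>" by (simp add: algebra_simps)
    then show "x - y \<in> \<qq>" by (rule q_cancel[OF _ S1])
  next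
    assume d: "x - y \<in> \<qq>"
    have "f - x * g \<in> \<qq> \<longleftrightarrow> f - y * g \<in> \<qq>" for f g
      by (rule mp.tideal_cong[OF tq]) (use mp.tidealD(5)[OF tq mp.tidealD(3)[OF tq d, of g]] in \<open>simp add: algebra_simps\<close>)
    then show "\<rho> x = \<rho> y" using frac_val by auto
  qed
  show "carrier ?R = range \<rho>"
  proof
    show "range \<rho> \<subseteq> carrier ?R"
    proof
      fix A assume "A \<in> range \<rho>"
      then obtain x where "A = frac_class r I P (S x) (S 1)" by (auto simp: \<rho>_def)
      then show "A \<in> carrier ?R" using fracsI[OF S(1) S(1) S1, of x] by (auto simp: local_ring_at_def quotient_def frac_class_def)
    qed
    show "carrier ?R \<subseteq> range \<rho>"
    proof
      fix A assume "A \<in> carrier ?R"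
      then obtain f g where fg: "(f, g) \<in> fracs r P" "A = frac_class r I P f g"
        by (auto simp: local_ring_at_def quotient_def frac_class_def)
      obtain x where "f - x * g \<in> \<qq>" using frac_exists[OF fg(1)] by (rule exE)
      then show "A \<in> range \<rho>" using frac_class_eq[OF fg(1)] fg(2) by simp
    qed
  qed
qed (rule tq)

text \<open>The interface to local rings. Fractions survive only in the last clause, which later
  computes the image of the linear forms.\<close>

lemma local_ring_at_quotient:
  obtains m \<rho> where "mp.maxi m" "\<aa> \<subseteq> m" "scheme_degree r P = mp.codim m" "\<And>f j. f \<in> forms r j \<Longrightarrow> f \<in> m \<longleftrightarrow> f \<in> P"
    "quotient_ring scalem (local_ring_at r I P) \<rho> (mp.loc \<aa> m)"
    "\<And>f g n x. f \<in> forms r n \<Longrightarrow> g \<in> forms r n \<Longrightarrow> g \<notin> P \<Longrightarrow> f - x * g \<in> mp.loc \<aa> m \<Longrightarrow> frac_class r I P f g = \<rho> x"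
proof (rule that)
  show "frac_class r I P f g = \<rho> x" if "f \<in> forms r n" "g \<in> forms r n" "g \<notin> P" "f - x * g \<in> \<qq>" for f g n x
    using frac_class_eq that by (auto simp: fracs_def)
qed (rule mx_maxi mx_superset mx_degree mx_form local_ring_quotient, assumption?)+

end

section \<open>Coefficient fields\<close>

context comm_alg
begin

lemma CHAR_eq: "CHAR('b) = CHAR('a)"
proof (rule CHAR_eqI)
  have of_nat: "of_nat n = scale (of_nat n) 1" for n :: nat
    by (induction n) (simp_all add: scale_left_distrib)
  show "of_nat CHAR('a) = (0 :: 'b)" by (simp add: of_nat)
  fix n :: nat assume "of_nat n = (0 :: 'b)"
  then have "of_nat n = (0 :: 'a)" by (simp add: of_nat)
  then show "CHAR('a) dvd n" by (simp add: of_nat_eq_0_iff_char_dvd)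
qed

lemma nat_unit:
  assumes "of_nat n \<noteq> (0 :: 'a)"
  shows "\<exists>y. of_nat n * y = (1 :: 'b)"
proof
  have "of_nat n = scale (of_nat n) (1 :: 'b)" for n :: nat
    by (induction n) (simp_all add: scale_left_distrib)
  then show "of_nat n * scale (inverse (of_nat n)) 1 = (1 :: 'b)" using assms by (simp add: scale_mult)
qed

end

locale local_quotient = comm_alg scale
  for scale :: "'a::field \<Rightarrow> 'b::comm_ring_1 \<Rightarrow> 'b" (infixr \<open>*s\<close> 75) +
  fixes \<qq> m :: "'b set" and \<nu> :: nat
  assumes tq: "tideal \<qq>" and mm: "maxi m" and qm: "\<qq> \<subseteq> m"
    and unit: "\<And>x. x \<notin> m \<Longrightarrow> \<exists>y. 1 - x * y \<in> \<qq>" and nil: "\<And>z. z \<in> m \<Longrightarrow> z ^ \<nu> \<in> \<qq>"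
begin

lemma tm: "tideal m" by (rule maxi_tideal[OF mm])

lemma one_notin: "1 \<notin> m" using mm by (simp add: maxi_def)

text \<open>Subrings containing \<open>\<qq>\<close>, standing for the subrings of the quotient by \<open>\<qq>\<close>.\<close>

definition sr :: "'b set \<Rightarrow> bool" where
  "sr L \<longleftrightarrow> \<qq> \<subseteq> L \<and> 1 \<in> L \<and> (\<forall>x\<in>L. \<forall>y\<in>L. x - y \<in> L) \<and> (\<forall>x\<in>L. \<forall>y\<in>L. x * y \<in> L)"

text \<open>Modulo \<open>\<qq>\<close>, such an \<open>L\<close> embeds into the residue field; a
  coefficient field is one that is also mapped onto it.\<close>

definition coh :: "'b set \<Rightarrow> bool" where "coh L \<longleftrightarrow> sr L \<and> L \<inter> m \<subseteq> \<qq>"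

definition inv_closed :: "'b set \<Rightarrow> bool" where
  "inv_closed T \<longleftrightarrow> (\<forall>x\<in>T. x \<notin> m \<longrightarrow> (\<exists>y\<in>T. 1 - x * y \<in> \<qq>))"

definition coeffs_in :: "'b set \<Rightarrow> 'b poly \<Rightarrow> bool" where "coeffs_in L f \<longleftrightarrow> (\<forall>i. Polynomial.coeff f i \<in> L)"

lemma srD:
  assumes "sr L"
  shows "x \<in> \<qq> \<Longrightarrow> x \<in> L" "1 \<in> L" "0 \<in> L" "x \<in> L \<Longrightarrow> y \<in> L \<Longrightarrow> x - y \<in> L" "x \<in> L \<Longrightarrow> y \<in> L \<Longrightarrow> x * y \<in> L"
    "x \<in> L \<Longrightarrow> y \<in> L \<Longrightarrow> x + y \<in> L" "x \<in> L \<Longrightarrow> x ^ n \<in> L" "(\<And>i. i \<in> F \<Longrightarrow> g i \<in> L) \<Longrightarrow> sum g F \<in> L"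
    "x \<in> L \<Longrightarrow> of_nat n * x \<in> L"
proof -
  have d: "\<And>x y. x \<in> L \<Longrightarrow> y \<in> L \<Longrightarrow> x - y \<in> L" and p: "\<And>x y. x \<in> L \<Longrightarrow> y \<in> L \<Longrightarrow> x * y \<in> L" and o: "1 \<in> L"
    using assms by (auto simp: sr_def)
  have z: "0 \<in> L" using d[OF o o] by simp
  have a: "x + y \<in> L" if "x \<in> L" "y \<in> L" for x y using d[OF that(1) d[OF z that(2)]] by simp
  show "x \<in> \<qq> \<Longrightarrow> x \<in> L" "1 \<in> L" "0 \<in> L" "x \<in> L \<Longrightarrow> y \<in> L \<Longrightarrow> x - y \<in> L" "x \<in> L \<Longrightarrow> y \<in> L \<Longrightarrow> x * y \<in> L"
    "x \<in> L \<Longrightarrow> y \<in> L \<Longrightarrow> x + y \<in> L" using assms z d p o a by (auto simp: sr_def)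
  show "x \<in> L \<Longrightarrow> x ^ n \<in> L" by (induction n) (simp_all add: o p)
  show "(\<And>i. i \<in> F \<Longrightarrow> g i \<in> L) \<Longrightarrow> sum g F \<in> L" by (induction F rule: infinite_finite_induct) (simp_all add: z a)
  show "of_nat n * x \<in> L" if "x \<in> L" using that by (induction n) (simp_all add: z a distrib_right)
qed

lemma sr_cong: "sr L \<Longrightarrow> x - y \<in> \<qq> \<Longrightarrow> y \<in> L \<Longrightarrow> x \<in> L"
  using srD(6)[of L "x - y" y] srD(1)[of L "x - y"] by auto

lemma coeffs_in_0: "sr L \<Longrightarrow> coeffs_in L 0" by (simp add: coeffs_in_def srD(3))

lemma coeffs_in_pCons: "coeffs_in L (pCons a f) \<longleftrightarrow> a \<in> L \<and> coeffs_in L f"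
proof
  assume h: "coeffs_in L (pCons a f)"
  have "Polynomial.coeff (pCons a f) 0 \<in> L" "\<And>i. Polynomial.coeff (pCons a f) (Suc i) \<in> L"
    using h unfolding coeffs_in_def by blast+
  then show "a \<in> L \<and> coeffs_in L f" by (simp add: coeffs_in_def)
qed (auto simp: coeffs_in_def coeff_pCons split: nat.split)

lemma coeffs_in_add: "sr L \<Longrightarrow> coeffs_in L f \<Longrightarrow> coeffs_in L g \<Longrightarrow> coeffs_in L (f + g)"
  and coeffs_in_diff: "sr L \<Longrightarrow> coeffs_in L f \<Longrightarrow> coeffs_in L g \<Longrightarrow> coeffs_in L (f - g)"
  and coeffs_in_smult: "sr L \<Longrightarrow> a \<in> L \<Longrightarrow> coeffs_in L f \<Longrightarrow> coeffs_in L (Polynomial.smult a f)"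
  and coeffs_in_monom: "sr L \<Longrightarrow> a \<in> L \<Longrightarrow> coeffs_in L (Polynomial.monom a n)"
  by (simp_all add: coeffs_in_def srD)

lemma coeffs_in_mult: "sr L \<Longrightarrow> coeffs_in L f \<Longrightarrow> coeffs_in L g \<Longrightarrow> coeffs_in L (f * g)"
  by (simp add: coeffs_in_def coeff_mult srD)

lemma poly_mem: "sr T \<Longrightarrow> coeffs_in T f \<Longrightarrow> c \<in> T \<Longrightarrow> poly f c \<in> T"
  by (induction f) (simp_all add: srD coeffs_in_pCons)

lemma poly_small:
  assumes "tideal J" "\<And>i. Polynomial.coeff f i \<in> J"
  shows "poly f c \<in> J"
  unfolding poly_altdef by (intro tidealD(8)[OF assms(1)] tidealD(4)[OF assms(1)] assms(2))

lemma poly_cong: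
  assumes J: "tideal J" and c: "c - c' \<in> J"
  shows "poly f c - poly f c' \<in> J"
proof (induction f)
  case 0 then show ?case by (simp add: tidealD(1)[OF J])
next
  case (pCons a f)
  have "poly (pCons a f) c - poly (pCons a f) c' = c * (poly f c - poly f c') + poly f c' * (c - c')" by (simp add: algebra_simps)
  then show ?case using tidealD(2)[OF J tidealD(3)[OF J pCons.IH] tidealD(3)[OF J c]] by (simp only:)
qed

section \<open>Division, Taylor expansion and Newton iteration over a subring\<close>

lemma monic_division:
  assumes L: "sr L" and g: "coeffs_in L g" "Polynomial.coeff g d = 1" "\<And>i. d < i \<Longrightarrow> Polynomial.coeff g i = 0" and f: "coeffs_in L f"
  shows "\<exists>q r. coeffs_in L q \<and> coeffs_in L r \<and> f = g * q + r \<and> (\<forall>i\<ge>d. Polynomial.coeff r i = 0)"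
  using f
proof (induction f)
  case 0 show ?case by (intro exI[of _ 0]) (simp add: coeffs_in_0[OF L])
next
  case (pCons a f)
  then have a: "a \<in> L" "coeffs_in L f" by (simp_all add: coeffs_in_pCons)
  obtain q r where qr: "coeffs_in L q" "coeffs_in L r" "f = g * q + r" "\<And>i. i \<ge> d \<Longrightarrow> Polynomial.coeff r i = 0"
    using pCons.IH[OF a(2)] by blast
  define r1 where "r1 = pCons a r"
  define b where "b = Polynomial.coeff r1 d"
  have r1: "coeffs_in L r1" using a qr(2) by (simp add: r1_def coeffs_in_pCons)
  then have b: "b \<in> L" by (simp add: b_def coeffs_in_def)
  have "pCons a f = g * (pCons b q) + (r1 - Polynomial.smult b g)"
    by (simp add: qr(3) r1_def)
  moreover have "coeffs_in L (pCons b q)" using b qr(1) by (simp add: coeffs_in_pCons)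
  moreover have "coeffs_in L (r1 - Polynomial.smult b g)" by (rule coeffs_in_diff[OF L r1 coeffs_in_smult[OF L b g(1)]])
  moreover have "Polynomial.coeff (r1 - Polynomial.smult b g) i = 0" if "d \<le> i" for i
  proof (cases "i = d")
    case False
    then have "i = Suc (i - 1)" "d \<le> i - 1" using that by linarith+
    then obtain k where "i = Suc k" "d \<le> k" by blast
    then show ?thesis using g(3)[of i] qr(4)[of k] by (simp add: r1_def)
  qed (simp add: b_def g(2))
  ultimately show ?case by blast
qed

text \<open>\<open>g'\<close> is the derivative. The remainder \<open>w\<close> is kept in
  \<open>T\<close> so that Newton iteration does not leave the subring.\<close>

lemma taylor:
  assumes T: "sr T" and g: "coeffs_in T g"
  shows "\<exists>g'. coeffs_in T g' \<and> (\<forall>i. Polynomial.coeff g' i = of_nat (Suc i) * Polynomial.coeff g (Suc i)) \<and>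
    (\<forall>c\<in>T. \<forall>h\<in>T. \<exists>w\<in>T. poly g (c + h) = poly g c + h * poly g' c + h * h * w)"
  using g
proof (induction g)
  case 0 show ?case using srD(3)[OF T] coeffs_in_0[OF T] by (intro exI[of _ 0]) (auto intro!: bexI[of _ 0])
next
  case (pCons a p)
  then have a: "a \<in> T" "coeffs_in T p" by (simp_all add: coeffs_in_pCons)
  obtain p' where p': "coeffs_in T p'" "\<And>i. Polynomial.coeff p' i = of_nat (Suc i) * Polynomial.coeff p (Suc i)"
    "\<And>c h. c \<in> T \<Longrightarrow> h \<in> T \<Longrightarrow> \<exists>w\<in>T. poly p (c + h) = poly p c + h * poly p' c + h * h * w"
    using pCons.IH[OF a(2)] by blast
  let ?g' = "p + pCons 0 p'"
  have "coeffs_in T ?g'" by (rule coeffs_in_add[OF T a(2)]) (simp add: coeffs_in_pCons p'(1) srD(3)[OF T])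
  moreover have "Polynomial.coeff ?g' i = of_nat (Suc i) * Polynomial.coeff (pCons a p) (Suc i)" for i
    by (cases i) (simp_all add: p'(2) algebra_simps)
  moreover have "\<exists>w\<in>T. poly (pCons a p) (c + h) = poly (pCons a p) c + h * poly ?g' c + h * h * w" if ch: "c \<in> T" "h \<in> T" for c h
  proof -
    obtain w where w: "w \<in> T" "poly p (c + h) = poly p c + h * poly p' c + h * h * w" using p'(3)[OF ch] by (rule bexE)
    have "poly p' c + c * w + h * w \<in> T" using srD(5,6)[OF T] poly_mem[OF T p'(1) ch(1)] ch w(1) by simp
    moreover have "poly (pCons a p) (c + h) = poly (pCons a p) c + h * poly ?g' c + h * h * (poly p' c + c * w + h * w)"
      by (simp add: w(2) algebra_simps)
    ultimately show ?thesis by blast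
  qed
  ultimately show ?case by blast
qed

text \<open>Newton's method. The initial error \<open>z\<close> lies in \<open>m\<close> and is
  nilpotent modulo \<open>\<qq>\<close>; gaining one power of \<open>z\<close> in each step is
  enough.\<close>

lemma newton:
  assumes T: "sr T" "inv_closed T" and g: "coeffs_in T g" "coeffs_in T g'" and c: "c \<in> T" "poly g c \<in> m" "poly g' c \<notin> m"
    and ty: "\<And>c h. c \<in> T \<Longrightarrow> h \<in> T \<Longrightarrow> \<exists>w\<in>T. poly g (c + h) = poly g c + h * poly g' c + h * h * w"
  shows "\<exists>c'\<in>T. c - c' \<in> m \<and> poly g c' \<in> \<qq>"
proof -
  define z where "z = poly g c"
  have zT: "z \<in> T" unfolding z_def by (rule poly_mem[OF T(1) g(1) c(1)])
  have step: "\<exists>c'\<in>T. c - c' \<in> m \<and> (\<exists>w\<in>T. poly g c' - z ^ Suc k * w \<in> \<qq>)" for k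
  proof (induction k)
    case 0
    have "poly g c - z ^ Suc 0 * 1 \<in> \<qq>" by (simp add: z_def tidealD(1)[OF tq])
    then show ?case using c(1) srD(2)[OF T(1)] tidealD(1)[OF tm] by (intro bexI[of _ c] conjI bexI[of _ 1]) simp_all
  next
    case (Suc k)
    then obtain c' w where c': "c' \<in> T" "c - c' \<in> m" "w \<in> T" "poly g c' - z ^ Suc k * w \<in> \<qq>" by blast
    have "poly g' c' \<notin> m" using tideal_cong[OF tm poly_cong[OF tm c'(2), of g']] c(3) by simp
    then obtain y where y: "y \<in> T" "1 - poly g' c' * y \<in> \<qq>" using T(2) poly_mem[OF T(1) g(2) c'(1)] unfolding inv_closed_def by blast
    \<comment> \<open>The Newton correction, where \<open>y\<close> inverts the derivative modulo
      \<open>\<qq>\<close> and \<open>z ^ Suc k * w\<close> replaces the value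
      \<open>poly g c'\<close> to which it is congruent.\<close>
    define h where "h = - (z ^ Suc k * w * y)"
    have zk: "z ^ Suc k * w * y \<in> T" by (intro srD(5,7)[OF T(1)] zT c' y) 
    then have hT: "h \<in> T" using srD(4)[OF T(1) srD(3)[OF T(1)]] by (simp add: h_def)
    obtain v where v: "v \<in> T" "poly g (c' + h) = poly g c' + h * poly g' c' + h * h * v" using ty[OF c'(1) hT] by (rule bexE)
    define w' where "w' = z ^ k * w * y * w * y * v"
    have "w' \<in> T" unfolding w'_def by (intro srD(5,7)[OF T(1)] zT c' y v)
    moreover have "poly g (c' + h) - z ^ Suc (Suc k) * w' = (poly g c' - z ^ Suc k * w) + (z ^ Suc k * w) * (1 - poly g' c' * y)"
      unfolding v(2) by (simp add: h_def w'_def algebra_simps)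
    then have "poly g (c' + h) - z ^ Suc (Suc k) * w' \<in> \<qq>"
      using tidealD(2)[OF tq c'(4) tidealD(3)[OF tq y(2)]] by (simp only:)
    moreover have "c - (c' + h) = (c - c') + z * (z ^ k * w * y)" by (simp add: h_def algebra_simps)
    then have "c - (c' + h) \<in> m" using tidealD(2)[OF tm c'(2) tidealD(4)[OF tm c(2)]] by (simp only: z_def)
    moreover have "c' + h \<in> T" by (rule srD(6)[OF T(1) c'(1) hT])
    ultimately show ?case by blast
  qed
  obtain c' w where c': "c' \<in> T" "c - c' \<in> m" "poly g c' - z ^ Suc \<nu> * w \<in> \<qq>" using step by blast
  have "z ^ Suc \<nu> * w \<in> \<qq>" using tidealD(4)[OF tq nil[OF c(2)]] tidealD(3)[OF tq] by (simp add: z_def mult.assoc)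
  then have "poly g c' \<in> \<qq>" using tideal_cong[OF tq c'(3)] by simp
  then show ?thesis using c' by blast
qed

text \<open>The \<open>x\<close> in \<open>T\<close> that some element of \<open>L\<close> outside
  \<open>m\<close> multiplies into \<open>L\<close> form a subring that still meets \<open>m\<close>
  only in \<open>\<qq>\<close>. It contains the required inverses, and maximality identifies it with
  \<open>L\<close>.\<close>

lemma coh_inv:
  assumes T: "sr T" "inv_closed T" and L: "coh L" "L \<subseteq> T"
    and max: "\<And>L'. coh L' \<Longrightarrow> L \<subseteq> L' \<Longrightarrow> L' \<subseteq> T \<Longrightarrow> L' = L"
  shows "inv_closed L"
  unfolding inv_closed_def
proof (intro ballI impI)
  fix l assume l: "l \<in> L" "l \<notin> m"
  obtain y where y: "y \<in> T" "1 - l * y \<in> \<qq>" using T(2) l L(2) unfolding inv_closed_def by blast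
  have sL: "sr L" using L(1) by (simp add: coh_def)
  define L' where "L' = {x \<in> T. \<exists>s\<in>L. s \<notin> m \<and> x * s \<in> L}"
  have "sr L'" unfolding sr_def
  proof (intro conjI ballI subsetI)
    show "x \<in> L'" if "x \<in> \<qq>" for x
      using that srD(1)[OF T(1) that] srD(1,2)[OF sL] one_notin by (auto simp: L'_def)
    show "1 \<in> L'" using srD(2)[OF T(1)] srD(2)[OF sL] one_notin by (auto simp: L'_def)
    fix a b assume "a \<in> L'" "b \<in> L'"
    then obtain s t where a: "a \<in> T" "s \<in> L" "s \<notin> m" "a * s \<in> L" and b: "b \<in> T" "t \<in> L" "t \<notin> m" "b * t \<in> L" by (auto simp: L'_def)
    have st: "s * t \<in> L" "s * t \<notin> m" using srD(5)[OF sL a(2) b(2)] maxi_prime[OF mm] a(3) b(3) by auto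
    have "(a - b) * (s * t) = (a * s) * t - s * (b * t)" "(a * b) * (s * t) = (a * s) * (b * t)" by (simp_all add: algebra_simps)
    then have "(a - b) * (s * t) \<in> L" "(a * b) * (s * t) \<in> L"
      using srD(4)[OF sL srD(5)[OF sL a(4) b(2)] srD(5)[OF sL a(2) b(4)]] srD(5)[OF sL a(4) b(4)] by (simp_all only:)
    then show "a - b \<in> L'" "a * b \<in> L'" using st srD(4,5)[OF T(1) a(1) b(1)] by (auto simp: L'_def)
  qed
  moreover have "x \<in> \<qq>" if x: "x \<in> L'" "x \<in> m" for x
  proof -
    obtain s where s: "s \<in> L" "s \<notin> m" "x * s \<in> L" using x(1) by (auto simp: L'_def)
    have "x * s \<in> \<qq>" using s(3) tidealD(4)[OF tm x(2)] L(1) by (auto simp: coh_def)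
    moreover obtain t where "1 - s * t \<in> \<qq>" using unit[OF s(2)] by (rule exE)
    moreover have "x = (x * s) * t + x * (1 - s * t)" by (simp add: algebra_simps)
    ultimately show ?thesis using tidealD(2)[OF tq tidealD(4)[OF tq] tidealD(3)[OF tq]] by metis
  qed
  moreover have "L \<subseteq> L'" "L' \<subseteq> T" using L(2) srD(2)[OF sL] one_notin by (auto simp: L'_def)
  ultimately have "L' = L" by (intro max) (auto simp: coh_def)
  moreover have "y * l \<in> L" by (rule sr_cong[OF sL _ srD(2)[OF sL]]) (use tidealD(5)[OF tq y(2)] in \<open>simp add: mult.commute\<close>)
  then have "y \<in> L'" using y(1) l by (auto simp: L'_def)
  ultimately show "\<exists>y\<in>L. 1 - l * y \<in> \<qq>" using y(2) by blast
qed

text \<open>By the second hypothesis on \<open>c\<close>, the ring generated by \<open>L\<close> and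
  \<open>c\<close> still meets \<open>m\<close> only in \<open>\<qq>\<close>, so maximality
  applies.\<close>

lemma coh_adjoin:
  assumes T: "sr T" and L: "coh L" "L \<subseteq> T" and max: "\<And>L'. coh L' \<Longrightarrow> L \<subseteq> L' \<Longrightarrow> L' \<subseteq> T \<Longrightarrow> L' = L"
    and c: "c \<in> T" "\<And>f. coeffs_in L f \<Longrightarrow> poly f c \<in> m \<Longrightarrow> poly f c \<in> \<qq>"
  shows "c \<in> L"
proof -
  have sL: "sr L" using L(1) by (simp add: coh_def)
  define L' where "L' = {x. \<exists>f. coeffs_in L f \<and> x - poly f c \<in> \<qq>}"
  have inL': "poly f c \<in> L'" if "coeffs_in L f" for f using that tidealD(1)[OF tq] by (auto simp: L'_def)
  have LL: "L \<subseteq> L'"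
  proof
    fix x assume "x \<in> L"
    then show "x \<in> L'" using inL'[of "[:x:]"] by (simp add: coeffs_in_pCons coeffs_in_0[OF sL])
  qed
  have "sr L'" unfolding sr_def
  proof (intro conjI ballI subsetI)
    show "x \<in> L'" if "x \<in> \<qq>" for x using LL srD(1)[OF sL that] by blast
    show "1 \<in> L'" using LL srD(2)[OF sL] by blast
    fix a b assume "a \<in> L'" "b \<in> L'"
    then obtain f g where f: "coeffs_in L f" "a - poly f c \<in> \<qq>" and g: "coeffs_in L g" "b - poly g c \<in> \<qq>" by (auto simp: L'_def)
    have "(a - b) - poly (f - g) c = (a - poly f c) - (b - poly g c)" by simp
    then have "(a - b) - poly (f - g) c \<in> \<qq>" using tidealD(6)[OF tq f(2) g(2)] by (simp only:)
    then show "a - b \<in> L'" using coeffs_in_diff[OF sL f(1) g(1)] unfolding L'_def by blast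
    have "a * b - poly (f * g) c = b * (a - poly f c) + poly f c * (b - poly g c)" by (simp add: algebra_simps)
    then have "a * b - poly (f * g) c \<in> \<qq>" using tidealD(2)[OF tq tidealD(3)[OF tq f(2)] tidealD(3)[OF tq g(2)]] by (simp only:)
    then show "a * b \<in> L'" using coeffs_in_mult[OF sL f(1) g(1)] unfolding L'_def by blast
  qed
  moreover have "x \<in> \<qq>" if x: "x \<in> L'" "x \<in> m" for x
  proof -
    obtain f where f: "coeffs_in L f" "x - poly f c \<in> \<qq>" using x(1) by (auto simp: L'_def)
    have "poly f c \<in> m" using tideal_cong[OF tm, of x "poly f c"] f(2) qm x(2) by blast
    then have "poly f c \<in> \<qq>" by (rule c(2)[OF f(1)])
    then show ?thesis using tideal_cong[OF tq f(2)] by simp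
  qed
  moreover have "L' \<subseteq> T"
  proof
    fix x assume "x \<in> L'"
    then obtain f where f: "coeffs_in L f" "x - poly f c \<in> \<qq>" by (auto simp: L'_def)
    have "coeffs_in T f" using f(1) L(2) by (auto simp: coeffs_in_def)
    then show "x \<in> T" using sr_cong[OF T f(2)] poly_mem[OF T _ c(1)] by blast
  qed
  ultimately have "L' = L" using max[OF _ LL] by (auto simp: coh_def)
  moreover have "coeffs_in L [:0, 1:]" by (simp add: coeffs_in_pCons coeffs_in_0[OF sL] srD[OF sL])
  then have "c \<in> L'" using inL'[of "[:0, 1:]"] by simp
  ultimately show ?thesis by simp
qed

text \<open>\<open>g\<close> lifts the minimal polynomial of the residue class of \<open>c\<close>
  over \<open>L\<close>; the last clause expresses that its degree \<open>d\<close> is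
  minimal.\<close>

lemma minimal_relation:
  assumes L: "coh L" "inv_closed L" and f: "coeffs_in L f" "poly f c \<in> m" "poly f c \<notin> \<qq>"
  shows "\<exists>g d. coeffs_in L g \<and> Polynomial.coeff g d = 1 \<and> (\<forall>i>d. Polynomial.coeff g i = 0) \<and> poly g c \<in> m \<and> 0 < d \<and>
    (\<forall>f i. coeffs_in L f \<longrightarrow> (\<forall>i\<ge>d. Polynomial.coeff f i = 0) \<longrightarrow> poly f c \<in> m \<longrightarrow> Polynomial.coeff f i \<in> \<qq>)"
proof -
  have sL: "sr L" using L(1) by (simp add: coh_def)
  \<comment> \<open>A polynomial relation of degree below \<open>d\<close> for the residue class of
    \<open>c\<close>, nontrivial modulo \<open>\<qq>\<close>.\<close>
  define bad where "bad d f \<longleftrightarrow> coeffs_in L f \<and> poly f c \<in> m \<and> (\<exists>i. Polynomial.coeff f i \<notin> \<qq>) \<and> (\<forall>i\<ge>d. Polynomial.coeff f i = 0)" for d f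
  have "bad (Suc (Polynomial.degree f)) f" using f poly_small[OF tq, of f c] by (auto simp: bad_def coeff_eq_0)
  then have ex: "\<exists>d f. bad d f" by blast
  define e where "e = (LEAST d. \<exists>f. bad d f)"
  obtain f0 where f0: "bad e f0" using LeastI_ex[OF ex] unfolding e_def by blast
  have least: "\<not> bad d f" if "d < e" for d f using not_less_Least[of d "\<lambda>d. \<exists>f. bad d f"] that unfolding e_def by blast
  have "e \<noteq> 0"
  proof
    assume "e = 0"
    then have "\<forall>i. Polynomial.coeff f0 i = 0" "\<exists>i. Polynomial.coeff f0 i \<notin> \<qq>" using f0 unfolding bad_def by blast+
    then show False using tidealD(1)[OF tq] by simp
  qed
  then obtain d where d: "e = Suc d" by (cases e) auto
  define a where "a = Polynomial.coeff f0 d"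
  have f0': "coeffs_in L f0" "poly f0 c \<in> m" "\<And>i. d < i \<Longrightarrow> Polynomial.coeff f0 i = 0" "\<exists>i. Polynomial.coeff f0 i \<notin> \<qq>"
    using f0 by (auto simp: bad_def d)
  have aL: "a \<in> L" using f0'(1) by (simp add: a_def coeffs_in_def)
  have aq: "a \<notin> \<qq>"
  proof
    assume a: "a \<in> \<qq>"
    \<comment> \<open>A leading coefficient in \<open>\<qq>\<close> could be removed without making
      the relation trivial, which contradicts the choice of \<open>e\<close>.\<close>
    let ?f = "f0 - Polynomial.monom a d"
    have "poly ?f c \<in> m" using tidealD(6)[OF tm f0'(2) tidealD(4)[OF tm, of a "c ^ d"]] a qm by (auto simp: poly_monom)
    moreover obtain i where i: "Polynomial.coeff f0 i \<notin> \<qq>" using f0'(4) by blast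
    then have "i \<noteq> d" using a by (auto simp: a_def)
    then have "Polynomial.coeff ?f i \<notin> \<qq>" using i by simp
    moreover have "Polynomial.coeff ?f i = 0" if "d \<le> i" for i using that f0'(3)[of i] by (cases "i = d") (simp_all add: a_def)
    ultimately have "bad d ?f" using coeffs_in_diff[OF sL f0'(1) coeffs_in_monom[OF sL aL]] unfolding bad_def by blast
    then show False using least[of d] d by simp
  qed
  then have "a \<notin> m" using aL L(1) by (auto simp: coh_def)
  then obtain b where b: "b \<in> L" "1 - a * b \<in> \<qq>" using L(2) aL unfolding inv_closed_def by blast
  \<comment> \<open>The leading coefficient \<open>a * b\<close> of the first summand is 1 only
    modulo \<open>\<qq>\<close>; the second summand makes it exactly 1, as division
    requires.\<close>
  define g where "g = Polynomial.smult b f0 + Polynomial.monom (1 - a * b) d"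
  have "coeffs_in L g" unfolding g_def by (intro coeffs_in_add coeffs_in_smult coeffs_in_monom sL b(1) f0'(1) srD(1)[OF sL b(2)])
  moreover have "Polynomial.coeff g d = 1" by (simp add: g_def a_def mult.commute)
  moreover have "\<forall>i>d. Polynomial.coeff g i = 0" using f0'(3) by (simp add: g_def)
  moreover have gm: "poly g c \<in> m"
    using tidealD(2)[OF tm tidealD(3)[OF tm f0'(2), of b] tidealD(4)[OF tm, of "1 - a * b" "c ^ d"]] b(2) qm by (auto simp: g_def poly_monom)
  moreover have "0 < d"
  proof (rule ccontr)
    assume "\<not> 0 < d"
    then have "g = [:1:]" using calculation(2,3) by (intro poly_eqI) (simp add: coeff_pCons split: nat.split)
    then show False using gm one_notin by simp
  qed
  moreover have "\<forall>f i. coeffs_in L f \<longrightarrow> (\<forall>i\<ge>d. Polynomial.coeff f i = 0) \<longrightarrow> poly f c \<in> m \<longrightarrow> Polynomial.coeff f i \<in> \<qq>"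
    using least[of d] d unfolding bad_def by blast
  ultimately show ?thesis by blast
qed

text \<open>Division by the monic \<open>g\<close> reduces a polynomial to degree below
  \<open>d\<close>, where \<open>min\<close> forces its coefficients into
  \<open>\<qq>\<close>.\<close>

lemma coh_adjoin_algebraic:
  assumes T: "sr T" and L: "coh L" "L \<subseteq> T" and max: "\<And>L'. coh L' \<Longrightarrow> L \<subseteq> L' \<Longrightarrow> L' \<subseteq> T \<Longrightarrow> L' = L"
    and c: "c \<in> T" and g: "coeffs_in L g" "Polynomial.coeff g d = 1" "\<And>i. d < i \<Longrightarrow> Polynomial.coeff g i = 0" "poly g c \<in> \<qq>"
    and min: "\<And>f i. coeffs_in L f \<Longrightarrow> \<forall>i\<ge>d. Polynomial.coeff f i = 0 \<Longrightarrow> poly f c \<in> m \<Longrightarrow> Polynomial.coeff f i \<in> \<qq>"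
  shows "c \<in> L"
proof (rule coh_adjoin[OF T L max c])
  fix f assume f: "coeffs_in L f" "poly f c \<in> m"
  have sL: "sr L" using L(1) by (simp add: coh_def)
  obtain q r where qr: "coeffs_in L r" "f = g * q + r" "\<forall>i\<ge>d. Polynomial.coeff r i = 0"
    using monic_division[OF sL g(1-3) f(1)] by blast
  have "poly f c - poly r c = poly g c * poly q c" by (simp add: qr(2))
  then have d: "poly f c - poly r c \<in> \<qq>" using tidealD(4)[OF tq g(4)] by (simp only:)
  then have "poly r c \<in> m" using tideal_cong[OF tm, of "poly f c" "poly r c"] f(2) qm by blast
  then have "\<And>i. Polynomial.coeff r i \<in> \<qq>" using min[OF qr(1,3)] by blast
  then have "poly r c \<in> \<qq>" by (rule poly_small[OF tq])
  then show "poly f c \<in> \<qq>" using tideal_cong[OF tq d] by simp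
qed assumption+

text \<open>Either all relations for \<open>c\<close> modulo \<open>m\<close> hold modulo
  \<open>\<qq>\<close>, or the residue class of \<open>c\<close> has a minimal polynomial of some
  degree \<open>d\<close>. If \<open>d\<close> is nonzero in the base field, its derivative does not
  vanish at \<open>c\<close>, and Newton's method moves \<open>c\<close> to an exact root. Otherwise
  the characteristic \<open>p\<close> divides \<open>d\<close>, and \<open>c\<close> is itself a
  root of \<open>x^p - a\<close> with \<open>a\<close> in \<open>L\<close>.\<close>

lemma coh_step:
  assumes T: "sr T" "inv_closed T" and L: "coh L" "L \<subseteq> T" and max: "\<And>L'. coh L' \<Longrightarrow> L \<subseteq> L' \<Longrightarrow> L' \<subseteq> T \<Longrightarrow> L' = L"
    and c: "c \<in> T" and ch: "CHAR('a) = 0 \<or> (\<exists>a\<in>L. 0 < CHAR('a) \<and> c ^ CHAR('a) - a \<in> \<qq>)"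
  shows "\<exists>l\<in>L. c - l \<in> m"
proof (cases "\<forall>f. coeffs_in L f \<longrightarrow> poly f c \<in> m \<longrightarrow> poly f c \<in> \<qq>")
  case True
  then have "c \<in> L" using coh_adjoin[OF T(1) L max c] by blast
  then show ?thesis using tidealD(1)[OF tm] by (intro bexI[of _ c]) simp_all
next
  case False
  have sL: "sr L" using L(1) by (simp add: coh_def)
  have iL: "inv_closed L" by (rule coh_inv[OF T L max])
  obtain f where f: "coeffs_in L f" "poly f c \<in> m" "poly f c \<notin> \<qq>" using False by blast
  obtain g d where gd: "coeffs_in L g \<and> Polynomial.coeff g d = 1 \<and> (\<forall>i>d. Polynomial.coeff g i = 0) \<and> poly g c \<in> m \<and> 0 < d \<and>
    (\<forall>f i. coeffs_in L f \<longrightarrow> (\<forall>i\<ge>d. Polynomial.coeff f i = 0) \<longrightarrow> poly f c \<in> m \<longrightarrow> Polynomial.coeff f i \<in> \<qq>)"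
    using minimal_relation[OF L(1) iL f] by (elim exE)
  then have g: "coeffs_in L g" "Polynomial.coeff g d = 1" "\<And>i. d < i \<Longrightarrow> Polynomial.coeff g i = 0" "poly g c \<in> m" "0 < d" by blast+
  have min: "Polynomial.coeff f i \<in> \<qq>" if "coeffs_in L f" "\<forall>i\<ge>d. Polynomial.coeff f i = 0" "poly f c \<in> m" for f i
    using gd that by blast
  show ?thesis
  proof (cases "of_nat d = (0 :: 'a)")
    case nd: False
    obtain k where k: "d = Suc k" using g(5) by (cases d) auto
    obtain g' where g': "coeffs_in L g'" "\<And>i. Polynomial.coeff g' i = of_nat (Suc i) * Polynomial.coeff g (Suc i)"
      using taylor[OF sL g(1)] by blast
    have gT: "coeffs_in T g" "coeffs_in T g'" using g(1) g'(1) L(2) by (auto simp: coeffs_in_def)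
    obtain g2 where g2: "\<And>i. Polynomial.coeff g2 i = of_nat (Suc i) * Polynomial.coeff g (Suc i)"
      and ty: "\<And>c h. c \<in> T \<Longrightarrow> h \<in> T \<Longrightarrow> \<exists>w\<in>T. poly g (c + h) = poly g c + h * poly g2 c + h * h * w"
      using taylor[OF T(1) gT(1)] by blast
    have "g2 = g'" by (rule poly_eqI) (simp only: g2 g'(2))
    note ty = ty[unfolded this]
    have "poly g' c \<notin> m"
    proof
      assume a: "poly g' c \<in> m"
      \<comment> \<open>The leading coefficient of the derivative is \<open>d\<close>, a unit, which
        minimality would put into \<open>\<qq>\<close>.\<close>
      have "Polynomial.coeff g' k \<in> \<qq>" by (rule min[OF g'(1) _ a]) (simp add: g'(2) g(3) k)
      then have q: "of_nat d \<in> \<qq>" using g(2) by (simp add: g'(2) k)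
      obtain y where "of_nat d * y = (1 :: 'b)" using nat_unit[OF nd] by (rule exE)
      then have "1 \<in> \<qq>" using tidealD(4)[OF tq q, of y] by simp
      then show False using one_notin qm by blast
    qed
    then obtain c' where c': "c' \<in> T" "c - c' \<in> m" "poly g c' \<in> \<qq>" using newton[OF T gT c g(4) _ ty] by blast
    have "c' \<in> L"
    proof (rule coh_adjoin_algebraic[OF T(1) L max c'(1) g(1-3) c'(3)])
      fix f i assume f: "coeffs_in L f" "\<forall>i\<ge>d. Polynomial.coeff f i = 0" "poly f c' \<in> m"
      have "poly f c \<in> m" using tideal_cong[OF tm poly_cong[OF tm c'(2), of f]] f(3) by simp
      then show "Polynomial.coeff f i \<in> \<qq>" using min[OF f(1,2)] by blast
    qed assumption+
    then show ?thesis using c'(2) by blast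
  next
    case True
    define p where "p = CHAR('a)"
    have pd: "p dvd d" using True by (simp add: of_nat_eq_0_iff_char_dvd p_def)
    then have p0: "0 < p" using g(5) by (intro Nat.gr0I) auto
    then obtain a where a: "a \<in> L" "c ^ p - a \<in> \<qq>" using ch unfolding p_def by auto
    have pd': "p \<le> d" using pd g(5) by (rule dvd_imp_le)
    \<comment> \<open>Since \<open>p \<le> d\<close>, the minimality of \<open>d\<close> also covers
      the relations of degree below \<open>p\<close>, so \<open>h\<close> can take the place of the
      minimal polynomial.\<close>
    define h where "h = Polynomial.monom 1 p - [:a:]"
    have "c \<in> L"
    proof (rule coh_adjoin_algebraic[OF T(1) L max c, where d = p])
      show "coeffs_in L h" unfolding h_def by (intro coeffs_in_diff coeffs_in_monom sL srD(2)[OF sL]) (simp add: coeffs_in_pCons a(1) coeffs_in_0[OF sL])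
      show "Polynomial.coeff h p = 1" using p0 by (simp add: h_def coeff_pCons split: nat.split)
      show "Polynomial.coeff h i = 0" if "p < i" for i using that p0 by (simp add: h_def coeff_pCons split: nat.split)
      show "poly h c \<in> \<qq>" using a(2) by (simp add: h_def poly_monom)
      fix f i assume f: "coeffs_in L f" "\<forall>i\<ge>p. Polynomial.coeff f i = 0" "poly f c \<in> m"
      then show "Polynomial.coeff f i \<in> \<qq>" using min[OF f(1) _ f(3)] pd' by simp
    qed assumption+
    then show ?thesis using tidealD(1)[OF tm] by (intro bexI[of _ c]) simp_all
  qed
qed

section \<open>Coefficient fields in characteristic 0 and in positive characteristic\<close>

lemma ex_maximal_coh:
  assumes "coh L0" "L0 \<subseteq> T"
  shows "\<exists>L. coh L \<and> L0 \<subseteq> L \<and> L \<subseteq> T \<and> (\<forall>L'. coh L' \<longrightarrow> L \<subseteq> L' \<longrightarrow> L' \<subseteq> T \<longrightarrow> L' = L)"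
proof -
  define \<A> where "\<A> = {L. coh L \<and> L0 \<subseteq> L \<and> L \<subseteq> T}"
  have "\<exists>M\<in>\<A>. \<forall>Y\<in>\<A>. M \<subseteq> Y \<longrightarrow> Y = M"
  proof (rule subset_Zorn_nonempty)
    show "\<A> \<noteq> {}" using assms by (auto simp: \<A>_def)
    fix C assume C: "C \<noteq> {}" "subset.chain \<A> C"
    then have CA: "C \<subseteq> \<A>" and lin: "\<And>A B. A \<in> C \<Longrightarrow> B \<in> C \<Longrightarrow> A \<subseteq> B \<or> B \<subseteq> A" by (auto simp: subset_chain_def)
    have sC: "sr A" "A \<inter> m \<subseteq> \<qq>" if "A \<in> C" for A using CA that by (auto simp: \<A>_def coh_def)
    have "sr (\<Union>C)" unfolding sr_def
    proof (intro conjI ballI)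
      obtain A where A: "A \<in> C" using C(1) by blast
      show "\<qq> \<subseteq> \<Union>C" "1 \<in> \<Union>C" using A srD(1,2)[OF sC(1)[OF A]] by blast+
      fix x y assume "x \<in> \<Union>C" "y \<in> \<Union>C"
      then obtain B B' where "B \<in> C" "B' \<in> C" "x \<in> B" "y \<in> B'" by blast
      then obtain B where B: "B \<in> C" "x \<in> B" "y \<in> B" using lin by blast
      show "x - y \<in> \<Union>C" "x * y \<in> \<Union>C" using B srD(4,5)[OF sC(1)[OF B(1)] B(2,3)] by blast+
    qed
    moreover have "\<Union>C \<inter> m \<subseteq> \<qq>" using sC(2) by blast
    moreover have "L0 \<subseteq> \<Union>C" "\<Union>C \<subseteq> T" using C(1) CA by (auto simp: \<A>_def)
    ultimately show "\<Union>C \<in> \<A>" by (simp add: \<A>_def coh_def)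
  qed
  then obtain L where L: "L \<in> \<A>" "\<forall>Y\<in>\<A>. L \<subseteq> Y \<longrightarrow> Y = L" by (rule bexE)
  have "L' = L" if "coh L'" "L \<subseteq> L'" "L' \<subseteq> T" for L' using L that by (auto simp: \<A>_def)
  then show ?thesis using L(1) by (intro exI[of _ L]) (simp add: \<A>_def)
qed

lemma sr_UNIV: "sr UNIV" by (simp add: sr_def)

lemma inv_closed_UNIV: "inv_closed UNIV" using unit by (simp add: inv_closed_def)

text \<open>\<open>L\<close> is a coefficient field of the subring \<open>T\<close>.\<close>

definition lifts :: "'b set \<Rightarrow> 'b set \<Rightarrow> bool" where "lifts T L \<longleftrightarrow> coh L \<and> L \<subseteq> T \<and> (\<forall>x\<in>T. \<exists>l\<in>L. x - l \<in> m)"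

text \<open>The image of the base field is the start, and \<open>coh_step\<close> applies to a
  maximal \<open>L\<close> above it.\<close>

lemma lift_char_0:
  assumes "CHAR('a) = 0"
  shows "\<exists>L. lifts UNIV L"
proof -
  define L0 where "L0 = {x. \<exists>a. x - a *s 1 \<in> \<qq>}"
  have "sr L0" unfolding sr_def
  proof (intro conjI ballI subsetI)
    show "x \<in> L0" if "x \<in> \<qq>" for x using that by (auto simp: L0_def intro: exI[of _ 0])
    show "1 \<in> L0" using tidealD(1)[OF tq] by (auto simp: L0_def intro: exI[of _ 1])
    fix x y assume "x \<in> L0" "y \<in> L0"
    then obtain a b where ab: "x - a *s 1 \<in> \<qq>" "y - b *s 1 \<in> \<qq>" by (auto simp: L0_def)
    have "x - y - (a - b) *s 1 = (x - a *s 1) - (y - b *s 1)" by (simp add: scale_left_diff_distrib)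
    then have "x - y - (a - b) *s 1 \<in> \<qq>" using tidealD(6)[OF tq ab] by (simp only:)
    then show "x - y \<in> L0" unfolding L0_def by blast
    have "x * y - (a * b) *s 1 = y * (x - a *s 1) + a *s (y - b *s 1)" by (simp add: algebra_simps scale_right_diff_distrib mult_scale)
    then have "x * y - (a * b) *s 1 \<in> \<qq>" using tidealD(2)[OF tq tidealD(3)[OF tq ab(1)] tidealD(7)[OF tq ab(2)]] by (simp only:)
    then show "x * y \<in> L0" unfolding L0_def by blast
  qed
  moreover have "x \<in> \<qq>" if x: "x \<in> L0" "x \<in> m" for x
  proof -
    obtain a where a: "x - a *s 1 \<in> \<qq>" using x(1) by (auto simp: L0_def)
    then have am: "a *s 1 \<in> m" using tideal_cong[OF tm, of x "a *s 1"] x(2) qm by blast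
    have "a = 0"
    proof (rule ccontr)
      assume "a \<noteq> 0"
      then show False using tidealD(7)[OF tm am, of "inverse a"] one_notin by simp
    qed
    then show ?thesis using a by simp
  qed
  ultimately have c: "coh L0" by (auto simp: coh_def)
  obtain L where L: "coh L" "L \<subseteq> UNIV" "\<And>L'. coh L' \<Longrightarrow> L \<subseteq> L' \<Longrightarrow> L' \<subseteq> UNIV \<Longrightarrow> L' = L"
    using ex_maximal_coh[OF c subset_UNIV] by blast
  have "\<exists>l\<in>L. x - l \<in> m" for x
    by (rule coh_step[OF sr_UNIV inv_closed_UNIV L]) (simp_all add: assms)
  then show ?thesis using L(1) by (auto simp: lifts_def)
qed

context
  fixes p :: nat
  assumes p: "p = CHAR('a)" "0 < p"
begin

private lemma prime_char: "Factorial_Ring.prime CHAR('b)" unfolding CHAR_eq using p by (intro prime_CHAR_semidom) simp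

private lemma frob_add: "((x::'b) + y) ^ p = x ^ p + y ^ p"
  using freshmans_dream[OF prime_char refl, of x y] by (simp add: p(1) CHAR_eq)

private lemma frob_diff: "((x::'b) - y) ^ p = x ^ p - y ^ p"
  using frob_add[of "x - y" y] by (simp add: algebra_simps)

private lemma q_pow: "x \<in> \<qq> \<Longrightarrow> x ^ p \<in> \<qq>" using tidealD(4)[OF tq, of x "x ^ (p - 1)"] p(2) by (simp flip: power_Suc)

private lemma frob_q: "x - y \<in> \<qq> \<Longrightarrow> x ^ p - y ^ p \<in> \<qq>" using q_pow[of "x - y"] by (simp add: frob_diff)

text \<open>The \<open>p\<close>-th powers of elements of \<open>T\<close>, modulo
  \<open>\<qq>\<close>. They form a subring because Frobenius is additive.\<close>

private definition "fr T = {x. \<exists>u\<in>T. x - u ^ p \<in> \<qq>}"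

private lemma fr_mem: "u \<in> T \<Longrightarrow> u ^ p \<in> fr T"
  unfolding fr_def using tidealD(1)[OF tq] by (intro CollectI bexI[of _ u]) simp_all

private lemma fr_facts:
  assumes T: "sr T" "inv_closed T"
  shows "sr (fr T)" "inv_closed (fr T)" "fr T \<subseteq> T"
proof -
  show "fr T \<subseteq> T" using srD(7)[OF T(1)] sr_cong[OF T(1)] by (auto simp: fr_def)
  show "sr (fr T)" unfolding sr_def
  proof (intro conjI ballI subsetI)
    show "x \<in> fr T" if "x \<in> \<qq>" for x unfolding fr_def using that srD(3)[OF T(1)] p(2) by (intro CollectI bexI[of _ 0]) (simp_all add: zero_power)
    show "1 \<in> fr T" using fr_mem[OF srD(2)[OF T(1)]] by simp
    fix x y assume "x \<in> fr T" "y \<in> fr T"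
    then obtain u v where u: "u \<in> T" "x - u ^ p \<in> \<qq>" and v: "v \<in> T" "y - v ^ p \<in> \<qq>" by (auto simp: fr_def)
    have "x - y - (u - v) ^ p = (x - u ^ p) - (y - v ^ p)" by (simp add: frob_diff)
    then have "x - y - (u - v) ^ p \<in> \<qq>" using tidealD(6)[OF tq u(2) v(2)] by (simp only:)
    then show "x - y \<in> fr T" using srD(4)[OF T(1) u(1) v(1)] unfolding fr_def by blast
    have "x * y - (u * v) ^ p = y * (x - u ^ p) + u ^ p * (y - v ^ p)" by (simp add: algebra_simps power_mult_distrib)
    then have "x * y - (u * v) ^ p \<in> \<qq>" using tidealD(2)[OF tq tidealD(3)[OF tq u(2)] tidealD(3)[OF tq v(2)]] by (simp only:)
    then show "x * y \<in> fr T" using srD(5)[OF T(1) u(1) v(1)] unfolding fr_def by blast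
  qed
  show "inv_closed (fr T)" unfolding inv_closed_def
  proof (intro ballI impI)
    fix x assume x: "x \<in> fr T" "x \<notin> m"
    then obtain u where u: "u \<in> T" "x - u ^ p \<in> \<qq>" by (auto simp: fr_def)
    have "u \<notin> m"
    proof
      assume "u \<in> m"
      then have "u ^ p \<in> m" using tidealD(4)[OF tm, of u "u ^ (p - 1)"] p(2) by (simp flip: power_Suc)
      then show False using tideal_cong[OF tm, of x "u ^ p"] u(2) qm x(2) by blast
    qed
    then obtain y where y: "y \<in> T" "1 - u * y \<in> \<qq>" using T(2) u(1) unfolding inv_closed_def by blast
    have "1 - u ^ p * y ^ p \<in> \<qq>" using frob_q[OF y(2)] by (simp add: power_mult_distrib)
    moreover have "1 - x * y ^ p = (1 - u ^ p * y ^ p) - y ^ p * (x - u ^ p)" by (simp add: algebra_simps)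
    ultimately have "1 - x * y ^ p \<in> \<qq>" using tidealD(6)[OF tq _ tidealD(3)[OF tq u(2)]] by metis
    then show "\<exists>y\<in>fr T. 1 - x * y \<in> \<qq>" using fr_mem[OF y(1)] by blast
  qed
qed

text \<open>By \<open>n\<close>, the subring of \<open>p\<close>-th powers meets \<open>m\<close>
  only in \<open>\<qq>\<close>. A maximal \<open>L\<close> above it contains every
  \<open>c ^ p\<close>, as \<open>coh_step\<close> demands in characteristic
  \<open>p\<close>.\<close>

private lemma lift_frob:
  assumes T: "sr T" "inv_closed T" and n: "\<And>x. x \<in> T \<Longrightarrow> x \<in> m \<Longrightarrow> x ^ p \<in> \<qq>"
  shows "\<exists>L. lifts T L"
proof -
  have "x \<in> \<qq>" if x: "x \<in> fr T" "x \<in> m" for x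
  proof -
    obtain u where u: "u \<in> T" "x - u ^ p \<in> \<qq>" using x(1) by (auto simp: fr_def)
    then have "u ^ p \<in> m" using tideal_cong[OF tm, of x "u ^ p"] x(2) qm by blast
    then have "u ^ p \<in> \<qq>" using maxi_power[OF mm] n[OF u(1)] by blast
    then show ?thesis using tideal_cong[OF tq u(2)] by simp
  qed
  then have c: "coh (fr T)" using fr_facts(1)[OF T] by (auto simp: coh_def)
  obtain L where L: "coh L" "fr T \<subseteq> L" "L \<subseteq> T" "\<And>L'. coh L' \<Longrightarrow> L \<subseteq> L' \<Longrightarrow> L' \<subseteq> T \<Longrightarrow> L' = L"
    using ex_maximal_coh[OF c fr_facts(3)[OF T]] by blast
  have "\<exists>l\<in>L. x - l \<in> m" if "x \<in> T" for x
  proof (rule coh_step[OF T L(1,3,4) that])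
    have "x ^ p \<in> fr T" by (rule fr_mem[OF that])
    then show "CHAR('a) = 0 \<or> (\<exists>a\<in>L. 0 < CHAR('a) \<and> x ^ CHAR('a) - a \<in> \<qq>)"
      using L(2) p tidealD(1)[OF tq] by (intro disjI2 bexI[of _ "x ^ p"]) auto
  qed
  then show ?thesis using L(1,3) by (auto simp: lifts_def)
qed

text \<open>Induction on the exponent of nilpotency. The \<open>p\<close>-th powers of
  \<open>T\<close> have a smaller exponent, so they have a coefficient field \<open>L1\<close>. The
  elements with \<open>p\<close>-th power in \<open>L1\<close> form a subring \<open>T'\<close> to
  which \<open>lift_frob\<close> applies, and \<open>T'\<close> still meets every residue class of
  \<open>T\<close>.\<close>

private lemma lift_char_p_aux:
  assumes "sr T" "inv_closed T" "\<And>x. x \<in> T \<Longrightarrow> x \<in> m \<Longrightarrow> x ^ (p ^ e) \<in> \<qq>"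
  shows "\<exists>L. lifts T L"
  using assms
proof (induction e arbitrary: T)
  case 0
  then have "lifts T T" using tidealD(1)[OF tm] by (auto simp: lifts_def coh_def intro: bexI[rotated])
  then show ?case by blast
next
  case (Suc e)
  note T = Suc.prems(1,2)
  note F = fr_facts[OF T]
  have "x ^ (p ^ e) \<in> \<qq>" if x: "x \<in> fr T" "x \<in> m" for x
  proof -
    obtain u where u: "u \<in> T" "x - u ^ p \<in> \<qq>" using x(1) by (auto simp: fr_def)
    have "u ^ p \<in> m" using tideal_cong[OF tm, of x "u ^ p"] x(2) u(2) qm by blast
    then have "u ^ (p ^ Suc e) \<in> \<qq>" using maxi_power[OF mm] Suc.prems(3)[OF u(1)] by blast
    then have a: "(u ^ p) ^ (p ^ e) \<in> \<qq>" by (simp add: power_mult)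
    have "x ^ (p ^ k) - (u ^ p) ^ (p ^ k) \<in> \<qq>" for k
    proof (induction k)
      case 0 then show ?case using u(2) by simp
    next
      case (Suc k) then show ?case using frob_q[OF Suc] by (simp add: power_mult[symmetric] mult.commute)
    qed
    then show ?thesis using tideal_cong[OF tq] a by blast
  qed
  then obtain L1 where L1: "coh L1" "L1 \<subseteq> fr T" "\<And>x. x \<in> fr T \<Longrightarrow> \<exists>l\<in>L1. x - l \<in> m"
    using Suc.IH[OF F(1,2)] by (auto simp: lifts_def)
  have s1: "sr L1" using L1(1) by (simp add: coh_def)
  have i1: "inv_closed L1" unfolding inv_closed_def
  proof (intro ballI impI)
    fix l assume l: "l \<in> L1" "l \<notin> m"
    then obtain y where y: "y \<in> fr T" "1 - l * y \<in> \<qq>" using F(2) L1(2) unfolding inv_closed_def by blast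
    obtain l' where l': "l' \<in> L1" "y - l' \<in> m" using L1(3)[OF y(1)] by (rule bexE)
    have "1 - l * l' = (1 - l * y) + l * (y - l')" by (simp add: algebra_simps)
    moreover have "1 - l * y \<in> m" using y(2) qm by blast
    ultimately have "1 - l * l' \<in> m" using tidealD(2)[OF tm _ tidealD(3)[OF tm l'(2)]] by metis
    moreover have "1 - l * l' \<in> L1" by (rule srD(4)[OF s1 srD(2)[OF s1] srD(5)[OF s1 l(1) l'(1)]])
    ultimately show "\<exists>y\<in>L1. 1 - l * y \<in> \<qq>" using L1(1) l'(1) by (auto simp: coh_def)
  qed
  define T' where "T' = {x \<in> T. x ^ p \<in> L1}"
  have sT': "sr T'" unfolding sr_def T'_def
    using srD(1)[OF T(1)] srD(1)[OF s1] q_pow srD(2,4,5)[OF T(1)] srD(2,4,5)[OF s1] by (auto simp: frob_diff power_mult_distrib)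
  have iT': "inv_closed T'" unfolding inv_closed_def
  proof (intro ballI impI)
    fix x assume x: "x \<in> T'" "x \<notin> m"
    then obtain y where y: "y \<in> T" "1 - x * y \<in> \<qq>" using T(2) unfolding inv_closed_def T'_def by blast
    have "x ^ p \<in> L1" "x ^ p \<notin> m" using x maxi_power[OF mm] by (auto simp: T'_def)
    then obtain l where l: "l \<in> L1" "1 - x ^ p * l \<in> \<qq>" using i1 unfolding inv_closed_def by blast
    have e: "1 - x ^ p * y ^ p \<in> \<qq>" using frob_q[OF y(2)] by (simp add: power_mult_distrib)
    have "y ^ p - l = y ^ p * (1 - x ^ p * l) - l * (1 - x ^ p * y ^ p)" by (simp add: algebra_simps)
    then have "y ^ p - l \<in> \<qq>" using tidealD(6)[OF tq tidealD(3)[OF tq l(2)] tidealD(3)[OF tq e]] by (simp only:)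
    then have "y \<in> T'" using sr_cong[OF s1 _ l(1)] y(1) by (simp add: T'_def)
    then show "\<exists>y\<in>T'. 1 - x * y \<in> \<qq>" using y(2) by blast
  qed
  have "x ^ p \<in> \<qq>" if x: "x \<in> T'" "x \<in> m" for x
  proof -
    have "x ^ p \<in> m" using tidealD(4)[OF tm x(2), of "x ^ (p - 1)"] p(2) by (simp flip: power_Suc)
    then show ?thesis using x(1) L1(1) by (auto simp: T'_def coh_def)
  qed
  then obtain L where L: "coh L" "L \<subseteq> T'" "\<And>x. x \<in> T' \<Longrightarrow> \<exists>l\<in>L. x - l \<in> m"
    using lift_frob[OF sT' iT'] by (auto simp: lifts_def)
  have "\<exists>l\<in>L. x - l \<in> m" if x: "x \<in> T" for x
  proof -
    have xp: "x ^ p \<in> fr T" by (rule fr_mem[OF x])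
    obtain l where l: "l \<in> L1" "x ^ p - l \<in> m" using L1(3)[OF xp] by (rule bexE)
    \<comment> \<open>So the difference is a \<open>p\<close>-th power \<open>w ^ p\<close> modulo
      \<open>\<qq>\<close>, with \<open>w\<close> in \<open>m\<close>. Then \<open>x - w\<close> has
      the residue class of \<open>x\<close>, and its \<open>p\<close>-th power is \<open>l\<close>
      modulo \<open>\<qq>\<close>.\<close>
    have "x ^ p - l \<in> fr T" using srD(4)[OF F(1) xp] l(1) L1(2) by blast
    then obtain w where w: "w \<in> T" "x ^ p - l - w ^ p \<in> \<qq>" by (auto simp: fr_def)
    have wm: "w \<in> m" using tideal_cong[OF tm, of "x ^ p - l" "w ^ p"] w(2) qm l(2) maxi_power[OF mm] by blast
    have "(x - w) ^ p - l \<in> \<qq>" using w(2) by (simp add: frob_diff algebra_simps)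
    then have "x - w \<in> T'" using sr_cong[OF s1 _ l(1)] srD(4)[OF T(1) x w(1)] by (simp add: T'_def)
    then obtain l' where l': "l' \<in> L" "x - w - l' \<in> m" using L(3) by blast
    then show ?thesis using tidealD(2)[OF tm l'(2) wm] by (intro bexI[of _ l']) (simp_all add: algebra_simps)
  qed
  then show ?case using L(1,2) unfolding lifts_def T'_def by blast
qed

lemma lift_char_p: "\<exists>L. lifts UNIV L"
proof (rule lift_char_p_aux[OF sr_UNIV inv_closed_UNIV])
  fix x assume x: "x \<in> m"
  have "1 < p" using p prime_gt_1_nat[OF prime_char] by (simp add: CHAR_eq)
  then have "\<nu> \<le> p ^ \<nu>" using power_gt_expt[of p \<nu>] by simp
  then have "x ^ (p ^ \<nu>) = x ^ \<nu> * x ^ (p ^ \<nu> - \<nu>)" by (simp flip: power_add)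
  then show "x ^ (p ^ \<nu>) \<in> \<qq>" using tidealD(4)[OF tq nil[OF x]] by simp
qed

end

theorem ex_coefficient_field: "\<exists>L. lifts UNIV L"
proof (cases "CHAR('a) = 0")
  case False then show ?thesis using lift_char_p[OF refl] by simp
qed (rule lift_char_0)

end

section \<open>Quotients with principal maximal ideal\<close>

context quotient_ring
begin

lemma rho_ex: "x \<in> carrier R \<Longrightarrow> \<exists>y. x = \<rho> y" and rho_in: "\<rho> y \<in> carrier R" using R(1) by auto

lemma rho_0: "\<rho> x = \<rho> 0 \<longleftrightarrow> x \<in> \<qq>" using rho_eq[of x 0] by simp

lemma subring_cring:
  assumes L: "0 \<in> L" "1 \<in> L" "\<And>x y. x \<in> L \<Longrightarrow> y \<in> L \<Longrightarrow> x + y \<in> L" "\<And>x y. x \<in> L \<Longrightarrow> y \<in> L \<Longrightarrow> x * y \<in> L" "\<And>x. x \<in> L \<Longrightarrow> - x \<in> L"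
  shows "cring (R\<lparr>carrier := \<rho> ` L\<rparr>)"
proof (rule cringI)
  let ?F = "R\<lparr>carrier := \<rho> ` L\<rparr>"
  show "abelian_group ?F"
  proof (rule abelian_groupI)
    fix x assume "x \<in> carrier ?F"
    then obtain a where a: "a \<in> L" "x = \<rho> a" by auto
    then show "\<exists>y\<in>carrier ?F. y \<oplus>\<^bsub>?F\<^esub> x = \<zero>\<^bsub>?F\<^esub>" using L(5)[OF a(1)] by (intro bexI[of _ "\<rho> (- a)"]) (simp_all add: R)
  qed (use L in \<open>auto simp: R add_ac\<close>)
  show "Group.comm_monoid ?F" by (rule comm_monoidI) (use L in \<open>auto simp: R mult_ac\<close>)
qed (auto simp: R distrib_right)

lemma R_cring: "cring R"
proof -
  have "R\<lparr>carrier := range \<rho>\<rparr> = R" using R(1) by simp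
  then show ?thesis using subring_cring[of UNIV] by simp
qed

sublocale RR: cring R by (rule R_cring)

lemma rho_minus: "\<ominus>\<^bsub>R\<^esub> \<rho> x = \<rho> (- x)"
  by (rule RR.minus_equality[OF _ rho_in rho_in]) (simp add: R)

lemma rho_pow: "\<rho> x [^]\<^bsub>R\<^esub> (i::nat) = \<rho> (x ^ i)"
  by (induction i) (simp_all add: R mult.commute)

lemma rho_finsum: "finite A \<Longrightarrow> finsum R (\<lambda>i. \<rho> (g i)) A = \<rho> (sum g A)"
proof (induction A rule: finite_induct)
  case (insert x A)
  have "finsum R (\<lambda>i. \<rho> (g i)) (insert x A) = \<rho> (g x) \<oplus>\<^bsub>R\<^esub> finsum R (\<lambda>i. \<rho> (g i)) A"
    by (rule RR.finsum_insert[OF insert(1,2)]) (auto simp: rho_in)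
  then show ?case using insert by (simp add: R)
qed (simp add: R)

lemma ideal_image:
  assumes J: "tideal J"
  shows "ideal (\<rho> ` J) R"
proof (rule idealI[OF RR.ring_axioms])
  have inv: "m_inv (add_monoid R) (\<rho> j) = \<rho> (- j)" for j using rho_minus unfolding a_inv_def .
  show "subgroup (\<rho> ` J) (add_monoid R)"
  proof
    show "\<rho> ` J \<subseteq> carrier (add_monoid R)" using rho_in by auto
    show "m_inv (add_monoid R) x \<in> \<rho> ` J" if "x \<in> \<rho> ` J" for x using that tidealD(5)[OF J] inv by auto
  qed (use tidealD(1,2)[OF J] in \<open>auto simp: R(3,5)\<close>)
  fix a x assume "a \<in> \<rho> ` J" "x \<in> carrier R"
  then obtain j y where "j \<in> J" "a = \<rho> j" "x = \<rho> y" using rho_ex by blast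
  then show "x \<otimes>\<^bsub>R\<^esub> a \<in> \<rho> ` J" "a \<otimes>\<^bsub>R\<^esub> x \<in> \<rho> ` J" using tidealD(3,4)[OF J] by (auto simp: R)
qed

lemma ideal_preimage:
  assumes "ideal I R"
  shows "tideal {x. \<rho> x \<in> I}" "\<qq> \<subseteq> {x. \<rho> x \<in> I}" "I = \<rho> ` {x. \<rho> x \<in> I}"
proof -
  interpret I: ideal I R by fact
  have 0: "\<rho> 0 \<in> I" using I.zero_closed by (simp add: R)
  show "tideal {x. \<rho> x \<in> I}" unfolding tideal_def
  proof (intro conjI ballI allI)
    fix x y assume h: "x \<in> {x. \<rho> x \<in> I}" "y \<in> {x. \<rho> x \<in> I}"
    have "\<rho> x \<oplus>\<^bsub>R\<^esub> \<rho> y \<in> I" by (rule I.a_closed) (use h in auto)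
    then show "x + y \<in> {x. \<rho> x \<in> I}" by (simp add: R)
  next
    fix x a assume h: "x \<in> {x. \<rho> x \<in> I}"
    have "\<rho> a \<otimes>\<^bsub>R\<^esub> \<rho> x \<in> I" by (rule I.I_l_closed) (use h rho_in in auto)
    then show "a * x \<in> {x. \<rho> x \<in> I}" by (simp add: R)
  qed (simp add: 0)
  show "\<qq> \<subseteq> {x. \<rho> x \<in> I}" using 0 rho_0 by (metis (mono_tags, lifting) mem_Collect_eq subsetI)
  show "I = \<rho> ` {x. \<rho> x \<in> I}" using I.a_subset R(1) by auto
qed

end

lemma UP_function:
  assumes "q \<in> UnivPoly.up F"
  shows "q \<in> carrier (UP F)" "up_ring.coeff (UP F) q i = q i"
  using assms by (simp_all add: UP_def)

text \<open>\<open>n\<close> is the exact exponent of nilpotency of the generator \<open>t\<close>,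
  which is the length of the chain ring \<open>R\<close>.\<close>

locale chain_quotient = quotient_ring scale R \<rho> \<qq> + local_quotient scale \<qq> m \<nu>
  for scale :: "'a::field \<Rightarrow> 'b::comm_ring_1 \<Rightarrow> 'b" (infixr \<open>*s\<close> 75)
    and R :: "'r ring" and \<rho> :: "'b \<Rightarrow> 'r" and \<qq> m :: "'b set" and \<nu> :: nat +
  fixes t :: 'b and n :: nat
  assumes mt: "m = prin t \<qq>" and tn: "t ^ n \<in> \<qq>" and tl: "\<And>i. i < n \<Longrightarrow> t ^ i \<notin> \<qq>"
begin

text \<open>The powers of \<open>t\<close> act as a valuation: \<open>t\<close> is divided out as
  often as possible, and what remains is a unit.\<close>

lemma val:
  assumes "x \<notin> \<qq>"
  shows "\<exists>i<n. \<exists>u. u \<notin> m \<and> x - t ^ i * u \<in> \<qq>"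
proof -
  define P where "P i \<longleftrightarrow> \<not> (\<exists>u. x - t ^ i * u \<in> \<qq>)" for i
  have "\<not> P 0" using tidealD(1)[OF tq] by (auto simp: P_def intro!: exI[of _ x])
  moreover have "P n" unfolding P_def
  proof
    assume "\<exists>u. x - t ^ n * u \<in> \<qq>"
    then show False using tideal_cong[OF tq] tidealD(4)[OF tq tn] assms by blast
  qed
  ultimately obtain i where i: "i < n" "\<forall>j\<le>i. \<not> P j" "P (Suc i)" using ex_least_nat_less[of P n] by blast
  then obtain u where u: "x - t ^ i * u \<in> \<qq>" by (auto simp: P_def)
  have "u \<notin> m"
  proof
    assume "u \<in> m"
    then obtain w where w: "u - t * w \<in> \<qq>" unfolding mt prin_iff by (rule exE)
    have "x - t ^ Suc i * w = (x - t ^ i * u) + t ^ i * (u - t * w)" by (simp add: algebra_simps)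
    then have "x - t ^ Suc i * w \<in> \<qq>" using tidealD(2)[OF tq u tidealD(3)[OF tq w]] by (simp only:)
    then show False using i(3) by (auto simp: P_def)
  qed
  then show ?thesis using i(1) u by blast
qed

lemma unit_cancel:
  assumes "tideal J" "\<qq> \<subseteq> J" "u \<notin> m" "x * u \<in> J"
  shows "x \<in> J"
proof -
  obtain y where y: "1 - u * y \<in> \<qq>" using unit[OF assms(3)] by (rule exE)
  have "x = (x * u) * y + x * (1 - u * y)" by (simp add: algebra_simps)
  then show ?thesis using tidealD(2)[OF assms(1) tidealD(4)[OF assms(1,4)] tidealD(3)[OF assms(1)]] y assms(2) by (metis subsetD)
qed

lemma ideals:
  assumes J: "tideal J" "\<qq> \<subseteq> J"
  shows "\<exists>i\<le>n. J = prin (t ^ i) \<qq> \<and> t ^ i \<in> J"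
proof -
  define i where "i = (LEAST i. t ^ i \<in> J)"
  have ex: "t ^ n \<in> J" using tn J(2) by blast
  have i: "t ^ i \<in> J" "i \<le> n" unfolding i_def by (rule LeastI[of _ n], rule ex) (rule Least_le[of _ n], rule ex)
  have "x \<in> prin (t ^ i) \<qq>" if x: "x \<in> J" for x
  proof (cases "x \<in> \<qq>")
    case True then show ?thesis using prin_superset by blast
  next
    case False
    then obtain j u where j: "u \<notin> m" "x - t ^ j * u \<in> \<qq>" using val by blast
    have "t ^ j * u \<in> J" using tideal_cong[OF J(1), of x "t ^ j * u"] j(2) J(2) x by blast
    then have "t ^ j \<in> J" by (rule unit_cancel[OF J j(1)])
    then have "i \<le> j" unfolding i_def by (rule Least_le)
    then have "t ^ j = t ^ i * t ^ (j - i)" by (simp flip: power_add)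
    then have "x - t ^ i * (t ^ (j - i) * u) \<in> \<qq>" using j(2) by (simp add: mult.assoc)
    then show ?thesis unfolding prin_iff by blast
  qed
  then have "J = prin (t ^ i) \<qq>" using prin_least[OF J i(1)] by blast
  then show ?thesis using i by blast
qed

text \<open>The property behind self-injectivity: the annihilator of a power of \<open>t\<close> is
  generated by the complementary power.\<close>

lemma divide:
  assumes i: "i \<le> n" and w: "t ^ (n - i) * w \<in> \<qq>"
  shows "\<exists>v. w - t ^ i * v \<in> \<qq>"
proof (cases "w \<in> \<qq>")
  case False
  then obtain j u where j: "u \<notin> m" "w - t ^ j * u \<in> \<qq>" using val by blast
  have "t ^ (n - i) * w - t ^ (n - i + j) * u = t ^ (n - i) * (w - t ^ j * u)" by (simp add: algebra_simps power_add)
  then have "t ^ (n - i) * w - t ^ (n - i + j) * u \<in> \<qq>" using tidealD(3)[OF tq j(2)] by (simp only:)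
  then have "t ^ (n - i + j) * u \<in> \<qq>" using tideal_cong[OF tq] w by blast
  then have "t ^ (n - i + j) \<in> \<qq>" by (rule unit_cancel[OF tq order_refl j(1)])
  then have "i \<le> j" using tl[of "n - i + j"] i by linarith
  then have "t ^ j = t ^ i * t ^ (j - i)" by (simp flip: power_add)
  then show ?thesis using j(2) by (intro exI[of _ "t ^ (j - i) * u"]) (simp add: mult.assoc)
qed (auto intro: exI[of _ 0])

lemma noetherian: "noetherian_ring R"
proof
  fix I assume I: "ideal I R"
  obtain i where i: "{x. \<rho> x \<in> I} = prin (t ^ i) \<qq>" using ideals[OF ideal_preimage(1,2)[OF I]] by blast
  have "I = PIdl\<^bsub>R\<^esub> \<rho> (t ^ i)"
  proof
    have "\<rho> (t ^ i) \<in> I" using prin_self[OF tq, of "t ^ i"] i by blast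
    then show "PIdl\<^bsub>R\<^esub> \<rho> (t ^ i) \<subseteq> I" by (rule RR.cgenideal_minimal[OF I])
    show "I \<subseteq> PIdl\<^bsub>R\<^esub> \<rho> (t ^ i)"
    proof
      fix y assume y: "y \<in> I"
      then obtain x where x: "y = \<rho> x" using ideal_preimage(3)[OF I] by blast
      then obtain w where "x - t ^ i * w \<in> \<qq>" using y i prin_iff[of x "t ^ i" \<qq>] by blast
      then have "y = \<rho> w \<otimes>\<^bsub>R\<^esub> \<rho> (t ^ i)" unfolding x R(2) rho_eq by (simp add: mult.commute)
      then show "y \<in> PIdl\<^bsub>R\<^esub> \<rho> (t ^ i)" using rho_in unfolding cgenideal_def by blast
    qed
  qed
  also have "\<dots> = Idl\<^bsub>R\<^esub> {\<rho> (t ^ i)}" by (rule RR.cgenideal_eq_genideal[OF rho_in])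
  finally show "\<exists>A\<subseteq>carrier R. finite A \<and> I = Idl\<^bsub>R\<^esub> A" using rho_in by (intro exI[of _ "{\<rho> (t ^ i)}"]) auto
qed

lemma ideal_unit:
  assumes I: "ideal I R" and x: "\<rho> x \<in> I" "x \<notin> m"
  shows "I = carrier R"
proof -
  have "1 * x \<in> {x. \<rho> x \<in> I}" using x(1) by simp
  then have "1 \<in> {x. \<rho> x \<in> I}" by (rule unit_cancel[OF ideal_preimage(1,2)[OF I] x(2)])
  then have "{x. \<rho> x \<in> I} = UNIV" by (rule tideal_one[OF ideal_preimage(1)[OF I]])
  then show ?thesis using ideal_preimage(3)[OF I] R(1) by simp
qed

lemma unique_maximal: "\<exists>!M. maximalideal M R"
proof
  have id: "ideal (\<rho> ` m) R" by (rule ideal_image[OF tm])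
  have mem: "\<rho> x \<in> \<rho> ` m \<longleftrightarrow> x \<in> m" for x using rho_eq tideal_cong[OF tm] qm by blast
  have ne: "carrier R \<noteq> \<rho> ` m" using mem[of 1] one_notin rho_in by blast
  show "maximalideal (\<rho> ` m) R"
  proof (rule maximalidealI[OF id ne])
    fix J assume J: "ideal J R" "\<rho> ` m \<subseteq> J" "J \<subseteq> carrier R"
    show "J = \<rho> ` m \<or> J = carrier R"
    proof (cases "\<exists>x. \<rho> x \<in> J \<and> x \<notin> m")
      case True then show ?thesis using ideal_unit[OF J(1)] by blast
    next
      case False then show ?thesis using J(2) ideal_preimage(3)[OF J(1)] by blast
    qed
  qed
  fix M assume "maximalideal M R"
  then interpret M: maximalideal M R .
  have "M \<subseteq> \<rho> ` m" using ideal_unit[OF M.ideal_axioms] M.I_notcarr ideal_preimage(3)[OF M.ideal_axioms] by blast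
  then show "M = \<rho> ` m" using M.I_maximal[OF id] ne id ideal.Icarr[OF id] by blast
qed

text \<open>A homomorphism to \<open>R\<close> defined on a submodule of \<open>N\<close> is given by its graph.\<close>

definition phom :: "('r, 'r) module \<Rightarrow> ('r \<times> 'r) set \<Rightarrow> bool" where
  "phom N G \<longleftrightarrow> G \<subseteq> carrier N \<times> carrier R \<and> (\<zero>\<^bsub>N\<^esub>, \<zero>\<^bsub>R\<^esub>) \<in> G \<and>
    (\<forall>x y x' y'. (x, y) \<in> G \<longrightarrow> (x', y') \<in> G \<longrightarrow> (x \<oplus>\<^bsub>N\<^esub> x', y \<oplus>\<^bsub>R\<^esub> y') \<in> G) \<and>
    (\<forall>a x y. a \<in> carrier R \<longrightarrow> (x, y) \<in> G \<longrightarrow> (a \<odot>\<^bsub>N\<^esub> x, a \<otimes>\<^bsub>R\<^esub> y) \<in> G) \<and> (\<forall>y. (\<zero>\<^bsub>N\<^esub>, y) \<in> G \<longrightarrow> y = \<zero>\<^bsub>R\<^esub>)"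

context
  fixes N :: "('r, 'r) module"
  assumes N: "Module.module R N"
begin

interpretation N: Module.module R N by (rule N)

private lemma phomD:
  assumes "phom N G"
  shows "(x, y) \<in> G \<Longrightarrow> x \<in> carrier N" "(x, y) \<in> G \<Longrightarrow> y \<in> carrier R" "(\<zero>\<^bsub>N\<^esub>, \<zero>\<^bsub>R\<^esub>) \<in> G"
    "(x, y) \<in> G \<Longrightarrow> (x', y') \<in> G \<Longrightarrow> (x \<oplus>\<^bsub>N\<^esub> x', y \<oplus>\<^bsub>R\<^esub> y') \<in> G" "(x, y) \<in> G \<Longrightarrow> (\<rho> a \<odot>\<^bsub>N\<^esub> x, \<rho> a \<otimes>\<^bsub>R\<^esub> y) \<in> G"
    "(\<zero>\<^bsub>N\<^esub>, y) \<in> G \<Longrightarrow> y = \<zero>\<^bsub>R\<^esub>"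
  using assms rho_in unfolding phom_def by blast+

private lemma minus_smult: "x \<in> carrier N \<Longrightarrow> \<rho> (- 1) \<odot>\<^bsub>N\<^esub> x = \<ominus>\<^bsub>N\<^esub> x"
  using N.smult_l_minus[OF rho_in[of 1]] N.smult_one R(4) by (simp add: rho_minus)

private lemma phom_unique:
  assumes G: "phom N G" and xy: "(x, y) \<in> G" "(x, y') \<in> G"
  shows "y = y'"
proof -
  note f = phomD[OF G]
  have x: "x \<in> carrier N" and y: "y \<in> carrier R" "y' \<in> carrier R" using f(1,2) xy by blast+
  have "(x \<oplus>\<^bsub>N\<^esub> \<rho> (- 1) \<odot>\<^bsub>N\<^esub> x, y \<oplus>\<^bsub>R\<^esub> \<rho> (- 1) \<otimes>\<^bsub>R\<^esub> y') \<in> G" by (rule f(4)[OF xy(1) f(5)[OF xy(2)]])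
  then have "(\<zero>\<^bsub>N\<^esub>, y \<oplus>\<^bsub>R\<^esub> \<rho> (- 1) \<otimes>\<^bsub>R\<^esub> y') \<in> G" using x by (simp add: minus_smult N.M.r_neg)
  then have e: "y \<oplus>\<^bsub>R\<^esub> \<rho> (- 1) \<otimes>\<^bsub>R\<^esub> y' = \<zero>\<^bsub>R\<^esub>" by (rule f(6))
  obtain a b where "y = \<rho> a" "y' = \<rho> b" using y rho_ex by blast
  then show ?thesis using e by (simp add: R rho_0 rho_eq)
qed

text \<open>As in Baer's criterion, the multipliers of \<open>x\<close> into the domain of
  \<open>G\<close> form an ideal, here generated by some \<open>t ^ i\<close>. The value
  \<open>w\<close> at \<open>t ^ i\<close> times \<open>x\<close> is annihilated by
  \<open>t ^ (n - i)\<close>, because \<open>t ^ n\<close> is 0; hence \<open>w = t ^ i * v\<close>,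
  and \<open>x\<close> may be sent to \<open>v\<close>.\<close>

private lemma phom_extend:
  assumes G: "phom N G" and x: "x \<in> carrier N"
  shows "\<exists>G'. phom N G' \<and> G \<subseteq> G' \<and> (\<exists>y. (x, y) \<in> G')"
proof -
  note f = phomD[OF G]
  define J where "J = {b. \<exists>y. (\<rho> b \<odot>\<^bsub>N\<^esub> x, y) \<in> G}"
  have sm: "\<rho> b \<odot>\<^bsub>N\<^esub> x \<in> carrier N" for b using x rho_in by simp
  have s0: "\<rho> q \<odot>\<^bsub>N\<^esub> x = \<zero>\<^bsub>N\<^esub>" if "q \<in> \<qq>" for q
  proof -
    have "\<rho> q = \<zero>\<^bsub>R\<^esub>" using that by (simp add: R(5) rho_0)
    then show ?thesis using N.smult_l_null[OF x] by (simp only:)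
  qed
  have sa: "\<rho> (a + b) \<odot>\<^bsub>N\<^esub> x = \<rho> a \<odot>\<^bsub>N\<^esub> x \<oplus>\<^bsub>N\<^esub> \<rho> b \<odot>\<^bsub>N\<^esub> x" for a b
    using N.smult_l_distr[OF rho_in rho_in x] by (simp add: R)
  have sp: "\<rho> (a * b) \<odot>\<^bsub>N\<^esub> x = \<rho> a \<odot>\<^bsub>N\<^esub> (\<rho> b \<odot>\<^bsub>N\<^esub> x)" for a b
    using N.smult_assoc1[OF rho_in rho_in x] by (simp add: R)
  have qJ: "\<qq> \<subseteq> J" using s0 f(3) by (auto simp: J_def)
  have tJ: "tideal J" unfolding tideal_def
  proof (intro conjI ballI allI)
    show "0 \<in> J" using qJ tidealD(1)[OF tq] by blast
    fix a b assume "a \<in> J" "b \<in> J"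
    then show "a + b \<in> J" unfolding J_def sa mem_Collect_eq using f(4) by blast
  next
    fix a b assume "b \<in> J"
    then show "a * b \<in> J" unfolding J_def sp mem_Collect_eq using f(5) by blast
  qed
  obtain i where i: "i \<le> n" "J = prin (t ^ i) \<qq>" "t ^ i \<in> J" using ideals[OF tJ qJ] by blast
  obtain y0 where y0: "(\<rho> (t ^ i) \<odot>\<^bsub>N\<^esub> x, y0) \<in> G" using i(3) by (auto simp: J_def)
  obtain w where w: "y0 = \<rho> w" using rho_ex[OF f(2)[OF y0]] by (rule exE)
  have "t ^ (n - i) * t ^ i = t ^ n" using i(1) by (simp flip: power_add)
  then have "\<rho> (t ^ (n - i)) \<odot>\<^bsub>N\<^esub> (\<rho> (t ^ i) \<odot>\<^bsub>N\<^esub> x) = \<zero>\<^bsub>N\<^esub>" using sp[of "t ^ (n - i)" "t ^ i"] s0[OF tn] by simp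
  then have "(\<zero>\<^bsub>N\<^esub>, \<rho> (t ^ (n - i) * w)) \<in> G" using f(5)[OF y0, of "t ^ (n - i)"] by (simp add: w R)
  then have "\<rho> (t ^ (n - i) * w) = \<zero>\<^bsub>R\<^esub>" by (rule f(6))
  then have "t ^ (n - i) * w \<in> \<qq>" by (simp add: R(5) rho_0)
  then obtain v where v: "w - t ^ i * v \<in> \<qq>" using divide[OF i(1)] by blast
  then have y0v: "(\<rho> (t ^ i) \<odot>\<^bsub>N\<^esub> x, \<rho> (t ^ i * v)) \<in> G" using y0 w rho_eq[of w "t ^ i * v"] by simp
  \<comment> \<open>The choice of \<open>v\<close> agrees with \<open>G\<close> wherever a multiple
    of \<open>x\<close> is in the domain, which keeps the enlarged graph single-valued.\<close>
  have JG: "(\<rho> b \<odot>\<^bsub>N\<^esub> x, \<rho> (b * v)) \<in> G" if b: "b \<in> J" for b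
  proof -
    obtain c where c: "b - t ^ i * c \<in> \<qq>" using b unfolding i(2) prin_iff by (rule exE)
    have "b * v - c * (t ^ i * v) = (b - t ^ i * c) * v" by (simp add: algebra_simps)
    then have "b * v - c * (t ^ i * v) \<in> \<qq>" using tidealD(4)[OF tq c] by (simp only:)
    then have "\<rho> (b * v) = \<rho> c \<otimes>\<^bsub>R\<^esub> \<rho> (t ^ i * v)" by (simp add: R rho_eq)
    moreover have "\<rho> b = \<rho> (c * t ^ i)" using c by (simp add: rho_eq mult.commute)
    then have "\<rho> b \<odot>\<^bsub>N\<^esub> x = \<rho> c \<odot>\<^bsub>N\<^esub> (\<rho> (t ^ i) \<odot>\<^bsub>N\<^esub> x)" using sp by simp
    ultimately show ?thesis using f(5)[OF y0v] by simp
  qed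
  define G' where "G' = {(d \<oplus>\<^bsub>N\<^esub> \<rho> b \<odot>\<^bsub>N\<^esub> x, e \<oplus>\<^bsub>R\<^esub> \<rho> (b * v)) | d e b. (d, e) \<in> G}"
  have memI: "(d, e) \<in> G \<Longrightarrow> (d \<oplus>\<^bsub>N\<^esub> \<rho> b \<odot>\<^bsub>N\<^esub> x, e \<oplus>\<^bsub>R\<^esub> \<rho> (b * v)) \<in> G'" for d e b unfolding G'_def by blast
  have memE: "\<exists>d e b. (d, e) \<in> G \<and> z = d \<oplus>\<^bsub>N\<^esub> \<rho> b \<odot>\<^bsub>N\<^esub> x \<and> y = e \<oplus>\<^bsub>R\<^esub> \<rho> (b * v)" if "(z, y) \<in> G'" for z y
    using that unfolding G'_def by blast
  have GG: "G \<subseteq> G'"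
  proof clarify
    fix d e assume de: "(d, e) \<in> G"
    have "d \<oplus>\<^bsub>N\<^esub> \<rho> 0 \<odot>\<^bsub>N\<^esub> x = d" "e \<oplus>\<^bsub>R\<^esub> \<rho> (0 * v) = e"
      using s0[OF tidealD(1)[OF tq]] f(1,2)[OF de] by (simp_all flip: R(5))
    then show "(d, e) \<in> G'" using memI[OF de, of 0] by simp
  qed
  have "phom N G'" unfolding phom_def
  proof (intro conjI allI impI)
    show "G' \<subseteq> carrier N \<times> carrier R" using f(1,2) sm rho_in unfolding G'_def by auto
    show "(\<zero>\<^bsub>N\<^esub>, \<zero>\<^bsub>R\<^esub>) \<in> G'" using GG f(3) by blast
    fix z y z' y' assume "(z, y) \<in> G'" "(z', y') \<in> G'"
    then obtain d e b d' e' b' where z: "(d, e) \<in> G" "z = d \<oplus>\<^bsub>N\<^esub> \<rho> b \<odot>\<^bsub>N\<^esub> x" "y = e \<oplus>\<^bsub>R\<^esub> \<rho> (b * v)"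
      and z': "(d', e') \<in> G" "z' = d' \<oplus>\<^bsub>N\<^esub> \<rho> b' \<odot>\<^bsub>N\<^esub> x" "y' = e' \<oplus>\<^bsub>R\<^esub> \<rho> (b' * v)" using memE by metis
    have "z \<oplus>\<^bsub>N\<^esub> z' = (d \<oplus>\<^bsub>N\<^esub> d') \<oplus>\<^bsub>N\<^esub> \<rho> (b + b') \<odot>\<^bsub>N\<^esub> x"
      unfolding z z' sa using f(1)[OF z(1)] f(1)[OF z'(1)] sm by (simp add: N.M.a_ac)
    moreover have "y \<oplus>\<^bsub>R\<^esub> y' = (e \<oplus>\<^bsub>R\<^esub> e') \<oplus>\<^bsub>R\<^esub> \<rho> ((b + b') * v)"
      unfolding z z' distrib_right R(3)[symmetric] using f(2)[OF z(1)] f(2)[OF z'(1)] rho_in by (simp add: RR.a_ac)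
    ultimately show "(z \<oplus>\<^bsub>N\<^esub> z', y \<oplus>\<^bsub>R\<^esub> y') \<in> G'" using memI[OF f(4)[OF z(1) z'(1)]] by simp
  next
    fix a z y assume a: "a \<in> carrier R" and "(z, y) \<in> G'"
    then obtain d e b where z: "(d, e) \<in> G" "z = d \<oplus>\<^bsub>N\<^esub> \<rho> b \<odot>\<^bsub>N\<^esub> x" "y = e \<oplus>\<^bsub>R\<^esub> \<rho> (b * v)" using memE by blast
    obtain a' where a': "a = \<rho> a'" using rho_ex[OF a] by (rule exE)
    have "a \<odot>\<^bsub>N\<^esub> z = \<rho> a' \<odot>\<^bsub>N\<^esub> d \<oplus>\<^bsub>N\<^esub> \<rho> (a' * b) \<odot>\<^bsub>N\<^esub> x"
      unfolding z a' sp using f(1)[OF z(1)] sm rho_in by (simp add: N.smult_r_distr)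
    moreover obtain e' where "e = \<rho> e'" using rho_ex[OF f(2)[OF z(1)]] by (rule exE)
    then have "a \<otimes>\<^bsub>R\<^esub> y = \<rho> a' \<otimes>\<^bsub>R\<^esub> e \<oplus>\<^bsub>R\<^esub> \<rho> ((a' * b) * v)" by (simp add: z a' R distrib_left mult.assoc)
    ultimately show "(a \<odot>\<^bsub>N\<^esub> z, a \<otimes>\<^bsub>R\<^esub> y) \<in> G'" using memI[OF f(5)[OF z(1)]] by simp
  next
    fix y assume "(\<zero>\<^bsub>N\<^esub>, y) \<in> G'"
    then obtain d e b where z: "(d, e) \<in> G" "\<zero>\<^bsub>N\<^esub> = d \<oplus>\<^bsub>N\<^esub> \<rho> b \<odot>\<^bsub>N\<^esub> x" "y = e \<oplus>\<^bsub>R\<^esub> \<rho> (b * v)" using memE by blast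
    have d: "d \<in> carrier N" by (rule f(1)[OF z(1)])
    have "\<ominus>\<^bsub>N\<^esub> d = \<rho> b \<odot>\<^bsub>N\<^esub> x" by (rule N.M.minus_equality[OF _ d sm]) (use z(2) d sm in \<open>simp add: N.M.a_comm\<close>)
    then have "b \<in> J" using f(5)[OF z(1), of "- 1"] by (auto simp: J_def minus_smult[OF d])
    then have "(\<zero>\<^bsub>N\<^esub>, y) \<in> G" using f(4)[OF z(1) JG] z by simp
    then show "y = \<zero>\<^bsub>R\<^esub>" by (rule f(6))
  qed
  moreover have "\<zero>\<^bsub>N\<^esub> \<oplus>\<^bsub>N\<^esub> \<rho> 1 \<odot>\<^bsub>N\<^esub> x = x" using x by (simp flip: R(4))
  then have "(x, \<zero>\<^bsub>R\<^esub> \<oplus>\<^bsub>R\<^esub> \<rho> (1 * v)) \<in> G'" using memI[OF f(3), of 1] by simp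
  ultimately show ?thesis using GG by blast
qed

private lemma phom_maximal:
  assumes G0: "phom N G0"
  shows "\<exists>G. phom N G \<and> G0 \<subseteq> G \<and> (\<forall>x\<in>carrier N. \<exists>y. (x, y) \<in> G)"
proof -
  define \<A> where "\<A> = {G. phom N G \<and> G0 \<subseteq> G}"
  have "\<exists>M\<in>\<A>. \<forall>Y\<in>\<A>. M \<subseteq> Y \<longrightarrow> Y = M"
  proof (rule subset_Zorn_nonempty)
    show "\<A> \<noteq> {}" using G0 by (auto simp: \<A>_def)
    fix C assume C: "C \<noteq> {}" "subset.chain \<A> C"
    then have CA: "C \<subseteq> \<A>" and lin: "\<And>A B. A \<in> C \<Longrightarrow> B \<in> C \<Longrightarrow> A \<subseteq> B \<or> B \<subseteq> A" by (auto simp: subset_chain_def)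
    have pC: "phom N A" if "A \<in> C" for A using CA that by (auto simp: \<A>_def)
    have "phom N (\<Union>C)" unfolding phom_def
    proof (intro conjI allI impI)
      show "\<Union>C \<subseteq> carrier N \<times> carrier R" using pC unfolding phom_def by blast
      show "(\<zero>\<^bsub>N\<^esub>, \<zero>\<^bsub>R\<^esub>) \<in> \<Union>C" using C(1) phomD(3)[OF pC] by blast
      fix x y x' y' assume "(x, y) \<in> \<Union>C" "(x', y') \<in> \<Union>C"
      then obtain B B' where "B \<in> C" "B' \<in> C" "(x, y) \<in> B" "(x', y') \<in> B'" by blast
      then obtain B where B: "B \<in> C" "(x, y) \<in> B" "(x', y') \<in> B" using lin by blast
      show "(x \<oplus>\<^bsub>N\<^esub> x', y \<oplus>\<^bsub>R\<^esub> y') \<in> \<Union>C" using phomD(4)[OF pC[OF B(1)] B(2,3)] B(1) by blast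
    next
      fix a x y assume "a \<in> carrier R" "(x, y) \<in> \<Union>C"
      then obtain a' B where "a = \<rho> a'" "B \<in> C" "(x, y) \<in> B" using rho_ex by blast
      then show "(a \<odot>\<^bsub>N\<^esub> x, a \<otimes>\<^bsub>R\<^esub> y) \<in> \<Union>C" using phomD(5)[OF pC] by blast
    next
      fix y assume "(\<zero>\<^bsub>N\<^esub>, y) \<in> \<Union>C"
      then show "y = \<zero>\<^bsub>R\<^esub>" using phomD(6)[OF pC] by blast
    qed
    moreover have "G0 \<subseteq> \<Union>C" using C(1) CA by (auto simp: \<A>_def)
    ultimately show "\<Union>C \<in> \<A>" by (simp add: \<A>_def)
  qed
  then obtain G where G: "G \<in> \<A>" "\<forall>Y\<in>\<A>. G \<subseteq> Y \<longrightarrow> Y = G" by (rule bexE)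
  have pG: "phom N G" "G0 \<subseteq> G" using G(1) by (auto simp: \<A>_def)
  have "\<exists>y. (x, y) \<in> G" if x: "x \<in> carrier N" for x
  proof -
    obtain G' where "phom N G' \<and> G \<subseteq> G' \<and> (\<exists>y. (x, y) \<in> G')" using phom_extend[OF pG(1) x] by (rule exE)
    then have G': "phom N G'" "G \<subseteq> G'" "\<exists>y. (x, y) \<in> G'" by simp_all
    have "G' = G" using G(2) G'(1,2) pG(2) by (auto simp: \<A>_def)
    then show ?thesis using G'(3) by simp
  qed
  then show ?thesis using pG by blast
qed

lemma hom_extend:
  assumes H: "submodule H R N" and fh: "f \<in> lin_homs R (N\<lparr>carrier := H\<rparr>) (self_module R)"
  shows "\<exists>g\<in>lin_homs R N (self_module R). \<forall>x\<in>H. g x = f x"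
proof -
  have HN: "H \<subseteq> carrier N" "H \<noteq> {}" "\<And>a b. a \<in> H \<Longrightarrow> b \<in> H \<Longrightarrow> a \<oplus>\<^bsub>N\<^esub> b \<in> H" "\<And>a b. a \<in> carrier R \<Longrightarrow> b \<in> H \<Longrightarrow> a \<odot>\<^bsub>N\<^esub> b \<in> H"
    by (rule N.submoduleE(1)[OF H], rule N.submoduleE(2)[OF H], rule N.submoduleE(5)[OF H], assumption+, rule N.submoduleE(4)[OF H])
  have f: "\<And>x. x \<in> H \<Longrightarrow> f x \<in> carrier R" "\<And>x y. x \<in> H \<Longrightarrow> y \<in> H \<Longrightarrow> f (x \<oplus>\<^bsub>N\<^esub> y) = f x \<oplus>\<^bsub>R\<^esub> f y"
    "\<And>a x. a \<in> carrier R \<Longrightarrow> x \<in> H \<Longrightarrow> f (a \<odot>\<^bsub>N\<^esub> x) = a \<otimes>\<^bsub>R\<^esub> f x"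
    using fh by (auto simp: lin_homs_def self_module_def)
  obtain x0 where x0: "x0 \<in> H" using HN(2) by blast
  have e: "\<zero>\<^bsub>R\<^esub> \<odot>\<^bsub>N\<^esub> x0 = \<zero>\<^bsub>N\<^esub>" by (rule N.smult_l_null) (use HN(1) x0 in blast)
  have z: "\<zero>\<^bsub>N\<^esub> \<in> H" using HN(4)[OF RR.zero_closed x0] by (simp only: e)
  have z': "f \<zero>\<^bsub>N\<^esub> = \<zero>\<^bsub>R\<^esub>" using f(3)[OF RR.zero_closed x0] RR.l_null[OF f(1)[OF x0]] by (simp only: e)
  have "phom N {(x, f x) | x. x \<in> H}" unfolding phom_def
  proof (intro conjI allI impI)
    show "{(x, f x) | x. x \<in> H} \<subseteq> carrier N \<times> carrier R" using HN(1) f(1) by blast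
    show "(\<zero>\<^bsub>N\<^esub>, \<zero>\<^bsub>R\<^esub>) \<in> {(x, f x) | x. x \<in> H}" using z z' by force
  next
    fix x y x' y' assume "(x, y) \<in> {(x, f x) | x. x \<in> H}" "(x', y') \<in> {(x, f x) | x. x \<in> H}"
    then have h: "x \<in> H" "y = f x" "x' \<in> H" "y' = f x'" by blast+
    then show "(x \<oplus>\<^bsub>N\<^esub> x', y \<oplus>\<^bsub>R\<^esub> y') \<in> {(x, f x) | x. x \<in> H}" using HN(3)[OF h(1,3)] f(2)[OF h(1,3)] by force
  next
    fix a x y assume a: "a \<in> carrier R" and "(x, y) \<in> {(x, f x) | x. x \<in> H}"
    then have h: "x \<in> H" "y = f x" by blast+
    then show "(a \<odot>\<^bsub>N\<^esub> x, a \<otimes>\<^bsub>R\<^esub> y) \<in> {(x, f x) | x. x \<in> H}" using HN(4)[OF a h(1)] f(3)[OF a h(1)] by force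
  next
    fix y assume "(\<zero>\<^bsub>N\<^esub>, y) \<in> {(x, f x) | x. x \<in> H}"
    then show "y = \<zero>\<^bsub>R\<^esub>" using z' by blast
  qed
  then obtain G where G: "phom N G" "{(x, f x) | x. x \<in> H} \<subseteq> G" "\<forall>x\<in>carrier N. \<exists>y. (x, y) \<in> G"
    using phom_maximal by blast
  define g where "g x = (THE y. (x, y) \<in> G)" for x
  have gG: "g x = y" if "(x, y) \<in> G" for x y unfolding g_def using that phom_unique[OF G(1)] by (intro the_equality)
  have Gg: "(x, g x) \<in> G" if "x \<in> carrier N" for x using G(3) gG that by auto
  have g1: "g x \<in> carrier R" if "x \<in> carrier N" for x by (rule phomD(2)[OF G(1) Gg[OF that]])
  have g2: "g (x \<oplus>\<^bsub>N\<^esub> y) = g x \<oplus>\<^bsub>R\<^esub> g y" if "x \<in> carrier N" "y \<in> carrier N" for x y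
    by (rule gG[OF phomD(4)[OF G(1) Gg[OF that(1)] Gg[OF that(2)]]])
  have g3: "g (a \<odot>\<^bsub>N\<^esub> x) = a \<otimes>\<^bsub>R\<^esub> g x" if ax: "a \<in> carrier R" "x \<in> carrier N" for a x
  proof -
    obtain a' where "a = \<rho> a'" using rho_ex[OF ax(1)] by (rule exE)
    then show ?thesis using gG[OF phomD(5)[OF G(1) Gg[OF ax(2)], of a']] by (simp only:)
  qed
  have "g \<in> lin_homs R N (self_module R)"
    unfolding lin_homs_def self_module_def module.simps partial_object.simps ring.simps using g1 g2 g3 by simp
  moreover have "\<forall>x\<in>H. g x = f x" using gG G(2) by blast
  ultimately show ?thesis by (intro bexI)
qed

end

lemma self_module_module: "Module.module R (self_module R)"
proof (rule moduleI[OF R_cring])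
  show "abelian_group (self_module R)"
  proof (rule abelian_groupI)
    fix x assume "x \<in> carrier (self_module R)"
    then show "\<exists>y\<in>carrier (self_module R). y \<oplus>\<^bsub>self_module R\<^esub> x = \<zero>\<^bsub>self_module R\<^esub>"
      using RR.l_neg[of x] RR.a_inv_closed[of x] by (auto simp: self_module_def)
  qed (auto simp: self_module_def RR.a_ac)
qed (auto simp: self_module_def RR.l_distr RR.r_distr RR.m_assoc)

text \<open>\<open>R\<close> is injective over itself, so it is its own resolution. The remaining
  terms are zero modules, whose injectivity the definition asks for as well.\<close>

lemma gorenstein_quotient: "gorenstein_local_ring R"
proof -
  define Z :: "('r, 'r) module" where "Z = (self_module R)\<lparr>carrier := {\<zero>\<^bsub>R\<^esub>}\<rparr>"
  have "Module.module R Z"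
  proof (rule moduleI[OF R_cring])
    show "abelian_group Z" by (rule abelian_groupI) (auto simp: Z_def self_module_def)
  qed (auto simp: Z_def self_module_def)
  moreover have "\<exists>g\<in>lin_homs R N Z. \<forall>x\<in>H. g x = f x"
    if N: "Module.module R N" and H: "submodule H R N" and f: "f \<in> lin_homs R (N\<lparr>carrier := H\<rparr>) Z" for N :: "('r, 'r) module" and H f
  proof (rule bexI[of _ "\<lambda>_. \<zero>\<^bsub>R\<^esub>"])
    show "\<forall>x\<in>H. \<zero>\<^bsub>R\<^esub> = f x" using f by (auto simp: lin_homs_def Z_def Pi_iff)
    show "(\<lambda>_. \<zero>\<^bsub>R\<^esub>) \<in> lin_homs R N Z" by (simp add: lin_homs_def Z_def self_module_def)
  qed
  ultimately have Z: "injective_module R Z" unfolding injective_module_def by blast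
  have S: "injective_module R (self_module R)"
    unfolding injective_module_def using self_module_module hom_extend by blast
  define E where "E i = (if i = 0 then self_module R else Z)" for i :: nat
  have "finite_injective_dim R (self_module R)" unfolding finite_injective_dim_def
  proof (intro exI[of _ E] exI[of _ id] exI[of _ "\<lambda>_ _. \<zero>\<^bsub>R\<^esub>"] exI[of _ 0] conjI allI impI)
    show "injective_module R (E i)" for i using Z S by (simp add: E_def)
  qed (auto simp: E_def Z_def self_module_def lin_homs_def)
  then show ?thesis using R_cring noetherian unique_maximal by (simp add: gorenstein_local_ring_def)
qed

text \<open>Evaluation at \<open>t\<close> maps the polynomials over a coefficient field onto
  \<open>R\<close>, and its kernel is generated by the \<open>n\<close>-th power of the
  variable.\<close>

lemma truncated_polynomials:
  "\<exists>(F :: 'r ring) n. Ring.field F \<and> ring_hom (ring_of_type_algebra :: 'a ring) F \<noteq> {} \<and> R \<simeq> truncated_poly_ring F n"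
proof -
  obtain L where "lifts UNIV L" using ex_coefficient_field by (rule exE)
  then have sL: "sr L" and Lm: "L \<inter> m \<subseteq> \<qq>" and lift: "\<And>x. \<exists>l\<in>L. x - l \<in> m" by (auto simp: lifts_def coh_def)
  have Lq: "l \<in> \<qq>" if "l \<in> L" "l \<in> m" for l using Lm that by blast
  define F where "F = R\<lparr>carrier := \<rho> ` L\<rparr>"
  have Lneg: "- x \<in> L" if "x \<in> L" for x using srD(4)[OF sL srD(3)[OF sL] that] by simp
  have Fc: "cring F" unfolding F_def by (rule subring_cring[OF srD(3,2)[OF sL] srD(6,5)[OF sL] Lneg])
  have Fs: "carrier F = \<rho> ` L" "\<one>\<^bsub>F\<^esub> = \<rho> 1" "\<zero>\<^bsub>F\<^esub> = \<rho> 0" "\<And>x y. x \<otimes>\<^bsub>F\<^esub> y = x \<otimes>\<^bsub>R\<^esub> y" "\<And>x y. x \<oplus>\<^bsub>F\<^esub> y = x \<oplus>\<^bsub>R\<^esub> y"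
    by (simp_all add: F_def R)
  interpret F: cring F by (rule Fc)
  have ff: "Ring.field F"
  proof (rule F.cring_fieldI2)
    show "\<zero>\<^bsub>F\<^esub> \<noteq> \<one>\<^bsub>F\<^esub>" using rho_0[of 1] one_notin qm by (auto simp: Fs)
    fix a assume a: "a \<in> carrier F" "a \<noteq> \<zero>\<^bsub>F\<^esub>"
    then obtain l where l: "l \<in> L" "a = \<rho> l" by (auto simp: Fs)
    then have "l \<notin> m" using a(2) Lq rho_0 by (auto simp: Fs)
    then obtain y where y: "1 - l * y \<in> \<qq>" using unit by blast
    obtain l' where l': "l' \<in> L" "y - l' \<in> m" using lift by blast
    have "1 - l * l' = (1 - l * y) + l * (y - l')" by (simp add: algebra_simps)
    then have "1 - l * l' \<in> m" using tidealD(2)[OF tm _ tidealD(3)[OF tm l'(2)]] y qm by (metis subsetD)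
    then have "1 - l * l' \<in> \<qq>" using Lq srD(4)[OF sL srD(2)[OF sL] srD(5)[OF sL l(1) l'(1)]] by blast
    then have "\<rho> (l * l') = \<rho> 1" using rho_eq[of 1 "l * l'"] by simp
    then show "\<exists>b\<in>carrier F. a \<otimes>\<^bsub>F\<^esub> b = \<one>\<^bsub>F\<^esub>" using l l'(1) by (intro bexI[of _ "\<rho> l'"]) (auto simp: Fs R)
  qed
  \<comment> \<open>The base field is mapped to \<open>F\<close> by taking the element of
    \<open>L\<close> in the residue class of a scalar. The scalar itself need not lie in
    \<open>L\<close>, so this may differ from the structure map of \<open>R\<close>.\<close>
  have "\<forall>c. \<exists>l. l \<in> L \<and> c *s 1 - l \<in> m" using lift by blast
  from choice[OF this] obtain \<kappa> where \<kappa>: "\<And>c. \<kappa> c \<in> L" "\<And>c. c *s 1 - \<kappa> c \<in> m" by blast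
  have \<kappa>_eq: "\<rho> (\<kappa> c) = \<rho> l" if "l \<in> L" "c *s 1 - l \<in> m" for c l
  proof -
    have "\<kappa> c - l \<in> m" using tidealD(6)[OF tm that(2) \<kappa>(2)[of c]] by simp
    then show ?thesis unfolding rho_eq by (rule Lq[OF srD(4)[OF sL \<kappa>(1) that(1)]])
  qed
  have "(\<lambda>c. \<rho> (\<kappa> c)) \<in> ring_hom (ring_of_type_algebra :: 'a ring) F"
  proof (rule ring_hom_memI)
    fix a b :: 'a
    have "(a * b) *s 1 - \<kappa> a * \<kappa> b = (b *s 1) * (a *s 1 - \<kappa> a) + \<kappa> a * (b *s 1 - \<kappa> b)"
      by (simp add: algebra_simps scale_mult mult_scale)
    then have "(a * b) *s 1 - \<kappa> a * \<kappa> b \<in> m" using tidealD(2)[OF tm tidealD(3)[OF tm \<kappa>(2)] tidealD(3)[OF tm \<kappa>(2)]] by (simp only:)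
    then show "\<rho> (\<kappa> (a \<otimes>\<^bsub>ring_of_type_algebra\<^esub> b)) = \<rho> (\<kappa> a) \<otimes>\<^bsub>F\<^esub> \<rho> (\<kappa> b)"
      using \<kappa>_eq[OF srD(5)[OF sL \<kappa>(1) \<kappa>(1)]] by (simp add: ring_of_type_algebra_def Fs R)
    have "(a + b) *s 1 - (\<kappa> a + \<kappa> b) = (a *s 1 - \<kappa> a) + (b *s 1 - \<kappa> b)" by (simp add: scale_left_distrib)
    then have "(a + b) *s 1 - (\<kappa> a + \<kappa> b) \<in> m" using tidealD(2)[OF tm \<kappa>(2) \<kappa>(2)] by (simp only:)
    then show "\<rho> (\<kappa> (a \<oplus>\<^bsub>ring_of_type_algebra\<^esub> b)) = \<rho> (\<kappa> a) \<oplus>\<^bsub>F\<^esub> \<rho> (\<kappa> b)"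
      using \<kappa>_eq[OF srD(6)[OF sL \<kappa>(1) \<kappa>(1)]] by (simp add: ring_of_type_algebra_def Fs R)
  next
    show "\<rho> (\<kappa> \<one>\<^bsub>ring_of_type_algebra\<^esub>) = \<one>\<^bsub>F\<^esub>"
      using \<kappa>_eq[OF srD(2)[OF sL], of 1] tidealD(1)[OF tm] by (simp add: ring_of_type_algebra_def Fs)
  qed (use \<kappa>(1) in \<open>auto simp: Fs\<close>)
  then have hom: "ring_hom (ring_of_type_algebra :: 'a ring) F \<noteq> {}" by blast
  have "id \<in> ring_hom F R" by (rule ring_hom_memI) (auto simp: Fs R)
  then interpret U: UP_pre_univ_prop F R id "UP F"
    by (intro UP_pre_univ_prop.intro ring_hom_cring.intro UP_cring.intro ring_hom_cring_axioms.intro Fc R_cring) simp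
  define ev where "ev = eval F R id (\<rho> t)"
  have evh: "ev \<in> ring_hom (UP F) R" unfolding ev_def by (rule U.eval_ring_hom[OF rho_in])
  interpret ev: ring_hom_ring "UP F" R ev by (rule ring_hom_ringI2[OF U.P.ring_axioms RR.ring_axioms evh])
  have ev_monom: "ev (up_ring.monom (UP F) (\<rho> l) i) = \<rho> (l * t ^ i)" if "l \<in> L" for l i
    using U.eval_monom[of "\<rho> l" "\<rho> t" i] that rho_in by (simp add: ev_def Fs R rho_pow)
  \<comment> \<open>Expansion in powers of \<open>t\<close>: each step lifts the residue class of
    the cofactor \<open>y\<close> to \<open>L\<close>.\<close>
  have "\<exists>p\<in>carrier (UP F). \<exists>y. \<rho> x = ev p \<oplus>\<^bsub>R\<^esub> \<rho> (t ^ k * y)" for x k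
  proof (induction k)
    case 0
    have "\<rho> x = ev \<zero>\<^bsub>UP F\<^esub> \<oplus>\<^bsub>R\<^esub> \<rho> (t ^ 0 * x)" using rho_in by simp
    then show ?case using U.P.zero_closed by blast
  next
    case (Suc k)
    then obtain p y where p: "p \<in> carrier (UP F)" "\<rho> x = ev p \<oplus>\<^bsub>R\<^esub> \<rho> (t ^ k * y)" by blast
    obtain l where l: "l \<in> L" "y - l \<in> m" using lift by blast
    obtain w where w: "y - l - t * w \<in> \<qq>" using l(2) unfolding mt prin_iff by (rule exE)
    have "t ^ k * y - (l * t ^ k + t ^ Suc k * w) = t ^ k * (y - l - t * w)" by (simp add: algebra_simps)
    then have "t ^ k * y - (l * t ^ k + t ^ Suc k * w) \<in> \<qq>" using tidealD(3)[OF tq w] by (simp only:)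
    then have e: "\<rho> (t ^ k * y) = \<rho> (l * t ^ k) \<oplus>\<^bsub>R\<^esub> \<rho> (t ^ Suc k * w)" by (simp add: R rho_eq)
    let ?p = "p \<oplus>\<^bsub>UP F\<^esub> up_ring.monom (UP F) (\<rho> l) k"
    have mc: "up_ring.monom (UP F) (\<rho> l) k \<in> carrier (UP F)" using l(1) by (intro U.monom_closed) (simp add: Fs)
    have "ev ?p = ev p \<oplus>\<^bsub>R\<^esub> \<rho> (l * t ^ k)" using ev.hom_add[OF p(1) mc] ev_monom[OF l(1)] by simp
    then have "\<rho> x = ev ?p \<oplus>\<^bsub>R\<^esub> \<rho> (t ^ Suc k * w)" using p e rho_in by (simp add: RR.a_assoc)
    then show ?case using U.P.a_closed[OF p(1) mc] by blast
  qed
  then have surj: "\<rho> x \<in> ev ` carrier (UP F)" for x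
  proof -
    obtain p y where p: "p \<in> carrier (UP F)" "\<rho> x = ev p \<oplus>\<^bsub>R\<^esub> \<rho> (t ^ n * y)"
      using \<open>\<And>x k. \<exists>p\<in>carrier (UP F). \<exists>y. \<rho> x = ev p \<oplus>\<^bsub>R\<^esub> \<rho> (t ^ k * y)\<close> by blast
    have "\<rho> (t ^ n * y) = \<zero>\<^bsub>R\<^esub>" using tidealD(4)[OF tq tn] by (simp add: R rho_0)
    then show ?thesis using p by simp
  qed
  let ?X = "up_ring.monom (UP F) \<one>\<^bsub>F\<^esub> n"
  have Xc: "?X \<in> carrier (UP F)" by (rule U.monom_closed[OF F.one_closed])
  have evX: "ev ?X = \<zero>\<^bsub>R\<^esub>" using ev_monom[OF srD(2)[OF sL], of n] tn by (simp add: Fs R rho_0)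
  have "a_kernel (UP F) R ev = PIdl\<^bsub>UP F\<^esub> ?X"
  proof
    show "PIdl\<^bsub>UP F\<^esub> ?X \<subseteq> a_kernel (UP F) R ev"
    proof
      fix y assume "y \<in> PIdl\<^bsub>UP F\<^esub> ?X"
      then obtain q where q: "q \<in> carrier (UP F)" "y = q \<otimes>\<^bsub>UP F\<^esub> ?X" unfolding cgenideal_def by blast
      have "ev y = \<zero>\<^bsub>R\<^esub>" unfolding q(2) ev.hom_mult[OF q(1) Xc] evX by (rule RR.r_null[OF ev.hom_closed[OF q(1)]])
      then show "y \<in> a_kernel (UP F) R ev" unfolding a_kernel_def' using U.P.m_closed[OF q(1) Xc] q(2) by blast
    qed
    show "a_kernel (UP F) R ev \<subseteq> PIdl\<^bsub>UP F\<^esub> ?X"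
    proof
      fix p assume "p \<in> a_kernel (UP F) R ev"
      then have p: "p \<in> carrier (UP F)" "ev p = \<zero>\<^bsub>R\<^esub>" unfolding a_kernel_def' by blast+
      let ?c = "up_ring.coeff (UP F) p"
      have "\<forall>i. \<exists>l. l \<in> L \<and> ?c i = \<rho> l" using U.coeff_closed[OF p(1)] by (auto simp: Fs)
      from choice[OF this] obtain l where l: "\<And>i. l i \<in> L" "\<And>i. ?c i = \<rho> (l i)" by blast
      have "ev p = finsum R (\<lambda>i. \<rho> (l i * t ^ i)) {..deg F p}"
        unfolding ev_def using p(1) by (simp add: U.eval_on_carrier l(2) R rho_pow)
      then have "\<rho> (\<Sum>i\<le>deg F p. l i * t ^ i) = \<rho> 0" using p(2) by (simp add: rho_finsum R)
      then have s0: "(\<Sum>i\<le>deg F p. l i * t ^ i) \<in> \<qq>" by (simp add: rho_0)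
      \<comment> \<open>Once the earlier coefficients vanish, only the term of index
        \<open>i\<close> survives modulo \<open>t ^ Suc i\<close>. If \<open>l i\<close> were a
        unit, \<open>t ^ i\<close> would be a multiple of \<open>t ^ Suc i\<close> and hence
        0.\<close>
      have "l i \<in> \<qq>" if "i < n" for i using that
      proof (induction i rule: less_induct)
        case (less i)
        show ?case
        proof (cases "i \<le> deg F p")
          case False
          then have "?c i = \<zero>\<^bsub>F\<^esub>" using U.deg_aboveD p(1) by simp
          then show ?thesis by (simp add: l(2) Fs rho_0)
        next
          case True
          define J where "J = prin (t ^ Suc i) \<qq>"
          have J: "tideal J" "\<qq> \<subseteq> J" by (simp_all add: J_def tideal_prin[OF tq] prin_superset)
          have "(\<Sum>j\<in>{..deg F p} - {i}. l j * t ^ j) \<in> J"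
          proof (rule tidealD(8)[OF J(1)])
            fix j assume j: "j \<in> {..deg F p} - {i}"
            show "l j * t ^ j \<in> J"
            proof (cases "j < i")
              case True then show ?thesis using less J(2) tidealD(4)[OF J(1)] by auto
            next
              case False
              then have "Suc i \<le> j" using j by auto
              then have "t ^ j = t ^ Suc i * t ^ (j - Suc i)" by (simp only: power_add[symmetric]) simp
              then show ?thesis using tidealD(3)[OF J(1) tidealD(4)[OF J(1) prin_self[OF tq, of "t ^ Suc i", folded J_def]]] by metis
            qed
          qed
          moreover have "(\<Sum>j\<le>deg F p. l j * t ^ j) = l i * t ^ i + (\<Sum>j\<in>{..deg F p} - {i}. l j * t ^ j)"
            using True by (subst sum.remove[of _ i]) auto
          then have "l i * t ^ i + (\<Sum>j\<in>{..deg F p} - {i}. l j * t ^ j) \<in> J" using s0 J(2) by auto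
          ultimately have iJ: "t ^ i * l i \<in> J" using tideal_add_cancel[OF J(1)] by (simp add: mult.commute)
          show ?thesis
          proof (rule ccontr)
            assume "l i \<notin> \<qq>"
            then have "l i \<notin> m" using Lq l(1) by blast
            then have "t ^ i \<in> J" by (rule unit_cancel[OF J _ iJ])
            then obtain w where "t ^ i - t ^ Suc i * w \<in> \<qq>" unfolding J_def prin_iff by (rule exE)
            then have "t ^ i * (1 - t * w) \<in> \<qq>" by (simp add: algebra_simps)
            moreover have "t * w \<in> m" unfolding mt by (rule prin_mem[OF tq])
            then have "1 - t * w \<notin> m" using tidealD(2)[OF tm, of "1 - t * w" "t * w"] one_notin by auto
            ultimately have "t ^ i \<in> \<qq>" using unit_cancel[OF tq order_refl] by blast
            then show False using tl less.prems by blast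
          qed
        qed
      qed
      then have c0: "?c i = \<zero>\<^bsub>F\<^esub>" if "i < n" for i using that by (simp add: l(2) Fs rho_0)
      \<comment> \<open>The quotient of \<open>p\<close> by the \<open>n\<close>-th power of the
        variable, obtained by shifting the coefficients.\<close>
      define q where "q i = ?c (i + n)" for i
      have "q \<in> UnivPoly.up F"
      proof (rule mem_upI)
        show "q i \<in> carrier F" for i using U.coeff_closed[OF p(1)] by (simp add: q_def)
        show "\<exists>k. bound \<zero>\<^bsub>F\<^esub> k q" using U.deg_aboveD[OF _ p(1)] by (intro exI[of _ "deg F p"] bound.intro) (simp add: q_def)
      qed
      then have qc: "q \<in> carrier (UP F)" "\<And>i. up_ring.coeff (UP F) q i = q i" by (rule UP_function)+
      have "p = ?X \<otimes>\<^bsub>UP F\<^esub> q"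
      proof (rule U.up_eqI[OF _ p(1) U.P.m_closed[OF Xc qc(1)]])
        fix k
        have qF: "q i \<in> carrier F" for i using U.coeff_closed[OF p(1)] by (simp add: q_def)
        have "up_ring.coeff (UP F) (?X \<otimes>\<^bsub>UP F\<^esub> q) k = finsum F (\<lambda>i. (if n = i then \<one>\<^bsub>F\<^esub> else \<zero>\<^bsub>F\<^esub>) \<otimes>\<^bsub>F\<^esub> q (k - i)) {..k}"
          using U.coeff_mult[OF Xc qc(1)] qc(2) U.coeff_monom[OF F.one_closed] by simp
        also have "\<dots> = finsum F (\<lambda>i. if n = i then q (k - i) else \<zero>\<^bsub>F\<^esub>) {..k}"
          using qF by (intro F.finsum_cong') auto
        also have "\<dots> = ?c k"
        proof (cases "n \<le> k")
          case True
          then have "finsum F (\<lambda>i. if n = i then q (k - i) else \<zero>\<^bsub>F\<^esub>) {..k} = q (k - n)" using qF by (intro F.finsum_singleton) auto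
          then show ?thesis using True by (simp add: q_def)
        next
          case False
          have "finsum F (\<lambda>i. if n = i then q (k - i) else \<zero>\<^bsub>F\<^esub>) {..k} = finsum F (\<lambda>i. \<zero>\<^bsub>F\<^esub>) {..k}"
            using False by (intro F.finsum_cong') auto
          then show ?thesis using c0[of k] False by simp
        qed
        finally show "?c k = up_ring.coeff (UP F) (?X \<otimes>\<^bsub>UP F\<^esub> q) k" by simp
      qed
      then have "p = q \<otimes>\<^bsub>UP F\<^esub> ?X" using U.P.m_comm[OF Xc qc(1)] by simp
      then show "p \<in> PIdl\<^bsub>UP F\<^esub> ?X" using qc(1) unfolding cgenideal_def by blast
    qed
  qed
  also have "\<dots> = genideal (UP F) {?X}" by (rule U.P.cgenideal_eq_genideal[OF Xc])
  finally have ker: "a_kernel (UP F) R ev = genideal (UP F) {?X}" .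
  have "ev ` carrier (UP F) = carrier R" using surj ev.hom_closed R(1) by (intro subset_antisym) auto
  then have "UP F Quot a_kernel (UP F) R ev \<simeq> R" by (rule ev.FactRing_iso)
  then have "truncated_poly_ring F n \<simeq> R" by (simp add: truncated_poly_ring_def ker)
  moreover have "ring (truncated_poly_ring F n)" unfolding truncated_poly_ring_def using Xc
    by (intro ideal.quotient_is_ring U.P.genideal_ideal) simp
  ultimately have "R \<simeq> truncated_poly_ring F n" by (rule ring_iso_sym[rotated])
  then show ?thesis using ff hom by blast
qed

end

section \<open>Schemes in linearly general position\<close>

lemma local_ring_chain:
  assumes p: "presents r I \<aa> N" and P: "P \<in> points r I"
    and pr: "\<And>m. mp.maxi m \<Longrightarrow> \<aa> \<subseteq> m \<Longrightarrow> \<exists>t\<in>m. m = mp.prin t (mp.loc \<aa> m)"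
  obtains m \<rho> \<nu> t n where "chain_quotient scalem (local_ring_at r I P) \<rho> (mp.loc \<aa> m) m \<nu> t n"
proof -
  obtain m \<rho> where m: "mp.maxi m" "\<aa> \<subseteq> m" and q: "quotient_ring scalem (local_ring_at r I P) \<rho> (mp.loc \<aa> m)"
    by (rule local_ring_at_quotient[OF p P])
  obtain t where t: "t \<in> m" "m = mp.prin t (mp.loc \<aa> m)" using pr[OF m] by (rule bexE)
  define n where "n = (LEAST n. t ^ n \<in> mp.loc \<aa> m)"
  have nil: "z ^ mp.codim \<aa> \<in> mp.loc \<aa> m" if "z \<in> m" for z
    by (rule mp.loc_nilpotent[OF presentsD(2)[OF p] m(1) presentsD(1)[OF p] that])
  interpret quotient_ring scalem "local_ring_at r I P" \<rho> "mp.loc \<aa> m" by (rule q)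
  have "chain_quotient scalem (local_ring_at r I P) \<rho> (mp.loc \<aa> m) m (mp.codim \<aa>) t n"
  proof
    show "mp.maxi m" "mp.loc \<aa> m \<subseteq> m" "mp.tideal (mp.loc \<aa> m)" using m(1) mp.loc_subset[OF m] tqR by auto
    show "\<exists>y. 1 - x * y \<in> mp.loc \<aa> m" if xm: "x \<notin> m" for x
    proof -
      obtain y where "1 - x * y \<in> mp.loc \<aa> m" by (rule mp.loc_unit[OF presentsD(2)[OF p] m(1) presentsD(1)[OF p] xm])
      then show ?thesis by (rule exI)
    qed
    show "m = mp.prin t (mp.loc \<aa> m)" by (rule t(2))
    show "t ^ n \<in> mp.loc \<aa> m" unfolding n_def by (rule LeastI, rule nil[OF t(1)])
    show "t ^ i \<notin> mp.loc \<aa> m" if "i < n" for i using not_less_Least that unfolding n_def by blast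
  qed (rule nil)
  then show thesis by (rule that)
qed

lemma unramified_at_rational:
  assumes p: "presents r I \<aa> N" and P: "P \<in> points r I" "scheme_degree r P = 1"
    and indep: "\<And>K v. mp.tideal K \<Longrightarrow> \<aa> \<subseteq> K \<Longrightarrow> r + 1 \<le> mp.codim K \<Longrightarrow> v \<in> forms r 1 \<Longrightarrow> v \<in> K \<Longrightarrow> v = 0"
    and span: "\<And>K x. mp.tideal K \<Longrightarrow> \<aa> \<subseteq> K \<Longrightarrow> mp.codim K \<le> r + 1 \<Longrightarrow> \<exists>v\<in>forms r 1. x - v \<in> K"
  shows "unramified_at r I P"
proof -
  let ?R = "local_ring_at r I P"
  obtain m \<rho> where m: "mp.maxi m" "\<aa> \<subseteq> m" "scheme_degree r P = mp.codim m" "\<And>f j. f \<in> forms r j \<Longrightarrow> f \<in> m \<longleftrightarrow> f \<in> P"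
    and q: "quotient_ring scalem ?R \<rho> (mp.loc \<aa> m)"
    and fr: "\<And>f g n x. f \<in> forms r n \<Longrightarrow> g \<in> forms r n \<Longrightarrow> g \<notin> P \<Longrightarrow> f - x * g \<in> mp.loc \<aa> m \<Longrightarrow> frac_class r I P f g = \<rho> x"
    using local_ring_at_quotient[OF p P(1)] by (metis (no_types, lifting))
  define \<qq> where "\<qq> = mp.loc \<aa> m"
  interpret quotient_ring scalem ?R \<rho> \<qq> unfolding \<qq>_def by (rule q)
  have aq: "\<aa> \<subseteq> \<qq>" unfolding \<qq>_def by (rule mp.loc_superset[OF m(1)])
  have qm: "\<qq> \<subseteq> m" unfolding \<qq>_def by (rule mp.loc_subset[OF m(1,2)])
  have fq: "mp.fcod \<qq>" by (rule mp.fcod_tideal[OF presentsD(2)[OF p] aq tqR])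
  \<comment> \<open>The elements of \<open>m\<close> are nilpotent modulo \<open>\<qq>\<close>, so
    \<open>m\<close> is the only maximal ideal over \<open>\<qq>\<close>; rationality of
    \<open>P\<close> then gives codimension 1.\<close>
  have max1: "mp.codim m' = 1" if m': "mp.maxi m'" "\<qq> \<subseteq> m'" for m'
  proof -
    have "m \<subseteq> m'"
    proof
      fix z assume "z \<in> m"
      then have "z ^ mp.codim \<aa> \<in> \<qq>" unfolding \<qq>_def by (rule mp.loc_nilpotent[OF presentsD(2)[OF p] m(1) presentsD(1)[OF p]])
      then show "z \<in> m'" using mp.maxi_power[OF m'(1)] m'(2) by blast
    qed
    moreover have "1 \<notin> m'" using m'(1) by (simp add: mp.maxi_def)
    ultimately have "m' = m" using mp.maxi_subset_eq[OF m(1) mp.maxi_tideal[OF m'(1)]] by blast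
    then show ?thesis using m(3) P(2) by simp
  qed
  obtain \<jj> where j: "mp.tideal \<jj>" "\<qq> \<subseteq> \<jj>" "mp.codim \<jj> = min (r + 1) (mp.codim \<qq>)"
    by (rule mp.ideal_between[OF fq tqR mp.tideal_UNIV subset_UNIV, of "min (r + 1) (mp.codim \<qq>)"]) (simp_all add: mp.codim_UNIV max1)
  have aj: "\<aa> \<subseteq> \<jj>" using aq j(2) by blast
  \<comment> \<open>If the local ring has dimension below \<open>r + 1\<close>, then
    \<open>\<jj> = \<qq>\<close> and the intersection is zero for that reason alone.\<close>
  have V1: "v \<in> \<qq>" if v: "v \<in> forms r 1" "v \<in> \<jj>" for v
  proof (cases "r + 1 \<le> mp.codim \<qq>")
    case True
    then have "v = 0" using indep[OF j(1) aj _ v] j(3) by simp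
    then show ?thesis using mp.tidealD(1)[OF tqR] by simp
  next
    case False
    then have "\<qq> = \<jj>" using mp.codim_eq_imp_eq[OF fq j(2) mp.tideal_subspace[OF j(1)]] j(3) by simp
    then show ?thesis using v(2) by simp
  qed
  have V2: "\<exists>v\<in>forms r 1. x - v \<in> \<jj>" for x using span[OF j(1) aj] j(3) by simp
  show ?thesis unfolding unramified_at_def Let_def
  proof (intro ballI)
    fix g assume "g \<in> forms r 1 - P"
    then have g: "g \<in> forms r 1" "g \<notin> P" by blast+
    have "g \<notin> m" using m(4)[OF g(1)] g(2) by simp
    then obtain y where y: "1 - g * y \<in> \<qq>" unfolding \<qq>_def by (rule mp.loc_unit[OF presentsD(2)[OF p] m(1) presentsD(1)[OF p]])
    have fc: "frac_class r I P l g = \<rho> (l * y)" if "l \<in> forms r 1" for l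
    proof (rule fr[OF that g])
      have "l - l * y * g = l * (1 - g * y)" by (simp add: algebra_simps)
      then show "l - l * y * g \<in> mp.loc \<aa> m" using mp.tidealD(3)[OF tqR y] by (simp only: \<qq>_def)
    qed
    then have img: "(\<lambda>l. frac_class r I P l g) ` forms r 1 = (\<lambda>l. \<rho> (l * y)) ` forms r 1" by simp
    \<comment> \<open>Division by \<open>g\<close> is multiplication by the unit \<open>y\<close>
      modulo \<open>\<qq>\<close>, which does not affect membership in \<open>\<jj>\<close>.\<close>
    have yj: "l * y \<in> \<jj> \<longleftrightarrow> l \<in> \<jj>" for l
    proof
      assume "l * y \<in> \<jj>"
      moreover have "l = g * (l * y) + l * (1 - g * y)" by (simp add: algebra_simps)
      ultimately show "l \<in> \<jj>" using mp.tidealD(2)[OF j(1) mp.tidealD(3)[OF j(1)] mp.tidealD(3)[OF j(1)]] y j(2) by (metis subsetD)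
    qed (rule mp.tidealD(4)[OF j(1)])
    show "\<exists>J. ideal J ?R \<and> (\<lambda>l. frac_class r I P l g) ` forms r 1 \<inter> J = {\<zero>\<^bsub>?R\<^esub>} \<and>
      (\<lambda>l. frac_class r I P l g) ` forms r 1 <+>\<^bsub>?R\<^esub> J = carrier ?R"
      unfolding img
    proof (intro exI[of _ "\<rho> ` \<jj>"] conjI)
      show "ideal (\<rho> ` \<jj>) ?R" by (rule ideal_image[OF j(1)])
      show "(\<lambda>l. \<rho> (l * y)) ` forms r 1 \<inter> \<rho> ` \<jj> = {\<zero>\<^bsub>?R\<^esub>}"
      proof
        show "{\<zero>\<^bsub>?R\<^esub>} \<subseteq> (\<lambda>l. \<rho> (l * y)) ` forms r 1 \<inter> \<rho> ` \<jj>"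
          using forms_0[of r 1] mp.tidealD(1)[OF j(1)] unfolding R(5) by (auto intro: rev_image_eqI)
        show "(\<lambda>l. \<rho> (l * y)) ` forms r 1 \<inter> \<rho> ` \<jj> \<subseteq> {\<zero>\<^bsub>?R\<^esub>}"
        proof
          fix z assume "z \<in> (\<lambda>l. \<rho> (l * y)) ` forms r 1 \<inter> \<rho> ` \<jj>"
          then obtain l x where l: "l \<in> forms r 1" "z = \<rho> (l * y)" and x: "x \<in> \<jj>" "z = \<rho> x" by blast
          have "l * y - x \<in> \<jj>" using rho_eq[of "l * y" x] l(2) x(2) j(2) by auto
          then have "l \<in> \<jj>" using mp.tideal_cong[OF j(1)] x(1) yj by blast
          then have "l \<in> \<qq>" by (rule V1[OF l(1)])
          then show "z \<in> {\<zero>\<^bsub>?R\<^esub>}" using mp.tidealD(4)[OF tqR] by (simp add: l(2) R(5) rho_0)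
        qed
      qed
      show "(\<lambda>l. \<rho> (l * y)) ` forms r 1 <+>\<^bsub>?R\<^esub> \<rho> ` \<jj> = carrier ?R"
      proof
        show "(\<lambda>l. \<rho> (l * y)) ` forms r 1 <+>\<^bsub>?R\<^esub> \<rho> ` \<jj> \<subseteq> carrier ?R"
          unfolding set_add_def' using rho_in RR.a_closed by blast
        show "carrier ?R \<subseteq> (\<lambda>l. \<rho> (l * y)) ` forms r 1 <+>\<^bsub>?R\<^esub> \<rho> ` \<jj>"
        proof
          fix z assume "z \<in> carrier ?R"
          then obtain x where x: "z = \<rho> x" using rho_ex by blast
          obtain v where v: "v \<in> forms r 1" "x * g - v \<in> \<jj>" using V2 by blast
          have "x - (v * y + (x * g - v) * y) = x * (1 - g * y)" by (simp add: algebra_simps)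
          then have "x - (v * y + (x * g - v) * y) \<in> \<qq>" using mp.tidealD(3)[OF tqR y] by (simp only:)
          then have "z = \<rho> (v * y) \<oplus>\<^bsub>?R\<^esub> \<rho> ((x * g - v) * y)" unfolding x R(3) rho_eq .
          then show "z \<in> (\<lambda>l. \<rho> (l * y)) ` forms r 1 <+>\<^bsub>?R\<^esub> \<rho> ` \<jj>"
            unfolding set_add_def' using v(1) mp.tidealD(4)[OF j(1) v(2), of y] by blast
        qed
      qed
    qed
  qed
qed

locale lgp_scheme =
  fixes r :: nat and \<Gamma> \<aa> :: "'k::field mpol set" and N :: nat
  assumes hom: "homogeneous_ideal r \<Gamma>" and lgp: "geom_lin_gen_pos r \<Gamma>" and p: "presents r \<Gamma> \<aa> N"
    and deg: "r + 3 \<le> mp.codim \<aa>"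
begin

lemma ta: "mp.tideal \<aa>" and fa: "mp.fcod \<aa>" using presentsD[OF p] by blast+

lemma id: "ideal \<Gamma> (polyring r)" using hom by (simp add: homogeneous_ideal_def)

text \<open>On \<open>P^0\<close> the forms of each degree have dimension at most 1, too little for
  degree \<open>r + 3\<close>.\<close>

lemma r1: "1 \<le> r"
proof (rule ccontr)
  assume "\<not> 1 \<le> r"
  then have "mpol.dim (forms r N :: 'k mpol set) \<le> 1" using card_mons_P0[of N] by (simp add: dim_forms not_le)
  then show False using presents_dim[OF p mp.tideal_subspace[OF ta] order_refl order_refl] deg by simp
qed

lemma pK: "presents r (base_change r \<Gamma>) (ext \<aa>) N" by (rule presents_base_change[OF p id])

lemma codimK: "mp.codim (ext \<aa>) = mp.codim \<aa>" by (rule ext_codim(2)[OF fa])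

lemma hyperplaneK:
  assumes "mp.tideal K" "ext \<aa> \<subseteq> K" "r + 1 \<le> mp.codim K" "v \<in> forms r 1" "v \<in> K"
  shows "v = 0"
  by (rule lgp_hyperplane[OF pK base_change_homogeneous[OF hom] lgp[unfolded geom_lin_gen_pos_def] r1 assms])

lemma maxK:
  assumes "mp.maxi M" "ext \<aa> \<subseteq> M"
  shows "\<exists>x. M = mp.prin x (ext \<aa>)"
proof (rule mpc.lgp_max_principal[OF presentsD(2,1)[OF pK] _ r1 forms_fdim _ _ assms])
  show "r + 3 \<le> mp.codim (ext \<aa>)" using deg by (simp add: codimK)
  show "mpol.dim (forms r 1 :: 'k alg_closure mpol set) = r + 1" unfolding dim_forms by (rule card_mons_1)
qed (rule hyperplaneK)

text \<open>\<open>K\<close> is shrunk to colength exactly \<open>r + 1\<close>. The linear forms,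
  of dimension \<open>r + 1\<close>, meet the smaller ideal in 0 and hence complement it.\<close>

lemma spanK:
  assumes K: "mp.tideal K" "ext \<aa> \<subseteq> K" "mp.codim K \<le> r + 1"
  shows "\<exists>v\<in>forms r 1. x - v \<in> K"
proof -
  have d: "r + 1 \<le> mp.codim (ext \<aa>)" using deg by (simp add: codimK)
  obtain K' where K': "mp.tideal K'" "ext \<aa> \<subseteq> K'" "K' \<subseteq> K" "mp.codim K' = r + 1"
    by (rule mpc.ideal_between_ac[OF presentsD(2,1)[OF pK] K(1,2,3) d])
  have fK: "mp.fcod K'" by (rule mp.fcod_tideal[OF presentsD(2)[OF pK] K'(2,1)])
  have v0: "v = 0" if "v \<in> forms r 1" "v \<in> K'" for v by (rule hyperplaneK[OF K'(1,2) _ that]) (simp add: K'(4))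
  note s = mp.codim_sum[OF fK forms_fdim[where r = r and n = 1] v0]
  have "mp.codim {v + j | v j. v \<in> (forms r 1 :: 'k alg_closure mpol set) \<and> j \<in> K'} = 0"
    using s(2) K'(4) card_mons_1[of r] by (simp add: dim_forms)
  then have "x \<in> {v + j | v j. v \<in> forms r 1 \<and> j \<in> K'}" using mp.codim_eq_0[OF s(1)] by blast
  then obtain v j where "x = v + j" "v \<in> forms r 1" "j \<in> K'" by blast
  then show ?thesis using K'(3) by (intro bexI[of _ v]) auto
qed

lemma hyperplane:
  assumes K: "mp.tideal K" "\<aa> \<subseteq> K" "r + 1 \<le> mp.codim K" and v: "v \<in> forms r 1" "v \<in> K"
  shows "v = 0"
proof -
  have "up v = 0"
  proof (rule hyperplaneK[OF ext_tideal[OF K(1)] ext_mono[OF K(2)] _ up_forms[OF v(1)]])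
    show "r + 1 \<le> mp.codim (ext K)" using ext_codim(2)[OF mp.fcod_tideal[OF fa K(2,1)]] K(3) by simp
    show "up v \<in> ext K" using ext_up[OF mp.tideal_subspace[OF K(1)]] v(2) by simp
  qed
  then show ?thesis using up_inj[of v 0] by (simp add: up_0)
qed

text \<open>Over the closure the sum \<open>W\<close> of \<open>K\<close> and the linear forms
  becomes everything, so it is everything already over \<open>k\<close>.\<close>

lemma span:
  assumes K: "mp.tideal K" "\<aa> \<subseteq> K" "mp.codim K \<le> r + 1"
  shows "\<exists>v\<in>forms r 1. x - v \<in> K"
proof -
  define W where "W = {v + j | v j. v \<in> forms r 1 \<and> j \<in> K}"
  have sW: "mpol.subspace W" unfolding W_def by (rule mpol.subspace_sums[OF forms_subspace mp.tideal_subspace[OF K(1)]])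
  have KW: "K \<subseteq> W" "forms r 1 \<subseteq> W" unfolding W_def using forms_0[of r 1] mp.tidealD(1)[OF K(1)] by force+
  have "ext W = UNIV"
  proof (intro equalityI subset_UNIV subsetI)
    fix f
    have "mp.codim (ext K) \<le> r + 1" using ext_codim(2)[OF mp.fcod_tideal[OF fa K(2,1)]] K(3) by simp
    then obtain v where v: "v \<in> forms r 1" "f - v \<in> ext K" using spanK[OF ext_tideal[OF K(1)] ext_mono[OF K(2)]] by blast
    have "v \<in> ext W" "f - v \<in> ext W" using v ext_forms_1 ext_mono[OF KW(1)] ext_mono[OF KW(2)] by blast+
    then show "f \<in> ext W" using mpol.subspace_add[OF ext_subspace[OF sW]] by fastforce
  qed
  then have "x \<in> W" using ext_proper[OF sW] by blast
  then obtain v j where "x = v + j" "v \<in> forms r 1" "j \<in> K" unfolding W_def by blast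
  then show ?thesis by (intro bexI[of _ v]) simp_all
qed

lemma principal:
  assumes "mp.maxi m" "\<aa> \<subseteq> m"
  shows "\<exists>t\<in>m. m = mp.prin t (mp.loc \<aa> m)"
  by (rule descend_principal(1)[OF fa ta maxK assms])

lemma conclusions:
  "gorenstein r \<Gamma>" "curvilinear r \<Gamma>" "unramified r (base_change r \<Gamma>)"
  "P \<in> points r \<Gamma> \<Longrightarrow> scheme_degree r P = 1 \<Longrightarrow> unramified_at r \<Gamma> P"
proof -
  show "gorenstein r \<Gamma>" unfolding gorenstein_def
  proof
    fix P assume P: "P \<in> points r \<Gamma>"
    obtain m \<rho> \<nu> t n where "chain_quotient scalem (local_ring_at r \<Gamma> P) \<rho> (mp.loc \<aa> m) m \<nu> t n"
      by (rule local_ring_chain[OF p P principal])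
    then show "gorenstein_local_ring (local_ring_at r \<Gamma> P)" by (rule chain_quotient.gorenstein_quotient)
  qed
  show "curvilinear r \<Gamma>" unfolding curvilinear_def
  proof
    fix P assume P: "P \<in> points r \<Gamma>"
    obtain m \<rho> \<nu> t n where "chain_quotient scalem (local_ring_at r \<Gamma> P) \<rho> (mp.loc \<aa> m) m \<nu> t n"
      by (rule local_ring_chain[OF p P principal])
    then show "\<exists>(F :: ('k mpol \<times> 'k mpol) set ring) n. Ring.field F \<and> ring_hom (ring_of_type_algebra :: 'k ring) F \<noteq> {} \<and>
      local_ring_at r \<Gamma> P \<simeq> truncated_poly_ring F n" by (rule chain_quotient.truncated_polynomials)
  qed
  show "unramified_at r \<Gamma> P" if "P \<in> points r \<Gamma>" "scheme_degree r P = 1" for P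
    by (rule unramified_at_rational[OF p that hyperplane span])
  show "unramified r (base_change r \<Gamma>)" unfolding unramified_def
  proof
    fix P assume P: "P \<in> points r (base_change r \<Gamma>)"
    obtain m where m: "mp.maxi m" "ext \<aa> \<subseteq> m" "scheme_degree r P = mp.codim m" by (rule local_ring_at_quotient[OF pK P])
    have "mp.codim m = 1"
      by (rule mpc.maxi_codim[OF mp.fcod_tideal[OF presentsD(2)[OF pK] m(2) mp.maxi_tideal[OF m(1)]] m(1)])
    then have "scheme_degree r P = 1" using m(3) by simp
    then show "unramified_at r (base_change r \<Gamma>) P" by (rule unramified_at_rational[OF pK P _ hyperplaneK spanK])
  qed
qed

end

section \<open>Rational normal curves\<close>

lemma (in vspace) independent_family:
  assumes "finite I" and z: "\<And>d i. (\<Sum>i\<in>I. d i *s b i) = 0 \<Longrightarrow> i \<in> I \<Longrightarrow> d i = 0"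
  shows "inj_on b I" "independent (b ` I)"
proof -
  show inj: "inj_on b I"
  proof (rule inj_onI, rule ccontr)
    fix i j assume ij: "i \<in> I" "j \<in> I" "b i = b j" "i \<noteq> j"
    define d :: "_ \<Rightarrow> 'a" where "d k = (if k = i then 1 else 0) - (if k = j then 1 else 0)" for k
    have "(\<Sum>k\<in>I. d k *s b k) = (\<Sum>k\<in>I. if k = i then b k else 0) - (\<Sum>k\<in>I. if k = j then b k else 0)"
      unfolding sum_subtractf[symmetric] by (intro sum.cong) (auto simp: d_def)
    also have "\<dots> = 0" using ij assms(1) by simp
    finally have "d i = 0" by (rule z) (rule ij)
    then show False using ij by (simp add: d_def)
  qed
  show "independent (b ` I)"
  proof (rule independent_if_scalars_zero)
    fix f x assume s: "(\<Sum>x\<in>b ` I. f x *s x) = 0" and "x \<in> b ` I"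
    then obtain i where i: "i \<in> I" "x = b i" by blast
    have "(\<Sum>i\<in>I. f (b i) *s b i) = 0" using s by (simp add: sum.reindex[OF inj])
    then show "f x = 0" using z[of "\<lambda>i. f (b i)"] i by simp
  qed (simp add: assms(1))
qed

context comm_alg
begin

section \<open>A functional vanishing on no nonzero ideal\<close>

lemma maxi_separate:
  assumes "finite F" "\<And>m. m \<in> F \<Longrightarrow> maxi m" "maxi m0" "m0 \<notin> F"
  shows "\<exists>e. (\<forall>m\<in>F. e \<in> m) \<and> 1 - e \<in> m0"
  using assms
proof (induction F rule: finite_induct)
  case empty
  have "1 - 1 \<in> m0" using tidealD(1)[OF maxi_tideal[OF assms(3)]] by simp
  then show ?case by blast
next
  case (insert m F)
  obtain e where e: "\<forall>m\<in>F. e \<in> m" "1 - e \<in> m0" using insert by auto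
  have m: "maxi m" "m \<noteq> m0" using insert by auto
  obtain e' where e': "e' \<in> m" "1 - e' \<in> m0" by (rule maxi_comaximal[OF m(1) insert.prems(2) m(2)])
  have t0: "tideal m0" by (rule maxi_tideal[OF insert.prems(2)])
  have "1 - e * e' = (1 - e) + e * (1 - e')" by (simp add: algebra_simps)
  then have "1 - e * e' \<in> m0" using tidealD(2)[OF t0 e(2) tidealD(3)[OF t0 e'(2)]] by (simp only:)
  moreover have "e * e' \<in> m" by (rule tidealD(3)[OF maxi_tideal[OF m(1)] e'(1)])
  moreover have "e * e' \<in> n" if "n \<in> F" for n
    using tidealD(4)[OF maxi_tideal] insert.prems(1)[of n] e(1) that by blast
  ultimately show ?case by blast
qed

lemma tideal_Inter: "(\<And>m. m \<in> F \<Longrightarrow> tideal m) \<Longrightarrow> tideal (\<Inter>F)"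
  unfolding tideal_def by blast

text \<open>Each further maximal ideal makes the intersection strictly smaller, while its
  codimension is bounded by that of \<open>\<aa>\<close>.\<close>

lemma finite_maxi:
  assumes a: "fcod \<aa>"
  shows "finite {m. maxi m \<and> \<aa> \<subseteq> m}"
proof (rule ccontr)
  have bound: "fcod (\<Inter>F) \<and> card F \<le> codim (\<Inter>F)" if "finite F" "F \<subseteq> {m. maxi m \<and> \<aa> \<subseteq> m}" for F
    using that
  proof (induction F rule: finite_induct)
    case empty show ?case by (simp add: fcod_UNIV)
  next
    case (insert m F)
    have mx: "maxi n" if "n \<in> insert m F" for n using insert.prems that by blast
    have t: "tideal (\<Inter>(insert m F))" by (rule tideal_Inter[OF maxi_tideal[OF mx]])
    have f: "fcod (\<Inter>(insert m F))" by (rule fcod_tideal[OF a _ t]) (use insert.prems in auto)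
    have tF: "tideal (\<Inter>F)" by (rule tideal_Inter[OF maxi_tideal[OF mx]]) simp
    obtain e where e: "\<forall>m\<in>F. e \<in> m" "1 - e \<in> m" using maxi_separate[OF insert(1) mx mx insert(2)] by auto
    have "e \<notin> m"
    proof
      assume "e \<in> m"
      then have "1 \<in> m" using tidealD(2)[OF maxi_tideal[OF mx] e(2), of e] by simp
      then show False using mx[of m] by (simp add: maxi_def)
    qed
    then have "\<Inter>(insert m F) \<subset> \<Inter>F" using e(1) by auto
    then have "codim (\<Inter>F) < codim (\<Inter>(insert m F))" by (rule codim_strict[OF f _ tideal_subspace[OF tF]])
    then have "card (insert m F) \<le> codim (\<Inter>(insert m F))" using insert.IH insert.prems insert(1,2) by simp
    then show ?case using f by blast
  qed
  assume "infinite {m. maxi m \<and> \<aa> \<subseteq> m}"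
  then have "\<exists>F. finite F \<and> card F = Suc (codim \<aa>) \<and> F \<subseteq> {m. maxi m \<and> \<aa> \<subseteq> m}" by (rule infinite_arbitrarily_large)
  then obtain F where F: "finite F \<and> card F = Suc (codim \<aa>) \<and> F \<subseteq> {m. maxi m \<and> \<aa> \<subseteq> m}" by (rule exE)
  then have F: "F \<subseteq> {m. maxi m \<and> \<aa> \<subseteq> m}" "finite F" "card F = Suc (codim \<aa>)" by simp_all
  have t: "subspace (\<Inter>F)" by (rule tideal_subspace[OF tideal_Inter[OF maxi_tideal]]) (use F(1) in blast)
  have "codim (\<Inter>F) \<le> codim \<aa>" by (rule codim_mono[OF a _ t]) (use F(1) in auto)
  then show False using bound[OF F(2,1)] F(3) by simp
qed

text \<open>By \<open>soc\<close> the socle at \<open>m\<close> has at most the dimension of the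
  residue field, so any nonzero element \<open>s m\<close> generates it. A functional with value 1
  at the finitely many \<open>s m\<close> vanishes on no minimal ideal, and every nonzero ideal
  contains a minimal one.\<close>

lemma ex_nondegenerate:
  assumes a: "fcod \<aa>" "tideal \<aa>"
    and soc: "\<And>m. maxi m \<Longrightarrow> \<aa> \<subseteq> m \<Longrightarrow> codim \<aa> \<le> codim m + codim {x. \<forall>z\<in>m. x * z \<in> \<aa>}"
  shows "\<exists>\<phi>. lin_fun \<phi> \<and> (\<forall>x\<in>\<aa>. \<phi> x = 0) \<and> (\<forall>x. (\<forall>y. \<phi> (x * y) = 0) \<longrightarrow> x \<in> \<aa>)"
proof -
  define M where "M = {m. maxi m \<and> (\<exists>t. t \<notin> \<aa> \<and> quo \<aa> t = m)}"
  have "M \<subseteq> {m. maxi m \<and> \<aa> \<subseteq> m}" using quo_superset[OF a(2)] by (auto simp: M_def)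
  then have fM: "finite M" by (rule finite_subset[OF _ finite_maxi[OF a(1)]])
  have "\<forall>m. \<exists>t. m \<in> M \<longrightarrow> t \<notin> \<aa> \<and> quo \<aa> t = m" by (auto simp: M_def)
  from choice[OF this] obtain s where s: "\<And>m. m \<in> M \<Longrightarrow> s m \<notin> \<aa>" "\<And>m. m \<in> M \<Longrightarrow> quo \<aa> (s m) = m" by blast
  have "\<exists>\<phi>. lin_fun \<phi> \<and> (\<forall>x\<in>\<aa>. \<phi> x = 0) \<and> (\<forall>m\<in>F. \<phi> (s m) = 1)" if "finite F" "F \<subseteq> M" for F
    using that
  proof (induction F rule: finite_induct)
    case empty show ?case by (intro exI[of _ "\<lambda>_. 0"]) (simp add: lin_fun_def)
  next
    case (insert m F)
    obtain \<phi> where \<phi>: "lin_fun \<phi>" "\<forall>x\<in>\<aa>. \<phi> x = 0" "\<forall>m\<in>F. \<phi> (s m) = 1" using insert by auto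
    have mM: "m \<in> M" using insert.prems by simp
    obtain w where w: "lin_fun w" "\<And>j. j \<in> \<aa> \<Longrightarrow> w j = 0" "w (s m) = 1"
      by (rule ex_lin_fun[OF tideal_subspace[OF a(2)] s(1)[OF mM]]) (rule that, assumption+)
    obtain e where e: "\<forall>m\<in>F. e \<in> m" "1 - e \<in> m"
      using maxi_separate[OF insert(1) _ _ insert(2)] insert.prems by (auto simp: M_def)
    have "s m * (1 - e) \<in> \<aa>" using e(2) s(2)[OF mM] unfolding quo_def by blast
    then have "w (s m - s m * e) = 0" by (intro w(2)) (simp add: algebra_simps)
    then have em: "w (e * s m) = 1" using w(3) by (simp add: lin_funD[OF w(1)] mult.commute)
    have eF: "w (e * s n) = 0" if "n \<in> F" for n
    proof -
      have "e \<in> quo \<aa> (s n)" using s(2)[of n] e(1) that insert.prems by auto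
      then show ?thesis by (intro w(2)) (simp add: quo_def mult.commute)
    qed
    have ea: "w (e * x) = 0" if "x \<in> \<aa>" for x by (rule w(2)[OF tidealD(3)[OF a(2) that]])
    \<comment> \<open>As \<open>e\<close> is 1 modulo \<open>m\<close> and lies in all members of
      \<open>F\<close>, the correction changes the value at \<open>s m\<close> to 1 and leaves those
      at the other \<open>s n\<close> alone.\<close>
    define \<psi> where "\<psi> x = \<phi> x + (1 - \<phi> (s m)) * w (e * x)" for x
    have "lin_fun \<psi>" unfolding lin_fun_def \<psi>_def
      by (simp add: lin_funD[OF \<phi>(1)] lin_funD[OF w(1)] distrib_left mult_scale algebra_simps)
    moreover have "\<forall>x\<in>\<aa>. \<psi> x = 0" using \<phi>(2) ea by (simp add: \<psi>_def)
    moreover have "\<forall>n\<in>insert m F. \<psi> (s n) = 1" using \<phi>(3) em eF by (simp add: \<psi>_def)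
    ultimately show ?case by blast
  qed
  then obtain \<phi> where \<phi>: "lin_fun \<phi>" "\<forall>x\<in>\<aa>. \<phi> x = 0" "\<forall>m\<in>M. \<phi> (s m) = 1" using fM by blast
  define J where "J = {x. \<forall>y. \<phi> (x * y) = 0}"
  have tJ: "tideal J" unfolding tideal_def
  proof (intro conjI ballI allI)
    show "0 \<in> J" by (simp add: J_def lin_funD[OF \<phi>(1)])
    fix x y assume "x \<in> J" "y \<in> J"
    then show "x + y \<in> J" by (simp add: J_def distrib_right lin_funD[OF \<phi>(1)])
  next
    fix x c assume "x \<in> J"
    then have "\<phi> (x * (c * y)) = 0" for y by (simp add: J_def)
    then show "c * x \<in> J" by (simp add: J_def mult_ac)
  qed
  have aJ: "\<aa> \<subseteq> J" using \<phi>(2) tidealD(4)[OF a(2)] by (auto simp: J_def)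
  have "J = \<aa>"
  proof (rule ccontr)
    assume "J \<noteq> \<aa>"
    then obtain t where t: "t \<in> J" "t \<notin> \<aa>" "maxi (quo \<aa> t)" using minimal_above[OF a tJ] aJ by blast
    define m where "m = quo \<aa> t"
    have mM: "m \<in> M" using t by (auto simp: M_def m_def)
    define S where "S = {x. \<forall>z\<in>m. x * z \<in> \<aa>}"
    have am: "\<aa> \<subseteq> m" unfolding m_def by (rule quo_superset[OF a(2)])
    have "prin t \<aa> = S"
    proof (rule codim_eq_imp_eq[OF codim_quo_prin(2)[OF a]])
      have tS: "tideal S" unfolding tideal_def S_def
        using tidealD(1)[OF a(2)] tidealD(2)[OF a(2)] tidealD(3)[OF a(2)] by (simp add: distrib_right mult.assoc)
      show "subspace S" by (rule tideal_subspace[OF tS])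
      show "prin t \<aa> \<subseteq> S" using tidealD(4)[OF a(2)] by (intro prin_least tS) (auto simp: S_def m_def quo_def)
      show "codim (prin t \<aa>) \<le> codim S" using soc[of m] am t(3) codim_quo_prin(3)[OF a, of t] by (simp add: S_def m_def)
    qed
    moreover have "s m \<in> S" using s(2)[OF mM] unfolding S_def quo_def by blast
    moreover have "prin t \<aa> \<subseteq> J" by (rule prin_least[OF tJ aJ t(1)])
    ultimately have "\<phi> (s m * 1) = 0" unfolding J_def by blast
    then show False using \<phi>(3) mM by simp
  qed
  then show ?thesis using \<phi> unfolding J_def by blast
qed

end

section \<open>Nonvanishing of binary forms\<close>

context lgp_quotient
begin

context
  fixes \<Phi> :: "'b \<Rightarrow> 'a" and A1 A2 :: 'b
  assumes Phi: "lin_fun \<Phi>" "\<And>x. x \<in> bb \<Longrightarrow> \<Phi> x = 0"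
    and ker: "\<And>z. \<Phi> (A1 * z) = 0 \<Longrightarrow> \<Phi> (A2 * z) = 0 \<Longrightarrow> z \<in> VB"
begin

text \<open>If the linear form \<open>l\<close> annihilated \<open>U\<close>, a member of the pencil
  would vanish on \<open>Q = (bb : l)\<close>, so \<open>Q\<close> could not contain an ideal of
  colength \<open>r + 1\<close> over \<open>bb\<close>. Hence \<open>Q\<close> is spanned by
  \<open>U\<close> modulo \<open>bb\<close>, and \<open>U\<close> is an eigenvector of
  \<open>A1\<close> and \<open>A2\<close>. The vanishing hypotheses then put \<open>U\<close> into
  \<open>VB\<close>, against linearly general position.\<close>

lemma linear_factor_nonzero:
  assumes U: "U \<notin> bb" "\<Phi> (U * A1 ^ e) = 0" "\<Phi> (U * A2 ^ e) = 0" and e: "1 \<le> e" and ab: "\<alpha> \<noteq> 0 \<or> \<beta> \<noteq> 0"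
  shows "(\<alpha> *s A1 + \<beta> *s A2) * U \<notin> bb"
proof
  define l where "l = \<alpha> *s A1 + \<beta> *s A2"
  define Q where "Q = quo bb l"
  assume "(\<alpha> *s A1 + \<beta> *s A2) * U \<in> bb"
  then have UQ: "U \<in> Q" by (simp add: Q_def quo_def l_def)
  have tQ: "tideal Q" and bQ: "bb \<subseteq> Q" using tideal_quo[OF tb] quo_superset[OF tb] by (auto simp: Q_def)
  have l0: "\<alpha> * \<Phi> (A1 * x) + \<beta> * \<Phi> (A2 * x) = 0" if "x \<in> Q" for x
  proof -
    have "\<Phi> (l * x) = 0" using that Phi(2) by (simp add: Q_def quo_def)
    then show ?thesis by (simp add: l_def distrib_right scale_mult lin_funD[OF Phi(1)])
  qed
  have big: "r + 2 \<le> codim Q"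
  proof (rule ccontr)
    assume "\<not> r + 2 \<le> codim Q"
    then have "codim Q \<le> r + 1" by simp
    then obtain J where J: "tideal J" "bb \<subseteq> J" "J \<subseteq> Q" "codim J = r + 1"
      by (rule ideal_between_ac[OF fb tb tQ bQ]) (simp_all add: cb)
    define A where "A = (if \<alpha> = 0 then A1 else A2)"
    have lA: "lin_fun (\<lambda>x. \<Phi> (A * x))" by (simp add: lin_fun_def distrib_left mult_scale lin_funD[OF Phi(1)])
    obtain x where x: "x \<in> J" "x \<notin> bb" "\<Phi> (A * x) = 0"
      by (rule ex_kernel_vector[OF fb J(2) tideal_subspace[OF J(1)] _ lA]) (use J(4) cb Phi(2) tidealD(3)[OF tb] in auto)
    have "x \<in> VB" using l0[of x] x(1,3) J(3) ab by (intro ker) (auto simp: A_def split: if_splits)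
    then show False using VB_ideal[OF J(1,2) _ x(1)] J(4) x(2) by simp
  qed
  have "codim bb = Suc (codim (adjoin U bb))" by (rule codim_adjoin[OF fb U(1)])
  then have "codim (adjoin U bb) \<le> codim Q" using big cb by simp
  moreover have "fcod (adjoin U bb)" by (rule fcod_mono[OF fb adjoin_superset subspace_adjoin[OF tideal_subspace[OF tb]]])
  ultimately have QU: "adjoin U bb = Q"
    using adjoin_least[OF tideal_subspace[OF tQ] bQ UQ] by (intro codim_eq_imp_eq tideal_subspace[OF tQ])
  \<comment> \<open>With eigenvalue \<open>c\<close>, the value \<open>\<Phi> (U * A ^ e)\<close> is
    \<open>c ^ e * \<Phi> U\<close>. Its vanishing gives \<open>c * \<Phi> U = 0\<close>, and this
    is \<open>\<Phi> (A * U)\<close>.\<close>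
  have eig: "\<Phi> (A * U) = 0" if h: "\<Phi> (U * A ^ e) = 0" for A
  proof -
    have "A * U \<in> adjoin U bb" unfolding QU by (rule tidealD(3)[OF tQ UQ])
    then obtain c j where cj: "A * U = c *s U + j" "j \<in> bb" unfolding adjoin_def by blast
    have pow: "A ^ k * U - (c ^ k) *s U \<in> bb" for k
    proof (induction k)
      case 0 then show ?case using tidealD(1)[OF tb] by simp
    next
      case (Suc k)
      have "A ^ Suc k * U - (c ^ Suc k) *s U = A * (A ^ k * U - (c ^ k) *s U) + (c ^ k) *s (A * U - c *s U)"
        by (simp add: algebra_simps mult_scale scale_right_diff_distrib)
      moreover have "A * U - c *s U \<in> bb" using cj by simp
      ultimately show ?case using tidealD(2)[OF tb tidealD(3)[OF tb Suc] tidealD(7)[OF tb]] by metis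
    qed
    have "\<Phi> (A ^ e * U - (c ^ e) *s U) = 0" by (rule Phi(2)[OF pow])
    then have "c ^ e * \<Phi> U = 0" using h by (simp add: lin_funD[OF Phi(1)] mult.commute)
    then have "c * \<Phi> U = 0" using e by auto
    then show ?thesis using Phi(2)[OF cj(2)] by (simp add: cj(1) lin_funD[OF Phi(1)])
  qed
  have "U \<in> VB" by (rule ker[OF eig[OF U(2)] eig[OF U(3)]])
  then show False using VB_ideal[OF tQ bQ _ UQ] big U(1) by simp
qed

text \<open>A binary form over an algebraically closed field is a product of linear forms, which are
  multiplied onto \<open>U\<close> one at a time. Each product inherits the vanishing hypothesis
  with \<open>e - 1\<close> in place of \<open>e\<close>, and \<open>j \<le> e\<close> keeps the
  exponent positive as long as factors remain.\<close>

lemma binary_form_nonzero: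
  assumes "p \<noteq> 0" "Polynomial.degree p \<le> j" "j \<le> e" "U \<notin> bb" "\<And>i. i \<le> e \<Longrightarrow> \<Phi> (U * (A1 ^ i * A2 ^ (e - i))) = 0"
  shows "psum p (\<lambda>i. A1 ^ i * A2 ^ (j - i)) * U \<notin> bb"
  using assms
proof (induction j arbitrary: p e U)
  case 0
  define c where "c = Polynomial.coeff p 0"
  have p: "p = [:c:]" unfolding c_def using 0(2) by (simp add: degree_0_id)
  have c: "p = [:c:]" "c \<noteq> 0" using p 0(1) by auto
  show ?case
  proof
    assume "psum p (\<lambda>i. A1 ^ i * A2 ^ (0 - i)) * U \<in> bb"
    then have "c *s U \<in> bb" by (simp add: psum_def c(1) scale_mult)
    then have "inverse c *s (c *s U) \<in> bb" by (rule tidealD(7)[OF tb])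
    then show False using c(2) 0(4) by simp
  qed
next
  case (Suc j)
  have ends: "\<Phi> (U * A1 ^ e) = 0" "\<Phi> (U * A2 ^ e) = 0" "1 \<le> e" using Suc.prems(5)[of e] Suc.prems(5)[of 0] Suc.prems(3) by auto
  \<comment> \<open>A polynomial of degree at most \<open>j\<close> stands for a form divisible by
    \<open>A2\<close>, which is the root at infinity; otherwise a root \<open>z\<close> yields the
    factor \<open>A1 - z * A2\<close>.\<close>
  have "\<exists>\<alpha> \<beta> q. (\<alpha> \<noteq> 0 \<or> \<beta> \<noteq> 0) \<and> q \<noteq> 0 \<and> Polynomial.degree q \<le> j \<and>
    psum p (\<lambda>i. A1 ^ i * A2 ^ (Suc j - i)) = psum q (\<lambda>i. A1 ^ i * A2 ^ (j - i)) * (\<alpha> *s A1 + \<beta> *s A2)"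
  proof (cases "Polynomial.degree p \<le> j")
    case True
    have "psum p (\<lambda>i. A1 ^ i * A2 ^ (Suc j - i)) = psum p (\<lambda>i. A1 ^ i * A2 ^ (j - i)) * (0 *s A1 + 1 *s A2)"
      unfolding psum_mult unfolding psum_def using True by (intro sum.cong) (simp_all add: Suc_diff_le mult_ac)
    then show ?thesis using Suc.prems(1) True by (intro exI[of _ 0] exI[of _ 1] exI[of _ p]) simp
  next
    case False
    then have "Polynomial.degree p > 0" by simp
    then obtain z where "poly p z = 0" using alg_closed_imp_poly_has_root by blast
    then obtain q where q: "p = [:- z, 1:] * q" unfolding poly_eq_0_iff_dvd by (rule dvdE)
    then have q0: "q \<noteq> 0" using Suc.prems(1) by auto
    have "Polynomial.degree p = Suc (Polynomial.degree q)" unfolding q using q0 by (subst degree_mult_eq) auto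
    then have dq: "Polynomial.degree q \<le> j" using Suc.prems(2) by simp
    have "psum p (\<lambda>i. A1 ^ i * A2 ^ (Suc j - i)) = psum q (\<lambda>i. A1 ^ Suc i * A2 ^ (Suc j - Suc i) - z *s (A1 ^ i * A2 ^ (Suc j - i)))"
      unfolding q by (rule psum_linear_factor)
    also have "\<dots> = psum q (\<lambda>i. A1 ^ i * A2 ^ (j - i)) * (1 *s A1 + (- z) *s A2)"
      unfolding psum_mult unfolding psum_def using dq by (intro sum.cong) (simp_all add: Suc_diff_le algebra_simps mult_scale scale_mult)
    finally show ?thesis using q0 dq by (intro exI[of _ 1] exI[of _ "- z"] exI[of _ q]) simp
  qed
  then obtain \<alpha> \<beta> q where q: "\<alpha> \<noteq> 0 \<or> \<beta> \<noteq> 0" "q \<noteq> 0" "Polynomial.degree q \<le> j"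
    "psum p (\<lambda>i. A1 ^ i * A2 ^ (Suc j - i)) = psum q (\<lambda>i. A1 ^ i * A2 ^ (j - i)) * (\<alpha> *s A1 + \<beta> *s A2)" by blast
  define U' where "U' = (\<alpha> *s A1 + \<beta> *s A2) * U"
  have U1: "U' \<notin> bb" unfolding U'_def by (rule linear_factor_nonzero[OF Suc.prems(4) ends q(1)])
  have U2: "\<Phi> (U' * (A1 ^ i * A2 ^ (e - 1 - i))) = 0" if i: "i \<le> e - 1" for i
  proof -
    have s: "e - i = Suc (e - 1 - i)" using i ends(3) by simp
    have "U' * (A1 ^ i * A2 ^ (e - 1 - i)) = \<alpha> *s (U * (A1 ^ Suc i * A2 ^ (e - Suc i))) + \<beta> *s (U * (A1 ^ i * A2 ^ (e - i)))"
      unfolding U'_def s by (simp add: algebra_simps scale_mult mult_scale)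
    then show ?thesis using Suc.prems(5)[of "Suc i"] Suc.prems(5)[of i] i ends(3) by (simp add: lin_funD[OF Phi(1)])
  qed
  have "j \<le> e - 1" using Suc.prems(3) by simp
  then have "psum q (\<lambda>i. A1 ^ i * A2 ^ (j - i)) * U' \<notin> bb" by (rule Suc.IH[OF q(2,3) _ U1 U2])
  then show ?case by (simp add: q(4) U'_def mult.assoc)
qed

end

end

section \<open>Functionals over the closure, and substitution\<close>

lemma cm_up_mult: "klin l \<Longrightarrow> cm l (up a * z) = a * cm l z"
proof -
  assume l: "klin l"
  obtain S \<Lambda> where S: "finite S" "\<And>b. klin (\<Lambda> b)" "z = (\<Sum>b\<in>S. scalem b (up (cm (\<Lambda> b) z)))"
    by (rule cm_expand[of z]) (rule that, assumption+)
  have "up a * z = (\<Sum>b\<in>S. scalem b (up (a * cm (\<Lambda> b) z)))"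
    by (subst S(3)) (simp add: sum_distrib_left mp.mult_scale up_mult)
  then have "cm l (up a * z) = (\<Sum>b\<in>S. scalem (l b) (a * cm (\<Lambda> b) z))" by (simp add: cm_sum[OF l] cm_scalem_up[OF l])
  also have "\<dots> = a * (\<Sum>b\<in>S. scalem (l b) (cm (\<Lambda> b) z))" by (simp add: sum_distrib_left mp.mult_scale)
  also have "\<dots> = a * cm l (\<Sum>b\<in>S. scalem b (up (cm (\<Lambda> b) z)))" by (simp add: cm_sum[OF l] cm_scalem_up[OF l])
  also have "\<dots> = a * cm l z" by (simp only: S(3)[symmetric])
  finally show ?thesis .
qed

text \<open>The extension of \<open>\<phi>\<close> that is linear over the closure, given by the
  values on monomials.\<close>

definition upf :: "('k::field mpol \<Rightarrow> 'k) \<Rightarrow> 'k alg_closure mpol \<Rightarrow> 'k alg_closure" where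
  "upf \<phi> f = (\<Sum>m\<in>Poly_Mapping.keys f. Poly_Mapping.lookup f m * to_ac (\<phi> (Poly_Mapping.single m 1)))"

lemma lin_fun_expand:
  assumes "mp.lin_fun \<phi>" "finite S" "Poly_Mapping.keys f \<subseteq> S"
  shows "\<phi> f = (\<Sum>m\<in>S. Poly_Mapping.lookup f m * \<phi> (Poly_Mapping.single m 1))"
proof -
  have "\<phi> f = \<phi> (\<Sum>m\<in>Poly_Mapping.keys f. scalem (Poly_Mapping.lookup f m) (Poly_Mapping.single m 1))"
    by (subst pm_sum_single[of f]) (simp add: scalem_single)
  also have "\<dots> = (\<Sum>m\<in>Poly_Mapping.keys f. Poly_Mapping.lookup f m * \<phi> (Poly_Mapping.single m 1))"
    by (simp add: mp.lin_funD[OF assms(1)])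
  also have "\<dots> = (\<Sum>m\<in>S. Poly_Mapping.lookup f m * \<phi> (Poly_Mapping.single m 1))"
    by (rule sum.mono_neutral_left) (use assms(2,3) in \<open>auto simp: in_keys_iff\<close>)
  finally show ?thesis .
qed

text \<open>Together with \<open>klin_eqI\<close> this reduces identities for
  \<open>upf \<phi>\<close> to identities for \<open>\<phi>\<close> over \<open>k\<close>.\<close>

lemma klin_upf:
  assumes "klin l" "mp.lin_fun \<phi>"
  shows "l (upf \<phi> f) = \<phi> (cm l f)"
proof -
  have "l (x * to_ac c) = c * l x" for x c using kv.lin_funD(2)[OF assms(1), of c x] by (simp add: mult.commute)
  then have "l (upf \<phi> f) = (\<Sum>m\<in>Poly_Mapping.keys f. Poly_Mapping.lookup (cm l f) m * \<phi> (Poly_Mapping.single m 1))"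
    unfolding upf_def kv.lin_funD(6)[OF assms(1)] by (simp add: lookup_cm[OF assms(1)] mult.commute)
  then show ?thesis using lin_fun_expand[OF assms(2) finite_keys keys_cm[OF assms(1)]] by simp
qed

lemma klin_eqI: "(\<And>l. klin l \<Longrightarrow> l x = l y) \<Longrightarrow> x = y"
proof (rule ccontr)
  assume h: "\<And>l. klin l \<Longrightarrow> l x = l y" "x \<noteq> y"
  then obtain l where "klin l" "l (x - y) = 1" using klin_separates[of "x - y"] by auto
  then show False using h(1)[of l] kv.lin_funD(5) by fastforce
qed

lemma upf_lin:
  fixes \<phi> :: "'k::field mpol \<Rightarrow> 'k"
  assumes "mp.lin_fun \<phi>"
  shows "mp.lin_fun (upf \<phi>)"
  unfolding mp.lin_fun_def
proof (intro conjI allI)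
  fix f g c
  show "upf \<phi> (f + g) = upf \<phi> f + upf \<phi> g"
    by (rule klin_eqI) (simp add: klin_upf assms kv.lin_funD cm_add mp.lin_funD[OF assms])
  show "upf \<phi> (scalem c f) = c * upf \<phi> f"
  proof (rule klin_eqI)
    fix l :: "'k alg_closure \<Rightarrow> 'k" assume l: "klin l"
    show "l (upf \<phi> (scalem c f)) = l (c * upf \<phi> f)"
      using klin_upf[OF klin_mult[OF l, of c] assms, of f] by (simp add: klin_upf[OF l assms] cm_scalem[OF l])
  qed
qed

lemma upf_up:
  fixes \<phi> :: "'k::field mpol \<Rightarrow> 'k"
  assumes \<phi>: "mp.lin_fun \<phi>"
  shows "upf \<phi> (up f) = to_ac (\<phi> f)"
proof (rule klin_eqI)
  fix l :: "'k alg_closure \<Rightarrow> 'k" assume l: "klin l"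
  show "l (upf \<phi> (up f)) = l (to_ac (\<phi> f))"
    using kv.lin_funD(2)[OF l, of "\<phi> f" 1] by (simp add: klin_upf[OF l \<phi>] cm_up[OF l] mp.lin_funD[OF \<phi>] mult.commute)
qed

lemma subst_superset:
  assumes "finite S" "Poly_Mapping.keys p \<subseteq> S"
  shows "subst_mpol b p = (\<Sum>m\<in>S. scalem (Poly_Mapping.lookup p m) (\<Prod>i\<in>Poly_Mapping.keys m. b i ^ Poly_Mapping.lookup m i))"
  unfolding subst_mpol_def by (rule sum.mono_neutral_left) (use assms in \<open>auto simp: in_keys_iff\<close>)

lemma subst_add: "subst_mpol b (p + q) = subst_mpol b p + subst_mpol b q"
proof -
  let ?S = "Poly_Mapping.keys p \<union> Poly_Mapping.keys q"
  have k: "Poly_Mapping.keys (p + q) \<subseteq> ?S" by (rule keys_add)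
  show ?thesis
    using subst_superset[OF _ k, of b] subst_superset[of ?S p b] subst_superset[of ?S q b]
    by (simp add: lookup_add mpol.scale_left_distrib sum.distrib)
qed

lemma subst_0: "subst_mpol b 0 = 0" by (simp add: subst_mpol_def)

lemma subst_single: "subst_mpol b (Poly_Mapping.single m c) = scalem c (\<Prod>i\<in>Poly_Mapping.keys m. b i ^ Poly_Mapping.lookup m i)"
  using subst_superset[of "{m}" "Poly_Mapping.single m c" b] by simp

lemma subst_1: "subst_mpol b 1 = 1" using subst_single[of b 0 1] by simp

lemma subst_sum: "subst_mpol b (sum f A) = (\<Sum>a\<in>A. subst_mpol b (f a))"
  by (induction A rule: infinite_finite_induct) (simp_all add: subst_add subst_0)

lemma monomial_value_add:
  fixes b :: "nat \<Rightarrow> 'a::comm_monoid_mult" and m m' :: "nat \<Rightarrow>\<^sub>0 nat"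
  shows "(\<Prod>i\<in>Poly_Mapping.keys (m + m'). b i ^ Poly_Mapping.lookup (m + m') i) =
    (\<Prod>i\<in>Poly_Mapping.keys m. b i ^ Poly_Mapping.lookup m i) * (\<Prod>i\<in>Poly_Mapping.keys m'. b i ^ Poly_Mapping.lookup m' i)"
proof -
  let ?S = "Poly_Mapping.keys m \<union> Poly_Mapping.keys m'"
  have e: "(\<Prod>i\<in>Poly_Mapping.keys n. b i ^ Poly_Mapping.lookup n i) = (\<Prod>i\<in>?S. b i ^ Poly_Mapping.lookup n i)"
    if "Poly_Mapping.keys n \<subseteq> ?S" for n :: "nat \<Rightarrow>\<^sub>0 nat"
    by (rule prod.mono_neutral_left) (use that in \<open>auto simp: in_keys_iff\<close>)
  show ?thesis using e[of m] e[of m'] e[of "m + m'"] keys_add_nat[of m m']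
    by (simp add: lookup_add power_add prod.distrib)
qed

lemma subst_mult: "subst_mpol b (p * q) = subst_mpol b p * subst_mpol b q"
proof (induction p rule: pm_induct)
  case (single m c)
  show ?case
  proof (induction q rule: pm_induct)
    case (single m' c')
    show ?case by (simp add: mult_single subst_single monomial_value_add mp.scale_mult mp.mult_scale)
  qed (simp_all add: subst_0 subst_add distrib_left)
qed (simp_all add: subst_0 subst_add distrib_right)

lemma subst_scalem: "subst_mpol b (scalem c p) = scalem c (subst_mpol b p)"
  using subst_mult[of b "Poly_Mapping.single 0 c" p] by (simp add: scalem_def subst_single)

lemma forms_prod: "(\<And>i. i \<in> A \<Longrightarrow> g i \<in> forms r (d i)) \<Longrightarrow> (\<Prod>i\<in>A. g i) \<in> forms r (\<Sum>i\<in>A. d i)"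
  by (induction A rule: infinite_finite_induct) (simp_all add: one_in_forms forms_mult)

lemma subst_forms:
  assumes b: "\<And>i. i \<le> r \<Longrightarrow> b i \<in> forms s n" and f: "f \<in> forms r j"
  shows "subst_mpol b f \<in> forms s (n * j)"
  unfolding subst_mpol_def
proof (intro forms_sum mpol.subspace_scale[OF forms_subspace])
  fix m assume "m \<in> Poly_Mapping.keys f"
  then have m: "m \<in> mons r j" using f forms_iff by blast
  have "(\<Prod>i\<in>Poly_Mapping.keys m. b i ^ Poly_Mapping.lookup m i) \<in> forms s (\<Sum>i\<in>Poly_Mapping.keys m. n * Poly_Mapping.lookup m i)"
    using m by (intro forms_prod forms_power b) (auto simp: mons_def)
  then show "(\<Prod>i\<in>Poly_Mapping.keys m. b i ^ Poly_Mapping.lookup m i) \<in> forms s (n * j)"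
    using m unfolding sum_distrib_left[symmetric] by (simp add: mons_def mdeg_def)
qed

text \<open>As \<open>n > 0\<close>, components of different degrees are sent to forms of different
  degrees, so their images cannot cancel.\<close>

lemma subst_hcr:
  assumes b: "\<And>i. i \<le> r \<Longrightarrow> b i \<in> forms s n" and n: "0 < n" and f: "f \<in> carrier (polyring r)" "subst_mpol b f = 0"
  shows "subst_mpol b (hcr r j f) = 0"
proof (cases "j \<le> dbound f")
  case True
  have s: "subst_mpol b (hcr r i f) \<in> forms s (n * i)" for i by (rule subst_forms[OF b hcr_forms])
  have "0 = hcr s (n * j) (subst_mpol b (\<Sum>i\<le>dbound f. hcr r i f))"
    using f(2) hcr_expand[OF f(1) order_refl] by (simp add: hcr_simps(3))
  also have "\<dots> = (\<Sum>i\<le>dbound f. if i = j then subst_mpol b (hcr r i f) else 0)"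
    unfolding subst_sum hcr_simps(6) using n by (intro sum.cong refl) (simp add: hcr_form[OF s])
  also have "\<dots> = subst_mpol b (hcr r j f)" using True by simp
  finally show ?thesis by simp
qed (simp add: hcr_dbound subst_0)

section \<open>The rational normal curve through the scheme\<close>

context lgp_scheme
begin

context
  assumes d3: "mp.codim \<aa> = r + 3"
begin

text \<open>Over \<open>k\<close> a binary form need not split, so the independence is proved over
  the closure, by \<open>binary_form_nonzero\<close> with \<open>j = r\<close> and
  \<open>e = r + 1\<close>.\<close>

lemma parametrization:
  "\<exists>a1 a2 u. (\<forall>i\<le>r. u * (a1 ^ i * a2 ^ (r - i)) \<in> {v + j | v j. v \<in> forms r 1 \<and> j \<in> \<aa>}) \<and>
    (\<forall>c. (\<Sum>i\<le>r. scalem (c i) (u * (a1 ^ i * a2 ^ (r - i)))) \<in> \<aa> \<longrightarrow> (\<forall>i\<le>r. c i = 0))"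
proof -
  have soc: "mp.codim \<aa> \<le> mp.codim m + mp.codim {x. \<forall>z\<in>m. x * z \<in> \<aa>}" if "mp.maxi m" "\<aa> \<subseteq> m" for m
    by (rule descend_principal(2)[OF fa ta maxK that])
  obtain \<phi> where \<phi>: "mp.lin_fun \<phi>" "\<forall>x\<in>\<aa>. \<phi> x = 0" "\<forall>x. (\<forall>y. \<phi> (x * y) = 0) \<longrightarrow> x \<in> \<aa>"
    using mp.ex_nondegenerate[OF fa ta soc] by blast
  define W where "W = {v + j | v j. v \<in> forms r 1 \<and> j \<in> \<aa>}"
  have v0: "v = 0" if "v \<in> forms r 1" "v \<in> \<aa>" for v by (rule hyperplane[OF ta order_refl _ that]) (simp add: d3)
  note cs = mp.codim_sum[OF fa forms_fdim[where r = r and n = 1] v0, folded W_def]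
  have fW: "mp.fcod W" by (rule cs(1))
  have cW: "mp.codim W = 2" using cs(2) card_mons_1[of r] d3 by (simp add: dim_forms)
  have aW: "\<aa> \<subseteq> W" unfolding W_def using forms_0[of r 1] by force
  obtain w1 w2 x1 x2 where w: "mp.lin_fun w1" "mp.lin_fun w2" "W = {z. w1 z = 0 \<and> w2 z = 0}"
    by (rule mp.ex_two_lin_funs[OF fW cW])
  have rep: "\<exists>a. \<forall>y. w y = \<phi> (a * y)" if wl: "mp.lin_fun w" and w0: "\<And>y. y \<in> \<aa> \<Longrightarrow> w y = 0" for w
  proof -
    obtain a where "\<And>y. y \<in> UNIV \<Longrightarrow> w y = \<phi> (a * y)"
    proof (rule mp.representable[OF fa subset_UNIV mpol.subspace_UNIV, where B = "\<lambda>x y. \<phi> (x * y)" and \<psi> = w])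
      show "mp.lin_fun (\<lambda>x. \<phi> (x * y))" "mp.lin_fun (\<lambda>y. \<phi> (x * y))" for x y
        by (simp_all add: mp.lin_fun_def distrib_left distrib_right mp.scale_mult mp.mult_scale mp.lin_funD[OF \<phi>(1)])
      show "\<phi> (x * y) = 0" if "y \<in> \<aa>" for x y using \<phi>(2) mp.tidealD(3)[OF ta that] by blast
    qed (use \<phi>(3) wl w0 in auto)
    then show ?thesis by blast
  qed
  obtain a1 where a1: "\<And>y. w1 y = \<phi> (a1 * y)" using rep[OF w(1)] aW w(3) by blast
  obtain a2 where a2: "\<And>y. w2 y = \<phi> (a2 * y)" using rep[OF w(2)] aW w(3) by blast
  define F where "F = (\<lambda>i x. \<phi> (x * (a1 ^ i * a2 ^ (r + 1 - i)))) ` {..r + 1}"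
  have cF: "finite F" "card F \<le> r + 2" using card_image_le[of "{..r + 1}" "\<lambda>i x. \<phi> (x * (a1 ^ i * a2 ^ (r + 1 - i)))"] by (simp_all add: F_def)
  have lF: "mp.lin_fun w" if "w \<in> F" for w
    using that by (auto simp: F_def mp.lin_fun_def distrib_right mp.scale_mult mp.lin_funD[OF \<phi>(1)])
  define H where "H = {x \<in> UNIV. \<forall>w\<in>F. w x = 0}"
  have H: "mp.codim H \<le> r + 2" "mp.fcod H"
    using mp.codim_kernel_functionals[OF mp.fcod_UNIV cF(1) lF] cF(2) unfolding H_def[symmetric] mp.codim_UNIV by simp_all
  have "\<not> H \<subseteq> \<aa>" using mp.codim_mono[OF H(2) _ mp.tideal_subspace[OF ta]] H(1) d3 by auto
  then obtain u where u: "u \<in> H" "u \<notin> \<aa>" by blast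
  have u0: "\<phi> (u * (a1 ^ i * a2 ^ (r + 1 - i))) = 0" if "i \<le> r + 1" for i using u(1) that by (auto simp: H_def F_def)
  have mem: "u * (a1 ^ i * a2 ^ (r - i)) \<in> W" if "i \<le> r" for i
  proof -
    have s: "r + 1 - i = Suc (r - i)" using that by simp
    have e: "a1 * (u * (a1 ^ i * a2 ^ (r - i))) = u * (a1 ^ Suc i * a2 ^ (r + 1 - Suc i))"
      "a2 * (u * (a1 ^ i * a2 ^ (r - i))) = u * (a1 ^ i * a2 ^ (r + 1 - i))" unfolding s by (simp_all add: mult_ac)
    show ?thesis unfolding w(3) mem_Collect_eq a1 a2 e using u0[of "Suc i"] u0[of i] that by simp
  qed
  have indep: "\<forall>i\<le>r. c i = 0" if c: "(\<Sum>i\<le>r. scalem (c i) (u * (a1 ^ i * a2 ^ (r - i)))) \<in> \<aa>" for c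
  proof -
    interpret K: lgp_quotient scalem "ext \<aa>" "forms r 1 :: 'k alg_closure mpol set" r
    proof
      show "mp.fcod (ext \<aa>)" "mp.tideal (ext \<aa>)" using presentsD(1,2)[OF pK] by auto
      show "mp.codim (ext \<aa>) = r + 3" by (simp add: codimK d3)
      show "mpol.dim (forms r 1 :: 'k alg_closure mpol set) = r + 1" unfolding dim_forms by (rule card_mons_1)
    qed (rule r1 forms_fdim hyperplaneK, assumption?)+
    \<comment> \<open>Both spaces have codimension 2, so one inclusion gives equality; membership in
      \<open>ext W\<close> can then be tested by \<open>w1\<close> and \<open>w2\<close> over
      \<open>k\<close>.\<close>
    have "K.VB \<subseteq> ext W"
    proof
      fix z assume "z \<in> K.VB"
      then obtain v j where vj: "z = v + j" "v \<in> forms r 1" "j \<in> ext \<aa>" unfolding K.VB_def by blast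
      have "forms r 1 \<subseteq> W" unfolding W_def using mp.tidealD(1)[OF ta] by force
      then have "v \<in> ext W" "j \<in> ext W" using vj(2,3) ext_forms_1 ext_mono[OF aW] ext_mono[of "forms r 1" W] by blast+
      then show "z \<in> ext W" unfolding vj(1) by (rule mpol.subspace_add[OF ext_subspace[OF mp.fcod_subspace[OF fW]]])
    qed
    then have VB: "K.VB = ext W"
      using K.VB_codim ext_codim[OF fW] cW by (intro mp.codim_eq_imp_eq) (auto intro: mp.fcod_subspace)
    have ker: "z \<in> K.VB" if z: "upf \<phi> (up a1 * z) = 0" "upf \<phi> (up a2 * z) = 0" for z
    proof -
      have "cm l z \<in> W" if l: "klin l" for l
      proof -
      have "l (upf \<phi> (up a1 * z)) = 0" "l (upf \<phi> (up a2 * z)) = 0" unfolding z by (rule kv.lin_funD(3)[OF l])+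
      then show ?thesis by (simp add: klin_upf[OF l \<phi>(1)] cm_up_mult[OF l] w(3) a1 a2)
      qed
      then show ?thesis unfolding VB by (simp add: ext_def)
    qed
    have van: "upf \<phi> x = 0" if x: "x \<in> ext \<aa>" for x
    proof (rule klin_eqI)
      fix l :: "'k alg_closure \<Rightarrow> 'k" assume l: "klin l"
      show "l (upf \<phi> x) = l 0" using x l \<phi>(2) by (simp add: klin_upf[OF l \<phi>(1)] kv.lin_funD(3)[OF l] ext_def)
    qed
    \<comment> \<open>The binary form with coefficients \<open>c i\<close>, dehomogenized.\<close>
    define p where "p = (\<Sum>i\<le>r. Polynomial.monom (to_ac (c i)) i)"
    have cp: "Polynomial.coeff p i = (if i \<le> r then to_ac (c i) else 0)" for i
      by (simp add: p_def Polynomial.coeff_sum)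
    have dp: "Polynomial.degree p \<le> r" by (rule degree_le) (simp add: cp)
    have "p = 0"
    proof (rule ccontr)
      assume "p \<noteq> 0"
      have uK: "up u \<notin> ext \<aa>" using ext_up[OF mp.tideal_subspace[OF ta]] u(2) by simp
      have "mp.psum p (\<lambda>i. up a1 ^ i * up a2 ^ (r - i)) * up u \<notin> ext \<aa>"
      proof (rule K.binary_form_nonzero[OF upf_lin[OF \<phi>(1)] van ker \<open>p \<noteq> 0\<close> dp _ uK])
        fix i assume "i \<le> r + 1"
        then have "to_ac (\<phi> (u * (a1 ^ i * a2 ^ (r + 1 - i)))) = 0" using u0 by simp
        then show "upf \<phi> (up u * (up a1 ^ i * up a2 ^ (r + 1 - i))) = 0" by (simp add: upf_up[OF \<phi>(1), symmetric] up_mult up_power)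
      qed simp_all
      moreover have "mp.psum p (\<lambda>i. up a1 ^ i * up a2 ^ (r - i)) * up u = up (\<Sum>i\<le>r. scalem (c i) (u * (a1 ^ i * a2 ^ (r - i))))"
        unfolding mp.psum_bound[OF dp] sum_distrib_right up_sum
        by (intro sum.cong refl) (simp add: cp up_scalem up_mult up_power mp.scale_mult mp.mult_scale mult_ac)
      ultimately show False using c ext_up[OF mp.tideal_subspace[OF ta]] by simp
    qed
    then show ?thesis using cp by (metis coeff_0 to_ac_0 to_ac_eq_iff)
  qed
  show ?thesis using mem indep unfolding W_def by blast
qed

text \<open>Modulo \<open>\<aa>\<close>, each variable is \<open>u\<close> times its value
  \<open>\<theta>\<close> on the parametrized curve at the parameters \<open>a1\<close>,
  \<open>a2\<close>. So a form \<open>f\<close> of degree \<open>j\<close> is congruent to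
  \<open>u ^ j * \<theta> f\<close>; the equations of the curve have \<open>\<theta> f = 0\<close>
  and lie in \<open>\<aa>\<close>, whose forms are those of the ideal
  \<open>\<Gamma>\<close>.\<close>

lemma on_rational_normal_curve: "\<exists>C. rational_normal_curve r C \<and> C \<subseteq> \<Gamma>"
proof -
  let ?x = "\<lambda>l. Poly_Mapping.single (Poly_Mapping.single l (Suc 0)) 1 :: 'k mpol"
  obtain a1 a2 u :: "'k mpol" where mem: "\<forall>i\<le>r. u * (a1 ^ i * a2 ^ (r - i)) \<in> {v + j | v j. v \<in> forms r 1 \<and> j \<in> \<aa>}"
    and ind: "\<And>c. (\<Sum>i\<le>r. scalem (c i) (u * (a1 ^ i * a2 ^ (r - i)))) \<in> \<aa> \<Longrightarrow> \<forall>i\<le>r. c i = 0"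
    using parametrization by blast
  define y where "y i = u * (a1 ^ i * a2 ^ (r - i))" for i
  have "\<forall>i. \<exists>v. i \<le> r \<longrightarrow> v \<in> forms r 1 \<and> y i - v \<in> \<aa>"
  proof
    fix i show "\<exists>v. i \<le> r \<longrightarrow> v \<in> forms r 1 \<and> y i - v \<in> \<aa>"
    proof (cases "i \<le> r")
      case True
      then obtain v j where "y i = v + j" "v \<in> forms r 1" "j \<in> \<aa>" using mem unfolding y_def by blast
      then show ?thesis by (intro exI[of _ v]) simp
    qed simp
  qed
  from choice[OF this] obtain v where v: "\<And>i. i \<le> r \<Longrightarrow> v i \<in> forms r 1" "\<And>i. i \<le> r \<Longrightarrow> y i - v i \<in> \<aa>" by blast
  have vind: "d i = 0" if s: "(\<Sum>i\<in>{..r}. scalem (d i) (v i)) = 0" and i: "i \<in> {..r}" for d i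
  proof -
    have "(\<Sum>i\<le>r. scalem (d i) (y i)) = (\<Sum>i\<le>r. scalem (d i) (y i - v i))" using s by (simp add: mpol.scale_right_diff_distrib sum_subtractf)
    also have "\<dots> \<in> \<aa>" by (intro mp.tidealD(8)[OF ta] mp.tidealD(7)[OF ta] v(2)) simp
    finally show ?thesis using ind i unfolding y_def by simp
  qed
  have vi: "inj_on v {..r}" "mpol.independent (v ` {..r})"
    by (rule mp.independent_family[OF finite_atMost], erule vind, assumption)+
  have "mpol.span (v ` {..r}) = forms r 1"
  proof (rule mp.dim_eq_imp_eq[OF forms_fdim mpol.subspace_span])
    show "mpol.span (v ` {..r}) \<subseteq> forms r 1" using v(1) by (intro mpol.span_minimal forms_subspace) auto
    have "mpol.dim (mpol.span (v ` {..r})) = r + 1" using vi by (simp add: mpol.dim_eq_card_independent card_image)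
    then show "mpol.dim (forms r 1 :: 'k mpol set) \<le> mpol.dim (mpol.span (v ` {..r}))" using card_mons_1[of r] by (simp add: dim_forms)
  qed
  then have ex: "\<exists>c. x = (\<Sum>i\<le>r. scalem (c i) (v i))" if "x \<in> forms r 1" for x
  proof -
    have "x \<in> mpol.span (v ` {..r})" using that \<open>mpol.span (v ` {..r}) = forms r 1\<close> by simp
    then obtain q where "x = (\<Sum>z\<in>v ` {..r}. scalem (q z) z)" unfolding mpol.span_finite[OF finite_imageI[OF finite_atMost]] by blast
    then have "x = (\<Sum>i\<le>r. scalem (q (v i)) (v i))" by (simp add: sum.reindex[OF vi(1)])
    then show ?thesis by (rule exI[of _ "\<lambda>i. q (v i)"])
  qed
  have xf: "?x l \<in> forms r 1" if "l \<le> r" for l using that by (intro single_in_forms) (simp add: mons_def)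
  have "\<forall>l. \<exists>c. l \<le> r \<longrightarrow> ?x l = (\<Sum>i\<le>r. scalem (c i) (v i))" using ex[OF xf] by blast
  from choice[OF this] obtain C where C: "\<And>l. l \<le> r \<Longrightarrow> ?x l = (\<Sum>i\<le>r. scalem (C l i) (v i))" by blast
  \<comment> \<open>The coordinates of the variable \<open>x_l\<close> in the basis \<open>v\<close>
    become the coefficients of a binary form; its value at \<open>a1\<close>, \<open>a2\<close>,
    multiplied by \<open>u\<close>, is congruent to \<open>x_l\<close>.\<close>
  define b where "b l = (\<Sum>i\<le>r. Poly_Mapping.single (bin r i) (C l i))" for l
  have bf: "b l \<in> forms 1 r" for l unfolding b_def using mons_P1 by (intro forms_sum single_in_forms) auto
  have lookup_b: "Poly_Mapping.lookup (b l) (bin r i) = C l i" if "i \<le> r" for l i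
  proof -
    have "Poly_Mapping.lookup (b l) (bin r i) = (\<Sum>j\<le>r. if j = i then C l j else 0)"
      unfolding b_def lookup_sum using inj_bin[of r] that
      by (intro sum.cong refl) (auto simp: lookup_single when_def inj_on_def)
    then show ?thesis using that by simp
  qed
  \<comment> \<open>The \<open>b l\<close> and the variables \<open>x_l\<close> have the same
    coordinates \<open>C\<close>, so a relation among the former is one among the latter.\<close>
  have bind: "d l = 0" if s: "(\<Sum>l\<in>{..r}. scalem (d l) (b l)) = 0" and l: "l \<in> {..r}" for d l
  proof -
    have "(\<Sum>l\<le>r. d l * C l i) = 0" if "i \<le> r" for i
      using arg_cong[OF s, of "\<lambda>f. Poly_Mapping.lookup f (bin r i)"] that by (simp add: lookup_sum lookup_scalem lookup_b)
    then have z: "(\<Sum>i\<le>r. scalem (\<Sum>l\<le>r. d l * C l i) (v i)) = 0" by simp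
    have "(\<Sum>l\<le>r. scalem (d l) (?x l)) = (\<Sum>l\<le>r. \<Sum>i\<le>r. scalem (d l * C l i) (v i))"
      by (intro sum.cong refl) (simp add: C mpol.scale_sum_right)
    also have "\<dots> = (\<Sum>i\<le>r. \<Sum>l\<le>r. scalem (d l * C l i) (v i))" by (rule sum.swap)
    also have "\<dots> = 0" using z by (simp add: mpol.scale_sum_left)
    finally have s0: "(\<Sum>l\<le>r. Poly_Mapping.single (Poly_Mapping.single l (Suc 0)) (d l)) = 0" by (simp add: scalem_single)
    have "(\<Sum>k\<le>r. if k = l then d k else 0) = Poly_Mapping.lookup (\<Sum>k\<le>r. Poly_Mapping.single (Poly_Mapping.single k (Suc 0)) (d k)) (Poly_Mapping.single l (Suc 0))"
      unfolding lookup_sum by (intro sum.cong refl) (auto simp: lookup_single when_def dest: arg_cong[of _ _ Poly_Mapping.keys])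
    also have "\<dots> = 0" unfolding s0 by simp
    finally show ?thesis using l by simp
  qed
  have bi: "inj_on b {..r}" "mpol.independent (b ` {..r})"
    by (rule mp.independent_family[OF finite_atMost], erule bind, assumption)+
  have span_b: "mpol.span (b ` {..r}) = forms 1 r"
  proof (rule mp.dim_eq_imp_eq[OF forms_fdim mpol.subspace_span])
    show "mpol.span (b ` {..r}) \<subseteq> forms 1 r" using bf by (intro mpol.span_minimal forms_subspace) auto
    have "mpol.dim (mpol.span (b ` {..r})) = r + 1" using bi by (simp add: mpol.dim_eq_card_independent card_image)
    then show "mpol.dim (forms 1 r :: 'k mpol set) \<le> mpol.dim (mpol.span (b ` {..r}))" using card_mons_P1[of r] by (simp add: dim_forms)
  qed
  \<comment> \<open>The variables are replaced by the binary forms \<open>b\<close>, and the two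
    variables of these by \<open>a1\<close> and \<open>a2\<close>.\<close>
  define \<theta> where "\<theta> f = subst_mpol (\<lambda>i. if i = 0 then a1 else a2) (subst_mpol b f)" for f
  have \<theta>_mult: "\<theta> (f * g) = \<theta> f * \<theta> g" for f g by (simp add: \<theta>_def subst_mult)
  have \<theta>_x: "?x l - u * \<theta> (?x l) \<in> \<aa>" if l: "l \<le> r" for l
  proof -
    have bv: "subst_mpol (\<lambda>i. if i = 0 then a1 else a2) (Poly_Mapping.single (bin r i) c) = scalem c (a1 ^ i * a2 ^ (r - i))" for i c
    proof -
      have "Poly_Mapping.single (bin r i) c = scalem c (Poly_Mapping.single (Poly_Mapping.single 0 i) 1 * Poly_Mapping.single (Poly_Mapping.single 1 (r - i)) 1)"
        by (simp add: bin_def mult_single scalem_single)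
      then show ?thesis by (simp add: subst_scalem subst_mult subst_single)
    qed
    have "\<theta> (?x l) = (\<Sum>i\<le>r. scalem (C l i) (a1 ^ i * a2 ^ (r - i)))"
      by (simp add: \<theta>_def subst_single) (simp add: b_def subst_sum bv)
    then have "u * \<theta> (?x l) = (\<Sum>i\<le>r. scalem (C l i) (y i))" by (simp add: y_def sum_distrib_left mp.mult_scale)
    then have "?x l - u * \<theta> (?x l) = (\<Sum>i\<le>r. scalem (C l i) (v i - y i))"
      by (simp add: C[OF l] mpol.scale_right_diff_distrib sum_subtractf)
    also have "\<dots> \<in> \<aa>"
      using mp.tidealD(5)[OF ta v(2)] by (intro mp.tidealD(8)[OF ta] mp.tidealD(7)[OF ta]) auto
    finally show ?thesis .
  qed
  have \<theta>_mon: "Poly_Mapping.single m 1 - u ^ j * \<theta> (Poly_Mapping.single m 1) \<in> \<aa>" if "m \<in> mons r j" for m j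
    using that
  proof (induction j arbitrary: m)
    case 0
    then have "\<forall>i\<in>Poly_Mapping.keys m. Poly_Mapping.lookup m i = 0" by (simp add: mons_def mdeg_def)
    then have "Poly_Mapping.keys m = {}" by (metis in_keys_iff equals0I)
    then have "Poly_Mapping.single m (1 :: 'k) = 1" by simp
    then show ?case using mp.tidealD(1)[OF ta] by (simp add: \<theta>_def subst_1)
  next
    case (Suc j)
    obtain m1 m2 where m: "m1 \<in> mons r j" "m2 \<in> mons r 1" "m = m1 + m2" using mons_split[of m r j 1] Suc.prems by auto
    obtain l where l: "l \<le> r" "m2 = Poly_Mapping.single l 1" using m(2) mons_1[of r] by blast
    let ?s = "Poly_Mapping.single m1 1 :: 'k mpol"
    have e: "Poly_Mapping.single m 1 = ?s * ?x l" by (simp add: m(3) l(2) mult_single)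
    have "Poly_Mapping.single m 1 - u ^ Suc j * \<theta> (Poly_Mapping.single m 1) =
      ?x l * (?s - u ^ j * \<theta> ?s) + (u ^ j * \<theta> ?s) * (?x l - u * \<theta> (?x l))"
      unfolding e \<theta>_mult by (simp add: algebra_simps)
    then show ?case using mp.tidealD(2)[OF ta mp.tidealD(3)[OF ta Suc.IH[OF m(1)]] mp.tidealD(3)[OF ta \<theta>_x[OF l(1)]]] by (simp only:)
  qed
  have \<theta>_form: "f - u ^ j * \<theta> f \<in> \<aa>" if f: "f \<in> forms r j" for f j
  proof -
    have e: "f = (\<Sum>m\<in>Poly_Mapping.keys f. scalem (Poly_Mapping.lookup f m) (Poly_Mapping.single m 1))"
      by (subst pm_sum_single[of f]) (simp add: scalem_single)
    have "\<theta> f = (\<Sum>m\<in>Poly_Mapping.keys f. scalem (Poly_Mapping.lookup f m) (\<theta> (Poly_Mapping.single m 1)))"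
      by (subst e) (simp add: \<theta>_def subst_sum subst_scalem)
    then have "f - u ^ j * \<theta> f = (\<Sum>m\<in>Poly_Mapping.keys f. scalem (Poly_Mapping.lookup f m) (Poly_Mapping.single m 1 - u ^ j * \<theta> (Poly_Mapping.single m 1)))"
      by (subst e) (simp add: sum_distrib_left mp.mult_scale mpol.scale_right_diff_distrib sum_subtractf)
    also have "\<dots> \<in> \<aa>" using f forms_iff by (intro mp.tidealD(8)[OF ta] mp.tidealD(7)[OF ta] \<theta>_mon) blast
    finally show ?thesis .
  qed
  define D where "D = {f \<in> carrier (polyring r). subst_mpol b f = 0}"
  have "D \<subseteq> \<Gamma>"
  proof
    fix f assume "f \<in> D"
    then have f: "f \<in> carrier (polyring r)" "subst_mpol b f = 0" by (auto simp: D_def)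
    have "hcr r j f \<in> \<Gamma>" for j
    proof -
      have "\<theta> (hcr r j f) = 0" using subst_hcr[OF bf _ f, of j] r1 by (simp add: \<theta>_def subst_0)
      then have "hcr r j f \<in> \<aa>" using \<theta>_form[OF hcr_forms, of j f] by simp
      then show ?thesis using presentsD(3)[OF p hcr_forms] by blast
    qed
    then have "(\<Sum>j\<le>dbound f. hcr r j f) \<in> \<Gamma>" by (intro ideal_polyringD(6)[OF id])
    then show "f \<in> \<Gamma>" using hcr_expand[OF f(1) order_refl] by simp
  qed
  moreover have "rational_normal_curve r D" unfolding rational_normal_curve_def using r1 bi span_b D_def by blast
  ultimately show ?thesis by blast
qed

end

end

theorem theorem4p1:
  fixes r :: nat and \<Gamma> :: "'k::field mpol set"
  assumes "finite_subscheme r \<Gamma>"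
    and "geom_lin_gen_pos r \<Gamma>"
  shows "(scheme_degree r \<Gamma> = r + 3 \<longrightarrow>
            ((\<exists>C. rational_normal_curve r C \<and> C \<subseteq> \<Gamma>) \<longleftrightarrow> gorenstein r \<Gamma>)) \<and>
         (scheme_degree r \<Gamma> \<ge> r + 3 \<and> gorenstein r \<Gamma> \<longrightarrow>
            curvilinear r \<Gamma> \<and> unramified r (base_change r \<Gamma>) \<and>
            (\<forall>P\<in>points r \<Gamma>. scheme_degree r P = 1 \<longrightarrow> unramified_at r \<Gamma> P))"
proof (cases "r + 3 \<le> scheme_degree r \<Gamma>")
  case True
  obtain \<aa> N where pr: "presents r \<Gamma> \<aa> N" "mp.codim \<aa> = scheme_degree r \<Gamma>"
    by (rule finite_subscheme_presents[OF assms(1)])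
  interpret lgp_scheme r \<Gamma> \<aa> N
    using assms pr True by unfold_locales (simp_all add: finite_subscheme_def closed_subscheme_def)
  show ?thesis using conclusions on_rational_normal_curve pr(2) by auto
\<comment> \<open>Below degree \<open>r + 3\<close> both implications are vacuous.\<close>
qed simp

end
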